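(* Let $T$ be a weakly positive current of bidimension $(p,p)$ on $\mathbb{R}^n\times\mathbb{R}^n$. Assume that $T$ is concave and that $\operatorname{Supp}T\subset\{x\in\mathbb{R}^n:|x_{k+1}|^\delta+\dots+|x_n|^\delta\le1\}$ for some integer $\delta\ge1$ and some integer $k$ with $p\ge k$. Then there exists a constant $C>0$ such that for all $r\ge1$, $$\nu_T(0,r)=\frac{1}{r^p}\int_{\mathbb{B}(r)\times\mathbb{R}^n}T\wedge\beta^p\le C,\qquad \mathbb{B}(r)=\{x\in\mathbb{R}^n:|x|<r\}.$$ In particular, if $dd^{\#}T=0$, then $T$ is of finite degree, i.e. $\int_{\mathbb{R}^n\times\mathbb{R}^n}T\wedge(dd^{\#}|x|)^p<+\infty$.
   Context: Superformalism. On $\mathbb{R}^n\times\mathbb{R}^n$ with coordinates $(x,\xi)$, a form of bidegree $(p,q)$ is $\sum_{|K|=p,|L|=q}\alpha_{KL}(x)\,dx_K\wedge d\xi_L$ with coefficients depending only on $x$ (smooth unless otherwise said); $dx_i,d\xi_j$ all anticommute. $d=\sum_i dx_i\wedge\partial_{x_i}$, $d^{\#}=\sum_j d\xi_j\wedge\partial_{x_j}$, $\beta=\frac12dd^{\#}|x|^2=\sum_i dx_i\wedge d\xi_i$. For $\alpha=\sum_i a_i\,dx_i$ put $J(\alpha)=\sum_i a_i\,d\xi_i$. The integral of $\alpha_0(x)\,dx_1\wedge d\xi_1\wedge\dots\wedge dx_n\wedge d\xi_n$ over $A\times\mathbb{R}^n$ is $\int_A\alpha_0\,dx$ (similarly for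 measures). Currents. A current of bidegree $(p,q)$ is $T=\sum_{|I|=p,|J|=q}T_{IJ}\,dx_I\wedge d\xi_J$ with $T_{IJ}$ distributions in $x$; it acts on forms of bidegree $(n-p,n-q)$ with compactly supported coefficients by $\langle T,\alpha\rangle=\int T\wedge\alpha$. Bidimension $(p,p)$ means bidegree $(n-p,n-p)$. A current of bidegree $(k,k)$ is symmetric if $T_{IJ}=T_{JI}$. A form of bidegree $(k,k)$ is strongly positive if it is a finite sum $\sum_s\lambda_s\alpha_{1,s}\wedge J(\alpha_{1,s})\wedge\dots\wedge\alpha_{k,s}\wedge J(\alpha_{k,s})$, $\lambda_s\ge0$, $\alpha_{i,s}$ of bidegree $(1,0)$. A symmetric current of bidimension $(p,p)$ is weakly positive if it is $\ge0$ on all compactly supported strongly positive forms of bidegree $(p,p)$; its coefficients are then measures. A current $S$ is convex if $dd^{\#}S$ is weakly positive, and concave if $-S$ is convex. $\operatorname{Supp}T\subset\mathbb{R}^n$ is the support of $T$. *)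

theory Defs
  imports "HOL-Analysis.Analysis"
begin

section \<open>Smooth functions, test functions and distributions\<close>

definition partial :: "'n::finite \<Rightarrow> (real^'n \<Rightarrow> real) \<Rightarrow> real^'n \<Rightarrow> real" where
  "partial i f = (\<lambda>x. frechet_derivative f (at x) (axis i 1))"

definition partials :: "'n::finite list \<Rightarrow> (real^'n \<Rightarrow> real) \<Rightarrow> real^'n \<Rightarrow> real" where
  "partials w f = foldr partial w f"

definition smooth :: "(real^'n::finite \<Rightarrow> real) \<Rightarrow> bool" where
  "smooth f \<longleftrightarrow> (\<forall>w x. partials w f differentiable at x)"

definition fun_support :: "(real^'n::finite \<Rightarrow> real) \<Rightarrow> (real^'n) set" where
  "fun_support f = closure {x. f x \<noteq> 0}"

definition test_function :: "(real^'n::finite \<Rightarrow> real) \<Rightarrow> bool" where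
  "test_function \<phi> \<longleftrightarrow> smooth \<phi> \<and> compact (fun_support \<phi>)"

text \<open>Distributions are functionals on all functions of which only the values on test functions
  are meaningful; accordingly, every condition on a distribution below is restricted to test
  functions.\<close>

type_synonym 'n functional = "(real^'n \<Rightarrow> real) \<Rightarrow> real"

definition distribution :: "'n::finite functional \<Rightarrow> bool" where
  "distribution u \<longleftrightarrow>
     (\<forall>\<phi> \<psi> a b. test_function \<phi> \<longrightarrow> test_function \<psi> \<longrightarrow>
        u (\<lambda>x. a * \<phi> x + b * \<psi> x) = a * u \<phi> + b * u \<psi>) \<and>
     (\<forall>K. compact K \<longrightarrow> (\<exists>C N. \<forall>\<phi>. test_function \<phi> \<longrightarrow> fun_support \<phi> \<subseteq> K \<longrightarrow>
        \<bar>u \<phi>\<bar> \<le> C * (\<Sum>w | length w \<le> N. SUP x. \<bar>partials w \<phi> x\<bar>)))"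

definition dist_partial :: "'n::finite \<Rightarrow> 'n functional \<Rightarrow> 'n functional" where
  "dist_partial i u = (\<lambda>\<phi>. - u (partial i \<phi>))"

text \<open>For a positive distribution, the locally finite Borel measure representing it (Riesz).\<close>

definition measure_of_dist :: "'n::finite functional \<Rightarrow> (real^'n) measure" where
  "measure_of_dist u = (THE \<mu>. sets \<mu> = sets borel \<and>
     (\<forall>K. compact K \<longrightarrow> emeasure \<mu> K < \<infinity>) \<and>
     (\<forall>\<phi>. test_function \<phi> \<longrightarrow> u \<phi> = (\<integral>x. \<phi> x \<partial>\<mu>)))"


section \<open>Superforms\<close>

text \<open>A family of coefficients \<open>c\<close> stands for the sum of \<open>c K L dx_K \<and> d\<xi>_L\<close> over
  all subsets \<open>K\<close>, \<open>L\<close> of the index type, where \<open>dx_K\<close> and \<open>d\<xi>_L\<close> are the wedge products taken in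
  increasing order of the indices.\<close>

type_synonym ('n, 'a) super = "'n set \<Rightarrow> 'n set \<Rightarrow> 'a"

text \<open>A superform is a function of \<open>x\<close>; since its coefficients do not depend on \<open>\<xi>\<close>,
  it takes values in the constant ones.\<close>

type_synonym 'n superform = "real^'n \<Rightarrow> ('n, real) super"

definition inversions :: "'n::linorder set \<Rightarrow> 'n set \<Rightarrow> nat" where
  "inversions A B = card {(a, b). a \<in> A \<and> b \<in> B \<and> b < a}"

text \<open>For disjoint \<open>K\<close>, \<open>K'\<close> and disjoint \<open>L\<close>, \<open>L'\<close>,
  \<open>dx_K \<and> d\<xi>_L \<and> dx_K' \<and> d\<xi>_L' = wedge_sign K L K' L' dx_(K \<union> K') \<and> d\<xi>_(L \<union> L')\<close>:
  moving \<open>dx_K'\<close> past \<open>d\<xi>_L\<close> costs \<open>card L * card K'\<close> transpositions, after which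
  both halves have to be sorted.\<close>

definition wedge_sign :: "'n::linorder set \<Rightarrow> 'n set \<Rightarrow> 'n set \<Rightarrow> 'n set \<Rightarrow> real" where
  "wedge_sign K L K' L' = (-1) ^ (card L * card K' + inversions K K' + inversions L L')"

text \<open>The wedge product relative to a product \<open>m\<close> of coefficients: it serves for products of
  forms, of currents with forms, and for the pairing of currents with forms.\<close>

definition wedge_with :: "('a \<Rightarrow> 'b \<Rightarrow> real) \<Rightarrow>
    ('n::{finite,linorder}, 'a) super \<Rightarrow> ('n, 'b) super \<Rightarrow> ('n, real) super" where
  "wedge_with m \<alpha> \<beta> I J = (\<Sum>K\<in>Pow I. \<Sum>L\<in>Pow J.
     wedge_sign K L (I - K) (J - L) * m (\<alpha> K L) (\<beta> (I - K) (J - L)))"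

definition wedge :: "('n::{finite,linorder}, real) super \<Rightarrow> ('n, real) super \<Rightarrow> ('n, real) super" where
  "wedge = wedge_with (*)"

definition one_super :: "('n, real) super" where
  "one_super K L = (if K = {} \<and> L = {} then 1 else 0)"

definition wedge_list :: "('n::{finite,linorder}, real) super list \<Rightarrow> ('n, real) super" where
  "wedge_list \<alpha>s = foldr wedge \<alpha>s one_super"

definition dx :: "'n \<Rightarrow> ('n, real) super" where
  "dx i K L = (if K = {i} \<and> L = {} then 1 else 0)"

definition d\<xi> :: "'n \<Rightarrow> ('n, real) super" where
  "d\<xi> j K L = (if K = {} \<and> L = {j} then 1 else 0)"

text \<open>Only meant for arguments of bidegree \<open>(1, 0)\<close>.\<close>

definition J_super :: "('n, real) super \<Rightarrow> ('n, real) super" where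
  "J_super \<alpha> K L = (if K = {} then \<alpha> L {} else 0)"

definition superform :: "nat \<Rightarrow> nat \<Rightarrow> 'n::finite superform \<Rightarrow> bool" where
  "superform p q \<alpha> \<longleftrightarrow> (\<forall>K L. smooth (\<lambda>x. \<alpha> x K L) \<and>
     (\<not> (card K = p \<and> card L = q) \<longrightarrow> (\<forall>x. \<alpha> x K L = 0)))"

definition compactly_supported :: "'n::finite superform \<Rightarrow> bool" where
  "compactly_supported \<alpha> \<longleftrightarrow> (\<forall>K L. compact (fun_support (\<lambda>x. \<alpha> x K L)))"

definition fun_form :: "(real^'n \<Rightarrow> real) \<Rightarrow> 'n superform" where
  "fun_form f x K L = (if K = {} \<and> L = {} then f x else 0)"

definition d_form :: "'n::{finite,linorder} superform \<Rightarrow> 'n superform" where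
  "d_form \<alpha> x I J = (\<Sum>i\<in>UNIV. wedge (dx i) (\<lambda>K L. partial i (\<lambda>y. \<alpha> y K L) x) I J)"

definition dsharp_form :: "'n::{finite,linorder} superform \<Rightarrow> 'n superform" where
  "dsharp_form \<alpha> x I J = (\<Sum>j\<in>UNIV. wedge (d\<xi> j) (\<lambda>K L. partial j (\<lambda>y. \<alpha> y K L) x) I J)"

definition ddsharp_fun :: "(real^'n::{finite,linorder} \<Rightarrow> real) \<Rightarrow> 'n superform" where
  "ddsharp_fun f = d_form (dsharp_form (fun_form f))"

definition beta :: "'n::{finite,linorder} superform" where
  "beta x K L = (\<Sum>i\<in>UNIV. wedge (dx i) (d\<xi> i) K L)"

definition form_power :: "'n::{finite,linorder} superform \<Rightarrow> nat \<Rightarrow> 'n superform" where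
  "form_power \<alpha> k x = wedge_list (replicate k (\<alpha> x))"

text \<open>The weights are nonnegative functions: with constant weights only, the
  case \<open>k = 0\<close> would contain no nonzero form of compact support.\<close>

definition strongly_positive :: "nat \<Rightarrow> 'n::{finite,linorder} superform \<Rightarrow> bool" where
  "strongly_positive k \<alpha> \<longleftrightarrow> (\<exists>(m::nat) (c :: nat \<Rightarrow> (real, 'n) vec \<Rightarrow> real) (a :: nat \<Rightarrow> nat \<Rightarrow> 'n superform).
     (\<forall>s<m. smooth (c s) \<and> (\<forall>x. 0 \<le> c s x)) \<and>
     (\<forall>s<m. \<forall>i<k. superform 1 0 (a s i)) \<and>
     \<alpha> = (\<lambda>x K L. \<Sum>s<m. c s x *
            wedge_list (map (\<lambda>i. wedge (a s i x) (J_super (a s i x))) [0..<k]) K L))"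


section \<open>Supercurrents\<close>

type_synonym 'n supercurrent = "('n, 'n functional) super"

definition supercurrent :: "nat \<Rightarrow> nat \<Rightarrow> 'n::finite supercurrent \<Rightarrow> bool" where
  "supercurrent p q T \<longleftrightarrow> (\<forall>I J. distribution (T I J) \<and>
     (\<not> (card I = p \<and> card J = q) \<longrightarrow> (\<forall>\<phi>. test_function \<phi> \<longrightarrow> T I J \<phi> = 0)))"

definition bidimension :: "nat \<Rightarrow> 'n::finite supercurrent \<Rightarrow> bool" where
  "bidimension p T \<longleftrightarrow> p \<le> CARD('n) \<and> supercurrent (CARD('n) - p) (CARD('n) - p) T"

definition zero_current :: "'n::finite supercurrent \<Rightarrow> bool" where
  "zero_current T \<longleftrightarrow> (\<forall>I J \<phi>. test_function \<phi> \<longrightarrow> T I J \<phi> = 0)"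

definition symmetric_current :: "'n::finite supercurrent \<Rightarrow> bool" where
  "symmetric_current T \<longleftrightarrow> (\<forall>I J \<phi>. test_function \<phi> \<longrightarrow> T I J \<phi> = T J I \<phi>)"

definition current_support :: "'n::finite supercurrent \<Rightarrow> (real^'n) set" where
  "current_support T = - \<Union>{U. open U \<and>
     (\<forall>I J \<phi>. test_function \<phi> \<longrightarrow> fun_support \<phi> \<subseteq> U \<longrightarrow> T I J \<phi> = 0)}"

definition uminus_current :: "'n supercurrent \<Rightarrow> 'n supercurrent" where
  "uminus_current T I J \<phi> = - T I J \<phi>"

definition d_current :: "'n::{finite,linorder} supercurrent \<Rightarrow> 'n supercurrent" where
  "d_current T I J \<phi> = (\<Sum>i\<in>UNIV.
     wedge_with (\<lambda>c u. c * u \<phi>) (dx i) (\<lambda>K L. dist_partial i (T K L)) I J)"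

definition dsharp_current :: "'n::{finite,linorder} supercurrent \<Rightarrow> 'n supercurrent" where
  "dsharp_current T I J \<phi> = (\<Sum>j\<in>UNIV.
     wedge_with (\<lambda>c u. c * u \<phi>) (d\<xi> j) (\<lambda>K L. dist_partial j (T K L)) I J)"

definition ddsharp_current :: "'n::{finite,linorder} supercurrent \<Rightarrow> 'n supercurrent" where
  "ddsharp_current T = d_current (dsharp_current T)"

definition current_wedge :: "'n::{finite,linorder} supercurrent \<Rightarrow> 'n superform \<Rightarrow> 'n supercurrent" where
  "current_wedge T \<alpha> I J \<phi> =
     wedge_with (\<lambda>u a. u (\<lambda>x. a x * \<phi> x)) T (\<lambda>K L x. \<alpha> x K L) I J"

text \<open>The coefficient of \<open>dx_1 \<and> d\<xi>_1 \<and> \<dots> \<and> dx_n \<and> d\<xi>_n\<close> in the basis used here; it is \<open>1\<close> or \<open>-1\<close>.\<close>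

definition orientation :: "'n::{finite,linorder} itself \<Rightarrow> real" where
  "orientation _ = wedge_list (map (\<lambda>i::'n. wedge (dx i) (d\<xi> i)) (sorted_list_of_set UNIV)) UNIV UNIV"

definition pairing :: "'n::{finite,linorder} supercurrent \<Rightarrow> 'n superform \<Rightarrow> real" where
  "pairing T \<alpha> = wedge_with (\<lambda>u a. u a) T (\<lambda>K L x. \<alpha> x K L) UNIV UNIV / orientation TYPE('n)"

definition top_coeff :: "'n::{finite,linorder} supercurrent \<Rightarrow> 'n functional" where
  "top_coeff S \<phi> = S UNIV UNIV \<phi> / orientation TYPE('n)"

text \<open>The integral over \<open>A \<times> \<real>\<^sup>n\<close> of a current of bidegree \<open>(n, n)\<close> whose
  coefficient is a positive measure.\<close>

definition super_integral :: "(real^'n::{finite,linorder}) set \<Rightarrow> 'n supercurrent \<Rightarrow> ennreal" where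
  "super_integral A S = emeasure (measure_of_dist (top_coeff S)) A"

definition weakly_positive :: "nat \<Rightarrow> 'n::{finite,linorder} supercurrent \<Rightarrow> bool" where
  "weakly_positive p T \<longleftrightarrow> bidimension p T \<and> symmetric_current T \<and>
     (\<forall>\<alpha>. superform p p \<alpha> \<longrightarrow> compactly_supported \<alpha> \<longrightarrow> strongly_positive p \<alpha> \<longrightarrow> 0 \<le> pairing T \<alpha>)"

text \<open>For a current \<open>S\<close> of bidimension \<open>(p, p)\<close>. If \<open>p = 0\<close>, then \<open>dd\<^sup>#S\<close> vanishes for
  degree reasons and the condition holds, whatever bidimension one assigns to it.\<close>

definition convex_current :: "nat \<Rightarrow> 'n::{finite,linorder} supercurrent \<Rightarrow> bool" where
  "convex_current p S \<longleftrightarrow> weakly_positive (p - 1) (ddsharp_current S)"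

definition concave_current :: "nat \<Rightarrow> 'n::{finite,linorder} supercurrent \<Rightarrow> bool" where
  "concave_current p S \<longleftrightarrow> convex_current p (uminus_current S)"

definition lelong_nu :: "nat \<Rightarrow> 'n::{finite,linorder} supercurrent \<Rightarrow> (real, 'n) vec \<Rightarrow> real \<Rightarrow> ennreal" where
  "lelong_nu p T a r =
     super_integral (ball a r) (current_wedge T (form_power beta p)) / ennreal (r ^ p)"

text \<open>For \<open>T\<close> of bidimension \<open>(p, p)\<close> and a convex function \<open>u\<close> which need not be smooth, the product
  of \<open>T\<close> with the \<open>p\<close>-th power of \<open>dd\<^sup>#u\<close> is the weak limit of the products formed with smooth
  convex functions decreasing to \<open>u\<close>; the limit \<open>S\<close> must not depend on their choice.\<close>

definition is_ddsharp_product ::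
    "nat \<Rightarrow> 'n::{finite,linorder} supercurrent \<Rightarrow> ((real, 'n) vec \<Rightarrow> real) \<Rightarrow> 'n supercurrent \<Rightarrow> bool" where
  "is_ddsharp_product p T u S \<longleftrightarrow> supercurrent (CARD('n)) (CARD('n)) S \<and>
     (\<forall>v :: nat \<Rightarrow> (real, 'n) vec \<Rightarrow> real.
        (\<forall>j. smooth (v j) \<and> convex_on UNIV (v j)) \<longrightarrow>
        (\<forall>x. decseq (\<lambda>j. v j x) \<and> (\<lambda>j. v j x) \<longlonglongrightarrow> u x) \<longrightarrow>
        (\<forall>I J \<phi>. test_function \<phi> \<longrightarrow>
           (\<lambda>j. current_wedge T (form_power (ddsharp_fun (v j)) p) I J \<phi>) \<longlonglongrightarrow> S I J \<phi>))"

definition finite_degree :: "nat \<Rightarrow> 'n::{finite,linorder} supercurrent \<Rightarrow> bool" where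
  "finite_degree p T \<longleftrightarrow>
     (\<exists>S. is_ddsharp_product p T norm S \<and> super_integral UNIV S < \<infinity>)"

end

theory Submission
  imports Defs
begin

text \<open>Concavity gives \<open>\<integral> dd\<^sup>#g \<and> \<gamma> \<and> T \<le> 0\<close> for compactly supported \<open>g \<ge> 0\<close> and products \<open>\<gamma>\<close> of forms
  \<open>dd\<^sup>#v\<close> with \<open>v\<close> convex. We use it with \<open>g = \<theta> \<circ> W\<close>, where \<open>\<theta>\<close> is convex and increasing, so that
  \<open>\<integral> \<theta>'(W) dd\<^sup>#W \<and> \<gamma> \<and> T \<le> 0\<close>.

  Write \<open>x = (x', y)\<close> with \<open>y\<close> bounded on the support of \<open>T\<close>, and \<open>\<beta> = \<beta>' + \<beta>''\<close> accordingly. The choice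
  \<open>W = 4 + |y|\<^sup>2 - |x'|\<^sup>2 / r\<^sup>2\<close> bounds \<open>\<beta>''\<close> by \<open>\<beta>' / r\<^sup>2\<close> inside the integral, one factor at a time, so that
  only \<open>T \<and> \<beta>'\<^sup>p\<close> remains. This vanishes if \<open>p > k\<close>. If \<open>p = k\<close>, its projection to the \<open>x'\<close>-space is a
  positive measure which is concave along every coordinate, hence translation invariant, and its mass
  grows like \<open>r\<^sup>k\<close>.

  If \<open>dd\<^sup>#T = 0\<close> and \<open>v\<close> is a smooth convex function close to \<open>|x|\<close>, then \<open>W = v / r + 2 - |x|\<^sup>2 / r\<^sup>2\<close>
  bounds \<open>dd\<^sup>#v\<close> by \<open>2 \<beta> / r\<close>, so the total mass of \<open>T \<and> (dd\<^sup>#v)\<^sup>p\<close> is controlled by the growth bound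
  for \<open>T \<and> \<beta>\<^sup>p\<close>. An energy estimate shows that \<open>T \<and> (dd\<^sup>#v)\<^sup>p\<close> is Cauchy as \<open>v\<close> tends to \<open>|x|\<close>.\<close>

section \<open>Smooth functions\<close>

text \<open>Concavity can only be tested against nonnegative functions of compact support. This
  dictates \<theta> \<circ> W: \<theta> vanishes on negative numbers, and the negative part of W
  makes {W > 0} bounded near the support of T. In dd#(\<theta> \<circ> W) = \<theta>'(W) dd#W +
  \<theta>''(W) dW \<and> d#W the last term has a sign, so only the weight \<theta>'(W) remains. In
  the growth bound this weight depends on r alone, so one weight serves all p exchanges, and it is
  at least 1/e on the ball of radius r, where W \<ge> 1. In the second part W involves v, so every
  exchange brings a new weight, and the radius grows by the factor 4.

  Two further obstacles shape the text. Weak positivity sees only sums of products of squares of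
  smooth one-forms, whereas a Hessian need not split smoothly into squares; adding a small multiple
  of the identity makes Gaussian elimination smooth. And the integrals are values of a measure given
  by a description, so Riesz representation, with smooth test functions, comes first.\<close>

lemma partial_eq: "(f has_derivative f') (at x) \<Longrightarrow> partial i f x = f' (axis i 1)"
  unfolding partial_def by (metis frechet_derivative_at)

lemma partials_simps [simp]: "partials [] f = f" "partials (i # w) f = partial i (partials w f)"
  "partials (w @ [i]) f = partials w (partial i f)"
  by (auto simp: partials_def)

text \<open>Partial derivatives up to order \<open>n\<close> are differentiable. The recursion takes
  the innermost derivative first, the one to which product and chain rule apply; closure properties
  then follow by induction on \<open>n\<close> for all functions at once.\<close>

fun ck :: "nat \<Rightarrow> (real^'n::finite \<Rightarrow> real) \<Rightarrow> bool" where
  "ck 0 f \<longleftrightarrow> (\<forall>x. f differentiable (at x))"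
| "ck (Suc n) f \<longleftrightarrow> (\<forall>x. f differentiable (at x)) \<and> (\<forall>i. ck n (partial i f))"

lemma ck_differentiable: "ck n f \<Longrightarrow> f differentiable (at x)"
  by (cases n) auto

lemma ck_Suc_imp: "ck (Suc n) f \<Longrightarrow> ck n f"
  by (induction n arbitrary: f) auto

lemma smooth_partial: "smooth f \<Longrightarrow> smooth (partial i f)"
  unfolding smooth_def by (metis partials_simps(3))

lemma smooth_differentiable: "smooth f \<Longrightarrow> f differentiable (at x)"
  unfolding smooth_def by (metis partials_simps(1))

lemma smooth_iff_ck: "smooth f \<longleftrightarrow> (\<forall>n. ck n f)"
proof
  assume "smooth f"
  show "\<forall>n. ck n f"
  proof
    fix n show "ck n f" using \<open>smooth f\<close>
      by (induction n arbitrary: f) (auto simp: smooth_differentiable smooth_partial)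
  qed
next
  assume a: "\<forall>n. ck n f"
  have "partials w f differentiable (at x)" if "ck (length w) f" for w x
    using that
  proof (induction w arbitrary: f rule: rev_induct)
    case Nil then show ?case by simp
  next
    case (snoc i w) then show ?case by simp
  qed
  then show "smooth f" using a by (auto simp: smooth_def)
qed

lemma partial_const [simp]: "partial i (\<lambda>x. c) = (\<lambda>x. 0)"
  by (rule ext, subst partial_eq[OF has_derivative_const]) simp

lemma has_derivative_frechet: "f differentiable (at x) \<Longrightarrow> (f has_derivative frechet_derivative f (at x)) (at x)"
  by (simp add: frechet_derivative_works)

lemma partial_add: "(\<And>x. f differentiable (at x)) \<Longrightarrow> (\<And>x. g differentiable (at x)) \<Longrightarrow>
  partial i (\<lambda>x. f x + g x) = (\<lambda>x. partial i f x + partial i g x)"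
  by (rule ext, subst partial_eq[OF has_derivative_add[OF has_derivative_frechet has_derivative_frechet]])
     (auto simp: partial_def)

lemma partial_diff: "(\<And>x. f differentiable (at x)) \<Longrightarrow> (\<And>x. g differentiable (at x)) \<Longrightarrow>
  partial i (\<lambda>x. f x - g x) = (\<lambda>x. partial i f x - partial i g x)"
  by (rule ext, subst partial_eq[OF has_derivative_diff[OF has_derivative_frechet has_derivative_frechet]])
     (auto simp: partial_def)

lemma partial_mult: "(\<And>x. f differentiable (at x)) \<Longrightarrow> (\<And>x. g differentiable (at x)) \<Longrightarrow>
  partial i (\<lambda>x. f x * g x) = (\<lambda>x. partial i f x * g x + f x * partial i g x)"
  by (rule ext, subst partial_eq[OF has_derivative_mult[OF has_derivative_frechet has_derivative_frechet]])
     (auto simp: partial_def)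

lemma partial_cmult: "(\<And>x. f differentiable (at x)) \<Longrightarrow>
  partial i (\<lambda>x. c * f x) = (\<lambda>x. c * partial i f x)"
  by (subst partial_mult) auto

lemma partial_coord: "partial i (\<lambda>x. x $ j) = (\<lambda>x. if i = j then 1 else 0)"
  by (rule ext, subst partial_eq[OF bounded_linear.has_derivative[OF bounded_linear_vec_nth has_derivative_ident]])
     (auto simp: axis_def)

lemma partial_compose:
  assumes "\<And>x. f differentiable (at x)" "\<And>t. (h has_real_derivative h' t) (at t)"
  shows "partial i (\<lambda>x. h (f x)) = (\<lambda>x. h' (f x) * partial i f x)"
proof
  fix x
  have "((\<lambda>x. h (f x)) has_derivative (\<lambda>z. h' (f x) * frechet_derivative f (at x) z)) (at x)"
    using has_derivative_compose[OF has_derivative_frechet[OF assms(1)], of h "(*) (h' (f x))"] assms(2)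
    by (simp add: has_field_derivative_def)
  then show "partial i (\<lambda>x. h (f x)) x = h' (f x) * partial i f x"
    by (subst partial_eq) (auto simp: partial_def)
qed

lemma ck_const: "ck n (\<lambda>x. c)"
  by (induction n arbitrary: c) auto

lemma ck_add: "ck n f \<Longrightarrow> ck n g \<Longrightarrow> ck n (\<lambda>x. f x + g x)"
  by (induction n arbitrary: f g) (auto simp: partial_add)

lemma ck_mult: "ck n f \<Longrightarrow> ck n g \<Longrightarrow> ck n (\<lambda>x. f x * g x)"
proof (induction n arbitrary: f g)
  case (Suc n)
  then have "ck n f" "ck n g" using ck_Suc_imp by blast+
  with Suc show ?case by (auto simp: partial_mult intro!: ck_add)
qed auto

lemma ck_inverse: "(\<And>x. f x \<noteq> 0) \<Longrightarrow> ck n f \<Longrightarrow> ck n (\<lambda>x. inverse (f x))"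
proof (induction n arbitrary: f)
  case 0 then show ?case by (auto intro: differentiable_inverse)
next
  case (Suc n)
  have d: "f differentiable (at x)" for x using Suc.prems by auto
  have p: "partial i (\<lambda>x. inverse (f x)) = (\<lambda>x. (- 1 * partial i f x) * (inverse (f x) * inverse (f x)))" for i
  proof
    fix x
    show "partial i (\<lambda>x. inverse (f x)) x = (- 1 * partial i f x) * (inverse (f x) * inverse (f x))"
      by (subst partial_eq[OF Deriv.has_derivative_inverse[OF Suc.prems(1) has_derivative_frechet[OF d]]])
        (auto simp: partial_def)
  qed
  have "ck n (\<lambda>x. inverse (f x))" using Suc.IH[OF Suc.prems(1) ck_Suc_imp[OF Suc.prems(2)]] .
  moreover have "ck n (partial i f)" for i using Suc.prems(2) by simp
  ultimately have "ck n (partial i (\<lambda>x. inverse (f x)))" for i unfolding p by (intro ck_mult ck_const)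
  moreover have "(\<lambda>x. inverse (f x)) differentiable (at x)" for x
    using d Suc.prems(1) by (auto intro: differentiable_inverse)
  ultimately show ?case by auto
qed

section \<open>Smooth functions of one real variable\<close>

fun ck1 :: "nat \<Rightarrow> (real \<Rightarrow> real) \<Rightarrow> bool" where
  "ck1 0 h \<longleftrightarrow> (\<forall>x. (h has_real_derivative deriv h x) (at x))"
| "ck1 (Suc n) h \<longleftrightarrow> (\<forall>x. (h has_real_derivative deriv h x) (at x)) \<and> ck1 n (deriv h)"

definition smooth1 :: "(real \<Rightarrow> real) \<Rightarrow> bool" where "smooth1 h \<longleftrightarrow> (\<forall>n. ck1 n h)"

lemma ck1_0I: "(\<And>x. (h has_real_derivative h' x) (at x)) \<Longrightarrow> ck1 0 h"
  by (auto simp: DERIV_deriv_iff_real_differentiable real_differentiable_def)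

lemma ck1_SucI: "(\<And>x. (h has_real_derivative h' x) (at x)) \<Longrightarrow> ck1 n h' \<Longrightarrow> ck1 (Suc n) h"
proof -
  assume a: "\<And>x. (h has_real_derivative h' x) (at x)" "ck1 n h'"
  then have "deriv h = h'" by (auto intro: DERIV_imp_deriv)
  with a show ?thesis by auto
qed

lemma ck1_Suc_imp: "ck1 (Suc n) h \<Longrightarrow> ck1 n h"
  by (induction n arbitrary: h) auto

lemma ck1_DERIV: "ck1 n h \<Longrightarrow> (h has_real_derivative deriv h x) (at x)"
  by (cases n) auto

lemma smooth1_DERIV: "smooth1 h \<Longrightarrow> (h has_real_derivative deriv h x) (at x)"
  unfolding smooth1_def using ck1_DERIV by blast

lemma smooth1_deriv: "smooth1 h \<Longrightarrow> smooth1 (deriv h)"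
  unfolding smooth1_def using ck1.simps(2) by blast

lemma smooth1_antideriv: "(\<And>x. (h has_real_derivative h' x) (at x)) \<Longrightarrow> smooth1 h' \<Longrightarrow> smooth1 h"
  unfolding smooth1_def
proof
  fix n assume "\<And>x. (h has_real_derivative h' x) (at x)" "\<forall>n. ck1 n h'"
  then show "ck1 n h" by (cases n) (auto intro: ck1_SucI ck1_0I simp del: ck1.simps)
qed

lemma smooth1_const: "smooth1 (\<lambda>x. c)"
proof -
  have "ck1 n (\<lambda>x. c)" for n c by (induction n arbitrary: c) (auto simp: deriv_const)
  then show ?thesis by (simp add: smooth1_def)
qed

lemma ck1_add: "ck1 n f \<Longrightarrow> ck1 n g \<Longrightarrow> ck1 n (\<lambda>x. f x + g x)"
proof (induction n arbitrary: f g)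
  case 0 then show ?case by (intro ck1_0I[OF DERIV_add[OF ck1_DERIV ck1_DERIV]])
next
  case (Suc n) then show ?case
    by (intro ck1_SucI[OF DERIV_add[OF ck1_DERIV[of "Suc n"] ck1_DERIV[of "Suc n"]]]) auto
qed

lemma ck1_mult: "ck1 n f \<Longrightarrow> ck1 n g \<Longrightarrow> ck1 n (\<lambda>x. f x * g x)"
proof (induction n arbitrary: f g)
  case 0 then show ?case by (intro ck1_0I[OF DERIV_mult[OF ck1_DERIV ck1_DERIV]])
next
  case (Suc n)
  have "ck1 n (\<lambda>x. deriv f x * g x + deriv g x * f x)"
    using Suc.prems ck1_Suc_imp[of n f] ck1_Suc_imp[of n g] by (intro ck1_add Suc.IH) auto
  with Suc.prems show ?case
    by (intro ck1_SucI[OF DERIV_mult[OF ck1_DERIV[of "Suc n"] ck1_DERIV[of "Suc n"]]]) auto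
qed

lemma smooth1_add: "smooth1 f \<Longrightarrow> smooth1 g \<Longrightarrow> smooth1 (\<lambda>x. f x + g x)"
  by (simp add: smooth1_def ck1_add)
lemma smooth1_mult: "smooth1 f \<Longrightarrow> smooth1 g \<Longrightarrow> smooth1 (\<lambda>x. f x * g x)"
  by (simp add: smooth1_def ck1_mult)
lemma smooth1_cmult: "smooth1 f \<Longrightarrow> smooth1 (\<lambda>x. c * f x)"
  by (intro smooth1_mult smooth1_const)
lemma smooth1_diff: "smooth1 f \<Longrightarrow> smooth1 g \<Longrightarrow> smooth1 (\<lambda>x. f x - g x)"
  using smooth1_add[of f "\<lambda>x. -1 * g x"] smooth1_cmult[of g "-1"] by simp
lemma smooth1_sum: "(\<And>i. i \<in> A \<Longrightarrow> smooth1 (f i)) \<Longrightarrow> smooth1 (\<lambda>x. \<Sum>i\<in>A. f i x)"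
  by (induction A rule: infinite_finite_induct) (auto intro: smooth1_add smooth1_const)

lemma smooth1_affine: "smooth1 h \<Longrightarrow> smooth1 (\<lambda>x. h (a * x + b))"
proof -
  assume h: "smooth1 h"
  have "ck1 n h \<Longrightarrow> ck1 n (\<lambda>x. h (a * x + b))" for n h
  proof (induction n arbitrary: h)
    case 0
    have "((\<lambda>x. h (a * x + b)) has_real_derivative deriv h (a * x + b) * a) (at x)" for x
      by (rule DERIV_chain2[OF ck1_DERIV[OF 0]]) (auto intro!: derivative_eq_intros)
    then show ?case by (rule ck1_0I)
  next
    case (Suc n)
    have "((\<lambda>x. h (a * x + b)) has_real_derivative a * deriv h (a * x + b)) (at x)" for x
      by (subst mult.commute, rule DERIV_chain2[OF ck1_DERIV[OF Suc.prems]]) (auto intro!: derivative_eq_intros)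
    moreover have "ck1 n (\<lambda>x. a)" using smooth1_const by (auto simp: smooth1_def)
    ultimately show ?case using Suc by (intro ck1_SucI[where h'="\<lambda>x. a * deriv h (a * x + b)"] ck1_mult) auto
  qed
  with h show ?thesis by (simp add: smooth1_def)
qed

lemma ck_compose: "ck1 n h \<Longrightarrow> ck n f \<Longrightarrow> ck n (\<lambda>x. h (f x))"
proof (induction n arbitrary: h)
  case 0
  have "((\<lambda>x. h (f x)) has_derivative (\<lambda>z. deriv h (f x) * frechet_derivative f (at x) z)) (at x)" for x
    using has_derivative_compose[OF has_derivative_frechet[OF ck_differentiable[OF 0(2)]], of h "(*) (deriv h (f x))"] ck1_DERIV[OF 0(1)]
    by (simp add: has_field_derivative_def)
  then show ?case by (auto simp: differentiable_def)
next
  case (Suc n)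
  have d: "((\<lambda>x. h (f x)) has_derivative (\<lambda>z. deriv h (f x) * frechet_derivative f (at x) z)) (at x)" for x
    using has_derivative_compose[OF has_derivative_frechet[OF ck_differentiable[OF Suc(3)]], of h "(*) (deriv h (f x))"] ck1_DERIV[OF Suc(2)]
    by (simp add: has_field_derivative_def)
  have "partial i (\<lambda>x. h (f x)) = (\<lambda>x. deriv h (f x) * partial i f x)" for i
    by (rule partial_compose[OF ck_differentiable[OF Suc(3)] ck1_DERIV[OF Suc(2)]])
  moreover have "ck n (\<lambda>x. deriv h (f x) * partial i f x)" for i
    using Suc ck_Suc_imp[of n f] by (intro ck_mult) auto
  ultimately show ?case using d by (auto simp: differentiable_def)
qed

lemma smooth_const [intro, simp]: "smooth (\<lambda>x. c)" by (simp add: smooth_iff_ck ck_const)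
lemma smooth_add [intro]: "smooth f \<Longrightarrow> smooth g \<Longrightarrow> smooth (\<lambda>x. f x + g x)" by (simp add: smooth_iff_ck ck_add)
lemma smooth_mult [intro]: "smooth f \<Longrightarrow> smooth g \<Longrightarrow> smooth (\<lambda>x. f x * g x)" by (simp add: smooth_iff_ck ck_mult)
lemma smooth_inverse: "(\<And>x. f x \<noteq> 0) \<Longrightarrow> smooth f \<Longrightarrow> smooth (\<lambda>x. inverse (f x))" by (simp add: smooth_iff_ck ck_inverse)
lemma smooth_compose: "smooth1 h \<Longrightarrow> smooth f \<Longrightarrow> smooth (\<lambda>x. h (f x))" by (simp add: smooth_iff_ck ck_compose smooth1_def)
lemma smooth_cmult: "smooth f \<Longrightarrow> smooth (\<lambda>x. c * f x)" by (intro smooth_mult smooth_const)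
lemma smooth_uminus [intro]: "smooth f \<Longrightarrow> smooth (\<lambda>x. - f x)" using smooth_cmult[of f "-1"] by simp
lemma smooth_diff [intro]: "smooth f \<Longrightarrow> smooth g \<Longrightarrow> smooth (\<lambda>x. f x - g x)"
  using smooth_add[of f "\<lambda>x. - g x"] by auto
lemma smooth_sum [intro]: "(\<And>i. i \<in> A \<Longrightarrow> smooth (f i)) \<Longrightarrow> smooth (\<lambda>x. \<Sum>i\<in>A. f i x)"
  by (induction A rule: infinite_finite_induct) auto
lemma smooth_prod [intro]: "(\<And>i. i \<in> A \<Longrightarrow> smooth (f i)) \<Longrightarrow> smooth (\<lambda>x. \<Prod>i\<in>A. f i x)"
  by (induction A rule: infinite_finite_induct) auto
lemma smooth_coord [intro, simp]: "smooth (\<lambda>x::real^'n::finite. x $ i)"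
proof -
  have "(\<lambda>x::real^'n. x $ i) differentiable (at x)" for x
    using bounded_linear.has_derivative[OF bounded_linear_vec_nth has_derivative_ident] by (auto simp: differentiable_def)
  then have "ck n (\<lambda>x. x $ i)" for n
    by (cases n) (auto simp: partial_coord ck_const)
  then show ?thesis by (simp add: smooth_iff_ck)
qed

lemma smooth_continuous: "smooth f \<Longrightarrow> continuous_on S f"
  by (meson smooth_differentiable differentiable_imp_continuous_within continuous_at_imp_continuous_on)

text \<open>\<open>frechet_derivative\<close> is a Hilbert choice: it suffices that both functions
  have the same derivatives at \<open>x\<close>, which also covers points where there is
  none.\<close>

lemma partial_cong_open: "open U \<Longrightarrow> x \<in> U \<Longrightarrow> (\<And>y. y \<in> U \<Longrightarrow> f y = g y) \<Longrightarrow> partial i f x = partial i g x"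
proof -
  assume a: "open U" "x \<in> U" "\<And>y. y \<in> U \<Longrightarrow> f y = g y"
  have "(f has_derivative F) (at x) \<longleftrightarrow> (g has_derivative F) (at x)" for F
    using has_derivative_transform_within_open[OF _ a(1,2), of f F UNIV g]
      has_derivative_transform_within_open[OF _ a(1,2), of g F UNIV f] a(3) by auto
  then show ?thesis by (simp add: partial_def frechet_derivative_def)
qed

section \<open>Supports and test functions\<close>

lemma fun_support_subset: "closed C \<Longrightarrow> (\<And>x. f x \<noteq> 0 \<Longrightarrow> x \<in> C) \<Longrightarrow> fun_support f \<subseteq> C"
  unfolding fun_support_def by (metis (mono_tags, lifting) closure_minimal mem_Collect_eq subsetI)

lemma fun_support_nonzero: "f x \<noteq> 0 \<Longrightarrow> x \<in> fun_support f"
  unfolding fun_support_def using closure_subset by fastforce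

lemma closed_fun_support [simp]: "closed (fun_support f)" by (simp add: fun_support_def)

lemma test_functionI: "smooth f \<Longrightarrow> compact K \<Longrightarrow> (\<And>x. f x \<noteq> 0 \<Longrightarrow> x \<in> K) \<Longrightarrow> test_function f"
  unfolding test_function_def
  by (metis closed_fun_support compact_Int_closed compact_imp_closed fun_support_subset inf.absorb_iff2)

lemma test_smooth: "test_function f \<Longrightarrow> smooth f" by (simp add: test_function_def)
lemma test_compact: "test_function f \<Longrightarrow> compact (fun_support f)" by (simp add: test_function_def)

lemma test_mult_smooth: "test_function f \<Longrightarrow> smooth g \<Longrightarrow> test_function (\<lambda>x. g x * f x)"
  by (rule test_functionI[of _ "fun_support f"]) (auto simp: test_function_def fun_support_nonzero)
lemma test_mult_smooth2: "test_function f \<Longrightarrow> smooth g \<Longrightarrow> test_function (\<lambda>x. f x * g x)"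
  by (rule test_functionI[of _ "fun_support f"]) (auto simp: test_function_def fun_support_nonzero)
lemma test_zero [simp]: "test_function (\<lambda>x. 0)"
  by (rule test_functionI[of _ "{}"]) auto
lemma test_add: "test_function f \<Longrightarrow> test_function g \<Longrightarrow> test_function (\<lambda>x. f x + g x)"
proof (rule test_functionI[of _ "fun_support f \<union> fun_support g"])
  fix x assume "f x + g x \<noteq> 0"
  then have "f x \<noteq> 0 \<or> g x \<noteq> 0" by auto
  then show "x \<in> fun_support f \<union> fun_support g" using fun_support_nonzero by blast
qed (auto simp: test_function_def)
lemma test_cmult: "test_function f \<Longrightarrow> test_function (\<lambda>x. c * f x)"
  by (rule test_mult_smooth) auto
lemma test_diff: "test_function f \<Longrightarrow> test_function g \<Longrightarrow> test_function (\<lambda>x. f x - g x)"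
  using test_add[of f "\<lambda>x. -1 * g x"] test_cmult[of g "-1"] by simp
lemma test_sum: "(\<And>i. i \<in> A \<Longrightarrow> test_function (f i)) \<Longrightarrow> test_function (\<lambda>x. \<Sum>i\<in>A. f i x)"
  by (induction A rule: infinite_finite_induct) (auto intro: test_add)

lemma partial_support: "fun_support (partial i f) \<subseteq> fun_support f"
proof (rule fun_support_subset)
  fix x assume "partial i f x \<noteq> 0"
  show "x \<in> fun_support f"
  proof (rule ccontr)
    assume "x \<notin> fun_support f"
    then have "partial i f x = partial i (\<lambda>x. 0) x"
      using fun_support_nonzero[of f] by (intro partial_cong_open[of "- fun_support f"]) auto
    then show False using \<open>partial i f x \<noteq> 0\<close> by simp
  qed
qed simp

lemma test_partial: "test_function f \<Longrightarrow> test_function (partial i f)"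
proof (rule test_functionI[of _ "fun_support f"])
  fix x assume "partial i f x \<noteq> 0"
  then show "x \<in> fun_support f" using partial_support fun_support_nonzero by blast
qed (auto simp: test_function_def smooth_partial)

lemma test_bounded: assumes "test_function f" obtains B where "\<And>x. \<bar>f x\<bar> \<le> B" "B > 0"
proof -
  have "compact (f ` fun_support f)"
    using assms smooth_continuous by (auto simp: test_function_def intro: compact_continuous_image)
  then obtain B where B: "\<forall>y\<in>f ` fun_support f. \<bar>y\<bar> \<le> B"
    by (meson bounded_real compact_imp_bounded)
  have "\<bar>f x\<bar> \<le> max B 1" for x
  proof (cases "f x = 0")
    case False
    then have "\<bar>f x\<bar> \<le> B" using fun_support_nonzero B by blast
    then show ?thesis by simp
  qed simp
  then show ?thesis using that[of "max B 1"] by auto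
qed

lemma partial_along:
  assumes "smooth f"
  shows "((\<lambda>t. f (x + t *\<^sub>R axis i 1)) has_real_derivative partial i f (x + t *\<^sub>R axis i 1)) (at t)"
proof -
  have "((\<lambda>t. f (x + t *\<^sub>R axis i 1)) has_derivative
     (\<lambda>h. frechet_derivative f (at (x + t *\<^sub>R axis i 1)) (h *\<^sub>R axis i 1))) (at t)"
    by (rule has_derivative_compose[OF _ has_derivative_frechet[OF smooth_differentiable[OF assms]], of "\<lambda>t. x + t *\<^sub>R axis i 1"])
       (auto intro!: derivative_eq_intros)
  moreover have "linear (frechet_derivative f (at y))" for y
    using has_derivative_frechet[OF smooth_differentiable[OF assms]] has_derivative_linear by blast
  ultimately show ?thesis
    by (simp add: has_field_derivative_def partial_def linear_cmul mult.commute[of _ "frechet_derivative f _ _"])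
qed

text \<open>Schwarz: by the mean value theorem in each order, the second difference of \<open>f\<close> over a small
  square is the area times either mixed derivative at a point of the square.\<close>

lemma second_difference:
  assumes "smooth f" "h > 0"
  obtains s t where "0 < s" "s < h" "0 < t" "t < h"
    "f (x + h *\<^sub>R axis i 1 + h *\<^sub>R axis j 1) - f (x + h *\<^sub>R axis i 1) - f (x + h *\<^sub>R axis j 1) + f x
      = h * h * partial j (partial i f) (x + s *\<^sub>R axis i 1 + t *\<^sub>R axis j 1)"
proof -
  define g where "g = (\<lambda>s. f ((x + h *\<^sub>R axis j 1) + s *\<^sub>R axis i 1) - f (x + s *\<^sub>R axis i 1))"
  have "\<exists>s. 0 < s \<and> s < h \<and> g h - g 0 = (h - 0) * (partial i f ((x + h *\<^sub>R axis j 1) + s *\<^sub>R axis i 1) - partial i f (x + s *\<^sub>R axis i 1))"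
    unfolding g_def by (rule MVT2) (use assms in \<open>auto intro!: DERIV_diff partial_along\<close>)
  then obtain s where s: "0 < s" "s < h" "g h - g 0 = h * (partial i f ((x + s *\<^sub>R axis i 1) + h *\<^sub>R axis j 1) - partial i f ((x + s *\<^sub>R axis i 1) + 0 *\<^sub>R axis j 1))"
    by (auto simp: algebra_simps)
  have "\<exists>t. 0 < t \<and> t < h \<and> partial i f ((x + s *\<^sub>R axis i 1) + h *\<^sub>R axis j 1) - partial i f ((x + s *\<^sub>R axis i 1) + 0 *\<^sub>R axis j 1)
     = (h - 0) * partial j (partial i f) ((x + s *\<^sub>R axis i 1) + t *\<^sub>R axis j 1)"
    by (rule MVT2) (use assms in \<open>auto intro!: partial_along smooth_partial\<close>)
  then obtain t where "0 < t" "t < h" "partial i f ((x + s *\<^sub>R axis i 1) + h *\<^sub>R axis j 1) - partial i f ((x + s *\<^sub>R axis i 1) + 0 *\<^sub>R axis j 1)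
     = h * partial j (partial i f) ((x + s *\<^sub>R axis i 1) + t *\<^sub>R axis j 1)" by auto
  with s show ?thesis by (intro that[of s t]) (auto simp: g_def algebra_simps)
qed

lemma partial_commute:
  assumes "smooth f" shows "partial i (partial j f) = partial j (partial i f)"
proof
  fix x
  have near: "\<exists>d>0. \<forall>y. dist y x < d \<longrightarrow> \<bar>partial i (partial j f) y - partial i (partial j f) x\<bar> < e" if "e > 0" for e i j
  proof -
    have "partial i (partial j f) differentiable (at x)"
      by (rule smooth_differentiable[OF smooth_partial[OF smooth_partial[OF assms]]])
    then have "isCont (partial i (partial j f)) x" by (rule differentiable_imp_continuous_within)
    with that show ?thesis unfolding continuous_at_eps_delta by (simp add: dist_real_def)
  qed
  show "partial i (partial j f) x = partial j (partial i f) x"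
  proof (rule ccontr)
    assume ne: "partial i (partial j f) x \<noteq> partial j (partial i f) x"
    \<comment> \<open>Half the supposed gap: near \<open>x\<close> each mixed derivative moves by
      less than this, yet the two agree at some pair of points of the square.\<close>
    define e where "e = \<bar>partial i (partial j f) x - partial j (partial i f) x\<bar> / 2"
    have "e > 0" using ne by (simp add: e_def)
    obtain d where d: "d > 0" "\<And>y. dist y x < d \<Longrightarrow> \<bar>partial i (partial j f) y - partial i (partial j f) x\<bar> < e"
      using near[OF \<open>e > 0\<close>] by blast
    obtain d' where d': "d' > 0" "\<And>y. dist y x < d' \<Longrightarrow> \<bar>partial j (partial i f) y - partial j (partial i f) x\<bar> < e"
      using near[OF \<open>e > 0\<close>] by blast
    \<comment> \<open>Points of the square with side \<open>h\<close> are less than 2h away from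
      \<open>x\<close>.\<close>
    define h where "h = min d d' / 2"
    have h: "h > 0" using d d' by (simp add: h_def)
    have close: "dist (x + s *\<^sub>R axis k 1 + t *\<^sub>R axis l 1) x < min d d'" if "0 < s" "s < h" "0 < t" "t < h" for s t k l
    proof -
      have "norm (s *\<^sub>R axis k 1 + t *\<^sub>R axis l 1 :: real^'a) \<le> norm (s *\<^sub>R axis k 1 :: real^'a) + norm (t *\<^sub>R axis l 1 :: real^'a)"
        by (rule norm_triangle_ineq)
      also have "\<dots> = s + t" using that by simp
      finally show ?thesis using that by (simp add: dist_norm h_def add.assoc)
    qed
    obtain s t where 1: "0 < s" "s < h" "0 < t" "t < h"
    "f (x + h *\<^sub>R axis i 1 + h *\<^sub>R axis j 1) - f (x + h *\<^sub>R axis i 1) - f (x + h *\<^sub>R axis j 1) + f x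
      = h * h * partial j (partial i f) (x + s *\<^sub>R axis i 1 + t *\<^sub>R axis j 1)" by (rule second_difference[OF assms h])
    obtain s' t' where 2: "0 < s'" "s' < h" "0 < t'" "t' < h"
    "f (x + h *\<^sub>R axis j 1 + h *\<^sub>R axis i 1) - f (x + h *\<^sub>R axis j 1) - f (x + h *\<^sub>R axis i 1) + f x
      = h * h * partial i (partial j f) (x + s' *\<^sub>R axis j 1 + t' *\<^sub>R axis i 1)" by (rule second_difference[OF assms h])
    have "h * h * partial j (partial i f) (x + s *\<^sub>R axis i 1 + t *\<^sub>R axis j 1) = h * h * partial i (partial j f) (x + s' *\<^sub>R axis j 1 + t' *\<^sub>R axis i 1)"
      using 1(5) 2(5) by (simp add: algebra_simps)
    with h have "partial j (partial i f) (x + s *\<^sub>R axis i 1 + t *\<^sub>R axis j 1) = partial i (partial j f) (x + s' *\<^sub>R axis j 1 + t' *\<^sub>R axis i 1)" by simp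
    then show False
      using d(2)[of "x + s' *\<^sub>R axis j 1 + t' *\<^sub>R axis i 1"] d'(2)[of "x + s *\<^sub>R axis i 1 + t *\<^sub>R axis j 1"]
        close[OF 1(1-4)] close[OF 2(1-4)] by (simp add: e_def) argo
  qed
qed

section \<open>Cutoff functions\<close>

text \<open>Every derivative of exp(-1/x) is a polynomial in 1/x times exp(-1/x). With the
  polynomial as a parameter the class is closed under differentiation, and smoothness at 0 becomes
  an induction.\<close>

definition flat_poly :: "real poly \<Rightarrow> real \<Rightarrow> real" where
  "flat_poly P x = (if 0 < x then poly P (1 / x) * exp (- (1 / x)) else 0)"

text \<open>With y = 1/x this is the decay of exp(-y) against every power of y.\<close>

lemma flat_poly_limit: "((\<lambda>x. poly (P :: real poly) (1 / x) * exp (- (1 / x))) \<longlongrightarrow> 0) (at_right 0)"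
proof -
  have "((\<lambda>y. poly P y * exp (- y)) \<longlongrightarrow> 0) at_top"
  proof (induction P)
    case 0 then show ?case by simp
  next
    case (pCons a P)
    have e: "((\<lambda>y::real. y ^ n * exp (- y)) \<longlongrightarrow> 0) at_top" for n
      using tendsto_power_div_exp_0[of n] by (simp add: exp_minus field_simps)
    have mono: "((\<lambda>y::real. y * (poly Q y * exp (- y))) \<longlongrightarrow> 0) at_top" for Q
    proof -
      have "((\<lambda>y::real. \<Sum>i\<le>degree Q. coeff Q i * (y ^ (Suc i) * exp (- y))) \<longlongrightarrow> (\<Sum>i\<le>degree Q. coeff Q i * 0)) at_top"
        by (intro tendsto_sum tendsto_mult tendsto_const e)
      then show ?thesis by (simp add: poly_altdef sum_distrib_left sum_distrib_right algebra_simps)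
    qed
    have "((\<lambda>y::real. a * (y ^ 0 * exp (- y))) \<longlongrightarrow> a * 0) at_top"
      by (rule tendsto_mult[OF tendsto_const e])
    from tendsto_add[OF this mono[of P]]
    have "((\<lambda>y. a * (y ^ 0 * exp (- y)) + y * (poly P y * exp (- y))) \<longlongrightarrow> a * 0 + 0) at_top" .
    then show ?case by (simp add: algebra_simps)
  qed
  then have "((\<lambda>x. poly P (inverse x) * exp (- inverse x)) \<longlongrightarrow> 0) (at_right 0)"
    by (rule filterlim_compose[OF _ filterlim_inverse_at_top_right])
  then show ?thesis by (simp add: inverse_eq_divide)
qed

lemma flat_poly_DERIV:
  "(flat_poly P has_real_derivative flat_poly ([:0, 0, 1:] * (P - pderiv P)) x) (at x)"
proof -
  consider "x > 0" | "x < 0" | "x = 0" by linarith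
  then show ?thesis
  proof cases
    case 1
    have "((\<lambda>x. poly P (1 / x) * exp (- (1 / x))) has_real_derivative
        flat_poly ([:0, 0, 1:] * (P - pderiv P)) x) (at x)"
      using 1 unfolding flat_poly_def
      by (auto intro!: derivative_eq_intros poly_DERIV[THEN DERIV_chain2]
          simp: field_simps power2_eq_square)
    then show ?thesis
      by (rule has_field_derivative_transform_within_open[where S="{0<..}"]) (use 1 in \<open>auto simp: flat_poly_def\<close>)
  next
    case 2
    have "((\<lambda>x. 0) has_real_derivative flat_poly ([:0, 0, 1:] * (P - pderiv P)) x) (at x)"
      using 2 by (simp add: flat_poly_def)
    then show ?thesis
      by (rule has_field_derivative_transform_within_open[where S="{..<0}"]) (use 2 in \<open>auto simp: flat_poly_def\<close>)
  next
    case 3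
    have "((\<lambda>h. (flat_poly P (0 + h) - flat_poly P 0) / h) \<longlongrightarrow> 0) (at 0)"
    unfolding filterlim_at_split
    proof (intro conjI)
      show "((\<lambda>h. (flat_poly P (0 + h) - flat_poly P 0) / h) \<longlongrightarrow> 0) (at_left 0)"
        by (rule tendsto_eventually) (auto simp: flat_poly_def eventually_at_left_field intro!: exI[of _ "-1"])
      show "((\<lambda>h. (flat_poly P (0 + h) - flat_poly P 0) / h) \<longlongrightarrow> 0) (at_right 0)"
      \<comment> \<open>Division by h multiplies the polynomial by its variable 1/h, which turns
        \<open>P\<close> into \<open>pCons 0 P\<close>.\<close>
      proof (rule Lim_transform_eventually[OF flat_poly_limit[of "pCons 0 P"]])
        show "\<forall>\<^sub>F x in at_right 0. poly (pCons 0 P) (1 / x) * exp (- (1 / x)) = (flat_poly P (0 + x) - flat_poly P 0) / x"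
          by (auto simp: flat_poly_def eventually_at_right_field intro!: exI[of _ 1])
      qed
    qed
    then show ?thesis using 3 by (simp add: DERIV_def flat_poly_def)
  qed
qed

lemma smooth1_flat_poly: "smooth1 (flat_poly P)"
proof -
  have "ck1 n (flat_poly P)" for n P
    by (induction n arbitrary: P) (auto intro: ck1_0I ck1_SucI flat_poly_DERIV simp del: ck1.simps)
  then show ?thesis by (simp add: smooth1_def)
qed

definition flat :: "real \<Rightarrow> real" where "flat x = (if 0 < x then exp (- (1 / x)) else 0)"

lemma flat_eq: "flat = flat_poly 1"
  by (rule ext) (simp add: flat_def flat_poly_def)

lemma smooth1_flat: "smooth1 flat" by (simp add: flat_eq smooth1_flat_poly)
lemma flat_nonneg [simp]: "0 \<le> flat x" by (simp add: flat_def)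
lemma flat_le_1 [simp]: "flat x \<le> 1" by (simp add: flat_def)
lemma flat_pos_iff [simp]: "0 < flat x \<longleftrightarrow> 0 < x" by (simp add: flat_def)
lemma flat_eq_0 [simp]: "flat x = 0 \<longleftrightarrow> x \<le> 0" by (simp add: flat_def)
lemma flat_mono: "x \<le> y \<Longrightarrow> flat x \<le> flat y"
  by (auto simp: flat_def divide_simps)
lemma flat_1: "flat 1 = exp (-1)" by (simp add: flat_def)

lemma deriv_nonneg_mono:
  fixes f :: "real \<Rightarrow> real"
  assumes "mono f" "(f has_real_derivative d) (at x)" shows "0 \<le> d"
proof (rule ccontr)
  assume "\<not> 0 \<le> d"
  then obtain e where "e > 0" "\<And>h. h > 0 \<Longrightarrow> h < e \<Longrightarrow> f (x + h) < f x"
    using DERIV_neg_dec_right[OF assms(2)] by auto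
  then have "f (x + e / 2) < f x" by simp
  moreover have "f x \<le> f (x + e / 2)" using assms(1) \<open>e > 0\<close> by (auto simp: mono_def)
  ultimately show False by simp
qed

lemma deriv_flat_nonneg: "0 \<le> deriv flat x"
  by (rule deriv_nonneg_mono[OF _ smooth1_DERIV[OF smooth1_flat]]) (simp add: mono_def flat_mono)

lemma antideriv_exists:
  assumes "smooth1 h" obtains F where "smooth1 F" "\<And>x. (F has_real_derivative h x) (at x)" "F a = 0"
proof -
  have c: "continuous_on S h" for S
    using smooth1_DERIV[OF assms] by (meson DERIV_isCont continuous_at_imp_continuous_on)
  define F where "F x = (if a \<le> x then integral {a..x} h else - integral {x..a} h)" for x
  \<comment> \<open>Both signs of the oriented integral are read off from a common lower limit
    \<open>b\<close>, from which the fundamental theorem starts.\<close>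
  have F: "F x = integral {b..x} h - integral {b..a} h" if "b \<le> x" "b \<le> a" for b x
  proof (cases "a \<le> x")
    case True
    have "integral {b..a} h + integral {a..x} h = integral {b..x} h"
      by (rule Henstock_Kurzweil_Integration.integral_combine) (use True that c integrable_continuous_interval in auto)
    with True show ?thesis by (simp add: F_def)
  next
    case False
    have "integral {b..x} h + integral {x..a} h = integral {b..a} h"
      by (rule Henstock_Kurzweil_Integration.integral_combine) (use False that c integrable_continuous_interval in auto)
    with False show ?thesis by (simp add: F_def)
  qed
  have D: "(F has_real_derivative h x) (at x)" for x
  proof -
    define b where "b = min a x - 1"
    have "((\<lambda>u. integral {b..u} h) has_real_derivative h x) (at x within {b..x+1})"
      by (rule integral_has_real_derivative) (use c b_def in auto)
    then have "((\<lambda>u. integral {b..u} h - integral {b..a} h) has_real_derivative h x - 0) (at x within {b..x+1})"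
      by (intro DERIV_diff DERIV_const)
    then have "((\<lambda>u. integral {b..u} h - integral {b..a} h) has_real_derivative h x - 0) (at x)"
      using at_within_interior[of x "{b..x+1}"] by (simp add: b_def)
    then have "((\<lambda>u. integral {b..u} h - integral {b..a} h) has_real_derivative h x) (at x)" by simp
    then show ?thesis
      by (rule has_field_derivative_transform_within_open[where S="{b<..}"]) (auto simp: b_def F[of "min a x - 1"])
  qed
  show ?thesis by (rule that[OF smooth1_antideriv[OF D assms] D]) (simp add: F_def)
qed

lemma const_if_deriv_zero:
  fixes F :: "real \<Rightarrow> real"
  assumes "\<And>x. (F has_real_derivative h x) (at x)" "\<And>x. a < x \<Longrightarrow> x < b \<Longrightarrow> h x = 0" "a \<le> b"
  shows "F a = F b"
proof (cases "a = b")
  case False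
  then have "\<exists>z. a < z \<and> z < b \<and> F b - F a = (b - a) * h z" by (intro MVT2) (use assms in auto)
  then show ?thesis using assms by auto
qed simp

text \<open>A primitive of a bump supported in [0, 1], divided by its value at 1.\<close>

lemma smooth_step_exists:
  obtains h :: "real \<Rightarrow> real" where "smooth1 h" "mono h" "\<And>x. 0 \<le> h x" "\<And>x. h x \<le> 1"
    "\<And>x. x \<le> 0 \<Longrightarrow> h x = 0" "\<And>x. 1 \<le> x \<Longrightarrow> h x = 1"
proof -
  define b where "b x = flat x * flat (1 - x)" for x
  have b: "smooth1 b" unfolding b_def
    using smooth1_mult[OF smooth1_flat smooth1_affine[OF smooth1_flat, of "-1" 1]] by simp
  obtain F where F: "smooth1 F" "\<And>x. (F has_real_derivative b x) (at x)" "F 0 = 0"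
    using antideriv_exists[OF b] by blast
  have bn: "b x \<ge> 0" for x by (simp add: b_def)
  have m: "F x \<le> F y" if "x \<le> y" for x y
    by (rule DERIV_nonneg_imp_nondecreasing[OF that]) (use F bn in blast)
  have F0: "F x = 0" if "x \<le> 0" for x
    using const_if_deriv_zero[OF F(2), of x 0] F(3) that by (simp add: b_def)
  have F1: "F x = F 1" if "1 \<le> x" for x
    using const_if_deriv_zero[OF F(2), of 1 x] that by (simp add: b_def)
  have "\<exists>z. 0 < z \<and> z < 1 \<and> F 1 - F 0 = (1 - 0) * b z" by (intro MVT2) (use F in auto)
  then have pos: "F 1 > 0" using F(3) by (auto simp: b_def)
  show ?thesis
  proof (rule that[of "\<lambda>x. inverse (F 1) * F x"])
    show "smooth1 (\<lambda>x. inverse (F 1) * F x)" by (rule smooth1_cmult[OF F(1)])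
    show "mono (\<lambda>x. inverse (F 1) * F x)" using m pos by (auto simp: mono_def)
    show "0 \<le> inverse (F 1) * F x" for x
      using m[of 0 x] F0[of x] F(3) pos by (cases "x \<le> 0") auto
    show "inverse (F 1) * F x \<le> 1" for x
      using m[of x 1] F1[of x] pos by (cases "x \<le> 1") (auto simp: field_simps)
    show "inverse (F 1) * F x = 0" if "x \<le> 0" for x using F0[OF that] by simp
    show "inverse (F 1) * F x = 1" if "1 \<le> x" for x using F1[OF that] pos by simp
  qed
qed

text \<open>\<open>b\<close> has a smooth second antiderivative \<open>F\<close>, which is convex and affine off the support of \<open>b\<close>;
  its second difference \<open>g\<close> is therefore nonnegative and compactly supported.\<close>

lemma second_difference_bump:
  obtains b g :: "real \<Rightarrow> real" where "smooth1 b" "\<And>x. 0 \<le> b x" "\<And>x. \<bar>x\<bar> \<ge> 1 \<Longrightarrow> b x = 0" "\<And>x. \<bar>x\<bar> < 1 \<Longrightarrow> 0 < b x"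
    "smooth1 g" "\<And>x. 0 \<le> g x" "\<And>x. \<bar>x\<bar> \<ge> 2 \<Longrightarrow> g x = 0"
    "\<And>x. deriv (deriv g) x = b (x + 1) - 2 * b x + b (x - 1)"
    "\<And>x. \<bar>x\<bar> \<le> 1/2 \<Longrightarrow> flat (1/2) * flat (1/2) \<le> b x"
proof -
  define b where "b x = flat (x + 1) * flat (1 - x)" for x
  have b: "smooth1 b" unfolding b_def
    using smooth1_mult[OF smooth1_affine[OF smooth1_flat, of 1 1] smooth1_affine[OF smooth1_flat, of "-1" 1]] by simp
  obtain R where R: "smooth1 R" "\<And>x. (R has_real_derivative b x) (at x)" "R (-1) = 0"
    using antideriv_exists[OF b] by blast
  obtain F where F: "smooth1 F" "\<And>x. (F has_real_derivative R x) (at x)" "F (-1) = 0"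
    using antideriv_exists[OF R(1)] by blast
  have bn: "b x \<ge> 0" for x by (simp add: b_def)
  have b0: "b x = 0" if "\<bar>x\<bar> \<ge> 1" for x using that by (auto simp: b_def)
  have m: "R x \<le> R y" if "x \<le> y" for x y
    by (rule DERIV_nonneg_imp_nondecreasing[OF that]) (use R bn in blast)
  have R0: "R x = 0" if "x \<le> -1" for x
    using const_if_deriv_zero[OF R(2), of x "-1"] R(3) that by (simp add: b0)
  have R1: "R x = R 1" if "1 \<le> x" for x
    using const_if_deriv_zero[OF R(2), of 1 x] that by (simp add: b0)
  have F0: "F x = 0" if "x \<le> -1" for x
    using const_if_deriv_zero[OF F(2), of x "-1"] F(3) that by (simp add: R0)
  have F1: "F x = F 1 + R 1 * (x - 1)" if "1 \<le> x" for x
  proof -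
    have "F 1 - R 1 * 1 = F x - R 1 * x"
    proof (rule const_if_deriv_zero[of "\<lambda>x. F x - R 1 * x" "\<lambda>x. R x - R 1"])
      show "((\<lambda>x. F x - R 1 * x) has_real_derivative R y - R 1) (at y)" for y
        using DERIV_diff[OF F(2) DERIV_cmult[OF DERIV_ident, of "R 1"]] by simp
      show "R y - R 1 = 0" if "1 < y" for y using R1[of y] that by simp
    qed (use that in simp)
    then show ?thesis by (simp add: algebra_simps)
  qed
  \<comment> \<open>The shape \<open>1 * x + c\<close> is that of
    \<open>smooth1_affine\<close>.\<close>
  define g where "g x = F (1 * x + 1) - 2 * F x + F (1 * x + - 1)" for x
  have sg: "smooth1 g" unfolding g_def
    by (intro smooth1_add smooth1_diff smooth1_cmult smooth1_affine F)
  have Ds: "((\<lambda>x. f (x + c)) has_real_derivative f' (x + c)) (at x)" if "\<And>x. (f has_real_derivative f' x) (at x)" for f f' :: "real \<Rightarrow> real" and c x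
    using that[of "x + c"] by (simp add: DERIV_shift)
  have g1: "(g has_real_derivative R (x + 1) - 2 * R x + R (x - 1)) (at x)" for x
    unfolding g_def using Ds[OF F(2), of 1 x] Ds[OF F(2), of "-1" x] F(2)[of x]
    by (auto intro!: derivative_eq_intros)
  have g2: "((\<lambda>x. R (x + 1) - 2 * R x + R (x - 1)) has_real_derivative b (x + 1) - 2 * b x + b (x - 1)) (at x)" for x
    using Ds[OF R(2), of 1 x] Ds[OF R(2), of "-1" x] R(2)[of x]
    by (auto intro!: derivative_eq_intros)
  have gn: "g x \<ge> 0" for x
  proof -
    have "\<exists>z. x < z \<and> z < x + 1 \<and> F (x + 1) - F x = (x + 1 - x) * R z" by (rule MVT2) (use F in auto)
    moreover have "\<exists>z. x - 1 < z \<and> z < x \<and> F x - F (x - 1) = (x - (x - 1)) * R z" by (rule MVT2) (use F in auto)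
    ultimately obtain z w where "x < z" "w < x" "F (x + 1) - F x = R z" "F x - F (x - 1) = R w" by auto
    then show ?thesis using m[of w z] by (simp add: g_def)
  qed
  show ?thesis
  proof (rule that[of b g])
    show "g x = 0" if "\<bar>x\<bar> \<ge> 2" for x
    proof (cases "x \<ge> 2")
      case True
      then have "F (x + 1) = F 1 + R 1 * x" "F x = F 1 + R 1 * (x - 1)" "F (x - 1) = F 1 + R 1 * (x - 2)"
        using F1[of "x+1"] F1[of x] F1[of "x-1"] by auto
      then show ?thesis by (simp add: g_def algebra_simps)
    next
      case False
      then show ?thesis using that F0 by (simp add: g_def)
    qed
    have "deriv g = (\<lambda>x. R (x + 1) - 2 * R x + R (x - 1))" using g1 by (auto intro: DERIV_imp_deriv)
    then show "deriv (deriv g) x = b (x + 1) - 2 * b x + b (x - 1)" for x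
      using g2 DERIV_imp_deriv by metis
    show "flat (1/2) * flat (1/2) \<le> b x" if "\<bar>x\<bar> \<le> 1/2" for x
      unfolding b_def using that by (intro mult_mono flat_mono) auto
  qed (use b bn b0 sg gn in \<open>auto simp: b_def zero_less_mult_iff\<close>)
qed

lemma smooth_norm2: "smooth (\<lambda>x::real^'n::finite. (norm (x - a))\<^sup>2)"
proof -
  have "(\<lambda>x::real^'n. (norm (x - a))\<^sup>2) = (\<lambda>x. \<Sum>i\<in>UNIV. (x $ i - a $ i) * (x $ i - a $ i))"
    by (rule ext) (simp only: power2_norm_eq_inner inner_vec_def, simp)
  then show ?thesis by (auto simp only: intro!: smooth_sum smooth_mult smooth_diff smooth_coord smooth_const)
qed

lemma cutoff_ball:
  fixes a :: "real^'n::finite"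
  assumes "0 \<le> r" "r < s"
  obtains \<phi> where "test_function \<phi>" "\<And>x. 0 \<le> \<phi> x" "\<And>x. \<phi> x \<le> 1"
    "\<And>x. x \<in> cball a r \<Longrightarrow> \<phi> x = 1" "\<And>x. x \<notin> ball a s \<Longrightarrow> \<phi> x = 0"
proof -
  obtain h where h: "smooth1 h" "mono h" "\<And>x. 0 \<le> h x" "\<And>x. h x \<le> 1"
    "\<And>x. x \<le> 0 \<Longrightarrow> h x = 0" "\<And>x. 1 \<le> x \<Longrightarrow> h x = 1" using smooth_step_exists by blast
  \<comment> \<open>The squared norm is smooth at \<open>a\<close> as well. The argument of
    \<open>h\<close> is 1 at distance \<open>r\<close> from \<open>a\<close> and 0 at distance
    \<open>s\<close>.\<close>
  define \<phi> where "\<phi> x = h (inverse (s\<^sup>2 - r\<^sup>2) * (s\<^sup>2 - (norm (x - a))\<^sup>2))" for x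
  have pos: "s\<^sup>2 - r\<^sup>2 > 0" using assms by (simp add: power_strict_mono)
  have sm: "smooth \<phi>" unfolding \<phi>_def
    by (intro smooth_compose[OF h(1)] smooth_mult smooth_diff smooth_const smooth_norm2)
  have 0: "\<phi> x = 0" if "x \<notin> ball a s" for x
  proof -
    have "s \<le> norm (x - a)" using that by (simp add: dist_norm norm_minus_commute)
    then have "s\<^sup>2 \<le> (norm (x - a))\<^sup>2" using assms by (intro power_mono) auto
    then have "inverse (s\<^sup>2 - r\<^sup>2) * (s\<^sup>2 - (norm (x - a))\<^sup>2) \<le> 0" using pos by (simp add: mult_nonneg_nonpos)
    then show ?thesis unfolding \<phi>_def by (rule h(5))
  qed
  show ?thesis
  proof (rule that[of \<phi>])
    show "test_function \<phi>" by (rule test_functionI[OF sm, of "cball a s"]) (use 0 in force)+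
    show "\<phi> x = 1" if "x \<in> cball a r" for x
    proof -
      have "norm (x - a) \<le> r" using that by (simp add: dist_norm norm_minus_commute)
      then have "(norm (x - a))\<^sup>2 \<le> r\<^sup>2" by (intro power_mono) auto
      then have "1 \<le> inverse (s\<^sup>2 - r\<^sup>2) * (s\<^sup>2 - (norm (x - a))\<^sup>2)" using pos by (simp add: field_simps)
      then show ?thesis unfolding \<phi>_def by (rule h(6))
    qed
  qed (use h 0 in \<open>auto simp: \<phi>_def\<close>)
qed

text \<open>Finitely many balls cover \<open>K\<close>, and 1 minus the product of the complements
  of their cutoffs stays between 0 and 1. The value 1 is reached on an open set \<open>W\<close>
  rather than only on \<open>K\<close>: supports are closures, and \<open>W\<close> is what keeps
  them apart.\<close>

lemma smooth_urysohn:
  fixes K :: "(real^'n::finite) set"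
  assumes "compact K" "open U" "K \<subseteq> U"
  obtains \<phi> W where "test_function \<phi>" "\<And>x. 0 \<le> \<phi> x" "\<And>x. \<phi> x \<le> 1"
    "open W" "K \<subseteq> W" "\<And>x. x \<in> W \<Longrightarrow> \<phi> x = 1" "fun_support \<phi> \<subseteq> U"
proof -
  have "\<forall>a\<in>K. \<exists>r>0. cball a r \<subseteq> U" using assms by (meson open_contains_cball subsetD)
  then obtain r where r: "\<And>a. a \<in> K \<Longrightarrow> r a > 0 \<and> cball a (r a) \<subseteq> U" by metis
  have "\<forall>a\<in>K. \<exists>\<phi>. test_function \<phi> \<and> (\<forall>x. 0 \<le> \<phi> x \<and> \<phi> x \<le> 1) \<and> (\<forall>x\<in>cball a (r a / 2). \<phi> x = 1) \<and>
      (\<forall>x. x \<notin> ball a (r a) \<longrightarrow> \<phi> x = 0)"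
  proof
    fix a assume "a \<in> K"
    from r[OF this] have "0 \<le> r a / 2" "r a / 2 < r a" by auto
    from cutoff_ball[OF this, of a] show "\<exists>\<phi>. test_function \<phi> \<and> (\<forall>x. 0 \<le> \<phi> x \<and> \<phi> x \<le> 1) \<and> (\<forall>x\<in>cball a (r a / 2). \<phi> x = 1) \<and>
      (\<forall>x. x \<notin> ball a (r a) \<longrightarrow> \<phi> x = 0)" by metis
  qed
  then obtain \<psi> where \<psi>: "\<And>a. a \<in> K \<Longrightarrow> test_function (\<psi> a) \<and> (\<forall>x. 0 \<le> \<psi> a x \<and> \<psi> a x \<le> 1) \<and> (\<forall>x\<in>cball a (r a / 2). \<psi> a x = 1) \<and>
      (\<forall>x. x \<notin> ball a (r a) \<longrightarrow> \<psi> a x = 0)" by metis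
  have "K \<subseteq> (\<Union>a\<in>K. ball a (r a / 2))" using r by force
  then obtain A where A: "A \<subseteq> K" "finite A" "K \<subseteq> (\<Union>a\<in>A. ball a (r a / 2))"
    using compactE_image[OF assms(1), of K "\<lambda>a. ball a (r a / 2)"] by auto
  define \<phi> where "\<phi> x = 1 - (\<Prod>a\<in>A. (1 - \<psi> a x))" for x
  have sm: "smooth \<phi>" unfolding \<phi>_def using \<psi> A by (intro smooth_diff smooth_const smooth_prod) (auto simp: test_smooth)
  have supp: "x \<in> (\<Union>a\<in>A. cball a (r a))" if "\<phi> x \<noteq> 0" for x
  proof (rule ccontr)
    assume c: "x \<notin> (\<Union>a\<in>A. cball a (r a))"
    have "\<psi> a x = 0" if "a \<in> A" for a
    proof -
      have "x \<notin> ball a (r a)" using c that by auto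
      then show ?thesis using \<psi> A(1) that by blast
    qed
    then have "\<phi> x = 0" by (simp add: \<phi>_def)
    with that show False by simp
  qed
  have 01: "0 \<le> (\<Prod>a\<in>A. (1 - \<psi> a x))" "(\<Prod>a\<in>A. (1 - \<psi> a x)) \<le> 1" for x
    using \<psi> A(1) by (auto intro!: prod_nonneg prod_le_1)
  have comp: "compact (\<Union>a\<in>A. cball a (r a))" using A by auto
  show ?thesis
  proof (rule that[of \<phi> "\<Union>a\<in>A. ball a (r a / 2)"])
    show "test_function \<phi>" by (rule test_functionI[OF sm comp supp])
    show "\<phi> x = 1" if x: "x \<in> (\<Union>a\<in>A. ball a (r a / 2))" for x
    proof -
      obtain a where "a \<in> A" "x \<in> ball a (r a / 2)" using x by auto
      moreover then have "x \<in> cball a (r a / 2)" by auto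
      ultimately have "\<psi> a x = 1" using \<psi> A(1) by blast
      then have "(\<Prod>a\<in>A. (1 - \<psi> a x)) = 0" using \<open>a \<in> A\<close> A(2) by (auto simp: prod_zero_iff)
      then show ?thesis by (simp add: \<phi>_def)
    qed
    have "fun_support \<phi> \<subseteq> (\<Union>a\<in>A. cball a (r a))" by (rule fun_support_subset[OF compact_imp_closed[OF comp] supp])
    then show "fun_support \<phi> \<subseteq> U" using r A(1) by blast
  qed (use 01 A in \<open>auto simp: \<phi>_def\<close>)
qed

text \<open>Choose \<eta> equal to 1 near the compact part of the support that \<open>V\<close>
  misses; then 1 - \<eta> vanishes there.\<close>

lemma test_split:
  fixes \<phi> :: "real^'n::finite \<Rightarrow> real"
  assumes "test_function \<phi>" "open U" "open V" "fun_support \<phi> \<subseteq> U \<union> V"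
  obtains \<eta> where "smooth \<eta>" "\<And>x. 0 \<le> \<eta> x" "\<And>x. \<eta> x \<le> 1"
    "fun_support (\<lambda>x. \<eta> x * \<phi> x) \<subseteq> U" "fun_support (\<lambda>x. (1 - \<eta> x) * \<phi> x) \<subseteq> V"
proof -
  have "compact (fun_support \<phi> - V)" "fun_support \<phi> - V \<subseteq> U"
    using assms by (auto simp: test_compact compact_diff)
  then obtain \<eta> W where \<eta>: "test_function \<eta>" "\<And>x. 0 \<le> \<eta> x" "\<And>x. \<eta> x \<le> 1"
    "open W" "fun_support \<phi> - V \<subseteq> W" "\<And>x. x \<in> W \<Longrightarrow> \<eta> x = 1" "fun_support \<eta> \<subseteq> U"
    using smooth_urysohn[OF _ assms(2)] by metis
  show ?thesis
  proof (rule that[of \<eta>])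
    have "fun_support (\<lambda>x. \<eta> x * \<phi> x) \<subseteq> fun_support \<eta>"
      by (rule fun_support_subset) (use fun_support_nonzero in auto)
    then show "fun_support (\<lambda>x. \<eta> x * \<phi> x) \<subseteq> U" using \<eta> by blast
    have "fun_support (\<lambda>x. (1 - \<eta> x) * \<phi> x) \<subseteq> fun_support \<phi> - W"
    proof (rule fun_support_subset)
      show "closed (fun_support \<phi> - W)" using \<eta>(4) by (intro closed_Diff) auto
      fix x assume a: "(1 - \<eta> x) * \<phi> x \<noteq> 0"
      then have "x \<in> fun_support \<phi>" by (intro fun_support_nonzero) auto
      moreover have "x \<notin> W" using a \<eta>(6) by auto
      ultimately show "x \<in> fun_support \<phi> - W" by simp
    qed
    then show "fun_support (\<lambda>x. (1 - \<eta> x) * \<phi> x) \<subseteq> V" using \<eta>(5) by blast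
  qed (use \<eta> in \<open>auto simp: test_smooth\<close>)
qed

text \<open>\<open>test_split\<close> cuts off the part inside one set, and the induction divides
  the rest. The functions need to sum to 1 only where \<phi> is nonzero, which is enough to write
  \<phi> as a sum of test functions subordinate to the cover.\<close>

lemma test_partition:
  fixes \<phi> :: "real^'n::finite \<Rightarrow> real"
  assumes "finite F" "test_function \<phi>" "\<And>i. i \<in> F \<Longrightarrow> open (U i)" "fun_support \<phi> \<subseteq> (\<Union>i\<in>F. U i)"
  shows "\<exists>\<eta>. (\<forall>i\<in>F. smooth (\<eta> i) \<and> (\<forall>x. 0 \<le> \<eta> i x \<and> \<eta> i x \<le> 1) \<and> fun_support (\<lambda>x. \<eta> i x * \<phi> x) \<subseteq> U i) \<and>
     (\<forall>x. \<phi> x = (\<Sum>i\<in>F. \<eta> i x * \<phi> x))"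
  using assms
proof (induction F arbitrary: \<phi> rule: finite_induct)
  case empty
  have "\<phi> x = 0" for x using empty fun_support_nonzero[of \<phi> x] by auto
  then show ?case by auto
next
  case (insert j F)
  have o: "open (U j)" "open (\<Union>i\<in>F. U i)" "fun_support \<phi> \<subseteq> U j \<union> (\<Union>i\<in>F. U i)"
    using insert.prems by auto
  obtain \<eta> where \<eta>: "smooth \<eta>" "\<And>x. 0 \<le> \<eta> x" "\<And>x. \<eta> x \<le> 1"
    "fun_support (\<lambda>x. \<eta> x * \<phi> x) \<subseteq> U j" "fun_support (\<lambda>x. (1 - \<eta> x) * \<phi> x) \<subseteq> (\<Union>i\<in>F. U i)"
    using test_split[OF insert.prems(1) o] by blast
  have sm: "smooth (\<lambda>x. 1 - \<eta> x)" using \<eta>(1) by auto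
  have oF: "\<And>i. i \<in> F \<Longrightarrow> open (U i)" using insert.prems(2) by simp
  from insert.IH[OF test_mult_smooth[OF insert.prems(1) sm] oF \<eta>(5)]
  obtain \<psi> where "(\<forall>i\<in>F. smooth (\<psi> i) \<and> (\<forall>x. 0 \<le> \<psi> i x \<and> \<psi> i x \<le> 1) \<and> fun_support (\<lambda>x. \<psi> i x * ((1 - \<eta> x) * \<phi> x)) \<subseteq> U i) \<and>
     (\<forall>x. (1 - \<eta> x) * \<phi> x = (\<Sum>i\<in>F. \<psi> i x * ((1 - \<eta> x) * \<phi> x)))"
    by (rule exE)
  then have \<psi>: "\<And>i. i \<in> F \<Longrightarrow> smooth (\<psi> i) \<and> (\<forall>x. 0 \<le> \<psi> i x \<and> \<psi> i x \<le> 1) \<and> fun_support (\<lambda>x. \<psi> i x * ((1 - \<eta> x) * \<phi> x)) \<subseteq> U i"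
     "\<And>x. (1 - \<eta> x) * \<phi> x = (\<Sum>i\<in>F. \<psi> i x * ((1 - \<eta> x) * \<phi> x))" by simp_all
  define \<rho> where "\<rho> i = (if i = j then \<eta> else (\<lambda>x. \<psi> i x * (1 - \<eta> x)))" for i
  have 1: "smooth (\<rho> i) \<and> (\<forall>x. 0 \<le> \<rho> i x \<and> \<rho> i x \<le> 1) \<and> fun_support (\<lambda>x. \<rho> i x * \<phi> x) \<subseteq> U i" if "i \<in> insert j F" for i
  proof (cases "i = j")
    case False
    then have "i \<in> F" using that by simp
    with \<psi>(1) have s: "smooth (\<psi> i)" "\<forall>x. 0 \<le> \<psi> i x \<and> \<psi> i x \<le> 1" "fun_support (\<lambda>x. \<psi> i x * ((1 - \<eta> x) * \<phi> x)) \<subseteq> U i" by auto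
    have "\<psi> i x * (1 - \<eta> x) \<le> 1 * 1" for x using s(2) \<eta>(2,3) by (intro mult_mono) auto
    with s False \<eta>(3) sm show ?thesis by (auto simp: \<rho>_def mult.assoc)
  qed (use \<eta> in \<open>auto simp: \<rho>_def\<close>)
  have 2: "\<phi> x = (\<Sum>i\<in>insert j F. \<rho> i x * \<phi> x)" for x
  proof -
    have "(\<Sum>i\<in>F. \<rho> i x * \<phi> x) = (\<Sum>i\<in>F. \<psi> i x * ((1 - \<eta> x) * \<phi> x))"
      by (rule sum.cong) (use insert.hyps in \<open>auto simp: \<rho>_def\<close>)
    then have "(\<Sum>i\<in>insert j F. \<rho> i x * \<phi> x) = \<eta> x * \<phi> x + (1 - \<eta> x) * \<phi> x"
      using insert.hyps \<psi>(2)[of x] by (simp add: \<rho>_def)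
    then show ?thesis by (simp add: algebra_simps)
  qed
  show ?case using 1 2 by (intro exI[of _ \<rho>]) blast
qed

section \<open>The measure of a positive functional\<close>

definition posfun :: "'n::finite functional \<Rightarrow> bool" where
  "posfun u \<longleftrightarrow> (\<forall>\<phi> \<psi> a b. test_function \<phi> \<longrightarrow> test_function \<psi> \<longrightarrow>
        u (\<lambda>x. a * \<phi> x + b * \<psi> x) = a * u \<phi> + b * u \<psi>) \<and>
     (\<forall>\<phi>. test_function \<phi> \<longrightarrow> (\<forall>x. 0 \<le> \<phi> x) \<longrightarrow> 0 \<le> u \<phi>)"

text \<open>The mass that a measure representing \<open>u\<close> is bound to give to an open set,
  since test functions below 1 with support in \<open>U\<close> exhaust its indicator. The outer
  measure below is the one of the Riesz theorem.\<close>

definition open_content :: "'n::finite functional \<Rightarrow> (real^'n) set \<Rightarrow> ennreal" where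
  "open_content u U = (SUP \<phi>\<in>{\<phi>. test_function \<phi> \<and> (\<forall>x. 0 \<le> \<phi> x \<and> \<phi> x \<le> 1) \<and> fun_support \<phi> \<subseteq> U}. ennreal (u \<phi>))"

definition outer_content :: "'n::finite functional \<Rightarrow> (real^'n) set \<Rightarrow> ennreal" where
  "outer_content u A = (INF U\<in>{U. open U \<and> A \<subseteq> U}. open_content u U)"

lemma open_content_ge: "test_function \<phi> \<Longrightarrow> (\<And>x. 0 \<le> \<phi> x) \<Longrightarrow> (\<And>x. \<phi> x \<le> 1) \<Longrightarrow> fun_support \<phi> \<subseteq> U \<Longrightarrow> ennreal (u \<phi>) \<le> open_content u U"
  unfolding open_content_def by (rule SUP_upper) auto

lemma open_content_least: "(\<And>\<phi>. test_function \<phi> \<Longrightarrow> (\<And>x. 0 \<le> \<phi> x) \<Longrightarrow> (\<And>x. \<phi> x \<le> 1) \<Longrightarrow> fun_support \<phi> \<subseteq> U \<Longrightarrow> ennreal (u \<phi>) \<le> b) \<Longrightarrow> open_content u U \<le> b"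
  unfolding open_content_def by (rule SUP_least) auto

lemma open_content_mono: "U \<subseteq> V \<Longrightarrow> open_content u U \<le> open_content u V"
  by (rule open_content_least) (rule open_content_ge, auto)

lemma outer_content_open: "open U \<Longrightarrow> outer_content u U = open_content u U"
  unfolding outer_content_def by (rule antisym) (auto intro!: INF_lower INF_greatest open_content_mono)

lemma outer_content_mono: "A \<subseteq> B \<Longrightarrow> outer_content u A \<le> outer_content u B"
  unfolding outer_content_def by (rule INF_superset_mono) auto

lemma outer_content_le: "open U \<Longrightarrow> A \<subseteq> U \<Longrightarrow> outer_content u A \<le> open_content u U"
  unfolding outer_content_def by (rule INF_lower) auto

context
  fixes u :: "'n::finite functional"
  assumes posfun: "posfun u"
begin

lemma posfun_lin: "test_function \<phi> \<Longrightarrow> test_function \<psi> \<Longrightarrow> u (\<lambda>x. a * \<phi> x + b * \<psi> x) = a * u \<phi> + b * u \<psi>"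
  using posfun unfolding posfun_def by blast

lemma posfun_nonneg: "test_function \<phi> \<Longrightarrow> (\<And>x. 0 \<le> \<phi> x) \<Longrightarrow> 0 \<le> u \<phi>"
  using posfun unfolding posfun_def by blast

lemma posfun_add: "test_function \<phi> \<Longrightarrow> test_function \<psi> \<Longrightarrow> u (\<lambda>x. \<phi> x + \<psi> x) = u \<phi> + u \<psi>"
  using posfun_lin[of \<phi> \<psi> 1 1] by simp
lemma posfun_cmult: "test_function \<phi> \<Longrightarrow> u (\<lambda>x. c * \<phi> x) = c * u \<phi>"
  using posfun_lin[of \<phi> \<phi> c 0] by simp
lemma posfun_diff: "test_function \<phi> \<Longrightarrow> test_function \<psi> \<Longrightarrow> u (\<lambda>x. \<phi> x - \<psi> x) = u \<phi> - u \<psi>"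
  using posfun_lin[of \<phi> \<psi> 1 "-1"] by simp
lemma posfun_zero: "u (\<lambda>x. 0) = 0"
  using posfun_cmult[OF test_zero, of 0] by simp
lemma posfun_sum: "(\<And>i. i \<in> A \<Longrightarrow> test_function (f i)) \<Longrightarrow> u (\<lambda>x. \<Sum>i\<in>A. f i x) = (\<Sum>i\<in>A. u (f i))"
  by (induction A rule: infinite_finite_induct) (auto simp: posfun_zero posfun_add test_sum)

lemma posfun_mono: "test_function \<phi> \<Longrightarrow> test_function \<psi> \<Longrightarrow> (\<And>x. \<phi> x \<le> \<psi> x) \<Longrightarrow> u \<phi> \<le> u \<psi>"
  using posfun_nonneg[OF test_diff[of \<psi> \<phi>]] posfun_diff[of \<psi> \<phi>] by simp

text \<open>A test function meets only finitely many of the sets because its support is compact, and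
  a subordinate partition splits its value among them.\<close>

lemma open_content_UN:
  assumes "\<And>i::nat. open (U i)"
  shows "open_content u (\<Union>i. U i) \<le> (\<Sum>i. open_content u (U i))"
proof (rule open_content_least)
  fix \<phi> assume \<phi>: "test_function \<phi>" "\<And>x. 0 \<le> \<phi> x" "\<And>x. \<phi> x \<le> 1" "fun_support \<phi> \<subseteq> (\<Union>i. U i)"
  obtain F where F: "finite F" "fun_support \<phi> \<subseteq> (\<Union>i\<in>F. U i)"
    using compactE_image[OF test_compact[OF \<phi>(1)], of UNIV U] assms \<phi>(4) by auto
  from test_partition[OF F(1) \<phi>(1) assms F(2)]
  obtain \<psi> where "(\<forall>i\<in>F. smooth (\<psi> i) \<and> (\<forall>x. 0 \<le> \<psi> i x \<and> \<psi> i x \<le> 1) \<and> fun_support (\<lambda>x. \<psi> i x * \<phi> x) \<subseteq> U i) \<and>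
     (\<forall>x. \<phi> x = (\<Sum>i\<in>F. \<psi> i x * \<phi> x))" by (rule exE)
  then have \<psi>: "\<And>i. i \<in> F \<Longrightarrow> smooth (\<psi> i)" "\<And>i x. i \<in> F \<Longrightarrow> 0 \<le> \<psi> i x" "\<And>i x. i \<in> F \<Longrightarrow> \<psi> i x \<le> 1"
    "\<And>i. i \<in> F \<Longrightarrow> fun_support (\<lambda>x. \<psi> i x * \<phi> x) \<subseteq> U i" "\<And>x. (\<Sum>i\<in>F. \<psi> i x * \<phi> x) = \<phi> x" by auto
  have t: "test_function (\<lambda>x. \<psi> i x * \<phi> x)" if "i \<in> F" for i by (rule test_mult_smooth[OF \<phi>(1) \<psi>(1)[OF that]])
  have n: "0 \<le> u (\<lambda>x. \<psi> i x * \<phi> x)" if "i \<in> F" for i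
    by (rule posfun_nonneg[OF t[OF that]]) (use \<psi>(2)[OF that] \<phi>(2) in simp)
  have "u \<phi> = u (\<lambda>x. \<Sum>i\<in>F. \<psi> i x * \<phi> x)" by (simp add: \<psi>(5))
  also have "\<dots> = (\<Sum>i\<in>F. u (\<lambda>x. \<psi> i x * \<phi> x))" by (rule posfun_sum[OF t])
  finally have "ennreal (u \<phi>) = (\<Sum>i\<in>F. ennreal (u (\<lambda>x. \<psi> i x * \<phi> x)))"
    using n by (simp add: sum_ennreal)
  also have "\<dots> \<le> (\<Sum>i\<in>F. open_content u (U i))"
  proof (rule sum_mono, rule open_content_ge[OF t])
    fix i x assume "i \<in> F"
    show "0 \<le> \<psi> i x * \<phi> x" using \<psi>(2)[OF \<open>i \<in> F\<close>] \<phi>(2) by simp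
    have "\<psi> i x * \<phi> x \<le> 1 * 1" using \<psi>(2,3)[OF \<open>i \<in> F\<close>] \<phi>(2,3) by (intro mult_mono) auto
    then show "\<psi> i x * \<phi> x \<le> 1" by simp
  qed (use \<psi>(4) in auto)
  also have "\<dots> \<le> (\<Sum>i. open_content u (U i))" by (rule sum_le_suminf) (use F in auto)
  finally show "ennreal (u \<phi>) \<le> (\<Sum>i. open_content u (U i))" .
qed

lemma open_content_empty: "open_content u {} = 0"
proof -
  have "open_content u {} \<le> 0"
  proof (rule open_content_least)
    fix \<phi> :: "real^'n \<Rightarrow> real" assume "fun_support \<phi> \<subseteq> {}"
    then have "\<phi> = (\<lambda>x. 0)" using fun_support_nonzero by blast
    then show "ennreal (u \<phi>) \<le> 0" by (simp add: posfun_zero)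
  qed
  then show ?thesis by simp
qed

lemma outer_measure_space_outer_content: "outer_measure_space (Pow UNIV) (outer_content u)"
  unfolding outer_measure_space_def
proof (intro conjI)
  show "positive (Pow UNIV) (outer_content u)" by (simp add: positive_def outer_content_open open_content_empty)
  show "increasing (Pow UNIV) (outer_content u)" by (simp add: increasing_def outer_content_mono)
  show "countably_subadditive (Pow UNIV) (outer_content u)"
  proof (simp add: countably_subadditive_def, safe)
    fix A :: "nat \<Rightarrow> (real^'n) set"
    show "outer_content u (\<Union>i. A i) \<le> (\<Sum>n. outer_content u (A n))"
    proof (rule ennreal_le_epsilon)
      fix e :: real assume e: "0 < e" "(\<Sum>n. outer_content u (A n)) < top"
      then have *: "\<And>n. outer_content u (A n) < outer_content u (A n) + e * (1/2)^Suc n"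
        by (auto simp add: less_top dest!: ennreal_suminf_lessD)
      have "\<exists>U. open U \<and> A n \<subseteq> U \<and> open_content u U \<le> outer_content u (A n) + e * (1/2)^Suc n" for n
        using *[of n] unfolding outer_content_def INF_less_iff by (auto intro: less_imp_le)
      then obtain U where U: "\<And>n. open (U n)" "\<And>n. A n \<subseteq> U n" "\<And>n. open_content u (U n) \<le> outer_content u (A n) + e * (1/2)^Suc n" by metis
      have "outer_content u (\<Union>i. A i) \<le> open_content u (\<Union>i. U i)" by (rule outer_content_le) (use U in auto)
      also have "\<dots> \<le> (\<Sum>n. open_content u (U n))" by (rule open_content_UN[OF U(1)])
      also have "\<dots> \<le> (\<Sum>n. outer_content u (A n) + e * (1/2) ^ Suc n)"
        by (intro suminf_le suminf_nonneg allI U) auto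
      also have "... = (\<Sum>n. outer_content u (A n)) + (\<Sum>n. ennreal e * ennreal ((1/2) ^ Suc n))"
        using \<open>0 < e\<close> by (subst suminf_add[symmetric])
                       (auto simp del: ennreal_suminf_cmult simp add: ennreal_mult[symmetric])
      also have "\<dots> = (\<Sum>n. outer_content u (A n)) + e"
        unfolding ennreal_suminf_cmult
        by (subst suminf_ennreal_eq[OF zero_le_power power_half_series]) auto
      finally show "outer_content u (\<Union>i. A i) \<le> (\<Sum>n. outer_content u (A n)) + e" .
    qed
  qed
qed

lemma outer_content_subadd: "outer_content u (A \<union> B) \<le> outer_content u A + outer_content u B"
proof -
  \<comment> \<open>\<open>countably_subadditive\<close> speaks of disjoint families, so an overlap
    is removed first by passing to \<open>B - A\<close>.\<close>
  have "outer_content u (\<Union>i. binaryset A B i) \<le> (\<Sum>n. outer_content u (binaryset A B n))" if "A \<inter> B = {}" for A B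
  proof -
    have "disjoint_family (binaryset A B)" using that by (auto simp: disjoint_family_on_def binaryset_def)
    then show ?thesis using outer_measure_space_outer_content unfolding outer_measure_space_def countably_subadditive_def by simp
  qed
  moreover have "(\<Sum>n. outer_content u (binaryset A B n)) = outer_content u A + outer_content u B" for A B
    by (rule suminf_binaryset_eq) (simp add: outer_content_open open_content_empty)
  ultimately have d: "outer_content u (A \<union> B) \<le> outer_content u A + outer_content u B" if "A \<inter> B = {}" for A B
    using that by (metis UN_binaryset_eq)
  have "outer_content u (A \<union> B) \<le> outer_content u A + outer_content u (B - A)" using d[of A "B - A"] by simp
  also have "\<dots> \<le> outer_content u A + outer_content u B" by (intro add_left_mono outer_content_mono) auto
  finally show ?thesis .
qed

text \<open>Caratheodory's criterion. Choose \<phi> for \<open>l \<inter> V\<close> first; the open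
  set \<open>V - fun_support \<phi>\<close> still contains the rest \<open>- l \<inter> V\<close>.
  Any \<psi> chosen there has support disjoint from that of \<phi>, so \<phi> + \<psi> is admissible
  for \<open>V\<close>. Two suprema give the inequality.\<close>

lemma open_in_lambda_system: assumes "open l" shows "l \<in> lambda_system UNIV (Pow UNIV) (outer_content u)"
proof -
  have "outer_content u (l \<inter> x) + outer_content u (- l \<inter> x) = outer_content u x" for x
  proof (rule antisym)
    have "outer_content u x \<le> outer_content u ((l \<inter> x) \<union> (- l \<inter> x))" by (rule outer_content_mono) auto
    also have "\<dots> \<le> outer_content u (l \<inter> x) + outer_content u (- l \<inter> x)" by (rule outer_content_subadd)
    finally show "outer_content u x \<le> outer_content u (l \<inter> x) + outer_content u (- l \<inter> x)" .
    have "outer_content u (l \<inter> x) + outer_content u (- l \<inter> x) \<le> open_content u V" if V: "open V" "x \<subseteq> V" for V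
    proof -
      let ?P = "{\<phi>. test_function \<phi> \<and> (\<forall>x. 0 \<le> \<phi> x \<and> \<phi> x \<le> 1) \<and> fun_support \<phi> \<subseteq> l \<inter> V}"
      let ?Q = "\<lambda>U. {\<phi>. test_function \<phi> \<and> (\<forall>x. 0 \<le> \<phi> x \<and> \<phi> x \<le> 1) \<and> fun_support \<phi> \<subseteq> U}"
      have zero: "(\<lambda>x. 0) \<in> ?Q U" for U by (auto simp: fun_support_def)
      have "outer_content u (l \<inter> x) + outer_content u (- l \<inter> x) \<le> open_content u (l \<inter> V) + outer_content u (- l \<inter> V)"
        by (intro add_mono outer_content_le outer_content_mono) (use assms V in auto)
      also have "\<dots> = (SUP \<phi>\<in>?P. ennreal (u \<phi>) + outer_content u (- l \<inter> V))"
        unfolding open_content_def by (rule ennreal_SUP_add_left[symmetric]) (use zero[of "l \<inter> V"] in blast)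
      also have "\<dots> \<le> open_content u V"
      proof (rule SUP_least)
        fix \<phi> assume \<phi>: "\<phi> \<in> ?P"
        have oV: "open (V - fun_support \<phi>)" using V by (simp add: open_Diff)
        have "ennreal (u \<phi>) + outer_content u (- l \<inter> V) \<le> ennreal (u \<phi>) + open_content u (V - fun_support \<phi>)"
          by (intro add_left_mono outer_content_le oV) (use \<phi> in auto)
        also have "\<dots> = (SUP \<psi>\<in>?Q (V - fun_support \<phi>). ennreal (u \<phi>) + ennreal (u \<psi>))"
          unfolding open_content_def by (rule ennreal_SUP_add_right) (use zero[of "V - fun_support \<phi>"] in blast)
        also have "\<dots> \<le> open_content u V"
        proof (rule SUP_least)
          fix \<psi> assume \<psi>: "\<psi> \<in> ?Q (V - fun_support \<phi>)"
          have t: "test_function \<phi>" "test_function \<psi>" using \<phi> \<psi> by auto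
          have "ennreal (u \<phi>) + ennreal (u \<psi>) = ennreal (u (\<lambda>x. \<phi> x + \<psi> x))"
            using \<phi> \<psi> posfun_nonneg by (simp add: posfun_add ennreal_plus[symmetric] del: ennreal_plus)
          also have "\<dots> \<le> open_content u V"
          proof (rule open_content_ge[OF test_add[OF t]])
            show "0 \<le> \<phi> x + \<psi> x" for x using \<phi> \<psi> by simp
            show "\<phi> x + \<psi> x \<le> 1" for x
            proof (cases "\<psi> x = 0")
              case False
              then have "x \<in> V - fun_support \<phi>" using \<psi> fun_support_nonzero by blast
              then have "\<phi> x = 0" using fun_support_nonzero by blast
              then show ?thesis using \<psi> by simp
            qed (use \<phi> in simp)
            have "fun_support (\<lambda>x. \<phi> x + \<psi> x) \<subseteq> fun_support \<phi> \<union> fun_support \<psi>"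
            proof (rule fun_support_subset)
              fix x assume "\<phi> x + \<psi> x \<noteq> 0"
              then have "\<phi> x \<noteq> 0 \<or> \<psi> x \<noteq> 0" by auto
              then show "x \<in> fun_support \<phi> \<union> fun_support \<psi>" using fun_support_nonzero by blast
            qed auto
            then show "fun_support (\<lambda>x. \<phi> x + \<psi> x) \<subseteq> V" using \<phi> \<psi> by blast
          qed
          finally show "ennreal (u \<phi>) + ennreal (u \<psi>) \<le> open_content u V" .
        qed
        finally show "ennreal (u \<phi>) + outer_content u (- l \<inter> V) \<le> open_content u V" .
      qed
      finally show ?thesis .
    qed
    then show "outer_content u (l \<inter> x) + outer_content u (- l \<inter> x) \<le> outer_content u x"
      unfolding outer_content_def[of u x] by (intro INF_greatest) auto
  qed
  then show ?thesis by (simp add: lambda_system_def Compl_eq_Diff_UNIV)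
qed

definition riesz_measure :: "(real^'n) measure" where "riesz_measure = measure_of UNIV (sets borel) (outer_content u)"

lemma sets_riesz_measure [simp]: "sets riesz_measure = sets borel"
  unfolding riesz_measure_def using sets.sigma_sets_eq[of "borel :: (real^'n) measure"] by (simp add: sets_measure_of_conv)

lemma emeasure_riesz_measure: "open U \<Longrightarrow> emeasure riesz_measure U = open_content u U"
proof -
  assume U: "open U"
  let ?L = "lambda_system UNIV (Pow UNIV) (outer_content u)"
  have m: "measure_space UNIV ?L (outer_content u)"
    using sigma_algebra.caratheodory_lemma[OF sigma_algebra_Pow outer_measure_space_outer_content] by simp
  have "sigma_sets UNIV {S::(real^'n) set. open S} \<subseteq> ?L"
    using m open_in_lambda_system by (intro sigma_algebra.sigma_sets_subset) (auto simp: measure_space_def)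
  then have "sets (borel :: (real^'n) measure) \<subseteq> ?L" by (simp add: borel_def)
  then have "measure_space UNIV (sets (borel :: (real^'n) measure)) (outer_content u)"
    using measure_down[OF m, of "sets borel"] sets.sigma_algebra_axioms[of "borel :: (real^'n) measure"] by simp
  then have "emeasure riesz_measure U = outer_content u U"
    unfolding riesz_measure_def by (intro emeasure_measure_of_sigma) (use U in \<open>auto simp: measure_space_def\<close>)
  then show ?thesis using U by (simp add: outer_content_open)
qed

definition represents :: "(real^'n) measure \<Rightarrow> bool" where
  "represents \<mu> \<longleftrightarrow> sets \<mu> = sets borel \<and> (\<forall>K. compact K \<longrightarrow> emeasure \<mu> K < \<infinity>) \<and>
     (\<forall>\<phi>. test_function \<phi> \<longrightarrow> u \<phi> = (\<integral>x. \<phi> x \<partial>\<mu>))"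

lemma test_integrable:
  assumes "sets \<mu> = sets borel" "\<And>K. compact K \<Longrightarrow> emeasure \<mu> K < \<infinity>" "test_function \<phi>"
  shows "integrable \<mu> (\<phi> :: real^'n \<Rightarrow> real)"
proof -
  obtain B where B: "\<And>x. \<bar>\<phi> x\<bar> \<le> B" "B > 0" using test_bounded[OF assms(3)] by blast
  have "\<phi> \<in> borel_measurable borel"
    by (rule borel_measurable_continuous_onI[OF smooth_continuous[OF test_smooth[OF assms(3)]]])
  then have m: "\<phi> \<in> borel_measurable \<mu>" using assms(1) measurable_cong_sets by blast
  have z: "\<phi> x = 0" if "x \<notin> fun_support \<phi>" for x using that fun_support_nonzero by blast
  show ?thesis
    by (rule integrableI_bounded_set[of "fun_support \<phi>" _ _ B])
      (use assms m B in \<open>auto simp: test_compact compact_imp_closed z\<close>)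
qed

text \<open>\<open>U\<close> is exhausted by compact sets, and a smooth cutoff fits between each of
  them and \<open>U\<close>. So the values on open sets are determined by \<open>u\<close>, which is
  the reason for uniqueness.\<close>

lemma represents_open_content:
  assumes "represents \<mu>" "open U" shows "emeasure \<mu> U = open_content u U"
proof (rule antisym)
  have s: "sets \<mu> = sets borel" and f: "\<And>K. compact K \<Longrightarrow> emeasure \<mu> K < \<infinity>"
    and r: "\<And>\<phi>. test_function \<phi> \<Longrightarrow> u \<phi> = (\<integral>x. \<phi> x \<partial>\<mu>)" using assms by (auto simp: represents_def)
  have le: "emeasure \<mu> K \<le> open_content u U" if K: "compact K" "K \<subseteq> U" for K
  proof -
    obtain \<phi> W where \<phi>: "test_function \<phi>" "\<And>x. 0 \<le> \<phi> x" "\<And>x. \<phi> x \<le> 1"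
      "open W" "K \<subseteq> W" "\<And>x. x \<in> W \<Longrightarrow> \<phi> x = 1" "fun_support \<phi> \<subseteq> U" using smooth_urysohn[OF K(1) assms(2) K(2)] by metis
    have Ks: "K \<in> sets \<mu>" using K s by (simp add: compact_imp_closed)
    have "emeasure \<mu> K = (\<integral>\<^sup>+x. indicator K x \<partial>\<mu>)" using Ks by simp
    also have "\<dots> \<le> (\<integral>\<^sup>+x. ennreal (\<phi> x) \<partial>\<mu>)" using \<phi>(5,6) by (intro nn_integral_mono) (auto simp: indicator_def)
    also have "\<dots> = ennreal (\<integral>x. \<phi> x \<partial>\<mu>)" by (rule nn_integral_eq_integral[OF test_integrable[OF s f \<phi>(1)]]) (use \<phi> in auto)
    also have "\<dots> \<le> open_content u U" using open_content_ge[OF \<phi>(1-3,7), of u] r[OF \<phi>(1)] by simp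
    finally show ?thesis .
  qed
  obtain C where C: "\<And>n. compact (C n)" "\<And>n. C n \<subseteq> U" "\<And>n. C n \<subseteq> interior (C (Suc n))" "\<Union>(range C) = U"
    using open_Union_compact_subsets[OF assms(2)] by metis
  have "incseq C" by (rule incseq_SucI) (use C(3) interior_subset in blast)
  moreover have "range C \<subseteq> sets \<mu>" using C(1) s by (auto simp: compact_imp_closed)
  ultimately have "(SUP n. emeasure \<mu> (C n)) = emeasure \<mu> U" using C(4) SUP_emeasure_incseq[of C \<mu>] by simp
  then show "emeasure \<mu> U \<le> open_content u U" using le[OF C(1,2)] by (metis SUP_least)
  show "open_content u U \<le> emeasure \<mu> U"
  proof (rule open_content_least)
    fix \<phi> assume \<phi>: "test_function \<phi>" "\<And>x. 0 \<le> \<phi> x" "\<And>x. \<phi> x \<le> 1" "fun_support \<phi> \<subseteq> U"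
    have z: "\<phi> x = 0" if "x \<notin> U" for x using \<phi>(4) that fun_support_nonzero[of \<phi> x] by blast
    have "ennreal (u \<phi>) = (\<integral>\<^sup>+x. ennreal (\<phi> x) \<partial>\<mu>)"
      using nn_integral_eq_integral[OF test_integrable[OF s f \<phi>(1)]] \<phi>(2) r[OF \<phi>(1)] by simp
    also have "\<dots> \<le> (\<integral>\<^sup>+x. indicator U x \<partial>\<mu>)"
      using \<phi>(3) by (intro nn_integral_mono) (auto simp: indicator_def z)
    also have "\<dots> = emeasure \<mu> U" using assms(2) s by simp
    finally show "ennreal (u \<phi>) \<le> emeasure \<mu> U" .
  qed
qed

lemma represents_unique:
  assumes "represents \<mu>" "represents \<nu>" shows "\<mu> = \<nu>"
proof (rule measure_eqI_generator_eq[where E="{U. open U}" and \<Omega>=UNIV and A="\<lambda>i. ball 0 (real i)"])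
  show "Int_stable {U :: (real^'n) set. open U}" by (auto simp: Int_stable_def)
  show "emeasure \<mu> X = emeasure \<nu> X" if "X \<in> {U. open U}" for X
    using represents_open_content[OF assms(1)] represents_open_content[OF assms(2)] that by simp
  show "sets \<mu> = sigma_sets UNIV {U. open U}" "sets \<nu> = sigma_sets UNIV {U. open U}"
    using assms by (auto simp: represents_def borel_def)
  show "(\<Union>i. ball (0::real^'n) (real i)) = UNIV"
    using reals_Archimedean2 by (auto simp: dist_norm)
  fix i :: nat
  have "emeasure \<mu> (ball 0 (real i)) \<le> emeasure \<mu> (cball 0 (real i))"
    by (rule emeasure_mono) (use assms in \<open>auto simp: represents_def\<close>)
  also have "\<dots> < \<infinity>" using assms(1) by (simp add: represents_def)
  finally show "emeasure \<mu> (ball 0 (real i)) \<noteq> \<infinity>" by simp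
qed auto

text \<open>For a < 1 the open set {f > a} contains \<open>K\<close>, and every \<phi> admissible
  for it satisfies a \<phi> \<le> f. Then a tends to 1.\<close>

lemma riesz_measure_compact_le:
  assumes "test_function f" "\<And>x. 0 \<le> f x" "compact K" "\<And>x. x \<in> K \<Longrightarrow> 1 \<le> f x"
  shows "emeasure riesz_measure K \<le> ennreal (u f)"
proof -
  have un: "0 \<le> u f" by (rule posfun_nonneg[OF assms(1,2)])
  have le: "emeasure riesz_measure K \<le> ennreal (u f / a)" if a: "0 < a" "a < 1" for a
  proof -
    let ?U = "{x. a < f x}"
    have "open ?U" by (intro open_Collect_less continuous_on_const smooth_continuous test_smooth assms)
    then have "emeasure riesz_measure K \<le> open_content u ?U"
      using assms(4) a by (subst emeasure_riesz_measure[symmetric]) (auto intro!: emeasure_mono dest!: assms(4))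
    also have "\<dots> \<le> ennreal (u f / a)"
    proof (rule open_content_least)
      fix \<phi> assume \<phi>: "test_function \<phi>" "\<And>x. 0 \<le> \<phi> x" "\<And>x. \<phi> x \<le> 1" "fun_support \<phi> \<subseteq> ?U"
      have "u (\<lambda>x. a * \<phi> x) \<le> u f"
      proof (rule posfun_mono[OF test_cmult[OF \<phi>(1)] assms(1)])
        fix x show "a * \<phi> x \<le> f x"
        proof (cases "\<phi> x = 0")
          case False
          then have "a < f x" using \<phi>(4) fun_support_nonzero[of \<phi> x] by auto
          moreover have "a * \<phi> x \<le> a * 1" using a \<phi>(3) by (intro mult_left_mono) auto
          ultimately show ?thesis by simp
        qed (use assms(2) in simp)
      qed
      then have "a * u \<phi> \<le> u f" by (simp add: posfun_cmult[OF \<phi>(1)])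
      then have "u \<phi> \<le> u f / a" using a by (simp add: field_simps)
      then show "ennreal (u \<phi>) \<le> ennreal (u f / a)" by (rule ennreal_leI)
    qed
    finally show ?thesis .
  qed
  have "emeasure riesz_measure K < \<infinity>" using le[of "1/2"] by (metis ennreal_less_top half_gt_zero_iff le_less_trans infinity_ennreal_def field_sum_of_halves less_add_same_cancel1 zero_less_one)
  then obtain m where m: "emeasure riesz_measure K = ennreal m" "0 \<le> m" by (cases "emeasure riesz_measure K") auto
  have "a * m \<le> u f" if "0 < a" "a < 1" for a
    using le[OF that] m that un by (simp add: field_simps)
  then have "m \<le> u f" by (rule field_le_mult_one_interval)
  then show ?thesis using m by (simp add: ennreal_leI)
qed

lemma riesz_measure_finite: "compact K \<Longrightarrow> emeasure riesz_measure K < \<infinity>"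
proof -
  assume "compact K"
  then obtain \<phi> W where "test_function \<phi>" "\<And>x. 0 \<le> \<phi> x" "K \<subseteq> W" "\<And>x. x \<in> W \<Longrightarrow> \<phi> x = 1"
    using smooth_urysohn[of K UNIV] by (metis open_UNIV subset_UNIV)
  then have "emeasure riesz_measure K \<le> ennreal (u \<phi>)" using \<open>compact K\<close> by (intro riesz_measure_compact_le) auto
  then show ?thesis using le_less_trans by fastforce
qed

lemmas riesz_measure_integrable = test_integrable[OF sets_riesz_measure riesz_measure_finite]

text \<open>The sum of the slices \<open>h (N \<phi> - m)\<close>, \<open>m < N\<close>, differs from \<open>N \<phi>\<close> by at most \<open>1\<close>, while \<open>u\<close> and the
  integral of each slice are squeezed between the measures of two consecutive superlevel sets.\<close>

lemma represents_unit:
  assumes \<phi>: "test_function \<phi>" "\<And>x. 0 \<le> \<phi> x" "\<And>x. \<phi> x \<le> 1"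
  shows "u \<phi> = (\<integral>x. \<phi> x \<partial>riesz_measure)"
proof -
  obtain h where h: "smooth1 h" "mono h" "\<And>x. 0 \<le> h x" "\<And>x. h x \<le> 1"
    "\<And>x. x \<le> 0 \<Longrightarrow> h x = 0" "\<And>x. 1 \<le> x \<Longrightarrow> h x = 1" using smooth_step_exists by blast
  obtain \<eta> W where \<eta>: "test_function \<eta>" "\<And>x. 0 \<le> \<eta> x" "\<And>x. \<eta> x \<le> 1"
      "fun_support \<phi> \<subseteq> W" "\<And>x. x \<in> W \<Longrightarrow> \<eta> x = 1"
    using smooth_urysohn[OF test_compact[OF \<phi>(1)] open_UNIV subset_UNIV] by metis
  have \<eta>1: "\<eta> x = 1" if "\<phi> x \<noteq> 0" for x using \<eta>(4,5) fun_support_nonzero[of \<phi> x] that by blast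
  have slice: "\<bar>t - (\<Sum>m<N. h (t - real m))\<bar> \<le> 1" if "0 \<le> t" "t \<le> real N" for t N
    using that
  proof (induction N)
    case (Suc N)
    show ?case
    proof (cases "t \<le> real N")
      case True
      then have "h (t - real N) = 0" by (intro h(5)) simp
      with Suc True show ?thesis by simp
    next
      case False
      have "(\<Sum>m<N. h (t - real m)) = (\<Sum>m<N. 1)"
        by (rule sum.cong) (use False in \<open>auto intro!: h(6)\<close>)
      then show ?thesis using False Suc.prems h(3)[of "t - real N"] h(4)[of "t - real N"] by simp
    qed
  qed simp
  \<comment> \<open>Free of \<open>N\<close>: comparing the two sums of slices costs two slices in
    \<open>SI\<close> and one in \<open>IS\<close>, each below \<eta>, and replacing N \<phi> by its
    slices costs one more \<eta> for \<open>u\<close> and for the integral.\<close>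
  define C where "C = 3 * u \<eta> + 2 * (\<integral>x. \<eta> x \<partial>riesz_measure)"
  have bound: "real N * \<bar>u \<phi> - (\<integral>x. \<phi> x \<partial>riesz_measure)\<bar> \<le> C" for N
  proof -
    define f where "f m x = h (real N * \<phi> x - real m)" for m :: nat and x
    have f0: "f m x = 0" if "\<phi> x = 0" for m x using that by (simp add: f_def h(5))
    have ft: "test_function (f m)" for m
    proof (rule test_functionI[OF _ test_compact[OF \<phi>(1)]])
      show "smooth (f m)" unfolding f_def by (intro smooth_compose[OF h(1)] smooth_diff smooth_mult smooth_const test_smooth[OF \<phi>(1)])
      show "x \<in> fun_support \<phi>" if "f m x \<noteq> 0" for x using f0 that fun_support_nonzero by metis
    qed
    have f01: "0 \<le> f m x" "f m x \<le> 1" for m x by (simp_all add: f_def h)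
    have f\<eta>: "f m x \<le> \<eta> x" for m x using f0[of x m] f01[of m x] \<eta>1[of x] \<eta>(2)[of x] by (cases "\<phi> x = 0") auto
    have cK: "compact {x. real (Suc m) \<le> real N * \<phi> x}" for m
    proof -
      have "closed {x. real (Suc m) \<le> real N * \<phi> x}"
        by (intro closed_Collect_le continuous_intros smooth_continuous test_smooth \<phi>)
      moreover have "{x. real (Suc m) \<le> real N * \<phi> x} \<subseteq> fun_support \<phi>"
        using fun_support_nonzero[of \<phi>] by force
      ultimately show ?thesis using test_compact[OF \<phi>(1)] by (metis compact_Int_closed inf.absorb_iff2)
    qed
    have a: "(\<integral>x. f (Suc m) x \<partial>riesz_measure) \<le> u (f m)" for m
    proof -
      have "ennreal (\<integral>x. f (Suc m) x \<partial>riesz_measure) = (\<integral>\<^sup>+x. ennreal (f (Suc m) x) \<partial>riesz_measure)"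
        using nn_integral_eq_integral[OF riesz_measure_integrable[OF _ ft]] f01 by simp
      also have "\<dots> \<le> (\<integral>\<^sup>+x. indicator {x. real (Suc m) \<le> real N * \<phi> x} x \<partial>riesz_measure)"
        using h(4,5) by (intro nn_integral_mono) (auto simp: indicator_def f_def)
      also have "\<dots> = emeasure riesz_measure {x. real (Suc m) \<le> real N * \<phi> x}"
        using cK by (intro nn_integral_indicator) (simp add: compact_imp_closed)
      also have "\<dots> \<le> ennreal (u (f m))"
        by (rule riesz_measure_compact_le[OF ft f01(1) cK]) (auto simp: f_def h(6))
      finally show ?thesis using posfun_nonneg[OF ft f01(1)] by simp
    qed
    \<comment> \<open>A shift by two: the support of slice m + 2 lies in a closed superlevel set,
      which has to fit into an open one on which slice m equals 1.\<close>
    have b: "u (f (Suc (Suc m))) \<le> (\<integral>x. f m x \<partial>riesz_measure)" for m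
    proof -
      let ?U = "{x. real (Suc m) < real N * \<phi> x}"
      have oU: "open ?U" by (intro open_Collect_less continuous_intros smooth_continuous test_smooth \<phi>)
      have "fun_support (f (Suc (Suc m))) \<subseteq> {x. real (Suc (Suc m)) \<le> real N * \<phi> x}"
      proof (rule fun_support_subset[OF compact_imp_closed[OF cK]])
        fix x assume "f (Suc (Suc m)) x \<noteq> 0"
        then show "x \<in> {x. real (Suc (Suc m)) \<le> real N * \<phi> x}" using h(5)[of "real N * \<phi> x - real (Suc (Suc m))"] unfolding f_def by (simp del: of_nat_Suc) (metis linear)
      qed
      then have "ennreal (u (f (Suc (Suc m)))) \<le> open_content u ?U"
        by (intro open_content_ge ft f01) auto
      also have "\<dots> = (\<integral>\<^sup>+x. indicator ?U x \<partial>riesz_measure)" using oU by (simp add: emeasure_riesz_measure)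
      also have "\<dots> \<le> (\<integral>\<^sup>+x. ennreal (f m x) \<partial>riesz_measure)"
        by (intro nn_integral_mono) (auto simp: indicator_def f_def h(6))
      also have "\<dots> = ennreal (\<integral>x. f m x \<partial>riesz_measure)"
        using nn_integral_eq_integral[OF riesz_measure_integrable[OF _ ft]] f01 by simp
      finally show ?thesis using f01 by (simp add: Bochner_Integration.integral_nonneg)
    qed
    define S where "S = (\<Sum>m<N. u (f m))"
    define I where "I = (\<Sum>m<N. (\<integral>x. f m x \<partial>riesz_measure))"
    have un: "0 \<le> u (f m)" for m by (rule posfun_nonneg[OF ft f01(1)])
    have inn: "0 \<le> (\<integral>x. f m x \<partial>riesz_measure)" for m using f01 by (simp add: Bochner_Integration.integral_nonneg)
    have ue: "u (f m) \<le> u \<eta>" for m by (rule posfun_mono[OF ft \<eta>(1) f\<eta>])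
    have ie: "(\<integral>x. f m x \<partial>riesz_measure) \<le> (\<integral>x. \<eta> x \<partial>riesz_measure)" for m
      by (rule integral_mono[OF riesz_measure_integrable[OF _ ft] riesz_measure_integrable[OF _ \<eta>(1)] f\<eta>]) auto
    have u\<eta>: "0 \<le> u \<eta>" by (rule posfun_nonneg[OF \<eta>(1,2)])
    have i\<eta>: "0 \<le> (\<integral>x. \<eta> x \<partial>riesz_measure)" using \<eta>(2) by (simp add: Bochner_Integration.integral_nonneg)
    have SI: "S \<le> 2 * u \<eta> + I"
    proof -
      have "(\<Sum>m<M. u (f m)) \<le> 2 * u \<eta> + (\<Sum>m<M. (\<integral>x. f m x \<partial>riesz_measure))" for M
      proof (cases M)
        case 0 then show ?thesis using u\<eta> by simp
      next
        case (Suc M')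
        show ?thesis
        proof (cases M')
          case 0 then show ?thesis using Suc ue[of 0] inn[of 0] u\<eta> by simp
        next
          case (Suc M'')
          have "(\<Sum>m<Suc (Suc M''). u (f m)) = u (f 0) + u (f 1) + (\<Sum>m<M''. u (f (Suc (Suc m))))"
            by (simp add: sum.lessThan_Suc_shift del: sum.lessThan_Suc)
          also have "\<dots> \<le> 2 * u \<eta> + (\<Sum>m<M''. (\<integral>x. f m x \<partial>riesz_measure))"
          proof -
            have "(\<Sum>m<M''. u (f (Suc (Suc m)))) \<le> (\<Sum>m<M''. (\<integral>x. f m x \<partial>riesz_measure))" by (rule sum_mono) (rule b)
            then show ?thesis using ue[of 0] ue[of 1] by simp
          qed
          also have "\<dots> \<le> 2 * u \<eta> + (\<Sum>m<Suc (Suc M''). (\<integral>x. f m x \<partial>riesz_measure))"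
            using inn by simp
          finally show ?thesis using \<open>M = Suc M'\<close> Suc by simp
        qed
      qed
      then show ?thesis by (simp add: S_def I_def)
    qed
    have IS: "I \<le> (\<integral>x. \<eta> x \<partial>riesz_measure) + S"
    proof -
      have "(\<Sum>m<M. (\<integral>x. f m x \<partial>riesz_measure)) \<le> (\<integral>x. \<eta> x \<partial>riesz_measure) + (\<Sum>m<M. u (f m))" for M
      proof (cases M)
        case 0 then show ?thesis using i\<eta> by simp
      next
        case (Suc M')
        have "(\<Sum>m<Suc M'. (\<integral>x. f m x \<partial>riesz_measure)) = (\<integral>x. f 0 x \<partial>riesz_measure) + (\<Sum>m<M'. (\<integral>x. f (Suc m) x \<partial>riesz_measure))"
          by (rule sum.lessThan_Suc_shift)
        also have "\<dots> \<le> (\<integral>x. \<eta> x \<partial>riesz_measure) + (\<Sum>m<M'. u (f m))"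
        proof -
          have "(\<Sum>m<M'. (\<integral>x. f (Suc m) x \<partial>riesz_measure)) \<le> (\<Sum>m<M'. u (f m))" by (rule sum_mono) (rule a)
          then show ?thesis using ie[of 0] by simp
        qed
        also have "\<dots> \<le> (\<integral>x. \<eta> x \<partial>riesz_measure) + (\<Sum>m<Suc M'. u (f m))" using un by simp
        finally show ?thesis using Suc by simp
      qed
      then show ?thesis by (simp add: S_def I_def)
    qed
    have near: "real N * \<phi> x - (\<Sum>m<N. f m x) \<le> \<eta> x" "- \<eta> x \<le> real N * \<phi> x - (\<Sum>m<N. f m x)" for x
    proof -
      have "\<bar>real N * \<phi> x - (\<Sum>m<N. f m x)\<bar> \<le> \<eta> x"
      proof (cases "\<phi> x = 0")
        case True then show ?thesis using f0[OF True] \<eta>(2) by simp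
      next
        case False
        have "real N * \<phi> x \<le> real N" using \<phi>(3)[of x] by (simp add: mult_left_le)
        then show ?thesis using slice[of "real N * \<phi> x" N] \<phi>(2)[of x] \<eta>1[OF False] by (simp add: f_def)
      qed
      then show "real N * \<phi> x - (\<Sum>m<N. f m x) \<le> \<eta> x" "- \<eta> x \<le> real N * \<phi> x - (\<Sum>m<N. f m x)" by auto
    qed
    have tN: "test_function (\<lambda>x. real N * \<phi> x)" "test_function (\<lambda>x. \<Sum>m<N. f m x)"
      by (simp_all add: test_cmult \<phi>(1) test_sum ft)
    have t\<eta>: "test_function (\<lambda>x. -1 * \<eta> x)" by (rule test_cmult[OF \<eta>(1)])
    have uN: "u (\<lambda>x. real N * \<phi> x - (\<Sum>m<N. f m x)) = real N * u \<phi> - S"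
      using posfun_diff[OF tN] by (simp add: posfun_cmult[OF \<phi>(1)] posfun_sum[OF ft] S_def)
    have 1: "real N * u \<phi> - S \<le> u \<eta>" "- u \<eta> \<le> real N * u \<phi> - S"
      using posfun_mono[OF test_diff[OF tN] \<eta>(1) near(1)] posfun_mono[OF t\<eta> test_diff[OF tN]] near(2) uN posfun_cmult[OF \<eta>(1), of "-1"] by auto
    have iN: "(\<integral>x. real N * \<phi> x - (\<Sum>m<N. f m x) \<partial>riesz_measure) = real N * (\<integral>x. \<phi> x \<partial>riesz_measure) - I"
      using riesz_measure_integrable[OF _ tN(1)] riesz_measure_integrable[OF _ tN(2)] riesz_measure_integrable[OF _ ft]
      by (simp add: I_def)
    have 2: "real N * (\<integral>x. \<phi> x \<partial>riesz_measure) - I \<le> (\<integral>x. \<eta> x \<partial>riesz_measure)" "- (\<integral>x. \<eta> x \<partial>riesz_measure) \<le> real N * (\<integral>x. \<phi> x \<partial>riesz_measure) - I"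
      using integral_mono[OF riesz_measure_integrable[OF _ test_diff[OF tN]] riesz_measure_integrable[OF _ \<eta>(1)] near(1)]
        integral_mono[OF riesz_measure_integrable[OF _ t\<eta>] riesz_measure_integrable[OF _ test_diff[OF tN]]] near(2) iN by auto
    have "\<bar>real N * u \<phi> - real N * (\<integral>x. \<phi> x \<partial>riesz_measure)\<bar> \<le> C"
      using SI IS 1 2 u\<eta> i\<eta> unfolding C_def abs_le_iff by linarith
    then show ?thesis by (simp add: right_diff_distrib[symmetric] abs_mult)
  qed
  have "\<not> 0 < \<bar>u \<phi> - (\<integral>x. \<phi> x \<partial>riesz_measure)\<bar>"
  proof
    assume "0 < \<bar>u \<phi> - (\<integral>x. \<phi> x \<partial>riesz_measure)\<bar>"
    then obtain N :: nat where "C < real N * \<bar>u \<phi> - (\<integral>x. \<phi> x \<partial>riesz_measure)\<bar>"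
      using reals_Archimedean3 by blast
    with bound[of N] show False by simp
  qed
  then show ?thesis by simp
qed

lemma represents_riesz_measure: "represents riesz_measure"
  unfolding represents_def
proof (intro conjI allI impI)
  fix \<phi> :: "real^'n \<Rightarrow> real" assume t: "test_function \<phi>"
  have nn: "u \<psi> = (\<integral>x. \<psi> x \<partial>riesz_measure)" if \<psi>: "test_function \<psi>" "\<And>x. 0 \<le> \<psi> x" for \<psi>
  proof -
    obtain B where B: "\<And>x. \<bar>\<psi> x\<bar> \<le> B" "B > 0" using test_bounded[OF \<psi>(1)] by blast
    have "u (\<lambda>x. (1 / B) * \<psi> x) = (\<integral>x. (1 / B) * \<psi> x \<partial>riesz_measure)"
      by (rule represents_unit[OF test_cmult[OF \<psi>(1)]]) (use B \<psi>(2) in \<open>auto simp: field_simps abs_le_iff\<close>)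
    then show ?thesis using B(2) posfun_cmult[OF \<psi>(1), of "1 / B"] by simp
  qed
  obtain B where B: "\<And>x. \<bar>\<phi> x\<bar> \<le> B" "B > 0" using test_bounded[OF t] by blast
  obtain \<eta> W where \<eta>: "test_function \<eta>" "\<And>x. 0 \<le> \<eta> x" "\<And>x. \<eta> x \<le> 1"
      "fun_support \<phi> \<subseteq> W" "\<And>x. x \<in> W \<Longrightarrow> \<eta> x = 1"
    using smooth_urysohn[OF test_compact[OF t] open_UNIV subset_UNIV] by metis
  \<comment> \<open>Both B \<eta> and \<phi> + B \<eta> are nonnegative; their difference is
    \<phi>.\<close>
  have t1: "test_function (\<lambda>x. B * \<eta> x)" by (rule test_cmult[OF \<eta>(1)])
  have t2: "test_function (\<lambda>x. \<phi> x + B * \<eta> x)" by (rule test_add[OF t t1])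
  have pos: "0 \<le> \<phi> x + B * \<eta> x" for x
  proof (cases "\<phi> x = 0")
    case False
    then have "\<eta> x = 1" using \<eta>(4,5) fun_support_nonzero[of \<phi> x] by blast
    then show ?thesis using B(1)[of x] by simp
  qed (use B \<eta>(2) in simp)
  have "u (\<lambda>x. \<phi> x + B * \<eta> x) = (\<integral>x. \<phi> x + B * \<eta> x \<partial>riesz_measure)" by (rule nn[OF t2 pos])
  moreover have "u (\<lambda>x. B * \<eta> x) = (\<integral>x. B * \<eta> x \<partial>riesz_measure)" by (rule nn[OF t1]) (use B \<eta>(2) in simp)
  moreover have "u (\<lambda>x. \<phi> x + B * \<eta> x) = u \<phi> + u (\<lambda>x. B * \<eta> x)" by (rule posfun_add[OF t t1])
  moreover have "(\<integral>x. \<phi> x + B * \<eta> x \<partial>riesz_measure) = (\<integral>x. \<phi> x \<partial>riesz_measure) + (\<integral>x. B * \<eta> x \<partial>riesz_measure)"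
    by (rule Bochner_Integration.integral_add[OF riesz_measure_integrable[OF _ t] riesz_measure_integrable[OF _ t1]])
  ultimately show "u \<phi> = (\<integral>x. \<phi> x \<partial>riesz_measure)" by simp
qed (simp_all add: riesz_measure_finite[unfolded infinity_ennreal_def])

text \<open>Existence and uniqueness give \<open>THE\<close> in \<open>measure_of_dist\<close> its
  meaning. Balls and the whole space are the only sets whose measure is taken later.\<close>

theorem measure_of_dist_open: "open U \<Longrightarrow> emeasure (measure_of_dist u) U = open_content u U"
proof -
  assume U: "open U"
  have "measure_of_dist u = riesz_measure"
    unfolding measure_of_dist_def
    by (rule the_equality)
      (use represents_riesz_measure represents_unique in \<open>auto simp: represents_def\<close>)
  then show ?thesis using U emeasure_riesz_measure by simp
qed

end

section \<open>The algebra of constant superforms\<close>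

text \<open>A copy of the type of constant superforms on which the wedge product is the multiplication of a
  real algebra.\<close>

typedef 'n sf = "UNIV :: ('n, real) super set" morphisms coef Sf by simp

lemma coef_Sf [simp]: "coef (Sf a) = a" by (simp add: Sf_inverse)
lemma Sf_coef [simp]: "Sf (coef a) = a" by (rule coef_inverse)
lemma sf_eqI: "(\<And>K L. coef a K L = coef b K L) \<Longrightarrow> a = b"
  by (metis coef_inject ext)

lemma inversions_Un1: "A \<inter> A' = {} \<Longrightarrow> inversions (A \<union> A') B = inversions A B + inversions A' (B :: 'n::{finite,linorder} set)"
proof -
  assume d: "A \<inter> A' = {}"
  have "{(a, b). a \<in> A \<union> A' \<and> b \<in> B \<and> b < a} = {(a, b). a \<in> A \<and> b \<in> B \<and> b < a} \<union> {(a, b). a \<in> A' \<and> b \<in> B \<and> b < a}" by auto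
  then show ?thesis unfolding inversions_def using d by (subst card_Un_disjoint[symmetric]) (auto intro: finite_subset[OF subset_UNIV])
qed

lemma inversions_Un2: "B \<inter> B' = {} \<Longrightarrow> inversions A (B \<union> B') = inversions A B + inversions A (B' :: 'n::{finite,linorder} set)"
proof -
  assume d: "B \<inter> B' = {}"
  have "{(a, b). a \<in> A \<and> b \<in> B \<union> B' \<and> b < a} = {(a, b). a \<in> A \<and> b \<in> B \<and> b < a} \<union> {(a, b). a \<in> A \<and> b \<in> B' \<and> b < a}" by auto
  then show ?thesis unfolding inversions_def using d by (subst card_Un_disjoint[symmetric]) (auto intro: finite_subset[OF subset_UNIV])
qed

lemma inversions_empty [simp]: "inversions {} B = 0" "inversions A {} = 0"
  by (simp_all add: inversions_def)

lemma inversions_swap: "i \<notin> K \<Longrightarrow> inversions {i} K + inversions K {i} = card (K :: 'n::{finite,linorder} set)"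
proof -
  assume i: "i \<notin> K"
  have "inversions {i} K = card {b \<in> K. b < i}" "inversions K {i} = card {a \<in> K. i < a}"
    unfolding inversions_def
    by (rule bij_betw_same_card[of snd] bij_betw_same_card[of fst]; auto simp: bij_betw_def inj_on_def image_iff)+
  moreover have "card K = card {b \<in> K. b < i} + card {a \<in> K. i < a}"
  proof -
    have "K = {b \<in> K. b < i} \<union> {a \<in> K. i < a}" using i by auto (metis linorder_neqE)
    then have "card K = card ({b \<in> K. b < i} \<union> {a \<in> K. i < a})" by simp
    also have "\<dots> = card {b \<in> K. b < i} + card {a \<in> K. i < a}" by (rule card_Un_disjoint) auto
    finally show ?thesis .
  qed
  ultimately show ?thesis by simp
qed

text \<open>Chains A \<subseteq> K \<subseteq> I correspond to ordered partitions of I into the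
  blocks A, K - A and I - K. This symmetric indexing is where the two bracketings of a triple
  product meet.\<close>

lemma sum_Pow_reindex:
  fixes F :: "'n::finite set \<Rightarrow> 'n set \<Rightarrow> 'n set \<Rightarrow> 'b::comm_monoid_add"
  shows "(\<Sum>K\<in>Pow I. \<Sum>A\<in>Pow K. F A (K - A) (I - K)) = (\<Sum>A\<in>Pow I. \<Sum>C\<in>Pow (I - A). F A C (I - A - C))"
proof -
  have "(\<Sum>K\<in>Pow I. \<Sum>A\<in>Pow K. F A (K - A) (I - K)) = (\<Sum>(K, A)\<in>Sigma (Pow I) Pow. F A (K - A) (I - K))"
    by (simp add: sum.Sigma)
  also have "\<dots> = (\<Sum>(A, C)\<in>Sigma (Pow I) (\<lambda>A. Pow (I - A)). F A C (I - A - C))"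
    by (rule sum.reindex_bij_witness[of _ "\<lambda>(A, C). (A \<union> C, A)" "\<lambda>(K, A). (A, K - A)"])
       (auto intro!: arg_cong2[where f="F _"])
  also have "\<dots> = (\<Sum>A\<in>Pow I. \<Sum>C\<in>Pow (I - A). F A C (I - A - C))" by (simp add: sum.Sigma)
  finally show ?thesis .
qed

text \<open>Cardinalities and inversions are additive over disjoint unions, so both exponents are
  the same sum over the pairs among the three factors.\<close>

lemma wedge_sign_cocycle:
  fixes A :: "'n::{finite,linorder} set"
  assumes "A \<inter> C = {}" "A \<inter> E = {}" "C \<inter> E = {}" "B \<inter> D = {}" "B \<inter> F = {}" "D \<inter> F = {}"
  shows "wedge_sign A B C D * wedge_sign (A \<union> C) (B \<union> D) E F = wedge_sign C D E F * wedge_sign A B (C \<union> E) (D \<union> F)"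
  using assms unfolding wedge_sign_def power_add[symmetric]
  by (simp add: inversions_Un1 inversions_Un2 card_Un_disjoint algebra_simps)

lemma wedge_assoc: "wedge (wedge a b) c = wedge a (wedge b (c :: ('n::{finite,linorder}, real) super))"
proof (intro ext)
  fix I J :: "'n set"
  define G where "G A C E B D F = wedge_sign A B C D * wedge_sign (A \<union> C) (B \<union> D) E F * (a A B * b C D * c E F)" for A C E B D F
  have "wedge (wedge a b) c I J = (\<Sum>K\<in>Pow I. \<Sum>L\<in>Pow J. \<Sum>A\<in>Pow K. \<Sum>B\<in>Pow L. G A (K - A) (I - K) B (L - B) (J - L))"
    unfolding wedge_def wedge_with_def sum_distrib_left sum_distrib_right
    by (intro sum.cong refl) (auto simp: G_def Un_absorb1 Un_Diff_cancel)
  \<comment> \<open>Abstracted so that the summand has the shape \<open>F A (K - A) (I - K)\<close>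
    of \<open>sum_Pow_reindex\<close>.\<close>
  also have "\<dots> = (\<Sum>K\<in>Pow I. \<Sum>A\<in>Pow K. (\<lambda>A C E. \<Sum>L\<in>Pow J. \<Sum>B\<in>Pow L. G A C E B (L - B) (J - L)) A (K - A) (I - K))"
    by (rule sum.cong[OF refl], subst sum.swap, simp)
  also have "\<dots> = (\<Sum>A\<in>Pow I. \<Sum>C\<in>Pow (I - A). \<Sum>L\<in>Pow J. \<Sum>B\<in>Pow L. G A C (I - A - C) B (L - B) (J - L))"
    by (subst sum_Pow_reindex) simp
  also have "\<dots> = (\<Sum>A\<in>Pow I. \<Sum>C\<in>Pow (I - A). \<Sum>B\<in>Pow J. \<Sum>D\<in>Pow (J - B). G A C (I - A - C) B D (J - B - D))"
    by (subst sum_Pow_reindex) simp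
  also have "\<dots> = (\<Sum>A\<in>Pow I. \<Sum>B\<in>Pow J. \<Sum>C\<in>Pow (I - A). \<Sum>D\<in>Pow (J - B). G A C (I - A - C) B D (J - B - D))"
    by (rule sum.cong[OF refl], subst sum.swap, simp)
  also have "\<dots> = wedge a (wedge b c) I J"
    unfolding wedge_def wedge_with_def sum_distrib_left sum_distrib_right
  proof (intro sum.cong refl)
    fix A B C D assume h: "A \<in> Pow I" "B \<in> Pow J" "C \<in> Pow (I - A)" "D \<in> Pow (J - B)"
    have "wedge_sign A B C D * wedge_sign (A \<union> C) (B \<union> D) (I - A - C) (J - B - D) =
       wedge_sign C D (I - A - C) (J - B - D) * wedge_sign A B (C \<union> (I - A - C)) (D \<union> (J - B - D))"
      by (rule wedge_sign_cocycle) (use h in auto)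
    moreover have "C \<union> (I - A - C) = I - A" "D \<union> (J - B - D) = J - B" using h by auto
    ultimately show "G A C (I - A - C) B D (J - B - D) = wedge_sign A B (I - A) (J - B) *
       (a A B * (wedge_sign C D (I - A - C) (J - B - D) * (b C D * c (I - A - C) (J - B - D))))"
      by (simp add: G_def)
  qed
  finally show "wedge (wedge a b) c I J = wedge a (wedge b c) I J" .
qed

lemma one_wedge: "wedge one_super a = (a :: ('n::{finite,linorder}, real) super)"
proof (intro ext)
  fix I J :: "'n set"
  have "wedge one_super a I J = (\<Sum>K\<in>Pow I. if K = {} then (\<Sum>L\<in>Pow J. if L = {} then a I J else 0) else 0)"
    unfolding wedge_def wedge_with_def
    by (intro sum.cong refl) (auto simp: one_super_def wedge_sign_def mult_delta_left mult_delta_right sum.delta sum.delta')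
  then show "wedge one_super a I J = a I J" by (simp add: sum.delta)
qed

lemma wedge_one: "wedge a one_super = (a :: ('n::{finite,linorder}, real) super)"
proof (intro ext)
  fix I J :: "'n set"
  have "wedge a one_super I J = (\<Sum>K\<in>Pow I. if K = I then (\<Sum>L\<in>Pow J. if L = J then a I J else 0) else 0)"
    unfolding wedge_def wedge_with_def
    by (intro sum.cong refl) (auto simp: one_super_def wedge_sign_def mult_delta_left mult_delta_right sum.delta sum.delta')
  then show "wedge a one_super I J = a I J" by (simp add: sum.delta)
qed

instantiation sf :: ("{finite,linorder}") real_algebra_1
begin
definition "0 = Sf (\<lambda>K L. 0)"
definition "1 = Sf one_super"
definition "a + b = Sf (\<lambda>K L. coef a K L + coef b K L)"
definition "a - b = Sf (\<lambda>K L. coef a K L - coef b K L)"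
definition "- a = Sf (\<lambda>K L. - coef a K L)"
definition "c *\<^sub>R a = Sf (\<lambda>K L. c * coef a K L)"
definition "a * b = Sf (wedge (coef a) (coef b))"
instance
proof
  fix a b c :: "'a sf" and r s :: real
  show "a * b * c = a * (b * c)" by (simp add: times_sf_def wedge_assoc)
  show "1 * a = a" "a * 1 = a" by (simp_all add: times_sf_def one_sf_def one_wedge wedge_one)
  have "coef (1 :: 'a sf) {} {} \<noteq> coef (0 :: 'a sf) {} {}"
    by (simp add: zero_sf_def one_sf_def one_super_def)
  then show "(0 :: 'a sf) \<noteq> 1" by metis
  show "(a + b) * c = a * c + b * c" "a * (b + c) = a * b + a * c"
    "r *\<^sub>R a * b = r *\<^sub>R (a * b)" "a * r *\<^sub>R b = r *\<^sub>R (a * b)"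
    by (auto intro!: sf_eqI sum.cong simp: plus_sf_def times_sf_def scaleR_sf_def wedge_def wedge_with_def
      sum.distrib[symmetric] sum_distrib_left algebra_simps)
qed (auto intro!: sf_eqI simp: zero_sf_def plus_sf_def minus_sf_def uminus_sf_def scaleR_sf_def algebra_simps)
end

lemma coef_simps [simp]: "coef 0 K L = 0" "coef (a + b) K L = coef a K L + coef b K L"
  "coef (a - b) K L = coef a K L - coef b K L" "coef (- a) K L = - coef a K L"
  "coef (c *\<^sub>R a) K L = c * coef a K L"
  by (auto simp: zero_sf_def plus_sf_def minus_sf_def uminus_sf_def scaleR_sf_def)

lemma coef_sum [simp]: "coef (\<Sum>i\<in>A. f i) K L = (\<Sum>i\<in>A. coef (f i) K L)"
  by (induction A rule: infinite_finite_induct) auto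

lemma coef_times: "coef (a * b) = wedge (coef a) (coef b)" by (simp add: times_sf_def)
lemma coef_one: "coef 1 = one_super" by (simp add: one_sf_def)

lemma wedge_list_coef: "wedge_list (map coef as) = coef (prod_list as)"
  by (induction as) (auto simp: wedge_list_def coef_times coef_one)

section \<open>The basis forms dx_K \<and> d\<xi>_L and their sign rules\<close>

definition bas :: "'n set \<Rightarrow> 'n set \<Rightarrow> 'n::{finite,linorder} sf" where
  "bas K L = Sf (\<lambda>K' L'. if K' = K \<and> L' = L then 1 else 0)"

lemma coef_bas: "coef (bas K L) K' L' = (if K' = K \<and> L' = L then 1 else 0)" by (simp add: bas_def)

lemma sf_expand: "a = (\<Sum>K\<in>UNIV. \<Sum>L\<in>UNIV. coef a K L *\<^sub>R bas K L)"
proof (rule sf_eqI)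
  fix K L
  have "(\<Sum>K'\<in>UNIV. \<Sum>L'\<in>UNIV. coef a K' L' * (if K = K' \<and> L = L' then 1 else 0)) =
     (\<Sum>K'\<in>UNIV. if K = K' then (\<Sum>L'\<in>UNIV. if L = L' then coef a K L else 0) else 0)"
    by (intro sum.cong refl) (auto simp: mult_delta_left mult_delta_right sum.delta sum.delta')
  then show "coef a K L = coef (\<Sum>K\<in>UNIV. \<Sum>L\<in>UNIV. coef a K L *\<^sub>R bas K L) K L"
    by (simp add: coef_bas)
qed

lemma sum_double_delta:
  assumes "finite P" "finite Q"
  shows "(\<Sum>K\<in>P. \<Sum>L\<in>Q. f K L * ((if K = A \<and> L = B then 1 else 0) * g K L)) = (if A \<in> P \<and> B \<in> Q then f A B * g A B else (0::real))"
proof -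
  have "(\<Sum>K\<in>P. \<Sum>L\<in>Q. f K L * ((if K = A \<and> L = B then 1 else 0) * g K L)) =
     (\<Sum>K\<in>P. if K = A then (\<Sum>L\<in>Q. if L = B then f A B * g A B else 0) else 0)"
  proof (rule sum.cong[OF refl])
    fix K
    show "(\<Sum>L\<in>Q. f K L * ((if K = A \<and> L = B then 1 else 0) * g K L)) =
      (if K = A then (\<Sum>L\<in>Q. if L = B then f A B * g A B else 0) else 0)"
      by (cases "K = A") (simp, rule sum.cong, auto)
  qed
  then show ?thesis using assms by (simp add: sum.delta)
qed

lemma bas_mult: "bas A B * bas C D = (if A \<inter> C = {} \<and> B \<inter> D = {} then wedge_sign A B C D *\<^sub>R bas (A \<union> C) (B \<union> D) else 0)"
proof (rule sf_eqI)
  fix I J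
  have "coef (bas A B * bas C D) I J = (if A \<in> Pow I \<and> B \<in> Pow J then wedge_sign A B (I - A) (J - B) * coef (bas C D) (I - A) (J - B) else 0)"
    unfolding coef_times wedge_def wedge_with_def coef_bas[of A B] by (rule sum_double_delta) auto
  also have "\<dots> = (if A \<subseteq> I \<and> B \<subseteq> J \<and> I - A = C \<and> J - B = D then wedge_sign A B C D else 0)"
    by (auto simp: coef_bas)
  also have "\<dots> = (if A \<inter> C = {} \<and> B \<inter> D = {} \<and> I = A \<union> C \<and> J = B \<union> D then wedge_sign A B C D else 0)"
  proof -
    have a: "(A \<subseteq> I \<and> I - A = C) = (A \<inter> C = {} \<and> I = A \<union> C)" by auto
    have b: "(B \<subseteq> J \<and> J - B = D) = (B \<inter> D = {} \<and> J = B \<union> D)" by auto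
    have "(A \<subseteq> I \<and> B \<subseteq> J \<and> I - A = C \<and> J - B = D) = ((A \<subseteq> I \<and> I - A = C) \<and> (B \<subseteq> J \<and> J - B = D))" by blast
    also have "\<dots> = (A \<inter> C = {} \<and> B \<inter> D = {} \<and> I = A \<union> C \<and> J = B \<union> D)" unfolding a b by blast
    finally show ?thesis by (simp only:)
  qed
  finally show "coef (bas A B * bas C D) I J =
    coef (if A \<inter> C = {} \<and> B \<inter> D = {} then wedge_sign A B C D *\<^sub>R bas (A \<union> C) (B \<union> D) else 0) I J"
    by (auto simp: coef_bas)
qed

definition X :: "'n \<Rightarrow> 'n::{finite,linorder} sf" where "X i = Sf (dx i)"
definition Y :: "'n \<Rightarrow> 'n::{finite,linorder} sf" where "Y i = Sf (d\<xi> i)"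

lemma X_bas: "X i = bas {i} {}" by (rule sf_eqI) (simp add: X_def dx_def bas_def)
lemma Y_bas: "Y i = bas {} {i}" by (rule sf_eqI) (simp add: Y_def d\<xi>_def bas_def)
lemma coef_X: "coef (X i) = dx i" by (simp add: X_def)
lemma coef_Y: "coef (Y i) = d\<xi> i" by (simp add: Y_def)

lemma minus_one_power_parity: "even (m + n) \<Longrightarrow> (-1 :: real) ^ m = (-1) ^ n"
  by (simp add: minus_one_power_iff)

text \<open>A one-form passes a form of degree m with the sign (-1)^m. The inversions of
  \<open>i\<close> on the two sides of \<open>K\<close> add up to \<open>card K\<close>, and the
  indices of \<open>L\<close> contribute the remaining transpositions.\<close>

lemma X_pass: "X i * bas K L = (-1) ^ (card K + card L) *\<^sub>R (bas K L * X i)"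
proof (cases "i \<in> K")
  case False
  then have "even (inversions {i} K + (card K + card L + (card L + inversions K {i})))"
    using inversions_swap[OF False] by presburger
  then have "wedge_sign {i} {} K L = (-1) ^ (card K + card L) * wedge_sign K L {i} {}"
    unfolding wedge_sign_def power_add[symmetric] by (intro minus_one_power_parity) simp
  then show ?thesis using False by (simp add: X_bas bas_mult)
qed (simp add: X_bas bas_mult)

lemma Y_pass: "Y j * bas K L = (-1) ^ (card K + card L) *\<^sub>R (bas K L * Y j)"
proof (cases "j \<in> L")
  case False
  then have "even (card K + inversions {j} L + (card K + card L + inversions L {j}))"
    using inversions_swap[OF False] by presburger
  then have "wedge_sign {} {j} K L = (-1) ^ (card K + card L) * wedge_sign K L {} {j}"
    unfolding wedge_sign_def power_add[symmetric] by (intro minus_one_power_parity) simp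
  then show ?thesis using False by (simp add: Y_bas bas_mult)
qed (simp add: Y_bas bas_mult)

lemma X_X: "X i * X j = - (X j * X i)" using X_pass[of i "{j}" "{}"] by (simp add: X_bas[of j])
lemma Y_Y: "Y i * Y j = - (Y j * Y i)" using Y_pass[of i "{}" "{j}"] by (simp add: Y_bas[of j])
lemma Y_X: "Y i * X j = - (X j * Y i)" using Y_pass[of i "{j}" "{}"] by (simp add: X_bas[of j])
lemma X_X_0 [simp]: "X i * X i = 0" by (simp add: X_bas bas_mult)
lemma Y_Y_0 [simp]: "Y i * Y i = 0" by (simp add: Y_bas bas_mult)

definition XY :: "'n \<Rightarrow> 'n \<Rightarrow> 'n::{finite,linorder} sf" where "XY i j = X i * Y j"

text \<open>The signs of the two one-forms multiply to 1. Products of forms of bidegree (1, 1) are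
  therefore commutative, and factors can be rearranged freely below.\<close>

lemma XY_central: "XY i j * a = a * XY i j"
proof -
  have "XY i j * bas K L = bas K L * XY i j" for K L
  proof -
    have "X i * Y j * bas K L = (-1) ^ (card K + card L) *\<^sub>R (X i * bas K L * Y j)"
      by (simp add: mult.assoc Y_pass)
    also have "\<dots> = ((-1) ^ (card K + card L) * (-1) ^ (card K + card L)) *\<^sub>R (bas K L * (X i * Y j))"
      by (simp add: X_pass mult.assoc)
    also have "\<dots> = bas K L * (X i * Y j)" by (simp add: power_add[symmetric] mult_2[symmetric])
    finally show ?thesis by (simp add: XY_def)
  qed
  then show ?thesis by (subst (1 2) sf_expand[of a]) (simp add: sum_distrib_left sum_distrib_right)
qed

text \<open>The form of bidegree (1, 1) with coefficient matrix \<open>A\<close>. For the Hessian of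
  v it is dd#v, as \<open>ddsharp_fun_coef\<close> confirms.\<close>

definition frm :: "('n \<Rightarrow> 'n \<Rightarrow> real) \<Rightarrow> 'n::{finite,linorder} sf" where
  "frm A = (\<Sum>i\<in>UNIV. \<Sum>j\<in>UNIV. A i j *\<^sub>R XY i j)"

lemma frm_central: "frm A * a = a * frm A"
  by (simp add: frm_def sum_distrib_left sum_distrib_right XY_central)

lemma frm_add: "frm (\<lambda>i j. A i j + B i j) = frm A + frm B"
  by (simp add: frm_def scaleR_add_left sum.distrib)
lemma frm_diff: "frm (\<lambda>i j. A i j - B i j) = frm A - frm B"
  by (simp add: frm_def scaleR_diff_left sum_subtractf)
lemma frm_scale: "frm (\<lambda>i j. c * A i j) = c *\<^sub>R frm A"
  by (simp add: frm_def scaleR_sum_right)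
lemma frm_sum: "frm (\<lambda>i j. \<Sum>s\<in>S. A s i j) = (\<Sum>s\<in>S. frm (A s))"
  by (induction S rule: infinite_finite_induct) (simp_all add: frm_add, simp_all add: frm_def)

text \<open>Successive factors use disjoint indices, so the product stays a basis form up to sign.
  This justifies the divisions by \<open>orientation\<close>.\<close>

lemma orientation_nonzero: "orientation TYPE('n::{finite,linorder}) \<noteq> 0"
proof -
  have "\<exists>c. c \<noteq> 0 \<and> prod_list (map (\<lambda>i::'n. XY i i) is) = c *\<^sub>R bas (set is) (set is)" if "distinct is" for "is"
    using that
  proof (induction "is")
    case Nil
    have "(1 :: 'n sf) = bas {} {}" by (rule sf_eqI) (simp add: coef_one one_super_def coef_bas)
    then show ?case by (intro exI[of _ 1]) simp
  next
    case (Cons i "is")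
    then obtain c where c: "c \<noteq> 0" "prod_list (map (\<lambda>i::'n. XY i i) is) = c *\<^sub>R bas (set is) (set is)" by auto
    have "XY i i = wedge_sign {i} {} {} {i} *\<^sub>R bas {i} {i}" by (simp add: XY_def X_bas Y_bas bas_mult)
    with c Cons.prems have "prod_list (map (\<lambda>i::'n. XY i i) (i # is)) =
      (wedge_sign {i} {} {} {i} * c * wedge_sign {i} {i} (set is) (set is)) *\<^sub>R bas (set (i # is)) (set (i # is))"
      by (simp add: bas_mult)
    moreover have "wedge_sign {i} {} {} {i} * c * wedge_sign {i} {i} (set is) (set is) \<noteq> 0"
      using c(1) by (simp add: wedge_sign_def)
    ultimately show ?case by blast
  qed
  from this[of "sorted_list_of_set UNIV"] obtain c where c: "c \<noteq> 0"
    "prod_list (map (\<lambda>i::'n. XY i i) (sorted_list_of_set UNIV)) = c *\<^sub>R bas UNIV UNIV" by auto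
  have "orientation TYPE('n) = coef (prod_list (map (\<lambda>i::'n. XY i i) (sorted_list_of_set UNIV))) UNIV UNIV"
    unfolding orientation_def wedge_list_coef[symmetric] by (simp add: comp_def XY_def coef_times coef_X coef_Y)
  then show ?thesis using c by (simp add: coef_bas)
qed

section \<open>Smooth superforms and the pairing\<close>

definition ssf :: "(real^'n::{finite,linorder} \<Rightarrow> 'n sf) \<Rightarrow> bool" where "ssf \<alpha> \<longleftrightarrow> (\<forall>K L. smooth (\<lambda>x. coef (\<alpha> x) K L))"
definition tsf :: "(real^'n::{finite,linorder} \<Rightarrow> 'n sf) \<Rightarrow> bool" where "tsf \<alpha> \<longleftrightarrow> (\<forall>K L. test_function (\<lambda>x. coef (\<alpha> x) K L))"
definition Dp :: "'n::{finite,linorder} \<Rightarrow> (real^'n::{finite,linorder} \<Rightarrow> 'n sf) \<Rightarrow> (real, 'n) vec \<Rightarrow> 'n sf" where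
  "Dp i \<alpha> x = Sf (\<lambda>K L. partial i (\<lambda>y. coef (\<alpha> y) K L) x)"

lemma coef_Dp: "coef (Dp i \<alpha> x) K L = partial i (\<lambda>y. coef (\<alpha> y) K L) x" by (simp add: Dp_def)

lemma ssf_const [simp]: "ssf (\<lambda>x. m)" by (simp add: ssf_def)
lemma ssf_sum: "(\<And>i. i \<in> A \<Longrightarrow> ssf (\<alpha> i)) \<Longrightarrow> ssf (\<lambda>x. \<Sum>i\<in>A. \<alpha> i x)" by (auto simp: ssf_def)
lemma ssf_scale: "smooth f \<Longrightarrow> ssf \<beta> \<Longrightarrow> ssf (\<lambda>x. f x *\<^sub>R \<beta> x)" by (auto simp: ssf_def)
lemma ssf_mult: "ssf \<alpha> \<Longrightarrow> ssf \<beta> \<Longrightarrow> ssf (\<lambda>x. \<alpha> x * \<beta> x)"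
  unfolding ssf_def coef_times wedge_def wedge_with_def
  by (intro allI smooth_sum smooth_mult smooth_const) auto
lemma ssf_frm: "(\<And>i j. smooth (\<lambda>x. A x i j)) \<Longrightarrow> ssf (\<lambda>x. frm (A x))"
  unfolding frm_def by (intro ssf_sum ssf_scale) auto

lemma tsf_ssf: "tsf \<alpha> \<Longrightarrow> ssf \<alpha>" by (simp add: tsf_def ssf_def test_smooth)
lemma tsf_add: "tsf \<alpha> \<Longrightarrow> tsf \<beta> \<Longrightarrow> tsf (\<lambda>x. \<alpha> x + \<beta> x)" by (auto simp: tsf_def test_add)
lemma tsf_diff: "tsf \<alpha> \<Longrightarrow> tsf \<beta> \<Longrightarrow> tsf (\<lambda>x. \<alpha> x - \<beta> x)" by (auto simp: tsf_def test_diff)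
lemma tsf_sum: "(\<And>i. i \<in> A \<Longrightarrow> tsf (\<alpha> i)) \<Longrightarrow> tsf (\<lambda>x. \<Sum>i\<in>A. \<alpha> i x)" by (auto simp: tsf_def test_sum)
lemma tsf_cscale: "tsf \<alpha> \<Longrightarrow> tsf (\<lambda>x. c *\<^sub>R \<alpha> x)" by (auto simp: tsf_def test_cmult)
lemma tsf_scale: "test_function f \<Longrightarrow> ssf \<beta> \<Longrightarrow> tsf (\<lambda>x. f x *\<^sub>R \<beta> x)"
  by (auto simp: tsf_def ssf_def test_mult_smooth2)
lemma tsf_mult: "tsf \<alpha> \<Longrightarrow> ssf \<beta> \<Longrightarrow> tsf (\<lambda>x. \<alpha> x * \<beta> x)"
  unfolding tsf_def ssf_def coef_times wedge_def wedge_with_def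
  by (intro allI test_sum test_cmult test_mult_smooth2) auto
lemma ssf_Dp: "ssf \<alpha> \<Longrightarrow> ssf (Dp i \<alpha>)" by (simp add: ssf_def coef_Dp smooth_partial)

lemma partial_sum: "(\<And>s. s \<in> A \<Longrightarrow> smooth (f s)) \<Longrightarrow> partial i (\<lambda>x. \<Sum>s\<in>A. f s x) = (\<lambda>x. \<Sum>s\<in>A. partial i (f s) x)"
proof (induction A rule: infinite_finite_induct)
  case (insert s A)
  then show ?case by (simp, subst partial_add) (auto intro: smooth_differentiable smooth_sum)
qed auto

lemma Dp_const [simp]: "Dp i (\<lambda>x. m) = (\<lambda>x. 0)" by (rule ext, rule sf_eqI) (simp add: coef_Dp)
lemma Dp_add: "ssf \<alpha> \<Longrightarrow> ssf \<beta> \<Longrightarrow> Dp i (\<lambda>x. \<alpha> x + \<beta> x) = (\<lambda>x. Dp i \<alpha> x + Dp i \<beta> x)"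
  by (rule ext, rule sf_eqI) (simp add: coef_Dp partial_add ssf_def smooth_differentiable)
lemma Dp_sum: "(\<And>s. s \<in> A \<Longrightarrow> ssf (\<alpha> s)) \<Longrightarrow> Dp i (\<lambda>x. \<Sum>s\<in>A. \<alpha> s x) = (\<lambda>x. \<Sum>s\<in>A. Dp i (\<alpha> s) x)"
  by (rule ext, rule sf_eqI) (simp add: coef_Dp partial_sum ssf_def)
lemma Dp_scale: "smooth f \<Longrightarrow> ssf \<beta> \<Longrightarrow> Dp i (\<lambda>x. f x *\<^sub>R \<beta> x) = (\<lambda>x. partial i f x *\<^sub>R \<beta> x + f x *\<^sub>R Dp i \<beta> x)"
  by (rule ext, rule sf_eqI) (simp add: coef_Dp partial_mult ssf_def smooth_differentiable)
lemma Dp_mult: "ssf \<alpha> \<Longrightarrow> ssf \<beta> \<Longrightarrow> Dp i (\<lambda>x. \<alpha> x * \<beta> x) = (\<lambda>x. Dp i \<alpha> x * \<beta> x + \<alpha> x * Dp i \<beta> x)"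
proof (rule ext, rule sf_eqI)
  fix x I J assume s: "ssf \<alpha>" "ssf \<beta>"
  have m: "partial i (\<lambda>y. c * (coef (\<alpha> y) K L * coef (\<beta> y) K' L')) =
     (\<lambda>x. c * (coef (Dp i \<alpha> x) K L * coef (\<beta> x) K' L') + c * (coef (\<alpha> x) K L * coef (Dp i \<beta> x) K' L'))" for c K L K' L'
    using s by (subst partial_cmult, use s in \<open>simp add: ssf_def smooth_mult smooth_differentiable\<close>)
      (subst partial_mult; simp add: ssf_def smooth_differentiable coef_Dp algebra_simps)
  have sm: "smooth (\<lambda>y. c * (coef (\<alpha> y) K L * coef (\<beta> y) K' L'))" for c K L K' L'
    using s unfolding ssf_def by (intro smooth_mult smooth_const) auto
  show "coef (Dp i (\<lambda>x. \<alpha> x * \<beta> x) x) I J = coef (Dp i \<alpha> x * \<beta> x + \<alpha> x * Dp i \<beta> x) I J"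
    unfolding coef_Dp coef_times coef_simps wedge_def wedge_with_def
    by (simp add: partial_sum sm smooth_sum m sum.distrib coef_Dp)
qed

text \<open>Evaluated at a test function \<open>\<phi>\<close>, a current becomes a constant superform; its product with \<open>m\<close>
  has the top coefficient \<open>\<langle>T, \<phi> m\<rangle>\<close>, up to the orientation.\<close>

definition cur :: "'n::{finite,linorder} supercurrent \<Rightarrow> ((real, 'n) vec \<Rightarrow> real) \<Rightarrow> 'n sf" where
  "cur T \<phi> = Sf (\<lambda>K L. T K L \<phi>)"

definition topc :: "'n::{finite,linorder} sf \<Rightarrow> real" where "topc a = coef a UNIV UNIV"

lemma topc_simps [simp]: "topc 0 = 0" "topc (a + b) = topc a + topc b" "topc (- a) = - topc a" "topc (c *\<^sub>R a) = c * topc a"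
  "topc (\<Sum>i\<in>A. f i) = (\<Sum>i\<in>A. topc (f i))"
  by (simp_all add: topc_def)

text \<open>The \<open>pairing\<close> with the current first evaluated on each scalar coefficient
  (\<open>pairing_Pf\<close>). What remains is a product of constant superforms, to which the
  algebra structure applies.\<close>

definition Pf :: "'n::{finite,linorder} supercurrent \<Rightarrow> ((real, 'n) vec \<Rightarrow> 'n sf) \<Rightarrow> real" where
  "Pf T \<alpha> = (\<Sum>K\<in>UNIV. \<Sum>L\<in>UNIV. topc (cur T (\<lambda>x. coef (\<alpha> x) K L) * bas K L)) / orientation TYPE('n)"

lemma topc_mult_bas: "topc (a * bas K L) = wedge_sign (- K) (- L) K L * coef a (- K) (- L)"
proof -
  have c: "(UNIV - A = B) = (A = - B)" for A B :: "'a set" by auto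
  have "topc (a * bas K L) = (\<Sum>K'\<in>UNIV. \<Sum>L'\<in>UNIV. wedge_sign K' L' (UNIV - K') (UNIV - L') *
     ((if K' = - K \<and> L' = - L then 1 else 0) * coef a K' L'))"
    unfolding topc_def coef_times wedge_def wedge_with_def Pow_UNIV coef_bas c by (simp only: mult.commute)
  then show ?thesis by (simp add: sum_double_delta double_complement Compl_eq_Diff_UNIV[symmetric])
qed

lemma sum_Compl: "(\<Sum>K\<in>UNIV. f (- K)) = (\<Sum>K\<in>(UNIV :: 'n::finite set set). f K)"
  by (rule sum.reindex_bij_witness[of _ uminus uminus]) auto

lemma wedge_with_UNIV:
  "wedge_with m T a UNIV UNIV = (\<Sum>K\<in>UNIV. \<Sum>L\<in>UNIV. wedge_sign (- K) (- L) K L * m (T (- K) (- L)) (a K L))"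
  unfolding wedge_with_def Pow_UNIV
  by (subst sum_Compl[symmetric], subst sum_Compl[symmetric]) (simp add: Compl_eq_Diff_UNIV[symmetric] double_complement)

lemma pairing_Pf: "pairing T (\<lambda>x. coef (\<alpha> x)) = Pf T \<alpha>"
  unfolding pairing_def Pf_def wedge_with_UNIV topc_mult_bas by (simp add: cur_def)

lemma current_wedge_Pf:
  "current_wedge T (\<lambda>x. coef (\<alpha> x)) UNIV UNIV \<phi> = orientation TYPE('n) * Pf (T :: 'n::{finite,linorder} supercurrent) (\<lambda>x. \<phi> x *\<^sub>R \<alpha> x)"
  unfolding current_wedge_def Pf_def wedge_with_UNIV topc_mult_bas
  using orientation_nonzero[where 'n='n] by (simp add: cur_def mult.commute)

definition lin :: "'n::finite supercurrent \<Rightarrow> bool" where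
  "lin T \<longleftrightarrow> (\<forall>K L \<phi> \<psi> a b. test_function \<phi> \<longrightarrow> test_function \<psi> \<longrightarrow>
        T K L (\<lambda>x. a * \<phi> x + b * \<psi> x) = a * T K L \<phi> + b * T K L \<psi>)"

lemma lin_zero: "lin T \<Longrightarrow> T K L (\<lambda>x. 0) = 0"
proof -
  assume a: "lin T"
  have "T K L (\<lambda>x. 0 * 0 + 0 * 0) = 0 * T K L (\<lambda>x. 0) + 0 * T K L (\<lambda>x. 0)" using a test_zero unfolding lin_def by blast
  then show ?thesis by simp
qed

lemma lin_add: "lin T \<Longrightarrow> test_function \<phi> \<Longrightarrow> test_function \<psi> \<Longrightarrow> T K L (\<lambda>x. \<phi> x + \<psi> x) = T K L \<phi> + T K L \<psi>"
proof -
  assume a: "lin T" "test_function \<phi>" "test_function \<psi>"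
  have "T K L (\<lambda>x. 1 * \<phi> x + 1 * \<psi> x) = 1 * T K L \<phi> + 1 * T K L \<psi>" using a unfolding lin_def by blast
  then show ?thesis by simp
qed

lemma lin_cmult: "lin T \<Longrightarrow> test_function \<phi> \<Longrightarrow> T K L (\<lambda>x. c * \<phi> x) = c * T K L \<phi>"
proof -
  assume a: "lin T" "test_function \<phi>"
  have "T K L (\<lambda>x. c * \<phi> x + 0 * \<phi> x) = c * T K L \<phi> + 0 * T K L \<phi>" using a unfolding lin_def by blast
  then show ?thesis by simp
qed

lemma cur_add: "lin T \<Longrightarrow> test_function \<phi> \<Longrightarrow> test_function \<psi> \<Longrightarrow> cur T (\<lambda>x. \<phi> x + \<psi> x) = cur T \<phi> + cur T \<psi>"
  by (rule sf_eqI) (simp add: cur_def lin_add)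
lemma cur_cmult: "lin T \<Longrightarrow> test_function \<phi> \<Longrightarrow> cur T (\<lambda>x. c * \<phi> x) = c *\<^sub>R cur T \<phi>"
  by (rule sf_eqI) (simp add: cur_def lin_cmult)
lemma cur_zero: "lin T \<Longrightarrow> cur T (\<lambda>x. 0) = 0"
  by (rule sf_eqI) (simp add: cur_def lin_zero)
lemma cur_sum: "lin T \<Longrightarrow> (\<And>i. i \<in> A \<Longrightarrow> test_function (f i)) \<Longrightarrow> cur T (\<lambda>x. \<Sum>i\<in>A. f i x) = (\<Sum>i\<in>A. cur T (f i))"
  by (induction A rule: infinite_finite_induct) (auto simp: cur_zero cur_add test_sum)

lemma Pf_add: "lin T \<Longrightarrow> tsf \<alpha> \<Longrightarrow> tsf \<beta> \<Longrightarrow> Pf T (\<lambda>x. \<alpha> x + \<beta> x) = Pf T \<alpha> + Pf T \<beta>"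
  by (simp add: Pf_def tsf_def cur_add distrib_right sum.distrib add_divide_distrib)
lemma Pf_cscale: "lin T \<Longrightarrow> tsf \<alpha> \<Longrightarrow> Pf T (\<lambda>x. c *\<^sub>R \<alpha> x) = c * Pf T \<alpha>"
  by (simp add: Pf_def tsf_def cur_cmult sum_distrib_left sum_divide_distrib)
lemma Pf_diff: "lin T \<Longrightarrow> tsf \<alpha> \<Longrightarrow> tsf \<beta> \<Longrightarrow> Pf T (\<lambda>x. \<alpha> x - \<beta> x) = Pf T \<alpha> - Pf T \<beta>"
  using Pf_add[of T \<alpha> "\<lambda>x. (-1) *\<^sub>R \<beta> x"] Pf_cscale[of T \<beta> "-1"] tsf_cscale[of \<beta> "-1"] by simp
lemma Pf_zero: "lin T \<Longrightarrow> Pf T (\<lambda>x. 0) = 0" by (simp add: Pf_def cur_zero)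
lemma Pf_sum: "lin T \<Longrightarrow> (\<And>i. i \<in> A \<Longrightarrow> tsf (\<alpha> i)) \<Longrightarrow> Pf T (\<lambda>x. \<Sum>i\<in>A. \<alpha> i x) = (\<Sum>i\<in>A. Pf T (\<alpha> i))"
  by (induction A rule: infinite_finite_induct) (auto simp: Pf_zero Pf_add tsf_sum)

lemma Pf_expand_const:
  assumes "lin T" "test_function \<phi>"
  shows "Pf T (\<lambda>x. \<phi> x *\<^sub>R m) = topc (cur (T :: 'n::{finite,linorder} supercurrent) \<phi> * m) / orientation TYPE('n)"
proof -
  have "cur T (\<lambda>x. coef (\<phi> x *\<^sub>R m) K L) = coef m K L *\<^sub>R cur T \<phi>" for K L
    using cur_cmult[OF assms, of "coef m K L"] by (simp add: mult.commute)
  then have "Pf T (\<lambda>x. \<phi> x *\<^sub>R m) = topc (cur T \<phi> * (\<Sum>K\<in>UNIV. \<Sum>L\<in>UNIV. coef m K L *\<^sub>R bas K L)) / orientation TYPE('n)"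
    by (simp add: Pf_def sum_distrib_left)
  then show ?thesis by (simp add: sf_expand[symmetric])
qed

lemma cur_d_current: "cur (d_current T) \<phi> = - (\<Sum>i\<in>UNIV. X i * cur T (partial i \<phi>))"
  by (rule sf_eqI)
    (simp add: cur_def d_current_def coef_times wedge_def wedge_with_def coef_X dist_partial_def sum_negf)

lemma cur_dsharp_current: "cur (dsharp_current T) \<phi> = - (\<Sum>i\<in>UNIV. Y i * cur T (partial i \<phi>))"
  by (rule sf_eqI)
    (simp add: cur_def dsharp_current_def coef_times wedge_def wedge_with_def coef_Y dist_partial_def sum_negf)

section \<open>Integration by parts\<close>

lemma cur_ddsharp_current:
  "cur (ddsharp_current T) \<phi> = (\<Sum>i\<in>UNIV. \<Sum>j\<in>UNIV. XY i j * cur T (partial j (partial i \<phi>)))"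
  by (simp add: ddsharp_current_def cur_d_current cur_dsharp_current sum_negf sum_distrib_left XY_def mult.assoc)

text \<open>dd# of a superform, with the one-forms of both derivatives collected in front.\<close>

definition ddf :: "(real^'n::{finite,linorder} \<Rightarrow> 'n sf) \<Rightarrow> (real, 'n) vec \<Rightarrow> 'n sf" where
  "ddf \<alpha> x = (\<Sum>i\<in>UNIV. \<Sum>j\<in>UNIV. XY i j * Dp j (Dp i \<alpha>) x)"

text \<open>The minus signs of the two distributional derivatives cancel, and the central
  \<open>XY i j\<close> moves from the current to the form without a sign.\<close>

lemma Pf_ddsharp:
  assumes "lin T" "tsf \<alpha>"
  shows "Pf (ddsharp_current (T :: 'n::{finite,linorder} supercurrent)) \<alpha> = Pf T (ddf \<alpha>)"
proof -
  define c where "c = orientation TYPE('n)"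
  define a where "a K L i j = partial j (partial i (\<lambda>x. coef (\<alpha> x) K L))" for K L i j
  have t: "test_function (a K L i j)" for K L i j
    using assms(2) by (simp add: a_def tsf_def test_partial)
  have "topc (cur (ddsharp_current T) (\<lambda>x. coef (\<alpha> x) K L) * bas K L) =
     (\<Sum>i\<in>UNIV. \<Sum>j\<in>UNIV. topc (cur T (a K L i j) * (XY i j * bas K L)))" for K L
    by (simp add: cur_ddsharp_current sum_distrib_right a_def XY_central mult.assoc)
  then have "Pf (ddsharp_current T) \<alpha> = (\<Sum>K\<in>UNIV. \<Sum>L\<in>UNIV. \<Sum>i\<in>UNIV. \<Sum>j\<in>UNIV. topc (cur T (a K L i j) * (XY i j * bas K L)) / c)"
    by (simp add: Pf_def sum_divide_distrib c_def)
  also have "\<dots> = (\<Sum>K\<in>UNIV. \<Sum>L\<in>UNIV. \<Sum>i\<in>UNIV. \<Sum>j\<in>UNIV. Pf T (\<lambda>x. a K L i j x *\<^sub>R (XY i j * bas K L)))"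
    by (simp add: Pf_expand_const[OF assms(1) t] c_def)
  also have "\<dots> = Pf T (\<lambda>x. \<Sum>K\<in>UNIV. \<Sum>L\<in>UNIV. \<Sum>i\<in>UNIV. \<Sum>j\<in>UNIV. a K L i j x *\<^sub>R (XY i j * bas K L))"
    by (simp add: Pf_sum[OF assms(1)] tsf_sum tsf_scale t)
  also have "(\<lambda>x. \<Sum>K\<in>UNIV. \<Sum>L\<in>UNIV. \<Sum>i\<in>UNIV. \<Sum>j\<in>UNIV. a K L i j x *\<^sub>R (XY i j * bas K L)) = ddf \<alpha>"
  proof
    fix x
    have e: "Dp j (Dp i \<alpha>) x = (\<Sum>K\<in>UNIV. \<Sum>L\<in>UNIV. a K L i j x *\<^sub>R bas K L)" for i j
      by (subst sf_expand) (simp add: coef_Dp a_def)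
    have "ddf \<alpha> x = (\<Sum>i\<in>UNIV. \<Sum>j\<in>UNIV. \<Sum>K\<in>UNIV. \<Sum>L\<in>UNIV. a K L i j x *\<^sub>R (XY i j * bas K L))"
      by (simp add: ddf_def e sum_distrib_left)
    also have "\<dots> = (\<Sum>i\<in>UNIV. \<Sum>K\<in>UNIV. \<Sum>j\<in>UNIV. \<Sum>L\<in>UNIV. a K L i j x *\<^sub>R (XY i j * bas K L))"
      by (rule sum.cong[OF refl], rule sum.swap)
    also have "\<dots> = (\<Sum>K\<in>UNIV. \<Sum>i\<in>UNIV. \<Sum>L\<in>UNIV. \<Sum>j\<in>UNIV. a K L i j x *\<^sub>R (XY i j * bas K L))"
      by (subst sum.swap, rule sum.cong[OF refl], rule sum.cong[OF refl], rule sum.swap)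
    also have "\<dots> = (\<Sum>K\<in>UNIV. \<Sum>L\<in>UNIV. \<Sum>i\<in>UNIV. \<Sum>j\<in>UNIV. a K L i j x *\<^sub>R (XY i j * bas K L))"
      by (rule sum.cong[OF refl], rule sum.swap)
    finally show "(\<Sum>K\<in>UNIV. \<Sum>L\<in>UNIV. \<Sum>i\<in>UNIV. \<Sum>j\<in>UNIV. a K L i j x *\<^sub>R (XY i j * bas K L)) = ddf \<alpha> x" by simp
  qed
  finally show ?thesis .
qed

definition hess :: "(real^'n::finite \<Rightarrow> real) \<Rightarrow> (real, 'n) vec \<Rightarrow> 'n \<Rightarrow> 'n \<Rightarrow> real" where
  "hess f x i j = partial i (partial j f) x"

definition closedsf :: "(real^'n::{finite,linorder} \<Rightarrow> 'n sf) \<Rightarrow> bool" where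
  "closedsf \<gamma> \<longleftrightarrow> ssf \<gamma> \<and> (\<forall>x. (\<Sum>i\<in>UNIV. X i * Dp i \<gamma> x) = 0 \<and> (\<Sum>i\<in>UNIV. Y i * Dp i \<gamma> x) = 0)"

lemma Dp_commute: "ssf \<gamma> \<Longrightarrow> Dp i (Dp j \<gamma>) = Dp j (Dp i \<gamma>)"
  by (rule ext, rule sf_eqI) (simp add: coef_Dp ssf_def partial_commute[of _ i j])

lemma Dp_cmult: "ssf \<gamma> \<Longrightarrow> Dp i (\<lambda>x. m * \<gamma> x) = (\<lambda>x. m * Dp i \<gamma> x)"
  by (subst Dp_mult) auto

text \<open>The Leibniz rule yields four terms. Those with one derivative on \<gamma> contain
  d#\<gamma> or d\<gamma>, and the one with two contains the derivatives of d#\<gamma> = 0; only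
  dd#f \<and> \<gamma> is left.\<close>

lemma ddf_closed:
  assumes "smooth f" "closedsf \<gamma>"
  shows "ddf (\<lambda>x. f x *\<^sub>R \<gamma> x) x = frm (hess f x) * \<gamma> x"
proof -
  have s: "ssf \<gamma>" and dX: "(\<Sum>i\<in>UNIV. X i * Dp i \<gamma> x) = 0" and dY: "\<And>x. (\<Sum>i\<in>UNIV. Y i * Dp i \<gamma> x) = 0" for x
    using assms(2) by (auto simp: closedsf_def)
  have D2: "Dp j (Dp i (\<lambda>x. f x *\<^sub>R \<gamma> x)) x = partial j (partial i f) x *\<^sub>R \<gamma> x + partial i f x *\<^sub>R Dp j \<gamma> x
     + partial j f x *\<^sub>R Dp i \<gamma> x + f x *\<^sub>R Dp j (Dp i \<gamma>) x" for i j
    using assms(1) s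
    by (simp add: Dp_scale Dp_add ssf_scale ssf_Dp smooth_partial)
  have z: "(\<Sum>j\<in>UNIV. Y j * Dp j (Dp i \<gamma>) x) = 0" for i
  proof -
    have "Dp i (\<lambda>x. \<Sum>j\<in>UNIV. Y j * Dp j \<gamma> x) x = (\<Sum>j\<in>UNIV. Y j * Dp i (Dp j \<gamma>) x)"
      using s by (subst Dp_sum) (auto intro!: ssf_mult ssf_Dp simp: Dp_cmult ssf_Dp)
    then show ?thesis using dY by (simp add: Dp_commute[OF s, of _ i])
  qed
  have 1: "(\<Sum>i\<in>UNIV. \<Sum>j\<in>UNIV. XY i j * (partial i f x *\<^sub>R Dp j \<gamma> x)) = 0"
  proof -
    have "(\<Sum>i\<in>UNIV. \<Sum>j\<in>UNIV. XY i j * (partial i f x *\<^sub>R Dp j \<gamma> x)) = (\<Sum>i\<in>UNIV. partial i f x *\<^sub>R (X i * (\<Sum>j\<in>UNIV. Y j * Dp j \<gamma> x)))"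
      by (simp add: XY_def sum_distrib_left scaleR_sum_right mult.assoc)
    then show ?thesis by (simp add: dY)
  qed
  have 2: "(\<Sum>i\<in>UNIV. \<Sum>j\<in>UNIV. XY i j * (partial j f x *\<^sub>R Dp i \<gamma> x)) = 0"
  proof -
    have e: "XY i j * a = - (Y j * (X i * a))" for i j and a :: "'a sf"
      using Y_X[of j i] by (simp add: XY_def flip: mult.assoc)
    have "(\<Sum>i\<in>UNIV. \<Sum>j\<in>UNIV. XY i j * (partial j f x *\<^sub>R Dp i \<gamma> x)) = - (\<Sum>j\<in>UNIV. partial j f x *\<^sub>R (Y j * (\<Sum>i\<in>UNIV. X i * Dp i \<gamma> x)))"
      by (subst sum.swap) (simp add: e sum_distrib_left scaleR_sum_right sum_negf)
    then show ?thesis by (simp add: dX)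
  qed
  have 3: "(\<Sum>i\<in>UNIV. \<Sum>j\<in>UNIV. XY i j * (f x *\<^sub>R Dp j (Dp i \<gamma>) x)) = 0"
  proof -
    have "(\<Sum>i\<in>UNIV. \<Sum>j\<in>UNIV. XY i j * (f x *\<^sub>R Dp j (Dp i \<gamma>) x)) = (\<Sum>i\<in>UNIV. f x *\<^sub>R (X i * (\<Sum>j\<in>UNIV. Y j * Dp j (Dp i \<gamma>) x)))"
      by (simp add: XY_def sum_distrib_left scaleR_sum_right mult.assoc)
    then show ?thesis by (simp add: z)
  qed
  have "ddf (\<lambda>x. f x *\<^sub>R \<gamma> x) x = (\<Sum>i\<in>UNIV. \<Sum>j\<in>UNIV. XY i j * (partial j (partial i f) x *\<^sub>R \<gamma> x))"
    using 1 2 3 by (simp add: ddf_def D2 distrib_left sum.distrib)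
  also have "\<dots> = frm (hess f x) * \<gamma> x"
    by (simp add: frm_def hess_def sum_distrib_right partial_commute[OF assms(1), of _ _])
  finally show ?thesis .
qed

lemma antisym_sum_zero:
  fixes M :: "'n::{finite,linorder} \<Rightarrow> 'n \<Rightarrow> 'n sf"
  assumes "\<And>i j. M i j = - M j i" shows "(\<Sum>i\<in>UNIV. \<Sum>j\<in>UNIV. M i j) = 0"
proof -
  define S where "S = (\<Sum>i\<in>UNIV. \<Sum>j\<in>UNIV. M i j)"
  have "S = - S"
    unfolding S_def by (subst sum.swap, subst assms) (simp add: sum_negf)
  then have "S + S = 0" by (metis add.right_inverse)
  then have "2 *\<^sub>R S = 0" by (simp add: scaleR_2)
  then show ?thesis by (simp add: S_def)
qed

lemma smooth_hess: "smooth f \<Longrightarrow> smooth (\<lambda>x. hess f x i j)"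
  unfolding hess_def by (intro smooth_partial)

lemma hess_sym: "smooth f \<Longrightarrow> hess f x i j = hess f x j i"
  by (simp add: hess_def partial_commute[of f i j])

lemma closedsf_one: "closedsf (\<lambda>x. m)" by (simp add: closedsf_def)

lemma Dp_frm: "(\<And>a b. smooth (\<lambda>x. A x a b)) \<Longrightarrow> Dp i (\<lambda>x. frm (A x)) = (\<lambda>x. frm (\<lambda>a b. partial i (\<lambda>x. A x a b) x))"
  unfolding frm_def
  by (subst Dp_sum, simp add: ssf_sum ssf_scale)
    (subst Dp_sum; simp add: ssf_scale Dp_scale)

text \<open>Third derivatives are symmetric in all indices while dx_i \<and> dx_a and d\<xi>_i
  \<and> d\<xi>_b are antisymmetric, so dd#v is closed under both differentials.\<close>

lemma closedsf_hess_mult: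
  assumes "smooth v" "closedsf \<gamma>"
  shows "closedsf (\<lambda>x. frm (hess v x) * \<gamma> x)"
proof -
  have s: "ssf \<gamma>" and dX: "\<And>x. (\<Sum>i\<in>UNIV. X i * Dp i \<gamma> x) = 0" and dY: "\<And>x. (\<Sum>i\<in>UNIV. Y i * Dp i \<gamma> x) = 0"
    using assms(2) by (auto simp: closedsf_def)
  have sh: "smooth (\<lambda>x. hess v x a b)" for a b by (rule smooth_hess[OF assms(1)])
  have sf: "ssf (\<lambda>x. frm (hess v x))" by (rule ssf_frm[OF sh])
  define h where "h x i a b = partial i (\<lambda>x. hess v x a b) x" for x i a b
  have hs1: "h x i a b = h x a i b" for x i a b
    unfolding h_def hess_def using partial_commute[OF smooth_partial[OF assms(1)], of i a b] by (simp add: eta_contract_eq)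
  have hs2: "h x i a b = h x i b a" for x i a b
    unfolding h_def hess_def by (simp add: partial_commute[OF assms(1), of a b])
  have D: "Dp i (\<lambda>x. frm (hess v x)) x = frm (h x i)" for i x
    using Dp_frm[OF sh] by (simp add: h_def[abs_def])
  have Xz: "(\<Sum>i\<in>UNIV. X i * frm (h x i)) = 0" for x
  proof -
    have "(\<Sum>i\<in>UNIV. X i * frm (h x i)) = (\<Sum>i\<in>UNIV. \<Sum>a\<in>UNIV. \<Sum>b\<in>UNIV. h x i a b *\<^sub>R (X i * X a * Y b))"
      by (simp add: frm_def sum_distrib_left XY_def mult.assoc)
    also have "\<dots> = 0"
    proof (rule antisym_sum_zero)
      fix i a
      have "h x i a b *\<^sub>R (X i * X a * Y b) = - (h x a i b *\<^sub>R (X a * X i * Y b))" for b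
        using X_X[of i a] hs1[of x i a b] by simp
      then show "(\<Sum>b\<in>UNIV. h x i a b *\<^sub>R (X i * X a * Y b)) = - (\<Sum>b\<in>UNIV. h x a i b *\<^sub>R (X a * X i * Y b))"
        by (simp add: sum_negf)
    qed
    finally show ?thesis .
  qed
  have Yz: "(\<Sum>i\<in>UNIV. Y i * frm (h x i)) = 0" for x
  proof -
    have e: "Y i * XY a b = - (X a * (Y i * Y b))" for i a b :: 'a
      using Y_X[of i a] by (simp add: XY_def flip: mult.assoc)
    have "(\<Sum>i\<in>UNIV. Y i * frm (h x i)) = (\<Sum>i\<in>UNIV. \<Sum>a\<in>UNIV. \<Sum>b\<in>UNIV. h x i a b *\<^sub>R - (X a * (Y i * Y b)))"
      by (simp add: frm_def sum_distrib_left e)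
    also have "\<dots> = (\<Sum>i\<in>UNIV. \<Sum>b\<in>UNIV. \<Sum>a\<in>UNIV. h x i a b *\<^sub>R - (X a * (Y i * Y b)))"
      by (rule sum.cong[OF refl], rule sum.swap)
    also have "\<dots> = 0"
    proof (rule antisym_sum_zero)
      fix i b
      have "h x i a b *\<^sub>R - (X a * (Y i * Y b)) = - (h x b a i *\<^sub>R - (X a * (Y b * Y i)))" for a
        using Y_Y[of i b] hs1[of x i a b] hs2[of x a i b] hs1[of x a b i] by simp
      then show "(\<Sum>a\<in>UNIV. h x i a b *\<^sub>R - (X a * (Y i * Y b))) = - (\<Sum>a\<in>UNIV. h x b a i *\<^sub>R - (X a * (Y b * Y i)))"
        unfolding sum_negf[symmetric] by (rule sum.cong[OF refl])
    qed
    finally show ?thesis .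
  qed
  have "(\<Sum>i\<in>UNIV. X i * Dp i (\<lambda>x. frm (hess v x) * \<gamma> x) x) = 0" for x
  proof -
    have "(\<Sum>i\<in>UNIV. X i * Dp i (\<lambda>x. frm (hess v x) * \<gamma> x) x) =
      (\<Sum>i\<in>UNIV. X i * frm (h x i)) * \<gamma> x + frm (hess v x) * (\<Sum>i\<in>UNIV. X i * Dp i \<gamma> x)"
      unfolding Dp_mult[OF sf s] D by (simp add: distrib_left sum.distrib sum_distrib_left sum_distrib_right flip: mult.assoc frm_central)
    then show ?thesis by (simp add: Xz dX)
  qed
  moreover have "(\<Sum>i\<in>UNIV. Y i * Dp i (\<lambda>x. frm (hess v x) * \<gamma> x) x) = 0" for x
  proof -
    have "(\<Sum>i\<in>UNIV. Y i * Dp i (\<lambda>x. frm (hess v x) * \<gamma> x) x) =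
      (\<Sum>i\<in>UNIV. Y i * frm (h x i)) * \<gamma> x + frm (hess v x) * (\<Sum>i\<in>UNIV. Y i * Dp i \<gamma> x)"
      unfolding Dp_mult[OF sf s] D by (simp add: distrib_left sum.distrib sum_distrib_left sum_distrib_right flip: mult.assoc frm_central)
    then show ?thesis by (simp add: Yz dY)
  qed
  ultimately show ?thesis using sf s by (simp add: closedsf_def ssf_mult)
qed

text \<open>The product dd#v_1 \<and> ... \<and> dd#v_m. A list allows mixed products; its order is
  immaterial since the factors are central.\<close>

definition Hl :: "(real^'n::{finite,linorder} \<Rightarrow> real) list \<Rightarrow> (real, 'n) vec \<Rightarrow> 'n sf" where
  "Hl vs x = prod_list (map (\<lambda>v. frm (hess v x)) vs)"

lemma Hl_simps [simp]: "Hl [] x = 1" "Hl (v # vs) x = frm (hess v x) * Hl vs x" "Hl (vs @ us) x = Hl vs x * Hl us x"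
  by (simp_all add: Hl_def)

lemma closedsf_Hl: "(\<And>v. v \<in> set vs \<Longrightarrow> smooth v) \<Longrightarrow> closedsf (Hl vs)"
proof (induction vs)
  case Nil
  show ?case by (rule back_subst[of closedsf, OF closedsf_one[of 1]], rule ext, simp)
next
  case (Cons v vs)
  have "closedsf (\<lambda>x. frm (hess v x) * Hl vs x)" by (rule closedsf_hess_mult) (use Cons in auto)
  moreover have "Hl (v # vs) = (\<lambda>x. frm (hess v x) * Hl vs x)" by (rule ext) simp
  ultimately show ?case by (simp only:)
qed

lemma ssf_Hl: "(\<And>v. v \<in> set vs \<Longrightarrow> smooth v) \<Longrightarrow> ssf (Hl vs)"
  using closedsf_Hl closedsf_def by blast

lemma Pf_ddsharp_Hl:
  assumes "lin T" "test_function f" "\<And>v. v \<in> set vs \<Longrightarrow> smooth v"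
  shows "Pf (ddsharp_current T) (\<lambda>x. f x *\<^sub>R Hl vs x) = Pf T (\<lambda>x. frm (hess f x) * Hl vs x)"
proof -
  have "ddf (\<lambda>x. f x *\<^sub>R Hl vs x) = (\<lambda>x. frm (hess f x) * Hl vs x)"
    using ddf_closed[OF test_smooth[OF assms(2)] closedsf_Hl[OF assms(3)]] by blast
  then show ?thesis
    using Pf_ddsharp[OF assms(1) tsf_scale[OF assms(2) ssf_Hl[OF assms(3)]]] by simp
qed

section \<open>Positivity\<close>

definition bidegree :: "nat \<Rightarrow> 'n::{finite,linorder} sf \<Rightarrow> bool" where
  "bidegree m a \<longleftrightarrow> (\<forall>K L. \<not> (card K = m \<and> card L = m) \<longrightarrow> coef a K L = 0)"

lemma bidegree_mult: "bidegree m a \<Longrightarrow> bidegree n b \<Longrightarrow> bidegree (m + n) (a * b)"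
  unfolding bidegree_def
proof (intro allI impI)
  fix K L :: "'a set"
  assume h: "\<forall>K L. \<not> (card K = m \<and> card L = m) \<longrightarrow> coef a K L = 0" "\<forall>K L. \<not> (card K = n \<and> card L = n) \<longrightarrow> coef b K L = 0"
    "\<not> (card K = m + n \<and> card L = m + n)"
  have "coef a A B * coef b (K - A) (L - B) = 0" if "A \<subseteq> K" "B \<subseteq> L" for A B
  proof (rule ccontr)
    assume "coef a A B * coef b (K - A) (L - B) \<noteq> 0"
    then have "coef a A B \<noteq> 0" "coef b (K - A) (L - B) \<noteq> 0" by auto
    then have "card A = m" "card B = m" "card (K - A) = n" "card (L - B) = n" using h(1,2) by blast+
    moreover have "card K = card A + card (K - A)" "card L = card B + card (L - B)"
      using that by (metis card_Diff_subset card_mono finite le_add_diff_inverse)+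
    ultimately show False using h(3) by simp
  qed
  then show "coef (a * b) K L = 0"
    unfolding coef_times wedge_def wedge_with_def by (auto intro!: sum.neutral)
qed

lemma bidegree_one: "bidegree 0 1" by (auto simp: bidegree_def coef_one one_super_def)
lemma bidegree_scale: "bidegree m a \<Longrightarrow> bidegree m (c *\<^sub>R a)" by (simp add: bidegree_def)
lemma bidegree_sum: "(\<And>i. i \<in> A \<Longrightarrow> bidegree m (a i)) \<Longrightarrow> bidegree m (\<Sum>i\<in>A. a i)" by (simp add: bidegree_def)
lemma bidegree_XY: "bidegree 1 (XY i j)"
  by (auto simp: bidegree_def XY_def X_bas Y_bas bas_mult coef_bas)
lemma bidegree_frm: "bidegree 1 (frm A)" unfolding frm_def by (intro bidegree_sum bidegree_scale bidegree_XY)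
lemma bidegree_prod_frm: "bidegree (length As) (prod_list (map frm As))"
  by (induction As) (auto simp: bidegree_one dest: bidegree_mult[OF bidegree_frm])

lemma supercurrent_lin: "supercurrent p q T \<Longrightarrow> lin T"
  unfolding supercurrent_def distribution_def lin_def by blast

lemma weakly_positive_lin: "weakly_positive p T \<Longrightarrow> lin T"
  unfolding weakly_positive_def bidimension_def using supercurrent_lin by blast

lemma frm_rank_one: "(\<Sum>i\<in>UNIV. a i *\<^sub>R X i) * (\<Sum>i\<in>UNIV. b i *\<^sub>R Y i) = frm (\<lambda>i j. a i * b j)"
  by (simp add: frm_def XY_def sum_product mult.commute)

lemma J_super_one_form: "J_super (coef (\<Sum>i\<in>UNIV. a i *\<^sub>R X i)) = coef (\<Sum>i\<in>UNIV. a i *\<^sub>R Y i)"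
  by (intro ext) (auto simp: J_super_def coef_X coef_Y dx_def d\<xi>_def intro!: sum.cong sum.neutral)

text \<open>Like \<open>Hl\<close>, for matrix fields: the decomposition of a Hessian into squares
  leaves the class of Hessians.\<close>

definition mform :: "(real^'n::{finite,linorder} \<Rightarrow> 'n \<Rightarrow> 'n \<Rightarrow> real) list \<Rightarrow> (real, 'n) vec \<Rightarrow> 'n sf" where
  "mform As x = prod_list (map (\<lambda>A. frm (A x)) As)"

lemma mform_simps [simp]: "mform [] x = 1" "mform (A # As) x = frm (A x) * mform As x"
  "mform (As @ Bs) x = mform As x * mform Bs x"
  by (simp_all add: mform_def)

lemma bidegree_mform: "bidegree (length As) (mform As x)"
  unfolding mform_def using bidegree_prod_frm[of "map (\<lambda>A. A x) As"] by (simp add: comp_def)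

lemma ssf_mform: "(\<And>A i j. A \<in> set As \<Longrightarrow> smooth (\<lambda>x. A x i j)) \<Longrightarrow> ssf (mform As)"
proof (induction As)
  case Nil then show ?case by (simp add: ssf_def)
next
  case (Cons A As)
  have "ssf (\<lambda>x. frm (A x) * mform As x)" by (intro ssf_mult ssf_frm Cons) (use Cons.prems in auto)
  then show ?case by (simp add: ssf_def)
qed

text \<open>A single summand with weight \<open>c\<close> in the definition of
  \<open>strongly_positive\<close>, once a \<and> J(a) is recognised as the form of the matrix with
  entries a_i a_j.\<close>

lemma pos_rank_one:
  assumes "weakly_positive p T" "length as = p" "\<And>a i. a \<in> set as \<Longrightarrow> smooth (\<lambda>x. a x i)"
    "test_function c" "\<And>x. 0 \<le> c x"
  shows "0 \<le> Pf (T :: 'n::{finite,linorder} supercurrent) (\<lambda>x. c x *\<^sub>R mform (map (\<lambda>a x i j. a x i * a x j) as) x)"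
proof -
  define \<alpha> where "\<alpha> x = c x *\<^sub>R mform (map (\<lambda>a x i j. a x i * a x j) as) x" for x
  have ss: "ssf (mform (map (\<lambda>a x i j. a x i * a x j) as))"
    by (rule ssf_mform) (use assms(3) in auto)
  have t: "tsf \<alpha>" unfolding \<alpha>_def by (rule tsf_scale[OF assms(4) ss])
  define f where "f i x = coef (\<Sum>j\<in>UNIV. (as ! i) x j *\<^sub>R X j)" for i x
  have "superform p p (\<lambda>x. coef (\<alpha> x))"
    using tsf_ssf[OF t] bidegree_mform[of "map (\<lambda>a x i j. a x i * a x j) as"] assms(2)
    by (auto simp: superform_def ssf_def \<alpha>_def bidegree_def)
  moreover have "compactly_supported (\<lambda>x. coef (\<alpha> x))"
    using t by (auto simp: compactly_supported_def tsf_def test_function_def)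
  moreover have "strongly_positive p (\<lambda>x. coef (\<alpha> x))"
    unfolding strongly_positive_def
  proof (intro exI conjI)
    show "\<forall>s<(1::nat). smooth ((\<lambda>_. c) s) \<and> (\<forall>x. 0 \<le> (\<lambda>_. c) s x)" using assms(4,5) by (simp add: test_smooth)
    show "\<forall>s<(1::nat). \<forall>i<p. superform 1 0 ((\<lambda>_. f) s i)"
    proof (intro allI impI)
      fix s i :: nat assume "i < p"
      then have "smooth (\<lambda>x. (as ! i) x j)" for j using assms(2,3) by simp
      then have "smooth (\<lambda>x. f i x K L)" for K L unfolding f_def coef_sum coef_simps by (intro smooth_sum smooth_mult smooth_const)
      moreover have "f i x K L = 0" if "\<not> (card K = 1 \<and> card L = 0)" for x K L
        using that unfolding f_def coef_sum coef_simps by (intro sum.neutral) (auto simp: coef_X dx_def)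
      ultimately show "superform 1 0 ((\<lambda>_. f) s i)" by (simp add: superform_def)
    qed
    have "prod_list (map (\<lambda>i. frm (\<lambda>k l. (as ! i) x k * (as ! i) x l)) [0..<p]) = mform (map (\<lambda>a x i j. a x i * a x j) as) x" for x
    proof -
      have "map (\<lambda>i. frm (\<lambda>k l. (as ! i) x k * (as ! i) x l)) [0..<length as] = map (\<lambda>a. frm (\<lambda>k l. a x k * a x l)) as"
        by (rule nth_equalityI) auto
      then show ?thesis using assms(2) by (simp add: mform_def comp_def)
    qed
    moreover have "wedge (f i x) (J_super (f i x)) = coef (frm (\<lambda>k l. (as ! i) x k * (as ! i) x l))" for i x
      unfolding f_def J_super_one_form coef_times[symmetric] frm_rank_one ..
    ultimately have wl: "wedge_list (map (\<lambda>i. wedge (f i x) (J_super (f i x))) [0..<p]) = coef (mform (map (\<lambda>a x i j. a x i * a x j) as) x)" for x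
      using wedge_list_coef[of "map (\<lambda>i. frm (\<lambda>k l. (as ! i) x k * (as ! i) x l)) [0..<p]"] by (simp add: comp_def)
    show "(\<lambda>x. coef (\<alpha> x)) = (\<lambda>x K L. \<Sum>s<(1::nat). (\<lambda>_. c) s x * wedge_list (map (\<lambda>i. wedge ((\<lambda>_. f) s i x) (J_super ((\<lambda>_. f) s i x))) [0..<p]) K L)"
      by (intro ext) (simp add: \<alpha>_def wl)
  qed
  ultimately have "0 \<le> pairing T (\<lambda>x. coef (\<alpha> x))"
    using assms(1) unfolding weakly_positive_def by blast
  then show ?thesis unfolding pairing_Pf by (simp add: \<alpha>_def[abs_def])
qed

definition psd :: "('n::finite \<Rightarrow> 'n \<Rightarrow> real) \<Rightarrow> bool" where
  "psd A \<longleftrightarrow> (\<forall>i j. A i j = A j i) \<and> (\<forall>z. 0 \<le> (\<Sum>i\<in>UNIV. \<Sum>j\<in>UNIV. A i j * z i * z j))"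

text \<open>Gaussian elimination, one pivot at a time; positive definiteness keeps the pivots positive,
  so the factors of the decomposition depend smoothly on \<open>x\<close>.\<close>

lemma smooth_LDL:
  fixes A :: "real^'m::finite \<Rightarrow> 'n::finite \<Rightarrow> 'n \<Rightarrow> real"
  assumes "finite I" "\<And>i j. smooth (\<lambda>x. A x i j)" "\<And>x i j. A x i j = A x j i"
    "\<And>x i j. i \<notin> I \<Longrightarrow> A x i j = 0"
    "\<And>x z. \<exists>i\<in>I. z i \<noteq> 0 \<Longrightarrow> 0 < (\<Sum>i\<in>I. \<Sum>j\<in>I. A x i j * z i * z j)"
  shows "\<exists>c a. (\<forall>s\<in>I. smooth (c s) \<and> (\<forall>x. 0 \<le> c s x) \<and> (\<forall>i. smooth (\<lambda>x. a s x i))) \<and>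
     (\<forall>x i j. A x i j = (\<Sum>s\<in>I. c s x * (a s x i * a s x j)))"
  using assms
proof (induction I arbitrary: A rule: finite_induct)
  case empty then show ?case by simp
next
  case (insert k I)
  note sm = insert.prems(1) and sym = insert.prems(2) and zero = insert.prems(3) and pd = insert.prems(4)
  have d: "A x k k > 0" for x
  proof -
    have "0 < (\<Sum>i\<in>insert k I. \<Sum>j\<in>insert k I. A x i j * (if i = k then 1 else 0) * (if j = k then 1 else 0))"
      by (rule pd) auto
    also have "\<dots> = A x k k" using insert.hyps(1) by (simp add: mult_delta_left mult_delta_right sum.delta)
    finally show ?thesis .
  qed
  then have dn: "A x k k \<noteq> 0" for x by (metis less_irrefl)
  \<comment> \<open>The Schur complement of the pivot \<open>A x k k\<close>.\<close>
  define A' where "A' x i j = A x i j - inverse (A x k k) * (A x k i * A x k j)" for x i j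
  have "\<exists>c a. (\<forall>s\<in>I. smooth (c s) \<and> (\<forall>x. 0 \<le> c s x) \<and> (\<forall>i. smooth (\<lambda>x. a s x i))) \<and>
     (\<forall>x i j. A' x i j = (\<Sum>s\<in>I. c s x * (a s x i * a s x j)))"
  proof (rule insert.IH)
    show "smooth (\<lambda>x. A' x i j)" for i j
      unfolding A'_def by (intro smooth_diff smooth_mult sm smooth_inverse dn)
    show "A' x i j = A' x j i" for x i j using sym[of x i j] by (simp add: A'_def)
    show "A' x i j = 0" if "i \<notin> I" for x i j
    proof (cases "i = k")
      case True then show ?thesis using dn by (simp add: A'_def)
    next
      case False
      then have "A x i j = 0" "A x k i = 0" using zero[of i x] that sym[of x k i] by auto
      then show ?thesis by (simp add: A'_def)
    qed
    fix x and z :: "'n \<Rightarrow> real" assume z: "\<exists>i\<in>I. z i \<noteq> 0"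
    define s where "s = (\<Sum>i\<in>I. A x k i * z i)"
    \<comment> \<open>This value at \<open>k\<close> minimises the quadratic form of
      \<open>A x\<close> over that coordinate; the minimum is the form of the Schur complement at
      \<open>z\<close>.\<close>
    define w where "w = z(k := - s / A x k k)"
    have wz: "w i = z i" if "i \<in> I" for i using that insert.hyps by (auto simp: w_def)
    have "0 < (\<Sum>i\<in>insert k I. \<Sum>j\<in>insert k I. A x i j * w i * w j)"
      by (rule pd) (use z wz in force)
    also have "\<dots> = A x k k * w k * w k + w k * (\<Sum>j\<in>I. A x k j * w j) + w k * (\<Sum>i\<in>I. A x i k * w i) + (\<Sum>i\<in>I. \<Sum>j\<in>I. A x i j * w i * w j)"
      using insert.hyps by (simp add: sum.distrib sum_distrib_left algebra_simps)
    also have "\<dots> = A x k k * w k * w k + w k * s + w k * s + (\<Sum>i\<in>I. \<Sum>j\<in>I. A x i j * z i * z j)"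
    proof -
      have "(\<Sum>j\<in>I. A x k j * w j) = s" "(\<Sum>i\<in>I. \<Sum>j\<in>I. A x i j * w i * w j) = (\<Sum>i\<in>I. \<Sum>j\<in>I. A x i j * z i * z j)"
        using wz by (simp_all add: s_def cong: sum.cong)
      moreover have "(\<Sum>i\<in>I. A x i k * w i) = s"
        unfolding s_def by (rule sum.cong) (use wz sym[of x k] in simp_all)
      ultimately show ?thesis by (simp only:)
    qed
    also have "\<dots> = (\<Sum>i\<in>I. \<Sum>j\<in>I. A x i j * z i * z j) - inverse (A x k k) * (s * s)"
      using dn[of x] by (simp add: w_def field_simps)
    also have "s * s = (\<Sum>i\<in>I. \<Sum>j\<in>I. (A x k i * A x k j) * z i * z j)"
      by (simp add: s_def sum_product algebra_simps)
    also have "(\<Sum>i\<in>I. \<Sum>j\<in>I. A x i j * z i * z j) - inverse (A x k k) * \<dots> = (\<Sum>i\<in>I. \<Sum>j\<in>I. A' x i j * z i * z j)"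
      by (simp add: A'_def left_diff_distrib sum_subtractf sum_distrib_left mult.assoc)
    finally show "0 < (\<Sum>i\<in>I. \<Sum>j\<in>I. A' x i j * z i * z j)" .
  qed
  then obtain c a where ca: "\<forall>s\<in>I. smooth (c s) \<and> (\<forall>x. 0 \<le> c s x) \<and> (\<forall>i. smooth (\<lambda>x. a s x i))"
    "\<forall>x i j. A' x i j = (\<Sum>s\<in>I. c s x * (a s x i * a s x j))" by blast
  define c' where "c' = c(k := (\<lambda>x. inverse (A x k k)))"
  define a' where "a' = a(k := (\<lambda>x. A x k))"
  have "\<forall>s\<in>insert k I. smooth (c' s) \<and> (\<forall>x. 0 \<le> c' s x) \<and> (\<forall>i. smooth (\<lambda>x. a' s x i))"
    using ca(1) less_imp_le[OF d] by (auto simp: c'_def a'_def smooth_inverse[OF dn sm] sm)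
  moreover have "A x i j = (\<Sum>s\<in>insert k I. c' s x * (a' s x i * a' s x j))" for x i j
  proof -
    have "(\<Sum>s\<in>I. c' s x * (a' s x i * a' s x j)) = A' x i j"
      unfolding ca(2)[rule_format] by (rule sum.cong) (use insert.hyps in \<open>auto simp: c'_def a'_def\<close>)
    then show ?thesis using insert.hyps by (simp add: c'_def a'_def A'_def)
  qed
  ultimately show ?case by blast
qed

text \<open>One matrix factor at a time is turned into squares, whose nonnegative coefficients are
  absorbed by the weight; hence \<open>c\<close> and \<open>as\<close> vary in the induction. A
  semidefinite \<open>B\<close> need not split smoothly, but B + \<epsilon> I does by
  \<open>smooth_LDL\<close>, and \<epsilon> tends to 0 in the resulting inequality.\<close>

lemma pos_mixed:
  assumes "weakly_positive p T" "length Bs + length as = p"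
    "\<And>B i j. B \<in> set Bs \<Longrightarrow> smooth (\<lambda>x. B x i j)" "\<And>B x. B \<in> set Bs \<Longrightarrow> psd (B x)"
    "\<And>a i. a \<in> set as \<Longrightarrow> smooth (\<lambda>x. a x i)"
    "test_function c" "\<And>x. 0 \<le> c x"
  shows "0 \<le> Pf (T :: 'n::{finite,linorder} supercurrent) (\<lambda>x. c x *\<^sub>R (mform Bs x * mform (map (\<lambda>a x i j. a x i * a x j) as) x))"
  using assms(2-)
proof (induction Bs arbitrary: as c)
  case Nil then show ?case using pos_rank_one[OF assms(1)] by simp
next
  case (Cons B Bs)
  note T = weakly_positive_lin[OF assms(1)]
  define R where "R x = mform Bs x * mform (map (\<lambda>a x i j. a x i * a x j) as) x" for x
  have sR: "ssf R" unfolding R_def by (intro ssf_mult ssf_mform) (use Cons.prems in auto)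
  have sB: "smooth (\<lambda>x. B x i j)" for i j using Cons.prems by simp
  define I where "I i j = (if i = j then 1 else (0::real))" for i j :: 'n
  have t: "tsf (\<lambda>x. c x *\<^sub>R (frm (B x) * R x))" "tsf (\<lambda>x. c x *\<^sub>R (frm I * R x))"
    by (intro tsf_scale ssf_mult sR ssf_frm sB Cons.prems ssf_const)+
  have "0 \<le> Pf T (\<lambda>x. c x *\<^sub>R (frm (B x) * R x)) + \<epsilon> * Pf T (\<lambda>x. c x *\<^sub>R (frm I * R x))" if \<epsilon>: "\<epsilon> > 0" for \<epsilon>
  proof -
    define A where "A x i j = B x i j + \<epsilon> * I i j" for x i j
    have pB: "psd (B x)" for x using Cons.prems by simp
    have "\<exists>d a. (\<forall>s\<in>(UNIV :: 'n set). smooth (d s) \<and> (\<forall>x. 0 \<le> d s x) \<and> (\<forall>i. smooth (\<lambda>x. a s x i))) \<and>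
     (\<forall>x i j. A x i j = (\<Sum>s\<in>UNIV. d s x * (a s x i * a s x j)))"
    proof (rule smooth_LDL)
      show "smooth (\<lambda>x. A x i j)" for i j unfolding A_def by (intro smooth_add sB smooth_const)
      show "A x i j = A x j i" for x i j using pB[of x] by (auto simp: A_def I_def psd_def)
      fix x and z :: "'n \<Rightarrow> real" assume "\<exists>i\<in>UNIV. z i \<noteq> 0"
      then obtain i where i: "z i \<noteq> 0" by blast
      have "(\<Sum>j\<in>UNIV. \<epsilon> * I i j * z i * z j) = \<epsilon> * (z i * z i)" for i
        by (simp add: I_def mult_delta_left mult_delta_right)
      then have "(\<Sum>i\<in>UNIV. \<Sum>j\<in>UNIV. A x i j * z i * z j) = (\<Sum>i\<in>UNIV. \<Sum>j\<in>UNIV. B x i j * z i * z j) + \<epsilon> * (\<Sum>i\<in>UNIV. z i * z i)"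
        by (simp add: A_def distrib_right sum.distrib sum_distrib_left)
      moreover have "0 \<le> (\<Sum>i\<in>UNIV. \<Sum>j\<in>UNIV. B x i j * z i * z j)" using pB[of x] by (simp add: psd_def)
      moreover have "0 < (\<Sum>i\<in>UNIV. z i * z i)" using i by (intro sum_pos2[of _ i]) (auto simp: zero_less_mult_iff linorder_neq_iff)
      ultimately show "0 < (\<Sum>i\<in>UNIV. \<Sum>j\<in>UNIV. A x i j * z i * z j)" using \<epsilon> by (simp add: add_nonneg_pos)
    qed auto
    then obtain d a where da0: "\<forall>s\<in>(UNIV :: 'n set). smooth (d s) \<and> (\<forall>x. 0 \<le> d s x) \<and> (\<forall>i. smooth (\<lambda>x. a s x i))"
      and da4: "\<forall>x i j. A x i j = (\<Sum>s\<in>UNIV. d s x * (a s x i * a s x j))" by blast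
    have da: "\<And>s. smooth (d s)" "\<And>s x. 0 \<le> d s x" "\<And>s i. smooth (\<lambda>x. a s x i)"
      using da0 by blast+
    define F where "F s x = (c x * d s x) *\<^sub>R (mform Bs x * mform (map (\<lambda>a x i j. a x i * a x j) (a s # as)) x)" for s x
    have tc: "test_function (\<lambda>x. c x * d s x)" for s by (rule test_mult_smooth2[OF Cons.prems(5) da(1)])
    have tF: "tsf (F s)" for s unfolding F_def
      by (intro tsf_scale[OF tc] ssf_mult ssf_mform) (use Cons.prems da in auto)
    have "0 \<le> Pf T (F s)" for s
      unfolding F_def by (rule Cons.IH[OF _ _ _ _ tc]) (use Cons.prems da in auto)
    then have "0 \<le> (\<Sum>s\<in>UNIV. Pf T (F s))" by (simp add: sum_nonneg)
    also have "\<dots> = Pf T (\<lambda>x. \<Sum>s\<in>UNIV. F s x)" by (simp add: Pf_sum[OF T tF])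
    also have "(\<lambda>x. \<Sum>s\<in>UNIV. F s x) = (\<lambda>x. c x *\<^sub>R (frm (B x) * R x) + \<epsilon> *\<^sub>R (c x *\<^sub>R (frm I * R x)))"
    proof
      fix x
      have A: "A x = (\<lambda>i j. \<Sum>s\<in>UNIV. d s x * (a s x i * a s x j))" using da4 by blast
      have F: "F s x = c x *\<^sub>R ((d s x *\<^sub>R frm (\<lambda>i j. a s x i * a s x j)) * R x)" for s
        by (simp add: F_def R_def frm_central mult.assoc)
      have "(\<Sum>s\<in>UNIV. F s x) = c x *\<^sub>R ((\<Sum>s\<in>UNIV. frm (\<lambda>i j. d s x * (a s x i * a s x j))) * R x)"
        unfolding F frm_scale by (simp add: sum_distrib_right scaleR_sum_right)
      also have "(\<Sum>s\<in>UNIV. frm (\<lambda>i j. d s x * (a s x i * a s x j))) = frm (A x)" unfolding A frm_sum ..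
      also have "frm (A x) = frm (B x) + \<epsilon> *\<^sub>R frm I"
        unfolding frm_scale[symmetric] frm_add[symmetric] by (simp add: A_def[abs_def])
      finally show "(\<Sum>s\<in>UNIV. F s x) = c x *\<^sub>R (frm (B x) * R x) + \<epsilon> *\<^sub>R (c x *\<^sub>R (frm I * R x))"
        by (simp add: algebra_simps)
    qed
    also have "Pf T \<dots> = Pf T (\<lambda>x. c x *\<^sub>R (frm (B x) * R x)) + \<epsilon> * Pf T (\<lambda>x. c x *\<^sub>R (frm I * R x))"
      unfolding Pf_add[OF T t(1) tsf_cscale[OF t(2)]] Pf_cscale[OF T t(2)] ..
    finally show ?thesis .
  qed
  then have *: "0 \<le> u + \<epsilon> * v" if "u = Pf T (\<lambda>x. c x *\<^sub>R (frm (B x) * R x))" "v = Pf T (\<lambda>x. c x *\<^sub>R (frm I * R x))" "\<epsilon> > 0" for u v \<epsilon>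
    using that by simp
  have "0 \<le> Pf T (\<lambda>x. c x *\<^sub>R (frm (B x) * R x))"
  proof (rule ccontr)
    define u where "u = Pf T (\<lambda>x. c x *\<^sub>R (frm (B x) * R x))"
    define v where "v = Pf T (\<lambda>x. c x *\<^sub>R (frm I * R x))"
    assume "\<not> 0 \<le> Pf T (\<lambda>x. c x *\<^sub>R (frm (B x) * R x))"
    then have u: "u < 0" by (simp add: u_def)
    \<comment> \<open>Small enough that \<epsilon> v makes up at most half of the negative value
      \<open>u\<close>.\<close>
    define \<epsilon> where "\<epsilon> = - u / (2 * (\<bar>v\<bar> + 1))"
    have "\<epsilon> > 0" using u unfolding \<epsilon>_def by (intro divide_pos_pos) auto
    then have "0 \<le> u + \<epsilon> * v" using *[OF u_def v_def] by blast
    moreover have "\<epsilon> * v \<le> \<epsilon> * (\<bar>v\<bar> + 1)" using \<open>\<epsilon> > 0\<close> by (intro mult_left_mono) auto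
    moreover have "\<epsilon> * (\<bar>v\<bar> + 1) = - u / 2"
    proof -
      have "- u / (2 * w) * w = - u / 2" if "w > 0" for w :: real using that by simp
      from this[of "\<bar>v\<bar> + 1"] show ?thesis by (simp add: \<epsilon>_def)
    qed
    ultimately show False using u by simp
  qed
  then show ?case by (simp add: R_def mult.assoc)
qed

lemma pos_psd:
  assumes "weakly_positive p T" "length Bs = p"
    "\<And>B i j. B \<in> set Bs \<Longrightarrow> smooth (\<lambda>x. B x i j)" "\<And>B x. B \<in> set Bs \<Longrightarrow> psd (B x)"
    "test_function c" "\<And>x. 0 \<le> c x"
  shows "0 \<le> Pf T (\<lambda>x. c x *\<^sub>R mform Bs x)"
  using pos_mixed[OF assms(1), of Bs "[]" c] assms by simp

section \<open>Concave currents\<close>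

text \<open>The complement of the support is a union of open sets on which \<open>T\<close>
  vanishes. A test function supported in the union is a finite sum of test functions supported in
  single members.\<close>

lemma current_support_null:
  fixes T :: "'n::{finite,linorder} supercurrent"
  assumes "lin T" "test_function \<phi>" "fun_support \<phi> \<inter> current_support T = {}"
  shows "T I J \<phi> = 0"
proof -
  let ?N = "{U. open U \<and> (\<forall>I J \<phi>. test_function \<phi> \<longrightarrow> fun_support \<phi> \<subseteq> U \<longrightarrow> T I J \<phi> = 0)}"
  have cover: "fun_support \<phi> \<subseteq> (\<Union>U\<in>?N. U)" using assms(3) unfolding current_support_def by auto
  have oN: "\<And>U. U \<in> ?N \<Longrightarrow> open U" by simp
  obtain F where F: "F \<subseteq> ?N" "finite F" "fun_support \<phi> \<subseteq> (\<Union>U\<in>F. U)"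
    by (rule compactE_image[OF test_compact[OF assms(2)] oN cover])
  have oF: "\<And>U. U \<in> F \<Longrightarrow> open U" using F(1) by auto
  from test_partition[OF F(2) assms(2) oF F(3)]
  obtain \<psi> where "(\<forall>i\<in>F. smooth (\<psi> i) \<and> (\<forall>x. 0 \<le> \<psi> i x \<and> \<psi> i x \<le> 1) \<and> fun_support (\<lambda>x. \<psi> i x * \<phi> x) \<subseteq> i) \<and>
     (\<forall>x. \<phi> x = (\<Sum>i\<in>F. \<psi> i x * \<phi> x))" by (rule exE)
  then have \<psi>: "\<And>i. i \<in> F \<Longrightarrow> smooth (\<psi> i)" "\<And>i. i \<in> F \<Longrightarrow> fun_support (\<lambda>x. \<psi> i x * \<phi> x) \<subseteq> i"
    "(\<lambda>x. \<Sum>i\<in>F. \<psi> i x * \<phi> x) = \<phi>" by auto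
  have t: "test_function (\<lambda>x. \<psi> i x * \<phi> x)" if "i \<in> F" for i by (rule test_mult_smooth[OF assms(2) \<psi>(1)[OF that]])
  have "cur T (\<lambda>x. \<Sum>i\<in>F. \<psi> i x * \<phi> x) = (\<Sum>i\<in>F. cur T (\<lambda>x. \<psi> i x * \<phi> x))"
    by (rule cur_sum[OF assms(1) t])
  then have "coef (cur T \<phi>) I J = coef (\<Sum>i\<in>F. cur T (\<lambda>x. \<psi> i x * \<phi> x)) I J" by (simp only: \<psi>(3))
  then have "T I J \<phi> = (\<Sum>i\<in>F. T I J (\<lambda>x. \<psi> i x * \<phi> x))" by (simp add: cur_def)
  also have "\<dots> = 0" by (rule sum.neutral) (use t \<psi>(2) F(1) in blast)
  finally show ?thesis .
qed

text \<open>As \<open>U\<close> is open, the closed support of the difference stays off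
  \<open>U\<close>, hence off the support of \<open>T\<close>.\<close>

lemma Pf_cong_support:
  assumes "lin T" "tsf \<alpha>" "tsf \<beta>" "open U" "current_support T \<subseteq> U" "\<And>x. x \<in> U \<Longrightarrow> \<alpha> x = \<beta> x"
  shows "Pf T \<alpha> = Pf T \<beta>"
proof -
  have "T I J (\<lambda>x. coef (\<alpha> x - \<beta> x) K L) = 0" for I J K L
  proof (rule current_support_null[OF assms(1)])
    show "test_function (\<lambda>x. coef (\<alpha> x - \<beta> x) K L)" using tsf_diff[OF assms(2,3)] by (simp add: tsf_def)
    have "fun_support (\<lambda>x. coef (\<alpha> x - \<beta> x) K L) \<subseteq> - U"
      by (rule fun_support_subset) (use assms(4,6) in auto)
    then show "fun_support (\<lambda>x. coef (\<alpha> x - \<beta> x) K L) \<inter> current_support T = {}" using assms(5) by blast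
  qed
  then have "cur T (\<lambda>x. coef (\<alpha> x - \<beta> x) K L) = 0" for K L by (intro sf_eqI) (simp add: cur_def)
  then have "Pf T (\<lambda>x. \<alpha> x - \<beta> x) = 0" unfolding Pf_def by simp
  then show ?thesis using Pf_diff[OF assms(1-3)] by simp
qed

definition cvx :: "(real^'n::finite \<Rightarrow> real) \<Rightarrow> bool" where
  "cvx v \<longleftrightarrow> smooth v \<and> (\<forall>x. psd (hess v x))"

lemma cvx_smooth: "cvx v \<Longrightarrow> smooth v" by (simp add: cvx_def)

lemma Hl_mform: "Hl vs x = mform (map hess vs) x" by (simp add: Hl_def mform_def comp_def)

lemma pos_Hl:
  assumes "weakly_positive p T" "length Bs + length vs = p"
    "\<And>B i j. B \<in> set Bs \<Longrightarrow> smooth (\<lambda>x. B x i j)" "\<And>B x. B \<in> set Bs \<Longrightarrow> psd (B x)"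
    "\<And>v. v \<in> set vs \<Longrightarrow> cvx v" "test_function c" "\<And>x. 0 \<le> c x"
  shows "0 \<le> Pf T (\<lambda>x. c x *\<^sub>R (mform Bs x * Hl vs x))"
proof -
  have "0 \<le> Pf T (\<lambda>x. c x *\<^sub>R mform (Bs @ map hess vs) x)"
    by (rule pos_psd[OF assms(1) _ _ _ assms(6,7)])
      (use assms(2-5) in \<open>auto simp: cvx_def intro: smooth_hess\<close>)
  then show ?thesis by (simp add: Hl_mform)
qed

lemma pos_Hl0:
  assumes "weakly_positive p T" "length vs = p" "\<And>v. v \<in> set vs \<Longrightarrow> cvx v" "test_function c" "\<And>x. 0 \<le> c x"
  shows "0 \<le> Pf T (\<lambda>x. c x *\<^sub>R Hl vs x)"
  using pos_Hl[OF assms(1), of "[]" vs c] assms by simp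

lemma pos_Hl1:
  assumes "weakly_positive p T" "Suc (length vs) = p" "\<And>i j. smooth (\<lambda>x. B x i j)" "\<And>x. psd (B x)"
    "\<And>v. v \<in> set vs \<Longrightarrow> cvx v" "test_function c" "\<And>x. 0 \<le> c x"
  shows "0 \<le> Pf T (\<lambda>x. c x *\<^sub>R (frm (B x) * Hl vs x))"
  using pos_Hl[OF assms(1), of "[B]" vs c] assms by simp

lemma cur_uminus: "cur (uminus_current T) \<phi> = - cur T \<phi>"
  by (rule sf_eqI) (simp add: cur_def uminus_current_def)

lemma Pf_ddsharp_uminus: "Pf (ddsharp_current (uminus_current T)) \<alpha> = - Pf (ddsharp_current T) \<alpha>"
proof -
  have "cur (ddsharp_current (uminus_current T)) \<phi> = - cur (ddsharp_current T) \<phi>" for \<phi>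
    by (simp add: cur_ddsharp_current cur_uminus sum_negf)
  then show ?thesis by (simp add: Pf_def sum_negf)
qed

lemma test_hess: "test_function f \<Longrightarrow> test_function (\<lambda>x. hess f x i j)"
  unfolding hess_def by (intro test_partial)

lemma tsf_frm: "(\<And>i j. test_function (\<lambda>x. A x i j)) \<Longrightarrow> tsf (\<lambda>x. frm (A x))"
  unfolding frm_def by (intro tsf_sum tsf_scale) auto

text \<open>The products of dd#v with convex v are closed and positive, so dd# moves from the
  current to \<open>f\<close> alone. Concavity enters the proof through this inequality
  only.\<close>

lemma concave_Hl:
  assumes "lin T" "concave_current p T" "length vs = p - 1" "\<And>v. v \<in> set vs \<Longrightarrow> cvx v"
    "test_function f" "\<And>x. 0 \<le> f x"
  shows "Pf T (\<lambda>x. frm (hess f x) * Hl vs x) \<le> 0"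
proof -
  have w: "weakly_positive (p - 1) (ddsharp_current (uminus_current T))"
    using assms(2) by (simp add: concave_current_def convex_current_def)
  have "0 \<le> Pf (ddsharp_current (uminus_current T)) (\<lambda>x. f x *\<^sub>R Hl vs x)"
    by (rule pos_Hl0[OF w assms(3,4,5,6)])
  moreover have "Pf (ddsharp_current T) (\<lambda>x. f x *\<^sub>R Hl vs x) = Pf T (\<lambda>x. frm (hess f x) * Hl vs x)"
    by (rule Pf_ddsharp_Hl[OF assms(1,5)]) (rule cvx_smooth[OF assms(4)])
  ultimately show ?thesis by (simp add: Pf_ddsharp_uminus)
qed

lemma hess_compose:
  assumes "smooth W" "\<And>t. (\<theta> has_real_derivative \<theta>1 t) (at t)" "\<And>t. (\<theta>1 has_real_derivative \<theta>2 t) (at t)"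
  shows "hess (\<lambda>x. \<theta> (W x)) x i j = \<theta>1 (W x) * hess W x i j + \<theta>2 (W x) * (partial i W x * partial j W x)"
proof -
  have 1: "partial j (\<lambda>x. \<theta> (W x)) = (\<lambda>x. \<theta>1 (W x) * partial j W x)"
    by (rule partial_compose[OF smooth_differentiable[OF assms(1)] assms(2)])
  have d: "(\<lambda>x. \<theta>1 (W x)) differentiable (at x)" for x
    using has_derivative_compose[OF has_derivative_frechet[OF smooth_differentiable[OF assms(1)]], of \<theta>1 "(*) (\<theta>2 (W x))"] assms(3)
    by (auto simp: has_field_derivative_def differentiable_def)
  show ?thesis
    unfolding hess_def 1
    by (subst partial_mult[OF d smooth_differentiable[OF smooth_partial[OF assms(1)]]],
        subst partial_compose[OF smooth_differentiable[OF assms(1)] assms(3)]) simp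
qed

lemma hess_mult:
  assumes "smooth f" "smooth g"
  shows "hess (\<lambda>x. f x * g x) x i j = hess f x i j * g x + partial i f x * partial j g x + partial j f x * partial i g x + f x * hess g x i j"
proof -
  note d = smooth_differentiable smooth_partial
  have 1: "partial j (\<lambda>x. f x * g x) = (\<lambda>x. partial j f x * g x + f x * partial j g x)"
    by (rule partial_mult[OF d(1)[OF assms(1)] d(1)[OF assms(2)]])
  have 2: "partial i (\<lambda>x. partial j f x * g x + f x * partial j g x) = (\<lambda>x. partial i (\<lambda>x. partial j f x * g x) x + partial i (\<lambda>x. f x * partial j g x) x)"
    by (rule partial_add) (intro d(1) smooth_mult d(2) assms)+
  have 3: "partial i (\<lambda>x. partial j f x * g x) = (\<lambda>x. partial i (partial j f) x * g x + partial j f x * partial i g x)"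
    by (rule partial_mult) (intro d(1) d(2) assms)+
  have 4: "partial i (\<lambda>x. f x * partial j g x) = (\<lambda>x. partial i f x * partial j g x + f x * partial i (partial j g) x)"
    by (rule partial_mult) (intro d(1) d(2) assms)+
  show ?thesis unfolding hess_def 1 2 3 4 by simp
qed

lemma hess_add: "smooth f \<Longrightarrow> smooth g \<Longrightarrow> hess (\<lambda>x. f x + g x) x i j = hess f x i j + hess g x i j"
  unfolding hess_def by (simp add: partial_add smooth_differentiable smooth_partial)
lemma hess_diff: "smooth f \<Longrightarrow> smooth g \<Longrightarrow> hess (\<lambda>x. f x - g x) x i j = hess f x i j - hess g x i j"
  unfolding hess_def by (simp add: partial_diff smooth_differentiable smooth_partial)
lemma hess_cmult: "smooth f \<Longrightarrow> hess (\<lambda>x. c * f x) x i j = c * hess f x i j"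
  unfolding hess_def by (simp add: partial_cmult smooth_differentiable smooth_partial)
lemma hess_const: "hess (\<lambda>x. c) x i j = 0"
  unfolding hess_def by simp

lemma psd_rank_one: "psd (\<lambda>i j. a i * (a j :: real))"
  unfolding psd_def
proof (intro conjI allI)
  fix z :: "'a \<Rightarrow> real"
  have "(\<Sum>i\<in>UNIV. \<Sum>j\<in>UNIV. a i * a j * z i * z j) = (\<Sum>i\<in>UNIV. a i * z i) * (\<Sum>i\<in>UNIV. a i * z i)"
    by (simp add: sum_product algebra_simps)
  then show "0 \<le> (\<Sum>i\<in>UNIV. \<Sum>j\<in>UNIV. a i * a j * z i * z j)" by simp
qed simp

text \<open>\<open>flat\<close> attains its minimum 0 at these points.\<close>

lemma deriv_flat_nonpos: "x \<le> 0 \<Longrightarrow> deriv flat x = 0"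
  by (rule DERIV_local_min[OF smooth1_DERIV[OF smooth1_flat], of 1]) (auto simp: flat_def)

lemma flat_antideriv:
  obtains \<theta> where "smooth1 \<theta>" "\<And>t. (\<theta> has_real_derivative flat t) (at t)" "\<And>t. 0 \<le> \<theta> t" "\<And>t. t \<le> 0 \<Longrightarrow> \<theta> t = 0"
proof -
  obtain \<theta> where \<theta>: "smooth1 \<theta>" "\<And>t. (\<theta> has_real_derivative flat t) (at t)" "\<theta> 0 = 0"
    using antideriv_exists[OF smooth1_flat] by blast
  have z: "\<theta> t = 0" if "t \<le> 0" for t
    using const_if_deriv_zero[OF \<theta>(2), of t 0] that \<theta>(3) by simp
  have "0 \<le> \<theta> t" for t
  proof (cases "t \<le> 0")
    case False
    have "\<theta> 0 \<le> \<theta> t" by (rule DERIV_nonneg_imp_nondecreasing) (use False \<theta> flat_nonneg in \<open>auto intro!: exI\<close>)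
    then show ?thesis using \<theta>(3) by simp
  qed (use z in simp)
  with \<theta> z show ?thesis using that by blast
qed

text \<open>The function \<open>\<theta>\<close> with \<open>\<theta>' = flat\<close> is convex and increasing, so \<open>dd\<^sup>#(\<theta> \<circ> W)\<close> dominates \<open>\<theta>'(W) dd\<^sup>#W\<close>;
  for compactly supported \<open>\<theta> \<circ> W\<close> the former integrates to something nonpositive against a concave
  current. The cutoff \<open>\<Psi>\<close> is locally constant near the support wherever \<open>W > 0\<close>.\<close>

lemma concave_cutoff:
  fixes T :: "'n::{finite,linorder} supercurrent"
  assumes pos: "weakly_positive p T" and conc: "concave_current p T"
    and vs: "Suc (length vs) = p" "\<And>v. v \<in> set vs \<Longrightarrow> cvx v"
    and W: "smooth W" and \<Psi>: "test_function \<Psi>" "\<And>x. 0 \<le> \<Psi> x"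
    and U: "open U" "current_support T \<subseteq> U"
    and \<Psi>1: "\<And>x. norm x < \<rho> \<Longrightarrow> \<Psi> x = 1" and \<Psi>0: "\<And>x. norm x > \<rho>' \<Longrightarrow> \<Psi> x = 0"
    and mid: "\<And>x. x \<in> U \<Longrightarrow> \<rho> \<le> norm x \<Longrightarrow> norm x \<le> \<rho>' \<Longrightarrow> W x \<le> 0"
  shows "Pf T (\<lambda>x. (\<Psi> x * flat (W x)) *\<^sub>R (frm (hess W x) * Hl vs x)) \<le> 0"
proof -
  note L = weakly_positive_lin[OF pos]
  obtain \<theta> where \<theta>: "smooth1 \<theta>" "\<And>t. (\<theta> has_real_derivative flat t) (at t)" "\<And>t. 0 \<le> \<theta> t" "\<And>t. t \<le> 0 \<Longrightarrow> \<theta> t = 0"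
    using flat_antideriv by blast
  note D2 = smooth1_DERIV[OF smooth1_flat]
  define f where "f x = \<Psi> x * \<theta> (W x)" for x
  have s\<theta>: "smooth (\<lambda>x. \<theta> (W x))" by (rule smooth_compose[OF \<theta>(1) W])
  have sf: "smooth (\<lambda>x. flat (W x))" by (rule smooth_compose[OF smooth1_flat W])
  have sf': "smooth (\<lambda>x. deriv flat (W x))" by (rule smooth_compose[OF smooth1_deriv[OF smooth1_flat] W])
  have s\<Psi>: "smooth \<Psi>" by (rule test_smooth[OF \<Psi>(1)])
  have tf: "test_function f" unfolding f_def by (rule test_mult_smooth2[OF \<Psi>(1) s\<theta>])
  have sH: "ssf (Hl vs)" by (rule ssf_Hl) (use vs(2) cvx_smooth in blast)
  define c1 where "c1 x = \<Psi> x * flat (W x)" for x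
  define c2 where "c2 x = \<Psi> x * deriv flat (W x)" for x
  define R where "R x i j = partial i W x * partial j W x" for x i j
  have tc: "test_function c1" "test_function c2" unfolding c1_def c2_def
    by (rule test_mult_smooth2[OF \<Psi>(1)], fact)+
  have sR: "smooth (\<lambda>x. R x i j)" for i j unfolding R_def by (intro smooth_mult smooth_partial W)
  have t1: "tsf (\<lambda>x. c1 x *\<^sub>R (frm (hess W x) * Hl vs x))" "tsf (\<lambda>x. c2 x *\<^sub>R (frm (R x) * Hl vs x))"
    by (intro tsf_scale tc ssf_mult ssf_frm sH smooth_hess W sR)+
  have eq: "hess f x i j = c1 x * hess W x i j + c2 x * R x i j" if x: "x \<in> U" for x i j
  proof -
    have h: "hess f x i j = hess \<Psi> x i j * \<theta> (W x) + partial i \<Psi> x * (flat (W x) * partial j W x) + partial j \<Psi> x * (flat (W x) * partial i W x)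
       + \<Psi> x * (flat (W x) * hess W x i j + deriv flat (W x) * (partial i W x * partial j W x))"
      unfolding f_def hess_mult[OF s\<Psi> s\<theta>] hess_compose[OF W \<theta>(2) D2]
        partial_compose[OF smooth_differentiable[OF W] \<theta>(2)] by simp
    have const: "partial i \<Psi> x = 0 \<and> hess \<Psi> x i j = 0" if V: "open V" "x \<in> V" "\<And>y. y \<in> V \<Longrightarrow> \<Psi> y = c" for V c i j
    proof -
      have p: "partial i \<Psi> y = 0" if "y \<in> V" for y i
        using partial_cong_open[OF V(1) that, of \<Psi> "\<lambda>_. c" i] V(3) by simp
      then have "partial i (partial j \<Psi>) x = 0"
        using partial_cong_open[OF V(1,2), of "partial j \<Psi>" "\<lambda>_. 0" i] by simp
      with p V(2) show ?thesis by (simp add: hess_def)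
    qed
    \<comment> \<open>Inside and outside the shell \<Psi> is locally constant and its derivatives
      vanish; in the shell W \<le> 0 annihilates \<theta> and its first two derivatives at
      W.\<close>
    consider "norm x < \<rho>" | "norm x > \<rho>'" | "\<rho> \<le> norm x" "norm x \<le> \<rho>'" by linarith
    then show ?thesis
    proof cases
      case 1
      then have "partial i \<Psi> x = 0 \<and> hess \<Psi> x i j = 0" for i j
        by (intro const[of "ball 0 \<rho>" 1]) (auto intro: \<Psi>1)
      then show ?thesis unfolding h by (simp add: c1_def c2_def R_def algebra_simps)
    next
      case 2
      then have "partial i \<Psi> x = 0 \<and> hess \<Psi> x i j = 0" for i j
        by (intro const[of "- cball 0 \<rho>'" 0]) (auto intro: \<Psi>0)
      then show ?thesis unfolding h by (simp add: c1_def c2_def R_def algebra_simps)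
    next
      case 3
      then have "W x \<le> 0" using mid x by blast
      then have "\<theta> (W x) = 0" "flat (W x) = 0" "deriv flat (W x) = 0" by (auto intro: \<theta>(4) deriv_flat_nonpos)
      then show ?thesis unfolding h c1_def c2_def by (simp del: flat_eq_0)
    qed
  qed
  have "Pf T (\<lambda>x. frm (hess f x) * Hl vs x) = Pf T (\<lambda>x. c1 x *\<^sub>R (frm (hess W x) * Hl vs x) + c2 x *\<^sub>R (frm (R x) * Hl vs x))"
  proof (rule Pf_cong_support[OF L _ _ U])
    show "tsf (\<lambda>x. frm (hess f x) * Hl vs x)" by (intro tsf_mult tsf_frm test_hess tf sH)
    show "tsf (\<lambda>x. c1 x *\<^sub>R (frm (hess W x) * Hl vs x) + c2 x *\<^sub>R (frm (R x) * Hl vs x))" by (intro tsf_add t1)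
    fix x assume "x \<in> U"
    then have "hess f x = (\<lambda>i j. c1 x * hess W x i j + c2 x * R x i j)" using eq by blast
    then have "frm (hess f x) = c1 x *\<^sub>R frm (hess W x) + c2 x *\<^sub>R frm (R x)"
      by (simp only: frm_add frm_scale)
    then show "frm (hess f x) * Hl vs x = c1 x *\<^sub>R (frm (hess W x) * Hl vs x) + c2 x *\<^sub>R (frm (R x) * Hl vs x)"
      by (simp add: distrib_right)
  qed
  also have "\<dots> = Pf T (\<lambda>x. c1 x *\<^sub>R (frm (hess W x) * Hl vs x)) + Pf T (\<lambda>x. c2 x *\<^sub>R (frm (R x) * Hl vs x))"
    by (rule Pf_add[OF L t1])
  finally have e: "Pf T (\<lambda>x. frm (hess f x) * Hl vs x) = Pf T (\<lambda>x. c1 x *\<^sub>R (frm (hess W x) * Hl vs x)) + Pf T (\<lambda>x. c2 x *\<^sub>R (frm (R x) * Hl vs x))" .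
  have "Pf T (\<lambda>x. frm (hess f x) * Hl vs x) \<le> 0"
    by (rule concave_Hl[OF L conc _ vs(2) tf]) (use vs(1) \<Psi>(2) \<theta>(3) in \<open>auto simp: f_def\<close>)
  moreover have "0 \<le> Pf T (\<lambda>x. c2 x *\<^sub>R (frm (R x) * Hl vs x))"
    by (rule pos_Hl1[OF pos vs(1) sR _ vs(2) tc(2)])
      (use psd_rank_one \<Psi>(2) deriv_flat_nonneg in \<open>auto simp: R_def c2_def\<close>)
  ultimately show ?thesis using e by (simp add: c1_def)
qed

text \<open>Half the squared norm of the coordinates in \<open>A\<close>. Its dd# is the part of
  \<beta> in these directions, so \<open>A\<close>, its complement and the whole index type give
  \<beta>', \<beta>'' and \<beta>.\<close>

definition qd :: "'n set \<Rightarrow> real^'n::finite \<Rightarrow> real" where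
  "qd A x = (\<Sum>i\<in>A. (1/2) * (x $ i * x $ i))"

lemma smooth_qd: "smooth (qd A)"
  unfolding qd_def[abs_def] by (intro smooth_sum smooth_mult smooth_const smooth_coord)

lemma hess_qd: "hess (qd A) x i j = (if i = j \<and> i \<in> A then 1 else 0)"
proof -
  have d: "\<And>x. (\<lambda>x::real^'a. x $ k) differentiable (at x)" for k by (rule smooth_differentiable) simp
  have "partial j (\<lambda>x::real^'a. (1/2) * (x $ k * x $ k)) = (\<lambda>x. if j = k then x $ j else 0)" for k
    by (subst partial_cmult, rule smooth_differentiable, intro smooth_mult smooth_coord)
      (subst partial_mult[OF d d], auto simp: partial_coord)
  then have "partial j (qd A) = (\<lambda>x. \<Sum>k\<in>A. if j = k then x $ j else 0)"
    unfolding qd_def[abs_def] partial_sum[OF smooth_mult[OF smooth_const smooth_mult[OF smooth_coord smooth_coord]]]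
    by (simp only:)
  then have "partial j (qd A) = (\<lambda>x. (if j \<in> A then 1 else 0) * x $ j)" by (auto simp: sum.delta)
  then show ?thesis unfolding hess_def by (simp add: partial_cmult[OF d] partial_coord)
qed

lemma cvx_qd: "cvx (qd A)"
  unfolding cvx_def psd_def hess_qd
proof (intro conjI allI smooth_qd)
  fix z :: "'a \<Rightarrow> real"
  have "(\<Sum>i\<in>UNIV. \<Sum>j\<in>UNIV. (if i = j \<and> i \<in> A then 1 else 0) * z i * z j) = (\<Sum>i\<in>UNIV. if i \<in> A then z i * z i else 0)"
  proof (rule sum.cong[OF refl])
    fix i
    have "(\<Sum>j\<in>UNIV. (if i = j \<and> i \<in> A then 1 else 0) * z i * z j) = (\<Sum>j\<in>UNIV. if i = j then (if i \<in> A then z i * z i else 0) else 0)"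
      by (rule sum.cong) auto
    then show "(\<Sum>j\<in>UNIV. (if i = j \<and> i \<in> A then 1 else 0) * z i * z j) = (if i \<in> A then z i * z i else 0)"
      by (simp add: sum.delta)
  qed
  also have "0 \<le> \<dots>" by (rule sum_nonneg) auto
  finally show "0 \<le> (\<Sum>i\<in>UNIV. \<Sum>j\<in>UNIV. (if i = j \<and> i \<in> A then 1 else 0) * z i * z j)" .
qed auto

abbreviation bq :: "real^'n::finite \<Rightarrow> real" where "bq \<equiv> qd UNIV"

lemma frm_hess_qd: "frm (hess (qd A) x) = (\<Sum>i\<in>A. XY i i)"
proof -
  have "frm (hess (qd A) x) = (\<Sum>i\<in>UNIV. \<Sum>j\<in>UNIV. if i = j then (if i \<in> A then XY i i else 0) else 0)"
    unfolding frm_def by (intro sum.cong refl) (auto simp: hess_qd)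
  also have "\<dots> = (\<Sum>i\<in>UNIV. if i \<in> A then XY i i else 0)" by (simp add: sum.delta)
  also have "\<dots> = (\<Sum>i\<in>A. XY i i)" by (subst sum.inter_restrict[symmetric]) auto
  finally show ?thesis .
qed

lemma norm_qd: "(norm x)\<^sup>2 = 2 * bq (x :: real^'n::finite)"
  by (simp only: power2_norm_eq_inner inner_vec_def) (simp add: qd_def sum_distrib_left)

lemma beta_coef: "beta x = coef (frm (hess bq x))"
  by (intro ext) (simp add: beta_def frm_hess_qd XY_def coef_times coef_X coef_Y)

lemma form_power_beta: "form_power beta p = (\<lambda>x. coef (Hl (replicate p bq) x))"
  unfolding form_power_def beta_coef
proof
  fix x
  show "wedge_list (replicate p (coef (frm (hess bq x)))) = coef (Hl (replicate p bq) x)"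
    using wedge_list_coef[of "replicate p (frm (hess bq x))"] by (simp add: Hl_def)
qed

lemma ddsharp_fun_coef:
  assumes "smooth v" shows "ddsharp_fun v = (\<lambda>x. coef (frm (hess v x)))"
proof (intro ext)
  fix x I J
  have 1: "dsharp_form (fun_form v) y K L = (\<Sum>j\<in>UNIV. partial j v y * coef (Y j) K L)" for y K L
  proof -
    have "(\<lambda>K L. partial j (\<lambda>y. fun_form v y K L) y) = coef (partial j v y *\<^sub>R 1)" for j
    proof (intro ext)
      fix K L
      show "partial j (\<lambda>y. fun_form v y K L) y = coef (partial j v y *\<^sub>R 1) K L"
      proof (cases "K = {} \<and> L = {}")
        case True
        then have "(\<lambda>y. fun_form v y K L) = v" by (auto simp: fun_form_def)
        with True show ?thesis by (simp add: coef_one one_super_def)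
      next
        case False
        then have "(\<lambda>y. fun_form v y K L) = (\<lambda>y. 0)" by (auto simp: fun_form_def)
        with False show ?thesis by (auto simp: coef_one one_super_def)
      qed
    qed
    then have "dsharp_form (fun_form v) y K L = (\<Sum>j\<in>UNIV. coef (Y j * (partial j v y *\<^sub>R 1)) K L)"
      unfolding dsharp_form_def coef_times coef_Y by simp
    then show ?thesis by simp
  qed
  have 2: "partial i (\<lambda>y. dsharp_form (fun_form v) y K L) x = coef (\<Sum>j\<in>UNIV. hess v x i j *\<^sub>R Y j) K L" for i K L
  proof -
    have c: "partial i (\<lambda>y. partial j v y * c) = (\<lambda>y. partial i (partial j v) y * c)" for j c
      by (subst partial_mult) (auto intro: smooth_differentiable smooth_partial assms)
    show ?thesis unfolding 1
      by (subst partial_sum) (auto simp: c hess_def intro!: smooth_mult smooth_partial assms)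
  qed
  have 3: "(\<lambda>K L. partial i (\<lambda>y. dsharp_form (fun_form v) y K L) x) = coef (\<Sum>j\<in>UNIV. hess v x i j *\<^sub>R Y j)" for i
    using 2 by blast
  have "ddsharp_fun v x I J = (\<Sum>i\<in>UNIV. coef (X i * (\<Sum>j\<in>UNIV. hess v x i j *\<^sub>R Y j)) I J)"
    unfolding ddsharp_fun_def d_form_def 3 coef_times coef_X ..
  also have "\<dots> = coef (frm (hess v x)) I J"
    by (simp add: frm_def XY_def sum_distrib_left)
  finally show "ddsharp_fun v x I J = coef (frm (hess v x)) I J" .
qed

lemma form_power_ddsharp:
  "smooth v \<Longrightarrow> form_power (ddsharp_fun v) p = (\<lambda>x. coef (Hl (replicate p v) x))"
  unfolding form_power_def
proof
  fix x assume "smooth v"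
  then show "wedge_list (replicate p (ddsharp_fun v x)) = coef (Hl (replicate p v) x)"
    using wedge_list_coef[of "replicate p (frm (hess v x))"] by (simp add: Hl_def ddsharp_fun_coef)
qed

section \<open>Powers of diagonal forms\<close>

lemma XY_XY_zero: "XY a b * XY a a = 0" "XY a b * XY b b = 0"
proof -
  have "XY a b * XY a a = X a * (Y b * X a) * Y a" by (simp add: XY_def mult.assoc)
  also have "\<dots> = - ((X a * X a) * Y b * Y a)" by (simp add: Y_X mult.assoc del: X_X_0)
  also have "\<dots> = 0" by simp
  finally show "XY a b * XY a a = 0" .
  have "XY a b * XY b b = X a * (Y b * X b) * Y b" by (simp add: XY_def mult.assoc)
  also have "\<dots> = - (X a * X b * (Y b * Y b))" by (simp add: Y_X mult.assoc)
  finally show "XY a b * XY b b = 0" by simp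
qed

text \<open>In the binomial formula all terms with two factors \<open>e\<close> drop out.\<close>

lemma power_add_square_zero:
  fixes S e :: "'n::{finite,linorder} sf"
  assumes "S * e = e * S" "e * e = 0"
  shows "(S + e) ^ Suc m = S ^ Suc m + real (Suc m) *\<^sub>R (S ^ m * e)"
proof (induction m)
  case 0 then show ?case by simp
next
  case (Suc m)
  have c: "S ^ n * e = e * S ^ n" for n using assms(1) by (metis power_commuting_commutes)
  have z: "e * (S ^ n * e) = 0" for n by (simp add: c assms(2) flip: mult.assoc)
  have "(S + e) ^ Suc (Suc m) = (S + e) * (S ^ Suc m + real (Suc m) *\<^sub>R (S ^ m * e))"
    using Suc by simp
  also have "\<dots> = S ^ Suc (Suc m) + real (Suc m) *\<^sub>R (S ^ Suc m * e) + e * S ^ Suc m"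
    by (simp add: distrib_right distrib_left z mult.assoc)
  also have "e * S ^ Suc m = 1 *\<^sub>R (S ^ Suc m * e)" using c[of "Suc m"] by simp
  also have "S ^ Suc (Suc m) + real (Suc m) *\<^sub>R (S ^ Suc m * e) + 1 *\<^sub>R (S ^ Suc m * e) =
    S ^ Suc (Suc m) + (real (Suc m) + 1) *\<^sub>R (S ^ Suc m * e)" by (simp only: scaleR_add_left add.assoc)
  also have "real (Suc m) + 1 = real (Suc (Suc m))" by simp
  finally show ?case .
qed

text \<open>Every dx_i \<and> d\<xi>_i has square zero, so a power of the sum retains only products
  of distinct ones, each m! times. This yields both cases of the overview: \<beta>' to the power p
  vanishes for p > k and is p! times the coordinate product for p = k.\<close>

lemma diagonal_power:
  "length js < m \<Longrightarrow> (\<Sum>i\<leftarrow>js. XY i i) ^ m = 0"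
  "(\<Sum>i\<leftarrow>js. XY i i) ^ length js = fact (length js) *\<^sub>R prod_list (map (\<lambda>i. XY i i) js)"
proof (induction js arbitrary: m)
  case Nil
  { case 1 then show ?case by (cases m) auto }
  { case 2 then show ?case by simp }
next
  case (Cons i js)
  let ?S = "\<Sum>i\<leftarrow>js. XY i i"
  have c: "?S * XY i i = XY i i * ?S" by (simp add: XY_central)
  have e: "(\<Sum>i\<leftarrow>i # js. XY i i) ^ Suc m = ?S ^ Suc m + real (Suc m) *\<^sub>R (?S ^ m * XY i i)" for m
    using power_add_square_zero[OF c XY_XY_zero(1), of m] by (simp add: add.commute)
  { case 1
    then obtain m' where "m = Suc m'" "length js < m'" by (cases m) auto
    with Cons.IH(1)[of m] Cons.IH(1)[of m'] e[of m'] show ?case by simp }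
  { case 2
    show ?case using Cons.IH(1)[of "Suc (length js)"] Cons.IH(2) e[of "length js"]
      by (simp add: XY_central) }
qed

abbreviation q1 :: "'n \<Rightarrow> real^'n::finite \<Rightarrow> real" where "q1 j \<equiv> qd {j}"

lemma frm_hess_q1: "frm (hess (q1 j) x) = XY j j" by (simp add: frm_hess_qd)

lemma Hl_q1: "Hl (map q1 js) x = prod_list (map (\<lambda>i. XY i i) js)"
  by (induction js) (simp_all add: frm_hess_q1)

lemma Hl_q1_remove1: "i \<in> set js \<Longrightarrow> Hl (map q1 js) x = XY i i * Hl (map q1 (remove1 i js)) x"
proof (induction js)
  case (Cons j js)
  show ?case
  proof (cases "i = j")
    case False
    then have "Hl (map q1 (j # js)) x = XY j j * (XY i i * Hl (map q1 (remove1 i js)) x)"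
      using Cons by (simp add: frm_hess_q1)
    also have "\<dots> = XY i i * (XY j j * Hl (map q1 (remove1 i js)) x)"
      using XY_central[of j j "XY i i"] by (simp flip: mult.assoc)
    finally show ?thesis using False by (simp add: frm_hess_q1)
  qed (simp add: frm_hess_q1)
qed simp

lemma XY_Hl_q1_zero: "a \<in> set js \<or> b \<in> set js \<Longrightarrow> XY a b * Hl (map q1 js) x = 0"
  using Hl_q1_remove1[of a js x] Hl_q1_remove1[of b js x] XY_XY_zero[of a b]
  by (metis mult.assoc mult_zero_left)

lemma Pf_mono_Hl:
  assumes "weakly_positive p T" "length vs = p" "\<And>v. v \<in> set vs \<Longrightarrow> cvx v"
    "test_function c" "test_function d" "\<And>x. c x \<le> d x"
  shows "Pf T (\<lambda>x. c x *\<^sub>R Hl vs x) \<le> Pf T (\<lambda>x. d x *\<^sub>R Hl vs x)"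
proof -
  note L = weakly_positive_lin[OF assms(1)]
  have s: "ssf (Hl vs)" by (rule ssf_Hl) (use assms(3) cvx_smooth in blast)
  have "0 \<le> Pf T (\<lambda>x. (d x - c x) *\<^sub>R Hl vs x)"
    by (rule pos_Hl0[OF assms(1-3) test_diff[OF assms(5,4)]]) (use assms(6) in auto)
  also have "\<dots> = Pf T (\<lambda>x. d x *\<^sub>R Hl vs x) - Pf T (\<lambda>x. c x *\<^sub>R Hl vs x)"
    unfolding scaleR_diff_left by (rule Pf_diff[OF L]) (intro tsf_scale assms s)+
  finally show ?thesis by simp
qed

section \<open>Products of functions of one coordinate\<close>

text \<open>With separated variables a derivative along coordinate \<open>i\<close> changes factor
  \<open>i\<close> alone, so each direction can be treated while the other factors stay
  frozen.\<close>

definition PR :: "('n::finite \<Rightarrow> real \<Rightarrow> real) \<Rightarrow> real^'n \<Rightarrow> real" where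
  "PR c x = (\<Prod>j\<in>UNIV. c j (x $ j))"

lemma PR_upd: "PR (c(i := g)) x = g (x $ i) * (\<Prod>j\<in>UNIV - {i}. c j (x $ j))"
  unfolding PR_def by (subst prod.remove[of _ i]) (auto intro!: arg_cong2[where f="(*)"] prod.cong)

lemma PR_split: "PR c x = c i (x $ i) * (\<Prod>j\<in>UNIV - {i}. c j (x $ j))"
  using PR_upd[of c i "c i" x] by simp

lemma smooth_coord_compose: "smooth1 h \<Longrightarrow> smooth (\<lambda>x. h (x $ j))"
  by (rule smooth_compose) auto

lemma smooth_PR: "(\<And>j. smooth1 (c j)) \<Longrightarrow> smooth (PR c)"
  unfolding PR_def[abs_def] by (intro smooth_prod smooth_coord_compose)

lemma partial_coord_compose: "smooth1 h \<Longrightarrow> partial i (\<lambda>x. h (x $ j)) = (\<lambda>x. if i = j then deriv h (x $ j) else 0)"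
  by (subst partial_compose[OF smooth_differentiable[OF smooth_coord] smooth1_DERIV]) (auto simp: partial_coord)

lemma partial_prod_other:
  "i \<notin> S \<Longrightarrow> (\<And>j. smooth1 (c j)) \<Longrightarrow> partial i (\<lambda>x. \<Prod>j\<in>S. c j (x $ j)) = (\<lambda>x. 0)"
proof (induction S rule: infinite_finite_induct)
  case (insert k S)
  have "partial i (\<lambda>x. c k (x $ k) * (\<Prod>j\<in>S. c j (x $ j))) = (\<lambda>x. 0)"
    by (subst partial_mult) (use insert in \<open>auto simp: partial_coord_compose intro!: smooth_differentiable smooth_coord_compose smooth_prod\<close>)
  then show ?case using insert by simp
qed auto

lemma partial_PR:
  assumes "\<And>j. smooth1 (c j)" shows "partial i (PR c) = PR (c(i := deriv (c i)))"
proof -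
  have "PR c = (\<lambda>x. c i (x $ i) * (\<Prod>j\<in>UNIV - {i}. c j (x $ j)))" using PR_split by blast
  moreover have "partial i (\<lambda>x. c i (x $ i) * (\<Prod>j\<in>UNIV - {i}. c j (x $ j))) = PR (c(i := deriv (c i)))"
    by (subst partial_mult)
      (auto simp: PR_upd partial_coord_compose partial_prod_other assms intro!: smooth_differentiable smooth_coord_compose smooth_prod)
  ultimately show ?thesis by simp
qed

lemma test_PR:
  assumes "\<And>j. smooth1 (c j)" "\<And>j s. R < \<bar>s\<bar> \<Longrightarrow> c j s = 0"
  shows "test_function (PR c)"
proof (rule test_functionI[OF smooth_PR[OF assms(1)]])
  show "compact (cbox (\<chi> j. - R) (\<chi> j. R) :: (real^'a) set)" by simp
  fix x assume "PR c x \<noteq> 0"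
  then have "c j (x $ j) \<noteq> 0" for j by (auto simp: PR_def)
  then have "\<bar>x $ j\<bar> \<le> R" for j using assms(2)[where s="x $ j"] by (metis not_le)
  then have "- R \<le> x $ j \<and> x $ j \<le> R" for j using abs_le_iff[of "x $ j" R] by (metis minus_le_iff)
  then show "x \<in> cbox (\<chi> j. - R) (\<chi> j. R)" by (simp add: mem_box_cart)
qed

text \<open>Once a concave sequence drops by d, it drops by at least d at every later step and
  becomes negative. Reflection excludes an increase.\<close>

lemma concave_int_const:
  fixes f :: "int \<Rightarrow> real"
  assumes pos: "\<And>n. 0 \<le> f n" and conc: "\<And>n. f (n - 1) + f (n + 1) \<le> 2 * f n"
  shows "f n = f 0"
proof -
  have half: "f n \<le> f (n + 1)" if pos: "\<And>n. 0 \<le> f n" and conc: "\<And>n. f (n - 1) + f (n + 1) \<le> 2 * f n" for f :: "int \<Rightarrow> real" and n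
  proof (rule ccontr)
    assume "\<not> f n \<le> f (n + 1)"
    define d where "d = f n - f (n + 1)"
    have d: "d > 0" using \<open>\<not> f n \<le> f (n + 1)\<close> by (simp add: d_def)
    have step: "f (n + int m + 1) \<le> f (n + int m) - d" for m
    proof (induction m)
      case (Suc m)
      have "f (n + int m) + f (n + int m + 2) \<le> 2 * f (n + int m + 1)"
        using conc[of "n + int m + 1"] by (simp add: algebra_simps)
      then show ?case using Suc by (simp add: algebra_simps)
    qed (simp add: d_def)
    have "f (n + int m) \<le> f n - real m * d" for m
    proof (induction m)
      case (Suc m) then show ?case using step[of m] by (simp add: algebra_simps)
    qed simp
    moreover obtain m where "f n < real m * d" using reals_Archimedean3[OF d] by blast
    ultimately show False using pos[of "n + int m"] by (smt (verit))
  qed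
  have up: "f n \<le> f (n + 1)" for n by (rule half[OF pos conc])
  have down: "f (n + 1) \<le> f n" for n
    using half[of "\<lambda>n. f (- n)" "- n - 1"] pos conc[of "- _"] by (simp add: algebra_simps)
  have eq: "f (n + 1) = f n" for n using up down by (simp add: antisym)
  show ?thesis
  proof (induction n rule: int_induct[where k=0])
    case (step1 i) then show ?case using eq[of i] by simp
  next
    case (step2 i) then show ?case using eq[of "i - 1"] by simp
  qed simp
qed

section \<open>Mass growth in a tube\<close>

text \<open>\<open>A\<close> indexes the coordinates x' along the tube. The exponent of the original
  support condition is gone: what matters is that each remaining coordinate is bounded by 1.\<close>

locale tube_current =
  fixes T :: "'n::{finite,linorder} supercurrent" and p :: nat and A :: "'n set"
  assumes pos: "weakly_positive p T" and conc: "concave_current p T" and card_A: "card A \<le> p"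
    and supp: "\<And>x i. x \<in> current_support T \<Longrightarrow> i \<notin> A \<Longrightarrow> \<bar>x $ i\<bar> \<le> 1"
begin

lemmas L = weakly_positive_lin[OF pos]

text \<open>An open neighbourhood of the support, still bounded in the directions across the tube;
  by \<open>Pf_cong_support\<close>, forms need to agree only here.\<close>

definition U :: "(real, 'n) vec set" where "U = {x. \<forall>i. i \<notin> A \<longrightarrow> \<bar>x $ i\<bar> < 2}"

lemma open_U: "open U"
proof -
  have "U = (\<Inter>i\<in>-A. {x. \<bar>x $ i\<bar> < 2})" by (auto simp: U_def)
  moreover have "open {x::(real, 'n) vec. \<bar>x $ i\<bar> < 2}" for i
    by (intro open_Collect_less continuous_intros)
  ultimately show ?thesis by (simp add: open_INT)
qed

lemma supp_U: "current_support T \<subseteq> U"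
  using supp by (fastforce simp: U_def)

definition As :: "'n list" where "As = sorted_list_of_set A"

lemma As: "distinct As" "set As = A" "length As = card A"
  by (simp_all add: As_def)

lemma frm_qdA: "frm (hess (qd A) x) = (\<Sum>i\<leftarrow>As. XY i i)"
  by (simp add: frm_hess_qd sum_list_distinct_conv_sum_set As)

text \<open>Only the second derivative along \<open>e_i\<close> survives after wedging with the remaining coordinates of
  \<open>A\<close>; hence \<open>T \<and> \<omega>\<close> is concave, and so translation invariant, along the coordinates of \<open>A\<close>.\<close>

lemma concave_coordinate:
  assumes A: "card A = p" "i \<in> A" and c: "\<And>j. smooth1 (c j)" "\<And>j s. 0 \<le> c j s" "\<And>j s. R < \<bar>s\<bar> \<Longrightarrow> c j s = 0"
    and c1: "\<And>j s. j \<notin> A \<Longrightarrow> \<bar>s\<bar> < 2 \<Longrightarrow> c j s = 1"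
  shows "Pf T (\<lambda>x. PR (c(i := deriv (deriv (c i)))) x *\<^sub>R Hl (map q1 As) x) \<le> 0"
proof -
  let ?vs = "map q1 (remove1 i As)"
  have t: "test_function (PR c)" by (rule test_PR[OF c(1,3)])
  have pPR: "partial a (PR c) = PR (c(a := deriv (c a)))" for a by (rule partial_PR) (rule c(1))
  have d0: "deriv h s = 0" if "\<And>s. R < \<bar>s\<bar> \<Longrightarrow> h s = 0" "smooth1 h" "R < \<bar>s\<bar>" for h s
  proof -
    have "open {s. R < \<bar>s\<bar>}" by (intro open_Collect_less continuous_intros)
    then have "(h has_real_derivative 0) (at s)"
      using that by (intro has_field_derivative_transform_within_open[where f="\<lambda>_. 0" and S="{s. R < \<bar>s\<bar>}" and g=h]) auto
    then show ?thesis by (rule DERIV_imp_deriv)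
  qed
  have sd: "smooth1 ((c(i := deriv (deriv (c i)))) j)" for j
    using c(1) by (simp add: smooth1_deriv)
  have td: "test_function (PR (c(i := deriv (deriv (c i)))))"
    by (rule test_PR[OF sd, of R]) (use c d0[OF d0[OF c(3) c(1)] smooth1_deriv[OF c(1)]] in auto)
  have i: "i \<in> set As" "i \<notin> set (remove1 i As)" "set (remove1 i As) = A - {i}" using A As by auto
  have sv: "\<And>v. v \<in> set ?vs \<Longrightarrow> cvx v" "\<And>v. v \<in> set (map q1 As) \<Longrightarrow> cvx v" using cvx_qd by auto
  have sH: "ssf (Hl ?vs)" "ssf (Hl (map q1 As))" by (rule ssf_Hl, use sv cvx_smooth in blast)+
  have len: "length ?vs = p - 1" using A As by (simp add: length_remove1)
  have "Pf T (\<lambda>x. frm (hess (PR c) x) * Hl ?vs x) = Pf T (\<lambda>x. PR (c(i := deriv (deriv (c i)))) x *\<^sub>R Hl (map q1 As) x)"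
  proof (rule Pf_cong_support[OF L _ _ open_U supp_U])
    show "tsf (\<lambda>x. frm (hess (PR c) x) * Hl ?vs x)" by (intro tsf_mult tsf_frm test_hess t sH)
    show "tsf (\<lambda>x. PR (c(i := deriv (deriv (c i)))) x *\<^sub>R Hl (map q1 As) x)" by (intro tsf_scale td sH)
    fix x assume x: "x \<in> U"
    have z: "partial b (PR c) y = 0" if b: "b \<notin> A" and y: "y \<in> U" for b y
    proof -
      have "\<bar>y $ b\<bar> < 2" using b y by (simp add: U_def)
      moreover have "open {s::real. \<bar>s\<bar> < 2}" by (intro open_Collect_less continuous_intros)
      ultimately have "(c b has_real_derivative 0) (at (y $ b))"
        using c1[OF b] by (intro has_field_derivative_transform_within_open[where f="\<lambda>_. 1" and S="{s::real. \<bar>s\<bar> < 2}" and g="c b"]) auto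
      then have "deriv (c b) (y $ b) = 0" by (rule DERIV_imp_deriv)
      then show ?thesis by (simp add: pPR PR_upd)
    qed
    have h0: "hess (PR c) x a b = 0" if "a \<notin> A \<or> b \<notin> A" for a b
    proof -
      have *: "hess (PR c) x a b = 0" if "b \<notin> A" for a b
        using partial_cong_open[OF open_U x, of "partial b (PR c)" "\<lambda>_. 0" a] z[OF that] by (simp add: hess_def)
      show ?thesis using that * hess_sym[OF test_smooth[OF t], of x a b] by metis
    qed
    have hi: "hess (PR c) x i i = PR (c(i := deriv (deriv (c i)))) x"
    proof -
      have "partial i (PR (c(i := deriv (c i)))) = PR ((c(i := deriv (c i)))(i := deriv ((c(i := deriv (c i))) i)))"
        by (rule partial_PR) (simp add: c(1) smooth1_deriv)
      then show ?thesis by (simp add: hess_def pPR)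
    qed
    \<comment> \<open>Derivatives across the tube vanish on \<open>U\<close>, and an index already
      used by a factor of \<open>Hl ?vs\<close> annihilates the product; only a = b = i is
      left.\<close>
    have trm: "hess (PR c) x a b *\<^sub>R (XY a b * Hl ?vs x) = (if a = i \<and> b = i then PR (c(i := deriv (deriv (c i)))) x *\<^sub>R Hl (map q1 As) x else 0)" for a b
    proof (cases "a = i \<and> b = i")
      case True then show ?thesis using hi Hl_q1_remove1[OF i(1), where x=x] by simp
    next
      case False
      then have "a \<notin> A \<or> b \<notin> A \<or> a \<in> set (remove1 i As) \<or> b \<in> set (remove1 i As)" using i(3) by blast
      then show ?thesis using h0[of a b] XY_Hl_q1_zero[where a=a and b=b and js="remove1 i As" and x=x] False by auto
    qed
    have "frm (hess (PR c) x) * Hl ?vs x = (\<Sum>a\<in>UNIV. \<Sum>b\<in>UNIV. hess (PR c) x a b *\<^sub>R (XY a b * Hl ?vs x))"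
      by (simp add: frm_def sum_distrib_right)
    also have "\<dots> = (\<Sum>a\<in>UNIV. if a = i then (\<Sum>b\<in>UNIV. if b = i then PR (c(i := deriv (deriv (c i)))) x *\<^sub>R Hl (map q1 As) x else 0) else 0)"
      unfolding trm by (rule sum.cong[OF refl]) auto
    also have "\<dots> = PR (c(i := deriv (deriv (c i)))) x *\<^sub>R Hl (map q1 As) x" by (simp add: sum.delta)
    finally show "frm (hess (PR c) x) * Hl ?vs x = PR (c(i := deriv (deriv (c i)))) x *\<^sub>R Hl (map q1 As) x" .
  qed
  moreover have "Pf T (\<lambda>x. frm (hess (PR c) x) * Hl ?vs x) \<le> 0"
    by (rule concave_Hl[OF L conc len sv(1) t]) (use c(2) in \<open>auto simp: PR_def intro: prod_nonneg\<close>)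
  ultimately show ?thesis by simp
qed

end

context tube_current
begin

text \<open>The second derivative of a translate of \<open>g\<close> is a second difference of
  translates of \<open>b\<close>. Thus \<open>concave_coordinate\<close> says that the masses of the
  translates of \<open>b\<close> form a concave sequence in \<open>n\<close>; they are nonnegative,
  hence constant.\<close>

lemma translation_invariant:
  fixes n :: int
  assumes A: "card A = p" "i \<in> A" and c: "\<And>j. smooth1 (c j)" "\<And>j s. 0 \<le> c j s" "\<And>j s. R < \<bar>s\<bar> \<Longrightarrow> c j s = 0"
    and c1: "\<And>j s. j \<notin> A \<Longrightarrow> \<bar>s\<bar> < 2 \<Longrightarrow> c j s = 1"
    and b: "smooth1 b" "\<And>s. 0 \<le> b s" "\<And>s. 1 \<le> \<bar>s\<bar> \<Longrightarrow> b s = 0"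
    and g: "smooth1 g" "\<And>s. 0 \<le> g s" "\<And>s. 2 \<le> \<bar>s\<bar> \<Longrightarrow> g s = 0"
    and gb: "\<And>s. deriv (deriv g) s = b (s + 1) - 2 * b s + b (s - 1)"
  shows "Pf T (\<lambda>x. PR (c(i := (\<lambda>s. b (s - of_int n)))) x *\<^sub>R Hl (map q1 As) x)
       = Pf T (\<lambda>x. PR (c(i := b)) x *\<^sub>R Hl (map q1 As) x)"
proof -
  have sv: "\<And>v. v \<in> set (map q1 As) \<Longrightarrow> cvx v" using cvx_qd by auto
  have sH: "ssf (Hl (map q1 As))" by (rule ssf_Hl) (use sv cvx_smooth in blast)
  define B where "B n = (\<lambda>s. b (s - of_int n))" for n :: int
  define F where "F h = Pf T (\<lambda>x. PR (c(i := h)) x *\<^sub>R Hl (map q1 As) x)" for h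
  have sB: "smooth1 (B n)" for n unfolding B_def using smooth1_affine[OF b(1), of 1 "- of_int n"] by simp
  have zB: "B n s = 0" if "\<bar>of_int n\<bar> + 1 \<le> \<bar>s\<bar>" for n s
    unfolding B_def by (rule b(3)) (use that in linarith)
  have t: "test_function (PR (c(i := h)))" if "smooth1 h" "\<And>s. R' < \<bar>s\<bar> \<Longrightarrow> h s = 0" for h R'
    by (rule test_PR[of _ "max R R'"]) (use that c in auto)
  have tB: "test_function (PR (c(i := B n)))" for n
    by (rule t[OF sB, of "\<bar>of_int n\<bar> + 1"]) (simp add: zB)
  have Fpos: "0 \<le> F (B n)" for n
    unfolding F_def by (rule pos_Hl0[OF pos _ sv tB]) (use As A b c in \<open>auto simp: PR_def B_def intro!: prod_nonneg\<close>)
  have Fconc: "F (B (n - 1)) + F (B (n + 1)) \<le> 2 * F (B n)" for n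
  proof -
    define G where "G = (\<lambda>s. g (s - of_int n))"
    have sG: "smooth1 G" unfolding G_def using smooth1_affine[OF g(1), of 1 "- of_int n"] by simp
    have dG: "deriv (deriv G) s = B (n - 1) s - 2 * B n s + B (n + 1) s" for s
    proof -
      have D: "((\<lambda>s. h (s - of_int n)) has_real_derivative h' (s - of_int n)) (at s)" if "\<And>s. (h has_real_derivative h' s) (at s)" for h h' s
        using that[of "s - of_int n"] DERIV_shift[of h "h' (s - of_int n)" s "- of_int n"] by simp
      have "deriv G = (\<lambda>s. deriv g (s - of_int n))" unfolding G_def
        by (rule ext, rule DERIV_imp_deriv, rule D, rule smooth1_DERIV[OF g(1)])
      then have "deriv (deriv G) s = deriv (deriv g) (s - of_int n)"
        by (simp, intro DERIV_imp_deriv D smooth1_DERIV smooth1_deriv g)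
      then show ?thesis unfolding gb by (simp add: B_def algebra_simps)
    qed
    have zG: "G s = 0" if "\<bar>of_int n\<bar> + 2 \<le> \<bar>s\<bar>" for s
      unfolding G_def by (rule g(3)) (use that in linarith)
    have "Pf T (\<lambda>x. PR ((c(i := G))(i := deriv (deriv ((c(i := G)) i)))) x *\<^sub>R Hl (map q1 As) x) \<le> 0"
    proof (rule concave_coordinate[OF A])
      show "smooth1 ((c(i := G)) j)" for j using c sG by simp
      show "0 \<le> (c(i := G)) j s" for j s using c g by (simp add: G_def)
      show "(c(i := G)) j s = 0" if "max R (\<bar>of_int n\<bar> + 2) < \<bar>s\<bar>" for j s using c zG that by simp
      show "(c(i := G)) j s = 1" if "j \<notin> A" "\<bar>s\<bar> < 2" for j s using c1 that A(2) by auto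
    qed
    moreover have "PR ((c(i := G))(i := deriv (deriv ((c(i := G)) i)))) x = PR (c(i := B (n - 1))) x - 2 * PR (c(i := B n)) x + PR (c(i := B (n + 1))) x" for x
      by (simp add: PR_upd dG algebra_simps)
    ultimately have "Pf T (\<lambda>x. (PR (c(i := B (n - 1))) x - 2 * PR (c(i := B n)) x + PR (c(i := B (n + 1))) x) *\<^sub>R Hl (map q1 As) x) \<le> 0" by simp
    also have "(\<lambda>x. (PR (c(i := B (n - 1))) x - 2 * PR (c(i := B n)) x + PR (c(i := B (n + 1))) x) *\<^sub>R Hl (map q1 As) x) =
      (\<lambda>x. (PR (c(i := B (n - 1))) x *\<^sub>R Hl (map q1 As) x - 2 *\<^sub>R (PR (c(i := B n)) x *\<^sub>R Hl (map q1 As) x)) + PR (c(i := B (n + 1))) x *\<^sub>R Hl (map q1 As) x)"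
      by (simp add: scaleR_add_left scaleR_diff_left)
    also have "Pf T \<dots> = F (B (n - 1)) - 2 * F (B n) + F (B (n + 1))"
      unfolding F_def
      by (subst Pf_add[OF L], (intro tsf_diff tsf_cscale tsf_scale tB sH)+,
          subst Pf_diff[OF L], (intro tsf_diff tsf_cscale tsf_scale tB sH)+,
          subst Pf_cscale[OF L], (intro tsf_diff tsf_cscale tsf_scale tB sH)+) simp
    finally show ?thesis by simp
  qed
  have "F (B n) = F (B 0)" by (rule concave_int_const[of "\<lambda>n. F (B n)", OF Fpos Fconc])
  moreover have "B 0 = b" by (simp add: B_def)
  ultimately show ?thesis by (simp add: F_def B_def)
qed

text \<open>A ball of radius N lies under a multiple of a sum of (2N + 1)^p integer translates of
  one product bump, all of which have the mass of the original.\<close>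

lemma flat_bound_A:
  assumes A: "card A = p"
  obtains C where "0 \<le> C" "\<And>N \<phi>. test_function \<phi> \<Longrightarrow> (\<And>x. 0 \<le> \<phi> x) \<Longrightarrow> (\<And>x. \<phi> x \<le> 1) \<Longrightarrow> (\<And>x. real N < norm x \<Longrightarrow> \<phi> x = 0) \<Longrightarrow>
    Pf T (\<lambda>x. \<phi> x *\<^sub>R Hl (map q1 As) x) \<le> C * real (2 * N + 1) ^ p"
proof -
  obtain b g where b: "smooth1 b" "\<And>s. 0 \<le> b s" "\<And>s. 1 \<le> \<bar>s\<bar> \<Longrightarrow> b s = 0" "\<And>x. \<bar>x\<bar> < 1 \<Longrightarrow> 0 < b x"
    and g: "smooth1 g" "\<And>s. 0 \<le> g s" "\<And>s. 2 \<le> \<bar>s\<bar> \<Longrightarrow> g s = 0"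
    and gb: "\<And>s. deriv (deriv g) s = b (s + 1) - 2 * b s + b (s - 1)"
    and bl: "\<And>x. \<bar>x\<bar> \<le> 1/2 \<Longrightarrow> flat (1/2) * flat (1/2) \<le> b x"
    by (rule second_difference_bump) blast
  \<comment> \<open>A lower bound of \<open>b\<close> on [-1/2, 1/2], the set of offsets from a
    nearest integer.\<close>
  define \<kappa> where "\<kappa> = flat (1/2) * flat (1/2)"
  have \<kappa>: "0 < \<kappa>" by (simp add: \<kappa>_def)
  obtain h where h: "smooth1 h" "mono h" "\<And>x. 0 \<le> h x" "\<And>x. h x \<le> 1"
    "\<And>x. x \<le> 0 \<Longrightarrow> h x = 0" "\<And>x. 1 \<le> x \<Longrightarrow> h x = 1" using smooth_step_exists by blast
  define ct where "ct s = h ((-1) * s + 3) * h (1 * s + 3)" for s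
  have ct: "smooth1 ct" "\<And>s. 0 \<le> ct s" "\<And>s. \<bar>s\<bar> < 2 \<Longrightarrow> ct s = 1" "\<And>s. 3 < \<bar>s\<bar> \<Longrightarrow> ct s = 0"
  proof -
    show "smooth1 ct" unfolding ct_def[abs_def] by (intro smooth1_mult smooth1_affine h(1))
  qed (auto simp: ct_def h(3,5,6) abs_if split: if_splits)
  have sv: "\<And>v. v \<in> set (map q1 As) \<Longrightarrow> cvx v" using cvx_qd by auto
  have sH: "ssf (Hl (map q1 As))" by (rule ssf_Hl) (use sv cvx_smooth in blast)
  have lenA: "length (map q1 As) = p" using As A by simp
  define BN where "BN N s = (\<Sum>m\<in>{- int N..int N}. b (s - of_int m))" for N :: nat and s
  have sb: "smooth1 (\<lambda>s. b (s - of_int m))" for m :: int using smooth1_affine[OF b(1), of 1 "- of_int m"] by simp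
  have sBN: "smooth1 (BN N)" for N unfolding BN_def[abs_def] by (intro smooth1_sum sb)
  have pBN: "0 \<le> BN N s" for N s unfolding BN_def by (intro sum_nonneg b)
  have zb: "b (s - of_int m) = 0" if "m \<in> {- int N..int N}" "real N + 1 \<le> \<bar>s\<bar>" for m N s
    by (rule b(3)) (use that in \<open>simp add: abs_if split: if_splits\<close>)
  have zBN: "BN N s = 0" if "real N + 1 \<le> \<bar>s\<bar>" for N s
    unfolding BN_def by (rule sum.neutral) (use zb that in blast)
  define C where "C = Pf T (\<lambda>x. PR (\<lambda>j. if j \<in> A then b else ct) x *\<^sub>R Hl (map q1 As) x)"
  \<comment> \<open>Interpolates between one bump (\<open>S\<close> empty) and the full sum of
    translates (\<open>S = A\<close>); each new coordinate in \<open>S\<close> multiplies the mass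
    by 2N + 1.\<close>
  define cS where "cS N S j = (if j \<in> S then BN N else if j \<in> A then b else ct)" for N S j
  have scS: "smooth1 (cS N S j)" for N S j using sBN b(1) ct(1) by (simp add: cS_def)
  have pcS: "0 \<le> cS N S j s" for N S j s using pBN b(2) ct(2) by (simp add: cS_def)
  have zcS: "cS N S j s = 0" if "real N + 3 < \<bar>s\<bar>" for N S j s using zBN[of N s] b(3)[of s] ct(4)[of s] that by (simp add: cS_def)
  have grow: "Pf T (\<lambda>x. PR (cS N S) x *\<^sub>R Hl (map q1 As) x) = real (2 * N + 1) ^ card S * C" if "S \<subseteq> A" for S N
    using finite_subset[OF that finite] that
  proof (induction S rule: finite_induct)
    case empty
    have "cS N {} = (\<lambda>j. if j \<in> A then b else ct)" by (rule ext) (simp add: cS_def)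
    then show ?case by (simp add: C_def)
  next
    case (insert i S)
    have i: "i \<in> A" using insert by simp
    have upd: "cS N (insert i S) = (cS N S)(i := BN N)" "cS N S = (cS N S)(i := b)"
      using insert by (auto simp: cS_def fun_eq_iff)
    have tb: "test_function (PR ((cS N S)(i := (\<lambda>s. b (s - of_int m)))))" if "m \<in> {- int N..int N}" for m
      by (rule test_PR[of _ "real N + 3"]) (use sb scS zcS zb[OF that] in auto)
    have "Pf T (\<lambda>x. PR (cS N (insert i S)) x *\<^sub>R Hl (map q1 As) x) =
       Pf T (\<lambda>x. \<Sum>m\<in>{- int N..int N}. PR ((cS N S)(i := (\<lambda>s. b (s - of_int m)))) x *\<^sub>R Hl (map q1 As) x)"
      unfolding upd(1) by (simp add: PR_upd BN_def sum_distrib_right scaleR_sum_left)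
    also have "\<dots> = (\<Sum>m\<in>{- int N..int N}. Pf T (\<lambda>x. PR ((cS N S)(i := (\<lambda>s. b (s - of_int m)))) x *\<^sub>R Hl (map q1 As) x))"
      by (rule Pf_sum[OF L]) (intro tsf_scale tb sH)
    also have "\<dots> = (\<Sum>m\<in>{- int N..int N}. Pf T (\<lambda>x. PR ((cS N S)(i := b)) x *\<^sub>R Hl (map q1 As) x))"
    proof (rule sum.cong[OF refl])
      fix m
      show "Pf T (\<lambda>x. PR ((cS N S)(i := (\<lambda>s. b (s - of_int m)))) x *\<^sub>R Hl (map q1 As) x) = Pf T (\<lambda>x. PR ((cS N S)(i := b)) x *\<^sub>R Hl (map q1 As) x)"
      proof (rule translation_invariant[OF A i scS pcS zcS _ b(1-3) g gb])
        fix j and s :: real assume "j \<notin> A" "\<bar>s\<bar> < 2"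
        moreover have "j \<notin> S" using \<open>j \<notin> A\<close> insert by auto
        ultimately show "cS N S j s = 1" using ct(3) by (simp add: cS_def)
      qed
    qed
    also have "\<dots> = real (2 * N + 1) * Pf T (\<lambda>x. PR (cS N S) x *\<^sub>R Hl (map q1 As) x)"
      unfolding upd(2)[symmetric] by (simp add: nat_add_distrib)
    also have "\<dots> = real (2 * N + 1) ^ card (insert i S) * C" using insert by simp
    finally show ?case .
  qed
  have C0: "0 \<le> C" unfolding C_def
  proof (rule pos_Hl0[OF pos lenA sv])
    show "test_function (PR (\<lambda>j. if j \<in> A then b else ct))"
      by (rule test_PR[of _ 3]) (use b ct in auto)
    show "0 \<le> PR (\<lambda>j. if j \<in> A then b else ct) x" for x
      using b ct by (auto simp: PR_def intro!: prod_nonneg)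
  qed
  show ?thesis
  proof (rule that[of "inverse \<kappa> ^ p * C"])
    show "0 \<le> inverse \<kappa> ^ p * C" using C0 \<kappa> by simp
    fix N and \<phi> :: "(real, 'n) vec \<Rightarrow> real"
    assume \<phi>: "test_function \<phi>" "\<And>x. 0 \<le> \<phi> x" "\<And>x. \<phi> x \<le> 1" "\<And>x. real N < norm x \<Longrightarrow> \<phi> x = 0"
    \<comment> \<open>Equal to 1 on \<open>U\<close>, so inserting it does not change the pairing,
      and it makes the comparison with the product \<open>PR (cS N A)\<close> possible.\<close>
    define ctp where "ctp x = (\<Prod>j\<in>-A. ct (x $ j))" for x :: "(real, 'n) vec"
    have sctp: "smooth ctp" unfolding ctp_def[abs_def] by (intro smooth_prod smooth_coord_compose ct)
    have t\<phi>: "test_function (\<lambda>x. \<phi> x * ctp x)" by (rule test_mult_smooth2[OF \<phi>(1) sctp])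
    have tP: "test_function (PR (cS N A))" by (rule test_PR[OF scS zcS])
    \<comment> \<open>The translate centred at the nearest integer alone contributes
      \<kappa>.\<close>
    have BNl: "\<kappa> \<le> BN N s" if "\<bar>s\<bar> \<le> real N" for s
    proof -
      define m where "m = round s"
      have m: "\<bar>s - of_int m\<bar> \<le> 1/2" unfolding m_def using of_int_round_abs_le[of s] by (simp add: abs_minus_commute)
      have "round (real N) = int N" "round (- real N) = - int N"
        by (metis of_int_of_nat_eq round_of_int, metis of_int_minus of_int_of_nat_eq round_of_int)
      then have "m \<le> int N" "- int N \<le> m"
        using round_mono[of s "real N"] round_mono[of "- real N" s] that by (simp_all add: m_def abs_le_iff)
      then have "b (s - of_int m) \<le> BN N s" unfolding BN_def
        by (intro member_le_sum) (auto intro: b)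
      then show ?thesis using bl[OF m] by (simp add: \<kappa>_def)
    qed
    have le: "\<phi> x * ctp x \<le> inverse \<kappa> ^ p * PR (cS N A) x" for x
    proof (cases "real N < norm x")
      case True
      then show ?thesis using \<phi>(4) \<kappa> pcS by (simp add: PR_def prod_nonneg)
    next
      case False
      have "\<kappa> ^ p = (\<Prod>j\<in>A. \<kappa>)" using A by simp
      also have "\<dots> \<le> (\<Prod>j\<in>A. BN N (x $ j))"
      proof (intro prod_mono conjI)
        fix j show "\<kappa> \<le> BN N (x $ j)" using component_le_norm_cart[of x j] False by (intro BNl) linarith
      qed (use \<kappa> in simp)
      finally have k: "\<kappa> ^ p \<le> (\<Prod>j\<in>A. BN N (x $ j))" .
      have c0: "0 \<le> ctp x" unfolding ctp_def by (intro prod_nonneg ballI ct)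
      have "PR (cS N A) x = (\<Prod>j\<in>A. cS N A j (x $ j)) * (\<Prod>j\<in>-A. cS N A j (x $ j))"
        unfolding PR_def by (subst prod.union_disjoint[symmetric]) (auto intro: prod.cong)
      also have "\<dots> = (\<Prod>j\<in>A. BN N (x $ j)) * ctp x" by (simp add: cS_def ctp_def)
      finally have "\<kappa> ^ p * ctp x \<le> PR (cS N A) x" using k c0 by (simp add: mult_right_mono)
      then have "ctp x \<le> inverse \<kappa> ^ p * PR (cS N A) x" using \<kappa> by (simp add: field_simps power_inverse)
      moreover have "\<phi> x * ctp x \<le> 1 * ctp x" using \<phi>(3) c0 by (intro mult_right_mono) auto
      ultimately show ?thesis by simp
    qed
    have "Pf T (\<lambda>x. \<phi> x *\<^sub>R Hl (map q1 As) x) = Pf T (\<lambda>x. (\<phi> x * ctp x) *\<^sub>R Hl (map q1 As) x)"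
      by (rule Pf_cong_support[OF L _ _ open_U supp_U])
        (intro tsf_scale \<phi>(1) t\<phi> sH, intro tsf_scale \<phi>(1) t\<phi> sH, simp add: ctp_def U_def ct(3))
    also have "\<dots> \<le> Pf T (\<lambda>x. (inverse \<kappa> ^ p * PR (cS N A) x) *\<^sub>R Hl (map q1 As) x)"
      by (rule Pf_mono_Hl[OF pos lenA sv t\<phi> test_cmult[OF tP] le])
    also have "\<dots> = inverse \<kappa> ^ p * Pf T (\<lambda>x. PR (cS N A) x *\<^sub>R Hl (map q1 As) x)"
      unfolding scaleR_scaleR[symmetric] by (rule Pf_cscale[OF L]) (intro tsf_scale tP sH)
    also have "\<dots> = inverse \<kappa> ^ p * C * real (2 * N + 1) ^ p" using grow[of A N] A by simp
    finally show "Pf T (\<lambda>x. \<phi> x *\<^sub>R Hl (map q1 As) x) \<le> inverse \<kappa> ^ p * C * real (2 * N + 1) ^ p" .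
  qed
qed

text \<open>The two cases of \<open>diagonal_power\<close>: fewer than p coordinates along the tube
  give 0, exactly p give the product form of \<open>flat_bound_A\<close> times p!.\<close>

lemma replicate_qdA_bound:
  obtains C where "0 \<le> C" "\<And>N \<phi>. test_function \<phi> \<Longrightarrow> (\<And>x. 0 \<le> \<phi> x) \<Longrightarrow> (\<And>x. \<phi> x \<le> 1) \<Longrightarrow> (\<And>x. real N < norm x \<Longrightarrow> \<phi> x = 0) \<Longrightarrow>
    Pf T (\<lambda>x. \<phi> x *\<^sub>R Hl (replicate p (qd A)) x) \<le> C * real (2 * N + 1) ^ p"
proof -
  have H: "Hl (replicate p (qd A)) x = (\<Sum>i\<leftarrow>As. XY i i) ^ p" for x by (simp add: Hl_def frm_qdA)
  show ?thesis
  proof (cases "card A = p")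
    case False
    then have "Hl (replicate p (qd A)) x = 0" for x
      unfolding H using card_A As by (intro diagonal_power) auto
    then show ?thesis using that[of 0] Pf_zero[OF L] by simp
  next
    case True
    then have Hp: "Hl (replicate p (qd A)) x = fact p *\<^sub>R Hl (map q1 As) x" for x
      unfolding H Hl_q1 using diagonal_power(2)[of As] As by simp
    obtain C where C: "0 \<le> C" "\<And>N \<phi>. test_function \<phi> \<Longrightarrow> (\<And>x. 0 \<le> \<phi> x) \<Longrightarrow> (\<And>x. \<phi> x \<le> 1) \<Longrightarrow> (\<And>x. real N < norm x \<Longrightarrow> \<phi> x = 0) \<Longrightarrow>
      Pf T (\<lambda>x. \<phi> x *\<^sub>R Hl (map q1 As) x) \<le> C * real (2 * N + 1) ^ p" using flat_bound_A[OF True] by blast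
    have sH: "ssf (Hl (map q1 As))" by (rule ssf_Hl) (use cvx_smooth[OF cvx_qd] in auto)
    show ?thesis
    proof (rule that[of "fact p * C"])
      fix N and \<phi> :: "(real, 'n) vec \<Rightarrow> real"
      assume \<phi>: "test_function \<phi>" "\<And>x. 0 \<le> \<phi> x" "\<And>x. \<phi> x \<le> 1" "\<And>x. real N < norm x \<Longrightarrow> \<phi> x = 0"
      have "Pf T (\<lambda>x. \<phi> x *\<^sub>R Hl (replicate p (qd A)) x) = Pf T (\<lambda>x. fact p *\<^sub>R (\<phi> x *\<^sub>R Hl (map q1 As) x))"
        by (simp add: Hp mult.commute)
      also have "\<dots> = fact p * Pf T (\<lambda>x. \<phi> x *\<^sub>R Hl (map q1 As) x)" by (rule Pf_cscale[OF L tsf_scale[OF \<phi>(1) sH]])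
      also have "\<dots> \<le> fact p * (C * real (2 * N + 1) ^ p)" by (intro mult_left_mono C(2) \<phi>) auto
      finally show "Pf T (\<lambda>x. \<phi> x *\<^sub>R Hl (replicate p (qd A)) x) \<le> fact p * C * real (2 * N + 1) ^ p" by simp
    qed (use C in simp)
  qed
qed

text \<open>On the tube \<open>W\<close> is positive only on a ball of radius proportional to \<open>r\<close>, and the concavity
  estimate for \<open>W\<close> trades a factor \<open>dd\<^sup>#(|y|\<^sup>2)\<close> transversal to the tube for \<open>r\<^sup>-\<^sup>2\<close> times one along it.\<close>

lemma mass_growth:
  obtains C where "0 < C" "\<And>r \<phi>. 1 \<le> r \<Longrightarrow> test_function \<phi> \<Longrightarrow> (\<And>x. 0 \<le> \<phi> x) \<Longrightarrow> (\<And>x. \<phi> x \<le> 1) \<Longrightarrow> (\<And>x. r < norm x \<Longrightarrow> \<phi> x = 0) \<Longrightarrow>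
    Pf T (\<lambda>x. \<phi> x *\<^sub>R Hl (replicate p bq) x) \<le> C * r ^ p"
proof -
  obtain C where C: "0 \<le> C" "\<And>N \<phi>. test_function \<phi> \<Longrightarrow> (\<And>x. 0 \<le> \<phi> x) \<Longrightarrow> (\<And>x. \<phi> x \<le> 1) \<Longrightarrow> (\<And>x. real N < norm x \<Longrightarrow> \<phi> x = 0) \<Longrightarrow>
    Pf T (\<lambda>x. \<phi> x *\<^sub>R Hl (replicate p (qd A)) x) \<le> C * real (2 * N + 1) ^ p" using replicate_qdA_bound by blast
  define n where "n = real (CARD('n))"
  \<comment> \<open>On \<open>U\<close> the complementary coordinates satisfy |y|^2 \<le> 4n, so W >
    0 forces |x|^2 < r^2 (4 + 4n) + 4n \<le> r^2 s, which is at most (r s)^2.\<close>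
  define s where "s = 4 + 8 * n"
  have n: "1 \<le> n" by (simp add: n_def Suc_le_eq)
  \<comment> \<open>exp 1 is the inverse of \<open>flat 1\<close>, the power of 2 counts the
    exchanges of factors, and (2 s + 5) r bounds 2N + 1 for the enclosing integer radius N.\<close>
  define D where "D = exp 1 * 2 ^ p * C * (2 * s + 5) ^ p"
  have main: "Pf T (\<lambda>x. \<phi> x *\<^sub>R Hl (replicate p bq) x) \<le> D * r ^ p"
    if r: "1 \<le> r" and \<phi>: "test_function \<phi>" "\<And>x. 0 \<le> \<phi> x" "\<And>x. \<phi> x \<le> 1" "\<And>x. r < norm x \<Longrightarrow> \<phi> x = 0" for r \<phi>
  proof -
    define \<rho> where "\<rho> = r * s"
    have \<rho>: "r \<le> \<rho>" "0 \<le> \<rho>" using r n by (auto simp: \<rho>_def s_def)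
    obtain \<Psi> where \<Psi>: "test_function \<Psi>" "\<And>x::(real, 'n) vec. 0 \<le> \<Psi> x" "\<And>x. \<Psi> x \<le> 1"
      "\<And>x. x \<in> cball 0 \<rho> \<Longrightarrow> \<Psi> x = 1" "\<And>x. x \<notin> ball 0 (\<rho> + 1) \<Longrightarrow> \<Psi> x = 0"
      using cutoff_ball[of \<rho> "\<rho> + 1" 0] \<rho> by (metis less_add_one)
    define \<epsilon> where "\<epsilon> = inverse (r\<^sup>2)"
    have \<epsilon>: "0 < \<epsilon>" "\<epsilon> \<le> 1" using r by (auto simp: \<epsilon>_def inverse_le_1_iff)
    define W where "W x = (4 + 2 * qd (- A) x) - (2 * \<epsilon>) * qd A x" for x :: "(real, 'n) vec"
    have sW: "smooth W" unfolding W_def[abs_def] by (intro smooth_diff smooth_add smooth_const smooth_mult smooth_qd)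
    have hW: "hess W x i j = 2 * hess (qd (- A)) x i j - (2 * \<epsilon>) * hess (qd A) x i j" for x i j
      unfolding W_def[abs_def]
      by (simp add: hess_diff hess_add hess_cmult hess_const smooth_qd smooth_add smooth_mult smooth_const)
    define wt where "wt x = \<Psi> x * flat (W x)" for x
    have twt: "test_function wt" unfolding wt_def[abs_def] by (rule test_mult_smooth2[OF \<Psi>(1) smooth_compose[OF smooth1_flat sW]])
    have wt0: "0 \<le> wt x" for x using \<Psi>(2) by (simp add: wt_def)
    have wt1: "wt x \<le> 1" for x unfolding wt_def using \<Psi>(2,3) by (intro mult_le_one) auto
    have qsum: "qd A x + qd (- A) x = bq x" for x :: "(real, 'n) vec"
      unfolding qd_def by (subst sum.union_disjoint[symmetric]) (auto intro: sum.cong)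
    have q0: "0 \<le> qd S x" for S and x :: "(real, 'n) vec" unfolding qd_def by (intro sum_nonneg) auto
    have mid: "W x \<le> 0" if x: "x \<in> U" "\<rho> \<le> norm x" for x
    proof (rule ccontr)
      assume "\<not> W x \<le> 0"
      have "qd (- A) x \<le> (\<Sum>i\<in>-A. 2)"
        unfolding qd_def
      proof (rule sum_mono)
        fix i assume "i \<in> - A"
        then have "\<bar>x $ i\<bar> < 2" using x(1) by (simp add: U_def)
        then have "\<bar>x $ i\<bar> * \<bar>x $ i\<bar> \<le> 2 * 2" by (intro mult_mono) auto
        then show "1 / 2 * (x $ i * x $ i) \<le> 2" by (simp add: abs_mult[symmetric])
      qed
      also have "\<dots> \<le> 2 * n" using card_mono[of UNIV "- A"] by (simp add: n_def)
      finally have y: "qd (- A) x \<le> 2 * n" .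
      have "\<epsilon> * (2 * qd A x) < 4 + 4 * n" using \<open>\<not> W x \<le> 0\<close> y by (simp add: W_def)
      then have a: "2 * qd A x < r\<^sup>2 * (4 + 4 * n)" using r by (simp add: \<epsilon>_def field_simps)
      have "(norm x)\<^sup>2 = 2 * qd A x + 2 * qd (- A) x" using qsum[of x] by (simp add: norm_qd)
      also have "\<dots> < r\<^sup>2 * (4 + 4 * n) + 4 * n" using a y by simp
      also have "\<dots> \<le> r\<^sup>2 * (4 + 4 * n) + r\<^sup>2 * (4 * n)" using r n mult_right_mono[of 1 "r\<^sup>2" "4 * n"] by simp
      also have "\<dots> = r\<^sup>2 * s" by (simp add: s_def algebra_simps)
      also have "\<dots> \<le> r\<^sup>2 * s\<^sup>2"
        using n by (intro mult_left_mono) (auto simp: s_def power2_eq_square)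
      also have "\<dots> = \<rho>\<^sup>2" by (simp add: \<rho>_def power_mult_distrib)
      finally have "norm x < \<rho>" using \<rho>(2) by (rule power_less_imp_less_base)
      then show False using x(2) by simp
    qed
    \<comment> \<open>All exchanges use the same weight. Each costs a factor 2, because the part
      across the tube is at most \<epsilon> \<le> 1 times the part along it.\<close>
    have step: "Pf T (\<lambda>x. wt x *\<^sub>R Hl (replicate a bq @ replicate b (qd A)) x) \<le> 2 ^ a * Pf T (\<lambda>x. wt x *\<^sub>R Hl (replicate p (qd A)) x)"
      if "a + b = p" for a b
      using that
    proof (induction a arbitrary: b)
      case 0 then show ?case by simp
    next
      case (Suc a)
      let ?vs = "replicate a bq @ replicate b (qd A)"
      have sv: "\<And>v. v \<in> set ?vs \<Longrightarrow> cvx v" using cvx_qd by auto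
      have sH: "ssf (Hl ?vs)" by (rule ssf_Hl) (use sv cvx_smooth in blast)
      have ts: "tsf (\<lambda>x. wt x *\<^sub>R (frm (hess (qd S) x) * Hl ?vs x))" for S
        by (intro tsf_scale twt ssf_mult ssf_frm smooth_hess smooth_qd sH)
      define P where "P S = Pf T (\<lambda>x. wt x *\<^sub>R (frm (hess (qd S) x) * Hl ?vs x))" for S
      have "Pf T (\<lambda>x. wt x *\<^sub>R (frm (hess W x) * Hl ?vs x)) \<le> 0"
        unfolding wt_def
        by (rule concave_cutoff[OF pos conc _ sv sW \<Psi>(1,2) open_U supp_U, where \<rho>=\<rho> and \<rho>'="\<rho> + 1"])
          (use Suc.prems mid \<Psi>(4,5) in auto)
      moreover have "Pf T (\<lambda>x. wt x *\<^sub>R (frm (hess W x) * Hl ?vs x)) = 2 * P (- A) - (2 * \<epsilon>) * P A"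
      proof -
        have "frm (hess W x) = 2 *\<^sub>R frm (hess (qd (- A)) x) - (2 * \<epsilon>) *\<^sub>R frm (hess (qd A) x)" for x
          unfolding frm_scale[symmetric] frm_diff[symmetric] hW[symmetric] by simp
        then have "Pf T (\<lambda>x. wt x *\<^sub>R (frm (hess W x) * Hl ?vs x)) =
          Pf T (\<lambda>x. 2 *\<^sub>R (wt x *\<^sub>R (frm (hess (qd (- A)) x) * Hl ?vs x)) - (2 * \<epsilon>) *\<^sub>R (wt x *\<^sub>R (frm (hess (qd A) x) * Hl ?vs x)))"
          by (simp add: left_diff_distrib scaleR_diff_right mult.commute mult.left_commute)
        then show ?thesis
          unfolding Pf_diff[OF L tsf_cscale[OF ts] tsf_cscale[OF ts]] Pf_cscale[OF L ts] P_def by simp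
      qed
      ultimately have 1: "P (- A) \<le> \<epsilon> * P A" by simp
      have PA: "0 \<le> P A" unfolding P_def
        using pos_Hl0[OF pos, of "qd A # ?vs" wt] Suc.prems cvx_qd twt wt0 by auto
      have 2: "Pf T (\<lambda>x. wt x *\<^sub>R (frm (hess bq x) * Hl ?vs x)) = P A + P (- A)"
      proof -
        have "frm (hess bq x) = frm (hess (qd A) x) + frm (hess (qd (- A)) x)" for x :: "(real, 'n) vec"
          unfolding frm_add[symmetric] by (rule arg_cong[where f=frm]) (auto simp: hess_qd fun_eq_iff)
        then have "Pf T (\<lambda>x. wt x *\<^sub>R (frm (hess bq x) * Hl ?vs x)) =
          Pf T (\<lambda>x. wt x *\<^sub>R (frm (hess (qd A) x) * Hl ?vs x) + wt x *\<^sub>R (frm (hess (qd (- A)) x) * Hl ?vs x))"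
          by (simp add: distrib_right scaleR_add_right)
        then show ?thesis unfolding Pf_add[OF L ts ts] P_def .
      qed
      have 3: "P A = Pf T (\<lambda>x. wt x *\<^sub>R Hl (replicate a bq @ replicate (Suc b) (qd A)) x)"
        unfolding P_def by (simp add: frm_central mult.assoc)
      have "Pf T (\<lambda>x. wt x *\<^sub>R Hl (replicate (Suc a) bq @ replicate b (qd A)) x) = P A + P (- A)"
        using 2 by (simp add: mult.assoc)
      also have "\<dots> \<le> 2 * P A" using 1 \<epsilon> PA mult_right_mono[of \<epsilon> 1 "P A"] by simp
      also have "\<dots> \<le> 2 * (2 ^ a * Pf T (\<lambda>x. wt x *\<^sub>R Hl (replicate p (qd A)) x))"
        unfolding 3 by (intro mult_left_mono Suc.IH) (use Suc.prems in auto)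
      finally show ?case by simp
    qed
    define N where "N = nat \<lceil>\<rho> + 1\<rceil>"
    have N: "\<rho> + 1 \<le> real N" "real N \<le> \<rho> + 2" unfolding N_def using \<rho>(2) by linarith+
    have "\<phi> x \<le> exp 1 * wt x" for x
    proof (cases "r < norm x")
      case True then show ?thesis using \<phi>(4) wt0 by simp
    next
      case False
      have "2 * qd A x \<le> (norm x)\<^sup>2" using qsum[of x] q0[of "- A" x] by (simp add: norm_qd)
      also have "\<dots> \<le> r\<^sup>2" using False by (intro power_mono) auto
      finally have "\<epsilon> * (2 * qd A x) \<le> \<epsilon> * r\<^sup>2" using \<epsilon> by (intro mult_left_mono) auto
      then have "\<epsilon> * (2 * qd A x) \<le> 1" using r by (simp add: \<epsilon>_def)
      then have "1 \<le> W x" using q0[of "- A" x] by (simp add: W_def)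
      then have "flat 1 \<le> flat (W x)" by (rule flat_mono)
      then have "exp 1 * exp (- 1) \<le> exp 1 * flat (W x)" by (intro mult_left_mono) (auto simp: flat_1)
      then have "1 \<le> exp 1 * flat (W x)" by (simp add: exp_minus_inverse)
      moreover have "\<Psi> x = 1" using \<Psi>(4) False \<rho> by simp
      ultimately show ?thesis using \<phi>(3)[of x] by (simp add: wt_def)
    qed
    then have "Pf T (\<lambda>x. \<phi> x *\<^sub>R Hl (replicate p bq) x) \<le> Pf T (\<lambda>x. (exp 1 * wt x) *\<^sub>R Hl (replicate p bq) x)"
      by (intro Pf_mono_Hl[OF pos _ _ \<phi>(1) test_cmult[OF twt]]) (use cvx_qd in auto)
    also have "\<dots> = exp 1 * Pf T (\<lambda>x. wt x *\<^sub>R Hl (replicate p bq) x)"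
      unfolding scaleR_scaleR[symmetric]
      by (rule Pf_cscale[OF L tsf_scale[OF twt ssf_Hl]]) (use smooth_qd in auto)
    also have "\<dots> \<le> exp 1 * (2 ^ p * Pf T (\<lambda>x. wt x *\<^sub>R Hl (replicate p (qd A)) x))"
      using step[of p 0] by (intro mult_left_mono) auto
    also have "\<dots> \<le> exp 1 * (2 ^ p * (C * real (2 * N + 1) ^ p))"
    proof (intro mult_left_mono C(2) twt wt0 wt1)
      fix x :: "(real, 'n) vec" assume "real N < norm x"
      then have "x \<notin> ball 0 (\<rho> + 1)" using N(1) by simp
      then show "wt x = 0" using \<Psi>(5) by (simp add: wt_def)
    qed auto
    also have "\<dots> \<le> exp 1 * (2 ^ p * (C * ((2 * s + 5) * r) ^ p))"
    proof -
      have "real (2 * N + 1) \<le> 2 * \<rho> + 5" using N(2) by simp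
      also have "\<dots> \<le> (2 * s + 5) * r" using r by (simp add: \<rho>_def algebra_simps)
      finally have "real (2 * N + 1) ^ p \<le> ((2 * s + 5) * r) ^ p" by (rule power_mono) simp
      then show ?thesis using C(1) by (intro mult_left_mono) auto
    qed
    also have "\<dots> = D * r ^ p" by (simp add: D_def power_mult_distrib)
    finally show ?thesis .
  qed
  have "0 \<le> D" unfolding D_def using C(1) n by (simp add: s_def)
  show ?thesis
  proof (rule that[of "D + 1"])
    fix r and \<phi> :: "(real, 'n) vec \<Rightarrow> real" assume h: "1 \<le> (r::real)" "test_function \<phi>" "\<And>x. 0 \<le> \<phi> x" "\<And>x. \<phi> x \<le> 1" "\<And>x. r < norm x \<Longrightarrow> \<phi> x = 0"
    have "D * r ^ p \<le> (D + 1) * r ^ p" using h(1) by (intro mult_right_mono) auto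
    with main[OF h] show "Pf T (\<lambda>x. \<phi> x *\<^sub>R Hl (replicate p bq) x) \<le> (D + 1) * r ^ p" by simp
  qed (use \<open>0 \<le> D\<close> in simp)
qed

end

section \<open>Convex functions close to the norm\<close>

lemma smooth_along_vector:
  fixes v :: "real^'n::finite \<Rightarrow> real"
  assumes "smooth v"
  shows "((\<lambda>t. v (x + t *\<^sub>R (\<chi> i. z i))) has_real_derivative (\<Sum>i\<in>UNIV. z i * partial i v (x + t *\<^sub>R (\<chi> i. z i)))) (at t)"
proof -
  let ?z = "\<chi> i. z i"
  let ?y = "x + t *\<^sub>R ?z"
  let ?D = "frechet_derivative v (at ?y)"
  have D: "(v has_derivative ?D) (at ?y)" by (rule has_derivative_frechet[OF smooth_differentiable[OF assms]])
  then have lin: "linear ?D" by (rule has_derivative_linear)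
  have F: "((\<lambda>t. x + t *\<^sub>R ?z) has_derivative (\<lambda>h. h *\<^sub>R ?z)) (at t)" by (auto intro!: derivative_eq_intros)
  have "((\<lambda>t. v (x + t *\<^sub>R ?z)) has_derivative (\<lambda>h. ?D (h *\<^sub>R ?z))) (at t)"
    by (rule has_derivative_compose[OF F D])
  moreover have "?D ?z = (\<Sum>i\<in>UNIV. z i * partial i v ?y)"
  proof -
    have "?z = (\<Sum>i\<in>UNIV. z i *\<^sub>R axis i 1)"
      by (simp add: vec_eq_iff axis_def if_distrib sum.delta' cong: if_cong)
    then have "?D ?z = ?D (\<Sum>i\<in>UNIV. z i *\<^sub>R axis i 1)" by (rule arg_cong)
    also have "\<dots> = (\<Sum>i\<in>UNIV. ?D (z i *\<^sub>R axis i 1))" by (rule linear_sum[OF lin])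
    finally show ?thesis by (simp add: linear_cmul[OF lin] partial_def)
  qed
  ultimately show ?thesis
    by (simp add: has_field_derivative_def linear_cmul[OF lin] mult.commute[of _ "sum _ _"])
qed

text \<open>Restricted to a line, a convex function has increasing derivative; its second derivative
  is the value of the Hessian form in that direction.\<close>

lemma cvx_if_convex:
  fixes v :: "real^'n::finite \<Rightarrow> real"
  assumes "smooth v" "convex_on UNIV v" shows "cvx v"
  unfolding cvx_def psd_def
proof (intro conjI allI assms(1))
  show "hess v x i j = hess v x j i" for x i j by (rule hess_sym[OF assms(1)])
  fix x and z :: "'n \<Rightarrow> real"
  let ?z = "\<chi> i. z i"
  define h where "h t = v (x + t *\<^sub>R ?z)" for t
  define h1 where "h1 t = (\<Sum>i\<in>UNIV. z i * partial i v (x + t *\<^sub>R ?z))" for t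
  have d1: "(h has_real_derivative h1 t) (at t)" for t
    unfolding h_def[abs_def] h1_def by (rule smooth_along_vector[OF assms(1)])
  have d2: "(h1 has_real_derivative (\<Sum>i\<in>UNIV. z i * (\<Sum>j\<in>UNIV. z j * partial j (partial i v) (x + t *\<^sub>R ?z)))) (at t)" for t
    unfolding h1_def[abs_def]
    by (intro DERIV_sum DERIV_cmult smooth_along_vector smooth_partial assms(1))
  have "convex_on UNIV h"
  proof (rule convex_onI)
    fix t a b :: real assume t: "0 < t" "t < 1"
    have "v ((1 - t) *\<^sub>R (x + a *\<^sub>R ?z) + t *\<^sub>R (x + b *\<^sub>R ?z)) \<le> (1 - t) * v (x + a *\<^sub>R ?z) + t * v (x + b *\<^sub>R ?z)"
      by (rule convex_onD[OF assms(2)]) (use t in auto)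
    moreover have "(1 - t) *\<^sub>R (x + a *\<^sub>R ?z) + t *\<^sub>R (x + b *\<^sub>R ?z) = x + ((1 - t) *\<^sub>R a + t *\<^sub>R b) *\<^sub>R ?z"
      by (simp add: algebra_simps)
    ultimately show "h ((1 - t) *\<^sub>R a + t *\<^sub>R b) \<le> (1 - t) * h a + t * h b" by (simp add: h_def)
  qed auto
  then have tan: "h1 c * (y - c) \<le> h y - h c" for c y
    by (rule convex_on_imp_above_tangent) (use d1 in auto)
  \<comment> \<open>The tangent inequalities at the two points, added.\<close>
  have "mono h1"
  proof (rule monoI)
    fix s t :: real assume "s \<le> t"
    show "h1 s \<le> h1 t"
    proof (cases "s = t")
      case False
      have "h1 s * (t - s) \<le> h1 t * (t - s)" using tan[of s t] tan[of t s] by (simp add: algebra_simps)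
      then show ?thesis using False \<open>s \<le> t\<close> by simp
    qed simp
  qed
  from deriv_nonneg_mono[OF this d2[of 0]]
  have "0 \<le> (\<Sum>i\<in>UNIV. \<Sum>j\<in>UNIV. hess v x j i * z i * z j)"
    by (simp add: hess_def sum_distrib_left algebra_simps)
  then show "0 \<le> (\<Sum>i\<in>UNIV. \<Sum>j\<in>UNIV. hess v x i j * z i * z j)"
    by (simp add: hess_sym[OF assms(1)])
qed

text \<open>From |z_i z_j| \<le> (z_i^2 + z_j^2) / 2, summed over both indices.\<close>

lemma psd_dominate:
  fixes B :: "'n::finite \<Rightarrow> 'n \<Rightarrow> real"
  assumes "\<And>i j. B i j = B j i" "\<And>i j. \<bar>B i j\<bar> \<le> b"
  shows "psd (\<lambda>i j. real CARD('n) * b * (if i = j then 1 else 0) - B i j)"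
  unfolding psd_def
proof (intro conjI allI)
  fix z :: "'n \<Rightarrow> real"
  have b0: "0 \<le> b" using assms(2) abs_ge_zero order_trans by blast
  have e: "B i j * z i * z j \<le> b * (z i * z i / 2 + z j * z j / 2)" for i j
  proof -
    have "B i j * z i * z j \<le> \<bar>B i j\<bar> * \<bar>z i * z j\<bar>" by (metis abs_ge_self abs_mult mult.assoc)
    also have "\<dots> \<le> b * \<bar>z i * z j\<bar>" by (intro mult_right_mono assms) auto
    also have "\<bar>z i * z j\<bar> \<le> z i * z i / 2 + z j * z j / 2"
    proof -
      have "0 \<le> (\<bar>z i\<bar> - \<bar>z j\<bar>) * (\<bar>z i\<bar> - \<bar>z j\<bar>)" by simp
      then show ?thesis by (simp add: algebra_simps abs_mult)
    qed
    then have "b * \<bar>z i * z j\<bar> \<le> b * (z i * z i / 2 + z j * z j / 2)" using b0 by (rule mult_left_mono)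
    finally show ?thesis .
  qed
  have "(\<Sum>i\<in>UNIV. \<Sum>j\<in>UNIV. B i j * z i * z j) \<le> (\<Sum>i\<in>UNIV. \<Sum>j\<in>UNIV. b * (z i * z i / 2 + z j * z j / 2))"
    by (intro sum_mono e)
  also have "\<dots> = real CARD('n) * b * (\<Sum>i\<in>UNIV. z i * z i)"
  proof -
    have 1: "(\<Sum>i\<in>UNIV. b * (z i * z i / 2)) = b * (\<Sum>i\<in>UNIV. z i * z i) / 2"
      by (simp add: sum_distrib_left sum_divide_distrib)
    have "(\<Sum>i\<in>UNIV. \<Sum>j\<in>UNIV. b * (z i * z i / 2 + z j * z j / 2)) =
      real CARD('n) * (\<Sum>i\<in>UNIV. b * (z i * z i / 2)) + real CARD('n) * (\<Sum>i\<in>UNIV. b * (z i * z i / 2))"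
      by (simp only: distrib_left sum.distrib sum_constant sum_distrib_left[symmetric])
    then show ?thesis unfolding 1 by simp
  qed
  also have "\<dots> = (\<Sum>i\<in>UNIV. \<Sum>j\<in>UNIV. real CARD('n) * b * (if i = j then 1 else 0) * z i * z j)"
    by (simp add: sum_distrib_left mult_delta_left mult_delta_right mult.assoc)
  finally show "0 \<le> (\<Sum>i\<in>UNIV. \<Sum>j\<in>UNIV. (real CARD('n) * b * (if i = j then 1 else 0) - B i j) * z i * z j)"
    by (simp add: left_diff_distrib sum_subtractf)
qed (use assms in auto)

text \<open>Convex everywhere, but close to the norm only on a ball, and from above: this is what a
  sequence decreasing to the norm eventually satisfies (\<open>eventually_near\<close>), so later
  estimates need no sequences.\<close>

definition near :: "(real^'n::finite \<Rightarrow> real) \<Rightarrow> real \<Rightarrow> real \<Rightarrow> bool" where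
  "near v R e \<longleftrightarrow> cvx v \<and> (\<forall>x. norm x \<le> R \<longrightarrow> norm x \<le> v x \<and> v x \<le> norm x + e)"

lemma near_mono: "near v R e \<Longrightarrow> R' \<le> R \<Longrightarrow> e \<le> e' \<Longrightarrow> near v R' e'"
  unfolding near_def
proof (elim conjE, intro conjI allI impI)
  fix x :: "(real, 'a) vec" assume h: "\<forall>x. norm x \<le> R \<longrightarrow> norm x \<le> v x \<and> v x \<le> norm x + e" "R' \<le> R" "e \<le> e'" "norm x \<le> R'"
  then have "norm x \<le> R" by linarith
  with h(1) have "norm x \<le> v x \<and> v x \<le> norm x + e" by blast
  with h(3) show "norm x \<le> v x" "v x \<le> norm x + e'" by linarith+
qed

lemma near_cvx: "near v R e \<Longrightarrow> cvx v" by (simp add: near_def)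
lemma near_smooth: "near v R e \<Longrightarrow> smooth v" by (simp add: near_def cvx_def)

text \<open>Geometry enters through \<open>growth\<close> alone, the conclusion of
  \<open>mass_growth\<close>.\<close>

locale degree_current =
  fixes T :: "'n::{finite,linorder} supercurrent" and p :: nat and C :: real
  assumes pos: "weakly_positive p T" and conc: "concave_current p T"
    and closed: "zero_current (ddsharp_current T)"
    and C: "0 < C"
    and growth: "\<And>r \<phi>. 1 \<le> r \<Longrightarrow> test_function \<phi> \<Longrightarrow> (\<And>x. 0 \<le> \<phi> x) \<Longrightarrow> (\<And>x. \<phi> x \<le> 1) \<Longrightarrow> (\<And>x. r < norm x \<Longrightarrow> \<phi> x = 0) \<Longrightarrow>
      Pf T (\<lambda>x. \<phi> x *\<^sub>R Hl (replicate p bq) x) \<le> C * r ^ p"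
begin

lemmas L = weakly_positive_lin[OF pos]

text \<open>For dd#T = 0 the function may take either sign, so differences of two approximations of
  the norm can be inserted.\<close>

lemma closed_Hl:
  assumes "test_function f" "\<And>v. v \<in> set vs \<Longrightarrow> smooth v"
  shows "Pf T (\<lambda>x. frm (hess f x) * Hl vs x) = 0"
proof -
  have "tsf (\<lambda>x. f x *\<^sub>R Hl vs x)" by (rule tsf_scale[OF assms(1) ssf_Hl[OF assms(2)]])
  then have "cur (ddsharp_current T) (\<lambda>x. coef (f x *\<^sub>R Hl vs x) K L) = 0" for K L
    using closed by (intro sf_eqI) (simp add: cur_def zero_current_def tsf_def)
  then have "Pf (ddsharp_current T) (\<lambda>x. f x *\<^sub>R Hl vs x) = 0" unfolding Pf_def by simp
  then show ?thesis using Pf_ddsharp_Hl[OF L assms] by simp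
qed

text \<open>Chern--Levine--Nirenberg: a factor \<open>dd\<^sup>#v\<close> with \<open>v\<close> close to \<open>|x|\<close> costs a factor of order \<open>1/r\<close>.\<close>

lemma CLN_step:
  assumes r: "1 \<le> r" and \<phi>: "test_function \<phi>" "\<And>x. 0 \<le> \<phi> x" "\<And>x. \<phi> x \<le> 1" "\<And>x. r < norm x \<Longrightarrow> \<phi> x = 0"
    and v: "near v (4 * r) 1" and vs: "Suc (length vs) = p" "\<And>v. v \<in> set vs \<Longrightarrow> cvx v"
  shows "\<exists>\<Phi>. test_function \<Phi> \<and> (\<forall>x. 0 \<le> \<Phi> x \<and> \<Phi> x \<le> 1) \<and> (\<forall>x. 4 * r < norm x \<longrightarrow> \<Phi> x = 0) \<and>
    Pf T (\<lambda>x. \<phi> x *\<^sub>R (frm (hess v x) * Hl vs x)) \<le> (2 * exp 1 / r) * Pf T (\<lambda>x. \<Phi> x *\<^sub>R (frm (hess bq x) * Hl vs x))"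
proof -
  obtain \<Psi> where \<Psi>: "test_function \<Psi>" "\<And>x::(real, 'n) vec. 0 \<le> \<Psi> x" "\<And>x. \<Psi> x \<le> 1"
    "\<And>x. x \<in> cball 0 (3 * r) \<Longrightarrow> \<Psi> x = 1" "\<And>x. x \<notin> ball 0 (4 * r) \<Longrightarrow> \<Psi> x = 0"
  proof -
    have "0 \<le> 3 * r" "3 * r < 4 * r" using r by auto
    from cutoff_ball[OF this, of 0] show ?thesis using that by blast
  qed
  \<comment> \<open>With t = |x| / r, on the ball of radius 4r the value lies between t + 2 - t^2
    and t + 3 - t^2: at least 1 for t \<le> 1 and at most 0 for t between 3 and 4.\<close>
  define W where "W x = ((1 / r) * v x + 2) - (2 / r\<^sup>2) * bq x" for x
  have sv: "smooth v" by (rule near_smooth[OF v])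
  have sW: "smooth W" unfolding W_def[abs_def] by (intro smooth_diff smooth_add smooth_const smooth_mult smooth_qd sv)
  have hW: "hess W x i j = (1 / r) * hess v x i j - (2 / r\<^sup>2) * hess bq x i j" for x i j
    unfolding W_def[abs_def]
    by (simp only: hess_diff hess_add hess_cmult hess_const smooth_qd sv smooth_add smooth_mult smooth_const add_0_right)
  define wt where "wt x = \<Psi> x * flat (W x)" for x
  have twt: "test_function wt" unfolding wt_def[abs_def] by (rule test_mult_smooth2[OF \<Psi>(1) smooth_compose[OF smooth1_flat sW]])
  have wt0: "0 \<le> wt x" for x using \<Psi>(2) by (simp add: wt_def)
  have wt\<Psi>: "wt x \<le> \<Psi> x" for x unfolding wt_def using \<Psi>(2) by (simp add: mult_left_le)
  have vb: "norm x \<le> v x" "v x \<le> norm x + 1" if "norm x \<le> 4 * r" for x using v that by (auto simp: near_def)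
  have Wn: "W x = (1 / r) * v x + 2 - (norm x / r)\<^sup>2" for x
    by (simp add: W_def norm_qd power_divide)
  have mid: "W x \<le> 0" if "3 * r \<le> norm x" "norm x \<le> 4 * r" for x
  proof -
    define t where "t = norm x / r"
    have t: "3 \<le> t" using that r by (simp add: t_def field_simps)
    have "(1 / r) * v x \<le> (1 / r) * (norm x + r)" using vb(2)[OF that(2)] r by (intro mult_left_mono) auto
    also have "\<dots> = t + 1" using r by (simp add: t_def field_simps)
    finally have "W x \<le> t + 3 - t\<^sup>2" using Wn[of x] by (simp add: t_def)
    moreover have "3 * t \<le> t\<^sup>2" using t by (simp add: power2_eq_square)
    ultimately show ?thesis using t by linarith
  qed
  have sH: "ssf (Hl vs)" by (rule ssf_Hl) (use vs(2) cvx_smooth in blast)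
  have ts: "tsf (\<lambda>x. wt x *\<^sub>R (frm (hess f x) * Hl vs x))" if "smooth f" for f
    by (intro tsf_scale twt ssf_mult ssf_frm smooth_hess that sH)
  have "Pf T (\<lambda>x. wt x *\<^sub>R (frm (hess W x) * Hl vs x)) \<le> 0"
    unfolding wt_def
    by (rule concave_cutoff[OF pos conc vs sW \<Psi>(1,2) open_UNIV subset_UNIV, where \<rho>="3 * r" and \<rho>'="4 * r"])
      (use mid \<Psi>(4,5) in auto)
  moreover have "Pf T (\<lambda>x. wt x *\<^sub>R (frm (hess W x) * Hl vs x)) =
    (1 / r) * Pf T (\<lambda>x. wt x *\<^sub>R (frm (hess v x) * Hl vs x)) - (2 / r\<^sup>2) * Pf T (\<lambda>x. wt x *\<^sub>R (frm (hess bq x) * Hl vs x))"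
  proof -
    have "frm (hess W x) = (1 / r) *\<^sub>R frm (hess v x) - (2 / r\<^sup>2) *\<^sub>R frm (hess bq x)" for x
      unfolding frm_scale[symmetric] frm_diff[symmetric] hW[symmetric] by simp
    then have "Pf T (\<lambda>x. wt x *\<^sub>R (frm (hess W x) * Hl vs x)) =
      Pf T (\<lambda>x. (1 / r) *\<^sub>R (wt x *\<^sub>R (frm (hess v x) * Hl vs x)) - (2 / r\<^sup>2) *\<^sub>R (wt x *\<^sub>R (frm (hess bq x) * Hl vs x)))"
      by (simp add: left_diff_distrib scaleR_diff_right mult.commute mult.left_commute)
    then show ?thesis
      unfolding Pf_diff[OF L tsf_cscale[OF ts[OF sv]] tsf_cscale[OF ts[OF smooth_qd]]] Pf_cscale[OF L ts[OF sv]] Pf_cscale[OF L ts[OF smooth_qd]] .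
  qed
  ultimately have 1: "Pf T (\<lambda>x. wt x *\<^sub>R (frm (hess v x) * Hl vs x)) \<le> (2 / r) * Pf T (\<lambda>x. wt x *\<^sub>R (frm (hess bq x) * Hl vs x))"
    using r by (simp add: field_simps power2_eq_square)
  have le: "\<phi> x \<le> exp 1 * wt x" for x
  proof (cases "r < norm x")
    case True then show ?thesis using \<phi>(4) wt0 by simp
  next
    case False
    have n4: "norm x \<le> 4 * r" using False r by simp
    define t where "t = norm x / r"
    have t: "0 \<le> t" "t \<le> 1" using False r by (auto simp: t_def field_simps)
    have "(1 / r) * norm x \<le> (1 / r) * v x" using vb(1)[OF n4] r by (intro mult_left_mono) auto
    then have "t + 2 - t\<^sup>2 \<le> W x" using Wn[of x] by (simp add: t_def)
    moreover have "t\<^sup>2 \<le> 1" using t by (simp add: power_le_one)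
    ultimately have "1 \<le> W x" using t(1) by linarith
    then have "flat 1 \<le> flat (W x)" by (rule flat_mono)
    then have "exp 1 * exp (- 1) \<le> exp 1 * flat (W x)" by (intro mult_left_mono) (auto simp: flat_1)
    then have "1 \<le> exp 1 * flat (W x)" by (simp add: exp_minus_inverse)
    moreover have "\<Psi> x = 1" using \<Psi>(4) False r by simp
    ultimately show ?thesis using \<phi>(3)[of x] by (simp add: wt_def)
  qed
  have sl: "\<And>w. w \<in> set (v # vs) \<Longrightarrow> cvx w" "\<And>w. w \<in> set (bq # vs) \<Longrightarrow> cvx w"
    using near_cvx[OF v] vs(2) cvx_qd by auto
  have "Pf T (\<lambda>x. \<phi> x *\<^sub>R Hl (v # vs) x) \<le> Pf T (\<lambda>x. (exp 1 * wt x) *\<^sub>R Hl (v # vs) x)"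
    by (rule Pf_mono_Hl[OF pos _ sl(1) \<phi>(1) test_cmult[OF twt] le]) (use vs(1) in auto)
  also have "\<dots> = exp 1 * Pf T (\<lambda>x. wt x *\<^sub>R (frm (hess v x) * Hl vs x))"
    unfolding scaleR_scaleR[symmetric] Hl_simps by (rule Pf_cscale[OF L ts[OF sv]])
  also have "\<dots> \<le> exp 1 * ((2 / r) * Pf T (\<lambda>x. wt x *\<^sub>R (frm (hess bq x) * Hl vs x)))"
    by (intro mult_left_mono 1) auto
  also have "\<dots> \<le> exp 1 * ((2 / r) * Pf T (\<lambda>x. \<Psi> x *\<^sub>R (frm (hess bq x) * Hl vs x)))"
  proof -
    have "Pf T (\<lambda>x. wt x *\<^sub>R Hl (bq # vs) x) \<le> Pf T (\<lambda>x. \<Psi> x *\<^sub>R Hl (bq # vs) x)"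
      by (rule Pf_mono_Hl[OF pos _ sl(2) twt \<Psi>(1) wt\<Psi>]) (use vs(1) in simp_all)
    then show ?thesis using r unfolding Hl_simps by (intro mult_left_mono) auto
  qed
  finally have "Pf T (\<lambda>x. \<phi> x *\<^sub>R (frm (hess v x) * Hl vs x)) \<le> (2 * exp 1 / r) * Pf T (\<lambda>x. \<Psi> x *\<^sub>R (frm (hess bq x) * Hl vs x))"
    by (simp add: algebra_simps)
  then show ?thesis using \<Psi> by (intro exI[of _ \<Psi>]) auto
qed

text \<open>Iteration of \<open>CLN_step\<close>: each exchange gains 1/r and enlarges the ball by
  the factor 4, and \<open>growth\<close> bounds the pure power of \<beta> left at the end.
  Closeness to the norm is thus required on the largest ball.\<close>

lemma CLN:
  assumes "1 \<le> r" "test_function \<phi>" "\<And>x. 0 \<le> \<phi> x" "\<And>x. \<phi> x \<le> 1" "\<And>x. r < norm x \<Longrightarrow> \<phi> x = 0"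
    and "\<And>v. v \<in> set vs \<Longrightarrow> near v (4 ^ length vs * r) 1" "length vs + q = p"
  shows "Pf T (\<lambda>x. \<phi> x *\<^sub>R Hl (vs @ replicate q bq) x) \<le> (2 * exp 1 / r) ^ length vs * (C * (4 ^ length vs * r) ^ p)"
  using assms
proof (induction vs arbitrary: r \<phi> q)
  case Nil
  then show ?case using growth[of r \<phi>] by simp
next
  case (Cons v vs)
  note r = Cons.prems(1)
  let ?ws = "vs @ replicate q bq"
  have cv: "\<And>w. w \<in> set ?ws \<Longrightarrow> cvx w" using Cons.prems(6) near_cvx cvx_qd by fastforce
  have "1 \<le> (4::real) ^ length vs" by simp
  then have "4 * r \<le> 4 ^ length vs * (4 * r)" using r mult_right_mono[of 1 "4 ^ length vs" "4 * r"] by simp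
  then have v: "near v (4 * r) 1" using Cons.prems(6)[of v] by (intro near_mono[of v "4 ^ length (v # vs) * r" 1 "4 * r" 1]) (auto simp: algebra_simps)
  obtain \<Phi> where \<Phi>: "test_function \<Phi>" "\<And>x. 0 \<le> \<Phi> x" "\<And>x. \<Phi> x \<le> 1" "\<And>x. 4 * r < norm x \<Longrightarrow> \<Phi> x = 0"
    "Pf T (\<lambda>x. \<phi> x *\<^sub>R (frm (hess v x) * Hl ?ws x)) \<le> (2 * exp 1 / r) * Pf T (\<lambda>x. \<Phi> x *\<^sub>R (frm (hess bq x) * Hl ?ws x))"
  proof -
    have "Suc (length ?ws) = p" using Cons.prems(7) by simp
    from CLN_step[OF Cons.prems(1-5) v this cv] show ?thesis using that by blast
  qed
  have "Pf T (\<lambda>x. \<Phi> x *\<^sub>R Hl (vs @ replicate (Suc q) bq) x) \<le> (2 * exp 1 / (4 * r)) ^ length vs * (C * (4 ^ length vs * (4 * r)) ^ p)"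
    by (rule Cons.IH[OF _ \<Phi>(1-4)]) (use Cons.prems in \<open>auto simp: algebra_simps\<close>)
  also have "\<dots> \<le> (2 * exp 1 / r) ^ length vs * (C * (4 ^ length (v # vs) * r) ^ p)"
  proof -
    have "(2 * exp 1 / (4 * r)) ^ length vs \<le> (2 * exp 1 / r) ^ length vs"
      using r by (intro power_mono) (auto simp: field_simps)
    then have "(2 * exp 1 / (4 * r)) ^ length vs * (C * (4 ^ length vs * (4 * r)) ^ p) \<le> (2 * exp 1 / r) ^ length vs * (C * (4 ^ length vs * (4 * r)) ^ p)"
      using r C by (intro mult_right_mono) auto
    then show ?thesis by (simp add: algebra_simps)
  qed
  finally have IH: "Pf T (\<lambda>x. \<Phi> x *\<^sub>R Hl (vs @ replicate (Suc q) bq) x) \<le> (2 * exp 1 / r) ^ length vs * (C * (4 ^ length (v # vs) * r) ^ p)" .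
  have e: "frm (hess bq x) * Hl ?ws x = Hl (vs @ replicate (Suc q) bq) x" for x
    by (simp add: frm_central[of "hess bq x" "Hl vs x"] flip: mult.assoc)
  have "Pf T (\<lambda>x. \<phi> x *\<^sub>R Hl ((v # vs) @ replicate q bq) x) \<le> (2 * exp 1 / r) * Pf T (\<lambda>x. \<Phi> x *\<^sub>R Hl (vs @ replicate (Suc q) bq) x)"
    using \<Phi>(5) unfolding e by (simp add: mult.assoc)
  also have "\<dots> \<le> (2 * exp 1 / r) * ((2 * exp 1 / r) ^ length vs * (C * (4 ^ length (v # vs) * r) ^ p))"
    using r by (intro mult_left_mono IH) auto
  finally show ?case by (simp add: mult.assoc)
qed

text \<open>The bound of \<open>CLN\<close> when all p factors come from functions close to the
  norm: the gain 1/r^p cancels the growth r^p, so it controls the total mass.\<close>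

definition mass_bound :: real where "mass_bound = (2 * exp 1) ^ p * (C * (4 ^ p) ^ p)"

lemma mass_near:
  assumes "1 \<le> r" "test_function \<phi>" "\<And>x. 0 \<le> \<phi> x" "\<And>x. \<phi> x \<le> 1" "\<And>x. r < norm x \<Longrightarrow> \<phi> x = 0"
    and "near v (4 ^ p * r) 1"
  shows "Pf T (\<lambda>x. \<phi> x *\<^sub>R Hl (replicate p v) x) \<le> mass_bound"
proof -
  have "Pf T (\<lambda>x. \<phi> x *\<^sub>R Hl (replicate p v) x) \<le> (2 * exp 1 / r) ^ p * (C * (4 ^ p * r) ^ p)"
    using CLN[OF assms(1-5), of "replicate p v" 0] assms(6) by auto
  also have "\<dots> = mass_bound" using assms(1) by (simp add: mass_bound_def power_mult_distrib power_divide)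
  finally show ?thesis .
qed

text \<open>For fixed \<phi> one constant serves all lists. The remaining powers of \<beta> are
  those by which the error terms of \<open>replace_factor\<close> are dominated.\<close>

lemma CLN_bounded:
  assumes "test_function \<phi>" "\<And>x. 0 \<le> \<phi> x" "\<And>x. \<phi> x \<le> 1"
  shows "\<exists>R M. 1 \<le> R \<and> 0 < M \<and> (\<forall>vs q. (\<forall>v\<in>set vs. near v R 1) \<longrightarrow> length vs + q = p \<longrightarrow>
    Pf T (\<lambda>x. \<phi> x *\<^sub>R Hl (vs @ replicate q bq) x) \<le> M)"
proof -
  obtain r0 where r0: "\<forall>x\<in>fun_support \<phi>. norm x \<le> r0"
    using compact_imp_bounded[OF test_compact[OF assms(1)]] bounded_iff by metis
  define r where "r = max 1 r0"
  have r: "1 \<le> r" by (simp add: r_def)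
  have z: "\<phi> x = 0" if "r < norm x" for x
    using r0 fun_support_nonzero[of \<phi> x] that by (fastforce simp: r_def)
  define M where "M = (2 * exp 1) ^ p * (C * (4 ^ p * r) ^ p)"
  have e1: "1 \<le> 2 * exp (1::real)" using exp_ge_add_one_self[of "1::real"] by simp
  show ?thesis
  proof (rule exI[of _ "4 ^ p * r"], rule exI[of _ M], intro conjI allI impI)
    have "1 * 1 \<le> 4 ^ p * r" using r by (intro mult_mono) auto
    then show "1 \<le> 4 ^ p * r" by simp
    show "0 < M" using C r by (simp add: M_def)
    fix vs :: "((real, 'n) vec \<Rightarrow> real) list" and q assume vs: "\<forall>v\<in>set vs. near v (4 ^ p * r) 1" "length vs + q = p"
    have p4: "(4::real) ^ length vs * r \<le> 4 ^ p * r" using vs(2) r by (intro mult_right_mono power_increasing) auto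
    have "Pf T (\<lambda>x. \<phi> x *\<^sub>R Hl (vs @ replicate q bq) x) \<le> (2 * exp 1 / r) ^ length vs * (C * (4 ^ length vs * r) ^ p)"
      by (rule CLN[OF r assms z _ vs(2)]) (use vs(1) p4 near_mono in blast)+
    also have "\<dots> \<le> (2 * exp 1) ^ p * (C * (4 ^ p * r) ^ p)"
    proof (intro mult_mono)
      have "(2 * exp 1 / r) ^ length vs \<le> (2 * exp 1) ^ length vs" using r by (intro power_mono) (auto simp: field_simps)
      also have "\<dots> \<le> (2 * exp 1) ^ p" using e1 vs(2) by (intro power_increasing) auto
      finally show "(2 * exp 1 / r) ^ length vs \<le> (2 * exp 1) ^ p" .
      show "(4 ^ length vs * r) ^ p \<le> (4 ^ p * r) ^ p" using p4 r by (intro power_mono) auto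
    qed (use C r in auto)
    finally show "Pf T (\<lambda>x. \<phi> x *\<^sub>R Hl (vs @ replicate q bq) x) \<le> M" by (simp add: M_def)
  qed
qed

end

lemma test_bounded_family:
  assumes "finite I" "\<And>i. i \<in> I \<Longrightarrow> test_function (f i)"
  shows "\<exists>B>0. \<forall>i\<in>I. \<forall>x. \<bar>f i x\<bar> \<le> B"
  using assms
proof (induction I rule: finite_induct)
  case empty then show ?case by (intro exI[of _ 1]) simp
next
  case (insert i I)
  then obtain B where B: "B > 0" "\<forall>i\<in>I. \<forall>x. \<bar>f i x\<bar> \<le> B" by auto
  obtain B' where B': "\<And>x. \<bar>f i x\<bar> \<le> B'" "B' > 0" using test_bounded[of "f i"] insert.prems by blast
  have "\<forall>k\<in>insert i I. \<forall>x. \<bar>f k x\<bar> \<le> max B B'"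
    using B B' by (auto simp: le_max_iff_disj)
  then show ?case using B(1) by (intro exI[of _ "max B B'"]) auto
qed

context degree_current
begin

text \<open>Uniqueness of the limit: test \<open>dd\<^sup>#T = 0\<close> against \<open>\<psi>\<^sup>2 (f + \<lambda> f\<^sup>2) \<and> \<gamma>\<close> with \<open>f = v - w\<close>.
  Completing the square absorbs the mixed terms \<open>d\<psi> \<and> d\<^sup>#f\<close> into \<open>2 \<lambda> \<psi>\<^sup>2 df \<and> d\<^sup>#f\<close>, at the price
  of \<open>(2 / \<lambda>) d\<psi> \<and> d\<^sup>#\<psi>\<close>, which is small for large \<open>\<lambda>\<close>.\<close>

lemma replace_factor:
  assumes \<psi>: "test_function \<psi>" and \<eta>: "0 < \<eta>"
  shows "\<exists>\<epsilon>>0. \<exists>R. \<forall>v w vs. near v R \<epsilon> \<longrightarrow> near w R \<epsilon> \<longrightarrow> (\<forall>u\<in>set vs. near u R \<epsilon>) \<longrightarrow> Suc (length vs) = p \<longrightarrow>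
    Pf T (\<lambda>x. (\<psi> x * \<psi> x) *\<^sub>R Hl (v # vs) x) - Pf T (\<lambda>x. (\<psi> x * \<psi> x) *\<^sub>R Hl (w # vs) x) \<le> \<eta>"
proof -
  have s\<psi>: "smooth \<psi>" by (rule test_smooth[OF \<psi>])
  obtain B0 where B0: "\<And>x. \<bar>\<psi> x\<bar> \<le> B0" "B0 > 0" using test_bounded[OF \<psi>] by blast
  obtain r0 where r0: "\<forall>x\<in>fun_support \<psi>. norm x \<le> r0"
    using compact_imp_bounded[OF test_compact[OF \<psi>]] bounded_iff by metis
  obtain et W where et: "test_function et" "\<And>x. 0 \<le> et x" "\<And>x. et x \<le> 1" "fun_support \<psi> \<subseteq> W" "\<And>x. x \<in> W \<Longrightarrow> et x = 1"
    using smooth_urysohn[OF test_compact[OF \<psi>] open_UNIV subset_UNIV] by metis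
  have et1: "et x = 1" if "x \<in> fun_support \<psi>" for x using et(4,5) that by blast
  define P where "P x = \<psi> x * \<psi> x" for x
  have tP: "test_function P" unfolding P_def[abs_def] by (rule test_mult_smooth[OF \<psi> s\<psi>])
  have "\<exists>B>0. \<forall>ij\<in>UNIV. \<forall>x. \<bar>(\<lambda>(i, j) x. partial i \<psi> x * partial j \<psi> x) ij x\<bar> \<le> B"
    by (rule test_bounded_family) (auto intro: test_mult_smooth test_partial \<psi> smooth_partial s\<psi>)
  then obtain B1 where B1: "B1 > 0" "\<And>i j x. \<bar>partial i \<psi> x * partial j \<psi> x\<bar> \<le> B1" by auto
  have "\<exists>B>0. \<forall>ij\<in>UNIV. \<forall>x. \<bar>(\<lambda>(i, j) x. hess P x i j) ij x\<bar> \<le> B"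
    by (rule test_bounded_family) (auto intro: test_hess tP)
  then obtain B2 where B2: "B2 > 0" "\<And>i j x. \<bar>hess P x i j\<bar> \<le> B2" by auto
  obtain R1 M1 where M1: "0 < M1" "\<And>vs q. (\<forall>v\<in>set vs. near v R1 1) \<Longrightarrow> length vs + q = p \<Longrightarrow>
      Pf T (\<lambda>x. et x *\<^sub>R Hl (vs @ replicate q bq) x) \<le> M1"
    using CLN_bounded[OF et(1-3)] by blast
  define \<phi>0 where "\<phi>0 x = (1 / B0\<^sup>2) * P x" for x
  have t\<phi>0: "test_function \<phi>0" unfolding \<phi>0_def[abs_def] by (rule test_cmult[OF tP])
  have P01: "0 \<le> P x" "P x \<le> B0\<^sup>2" for x
    using B0(1)[of x] abs_le_square_iff[of "\<psi> x" B0] B0(2) by (auto simp: P_def power2_eq_square)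
  have \<phi>01: "0 \<le> \<phi>0 x" "\<phi>0 x \<le> 1" for x using P01[of x] B0(2) by (auto simp: \<phi>0_def field_simps)
  obtain R2 M2 where M2: "0 < M2" "\<And>vs q. (\<forall>v\<in>set vs. near v R2 1) \<Longrightarrow> length vs + q = p \<Longrightarrow>
      Pf T (\<lambda>x. \<phi>0 x *\<^sub>R Hl (vs @ replicate q bq) x) \<le> M2"
    using CLN_bounded[OF t\<phi>0 \<phi>01] by blast
  define n where "n = real CARD('n)"
  have n: "n > 0" by (simp add: n_def)
  \<comment> \<open>Makes the price (2 / \<lambda>) d\<psi> \<and> d#\<psi> of completing the square
    at most \<eta> / 3; \<open>l\<close> is the \<lambda> of the text above.\<close>
  define l where "l = 24 * n * B1 * M1 / \<eta> + 1"
  have l: "l > 0" "8 * n * B1 * M1 / l \<le> \<eta> / 3"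
  proof -
    have "0 \<le> 24 * n * B1 * M1 / \<eta>" using n B1(1) M1(1) \<eta> by simp
    then show l0: "l > 0" by (simp add: l_def)
    have "24 * n * B1 * M1 \<le> \<eta> * l" using \<eta> by (simp add: l_def field_simps)
    then show "8 * n * B1 * M1 / l \<le> \<eta> / 3" using l0 by (simp add: field_simps)
  qed
  \<comment> \<open>\<epsilon> = 1 / K0 meets four demands, one for each summand: \<epsilon> \<le>
    1; 2 l \<epsilon> \<le> 1, which keeps \<open>s\<close> below 2; the term with dd#(\<psi>^2)
    costs at most \<eta> / 3; and so does the factor 2 l f hidden in \<open>s\<close>.\<close>
  define K0 where "K0 = 1 + 2 * l + 6 * n * B2 * M1 / \<eta> + 12 * l * B0\<^sup>2 * M2 / \<eta>"
  define \<epsilon> where "\<epsilon> = 1 / K0"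
  have Kp: "0 \<le> 6 * n * B2 * M1 / \<eta>" "0 \<le> 12 * l * B0\<^sup>2 * M2 / \<eta>" using n B2(1) M1(1) M2(1) \<eta> l by simp_all
  then have K0: "1 \<le> K0" "2 * l \<le> K0" "6 * n * B2 * M1 / \<eta> \<le> K0" "12 * l * B0\<^sup>2 * M2 / \<eta> \<le> K0" using l by (simp_all add: K0_def)
  have \<epsilon>: "0 < \<epsilon>" "\<epsilon> \<le> 1" "2 * l * \<epsilon> \<le> 1" using K0(1,2) by (simp_all add: \<epsilon>_def)
  have \<epsilon>1: "2 * n * \<epsilon> * B2 * M1 \<le> \<eta> / 3" using K0(1,3) \<eta> by (simp add: \<epsilon>_def field_simps)
  have \<epsilon>2: "4 * l * \<epsilon> * (B0\<^sup>2 * M2) \<le> \<eta> / 3" using K0(1,4) \<eta> by (simp add: \<epsilon>_def field_simps)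
  define R where "R = max R1 (max R2 r0)"
  have main: "Pf T (\<lambda>x. P x *\<^sub>R Hl (v # vs) x) - Pf T (\<lambda>x. P x *\<^sub>R Hl (w # vs) x) \<le> \<eta>"
    if v: "near v R \<epsilon>" and w: "near w R \<epsilon>" and vs: "\<And>u. u \<in> set vs \<Longrightarrow> near u R \<epsilon>" and len: "Suc (length vs) = p" for v w vs
  proof -
    have near1: "near u R1 1" if "near u R \<epsilon>" for u using near_mono[OF that, of R1 1] \<epsilon> by (simp add: R_def)
    have near2: "near u R2 1" if "near u R \<epsilon>" for u using near_mono[OF that, of R2 1] \<epsilon> by (simp add: R_def)
    have cv: "\<And>u. u \<in> set vs \<Longrightarrow> cvx u" using vs near_cvx by blast
    have sv: "smooth v" "smooth w" using v w near_smooth by auto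
    have sH: "ssf (Hl vs)" by (rule ssf_Hl) (use cv cvx_smooth in blast)
    define f where "f x = v x - w x" for x
    have sf: "smooth f" unfolding f_def[abs_def] by (rule smooth_diff[OF sv])
    have f\<epsilon>: "\<bar>f x\<bar> \<le> \<epsilon>" if "x \<in> fun_support \<psi>" for x
    proof -
      have "norm x \<le> R" using r0 that by (auto simp: R_def le_max_iff_disj)
      then have "norm x \<le> v x \<and> v x \<le> norm x + \<epsilon>" "norm x \<le> w x \<and> w x \<le> norm x + \<epsilon>" using v w unfolding near_def by blast+
      then show ?thesis by (simp add: f_def abs_le_iff)
    qed
    define s where "s x = 1 + 2 * l * f x" for x
    have ss: "smooth s" unfolding s_def[abs_def] by (intro smooth_add smooth_mult smooth_const sf)
    \<comment> \<open>\<open>s\<close> is the derivative of t + l t^2 at \<open>f\<close>, and its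
      second derivative 2 l supplies the multiple of df \<and> d#f needed to complete the
      square.\<close>
    define K where "K x = f x + l * (f x * f x)" for x
    have sK: "smooth K" unfolding K_def[abs_def] by (intro smooth_add smooth_mult smooth_const sf)
    define g where "g x = P x * K x" for x
    have tg: "test_function g" unfolding g_def[abs_def] by (rule test_mult_smooth2[OF tP sK])
    define a where "a x i = \<psi> x * partial i f x + (1 / l) * (s x * partial i \<psi> x)" for x i
    define E1 where "E1 x i j = hess P x i j * K x" for x i j
    define E3 where "E3 x i j = a x i * a x j" for x i j
    define E4 where "E4 x i j = (s x * s x) * (partial i \<psi> x * partial j \<psi> x)" for x i j
    \<comment> \<open>The mixed products of d\<psi> and df in the Leibniz rule are those of 2 l
      times the square of \<open>a\<close>; the surplus square of d\<psi> in it is subtracted as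
      \<open>E4\<close>.\<close>
    have hg: "hess g x i j = ((E1 x i j + (P x * s x) * hess f x i j) + 2 * l * E3 x i j) - (2 / l) * E4 x i j" for x i j
    proof -
      have dt: "((\<lambda>t. t + l * (t * t)) has_real_derivative 1 + 2 * l * t) (at t)" for t
        by (auto intro!: derivative_eq_intros simp: algebra_simps)
      have dt2: "((\<lambda>t. 1 + 2 * l * t) has_real_derivative 2 * l) (at t)" for t
        by (auto intro!: derivative_eq_intros)
      have pK: "partial k K x = s x * partial k f x" for k
        unfolding K_def[abs_def] partial_compose[OF smooth_differentiable[OF sf] dt] s_def ..
      have hK: "hess K x i j = s x * hess f x i j + 2 * l * (partial i f x * partial j f x)"
        unfolding K_def[abs_def] hess_compose[OF sf dt dt2] s_def ..
      have pP: "partial k P x = 2 * \<psi> x * partial k \<psi> x" for k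
        unfolding P_def[abs_def] by (subst partial_mult) (auto intro: smooth_differentiable s\<psi>)
      have "hess g x i j = hess P x i j * K x + partial i P x * partial j K x + partial j P x * partial i K x + P x * hess K x i j"
        unfolding g_def[abs_def] by (rule hess_mult[OF test_smooth[OF tP] sK])
      then show ?thesis unfolding pK hK pP using l(1)
        by (simp add: E1_def E3_def E4_def a_def P_def field_simps)
    qed
    have z\<psi>: "\<psi> x = 0" "partial i \<psi> x = 0" "hess P x i j = 0" if "x \<notin> fun_support \<psi>" for x i j
    proof -
      show "\<psi> x = 0" using that fun_support_nonzero by blast
      show "partial i \<psi> x = 0" using that partial_support fun_support_nonzero by blast
      have "fun_support P \<subseteq> fun_support \<psi>"
        by (rule fun_support_subset) (auto simp: P_def intro: fun_support_nonzero)
      then show "hess P x i j = 0" unfolding hess_def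
        using that partial_support[of i "partial j P"] partial_support[of j P] fun_support_nonzero[of "partial i (partial j P)" x] by blast
    qed
    have ta: "test_function (\<lambda>x. a x i)" for i
      unfolding a_def[abs_def] by (intro test_add test_cmult test_mult_smooth2[OF \<psi>] test_mult_smooth[OF test_partial[OF \<psi>]] smooth_partial sf ss)
    have tE1: "test_function (\<lambda>x. E1 x i j)" for i j
      unfolding E1_def by (intro test_mult_smooth2[OF test_hess[OF tP]] sK)
    have tE2: "test_function (\<lambda>x. (P x * s x) * hess f x i j)" for i j
      by (intro test_mult_smooth2[OF test_mult_smooth2[OF tP ss]] smooth_hess sf)
    have tE3: "test_function (\<lambda>x. E3 x i j)" for i j
      unfolding E3_def by (rule test_mult_smooth[OF ta test_smooth[OF ta]])
    have tE4: "test_function (\<lambda>x. E4 x i j)" for i j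
      unfolding E4_def by (intro test_mult_smooth[OF test_mult_smooth[OF test_partial[OF \<psi>]]] smooth_mult ss smooth_partial s\<psi>)
    have tt: "tsf (\<lambda>x. frm (E x) * Hl vs x)" if "\<And>i j. test_function (\<lambda>x. E x i j)" for E
      by (intro tsf_mult tsf_frm that sH)
    define A1 where "A1 = Pf T (\<lambda>x. frm (E1 x) * Hl vs x)"
    define A2 where "A2 = Pf T (\<lambda>x. frm (\<lambda>i j. (P x * s x) * hess f x i j) * Hl vs x)"
    define A3 where "A3 = Pf T (\<lambda>x. frm (E3 x) * Hl vs x)"
    define A4 where "A4 = Pf T (\<lambda>x. frm (E4 x) * Hl vs x)"
    define Q where "Q = Pf T (\<lambda>x. et x *\<^sub>R (frm (hess bq x) * Hl vs x))"
    have zero: "A1 + A2 + 2 * l * A3 - (2 / l) * A4 = 0"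
    proof -
      have "frm (hess g x) = ((frm (E1 x) + frm (\<lambda>i j. (P x * s x) * hess f x i j)) + (2 * l) *\<^sub>R frm (E3 x)) - (2 / l) *\<^sub>R frm (E4 x)" for x
        unfolding frm_scale[symmetric] frm_add[symmetric] frm_diff[symmetric] hg[symmetric] ..
      then have "Pf T (\<lambda>x. frm (hess g x) * Hl vs x) = Pf T (\<lambda>x. ((frm (E1 x) * Hl vs x + frm (\<lambda>i j. (P x * s x) * hess f x i j) * Hl vs x)
         + (2 * l) *\<^sub>R (frm (E3 x) * Hl vs x)) - (2 / l) *\<^sub>R (frm (E4 x) * Hl vs x))"
        by (simp add: distrib_right left_diff_distrib)
      also have "\<dots> = A1 + A2 + 2 * l * A3 - (2 / l) * A4"
        unfolding A1_def A2_def A3_def A4_def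
        by (subst Pf_diff[OF L], (intro tsf_add tsf_cscale tt tE1 tE2 tE3 tE4)+,
            subst Pf_add[OF L], (intro tsf_add tsf_cscale tt tE1 tE2 tE3 tE4)+,
            subst Pf_add[OF L], (intro tsf_add tsf_cscale tt tE1 tE2 tE3 tE4)+,
            subst Pf_cscale[OF L], (intro tt tE3)+,
            subst Pf_cscale[OF L], (intro tt tE4)+) (rule refl)
      finally show ?thesis using closed_Hl[OF tg, of vs] cv cvx_smooth by auto
    qed
    \<comment> \<open>The matrix field carries the compact support, but positivity asks for a scalar
      test function: \<open>et\<close>, equal to 1 on the support of \<psi>, is inserted.\<close>
    have A3: "0 \<le> A3"
    proof -
      have e: "frm (E3 x) * Hl vs x = et x *\<^sub>R (frm (E3 x) * Hl vs x)" for x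
      proof (cases "x \<in> fun_support \<psi>")
        case False
        then have "E3 x = (\<lambda>i j. 0 * 0)" by (intro ext) (simp add: E3_def a_def z\<psi>[OF False])
        then have "frm (E3 x) = 0" using frm_scale[of 0 "\<lambda>i j. 0"] by simp
        then show ?thesis by simp
      qed (simp add: et1)
      have "0 \<le> Pf T (\<lambda>x. et x *\<^sub>R (frm (E3 x) * Hl vs x))"
      proof (rule pos_Hl1[OF pos len test_smooth[OF tE3] _ cv et(1,2)])
        show "psd (E3 x)" for x unfolding E3_def by (rule psd_rank_one)
      qed
      then show ?thesis unfolding A3_def using e by simp
    qed
    have tQ: "tsf (\<lambda>x. et x *\<^sub>R (frm (hess bq x) * Hl vs x))"
      by (intro tsf_scale et ssf_mult ssf_frm smooth_hess smooth_qd sH)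
    \<comment> \<open>Error terms without a sign are compared with n b \<beta>, by
      \<open>psd_dominate\<close>.\<close>
    have dom: "Pf T (\<lambda>x. frm (E x) * Hl vs x) \<le> n * b * Q"
      if tE: "\<And>i j. test_function (\<lambda>x. E x i j)" and sym: "\<And>x i j. E x i j = E x j i"
        and bd: "\<And>x i j. \<bar>E x i j\<bar> \<le> b" and sup: "\<And>x i j. x \<notin> fun_support \<psi> \<Longrightarrow> E x i j = 0" for E b
    proof -
      define G where "G x i j = n * b * (if i = j then 1 else 0) - E x i j" for x i j
      have sG: "smooth (\<lambda>x. G x i j)" for i j unfolding G_def by (intro smooth_diff smooth_const test_smooth tE)
      have pG: "psd (G x)" for x unfolding G_def n_def by (rule psd_dominate[OF sym bd])
      have e: "frm (E x) * Hl vs x = et x *\<^sub>R (frm (E x) * Hl vs x)" for x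
      proof (cases "x \<in> fun_support \<psi>")
        case False
        then have "E x = (\<lambda>i j. 0 * 0)" by (intro ext) (simp add: sup[OF False])
        then have "frm (E x) = 0" using frm_scale[of 0 "\<lambda>i j. 0"] by simp
        then show ?thesis by simp
      qed (simp add: et1)
      have fG: "frm (G x) = (n * b) *\<^sub>R frm (hess bq x) - frm (E x)" for x
        unfolding frm_scale[symmetric] frm_diff[symmetric] by (rule arg_cong[where f=frm]) (auto simp: G_def hess_qd fun_eq_iff)
      have "0 \<le> Pf T (\<lambda>x. et x *\<^sub>R (frm (G x) * Hl vs x))"
        by (rule pos_Hl1[OF pos len sG pG cv et(1,2)])
      also have "(\<lambda>x. et x *\<^sub>R (frm (G x) * Hl vs x)) = (\<lambda>x. (n * b) *\<^sub>R (et x *\<^sub>R (frm (hess bq x) * Hl vs x)) - frm (E x) * Hl vs x)"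
      proof
        fix x
        have "et x *\<^sub>R (frm (G x) * Hl vs x) = (n * b) *\<^sub>R (et x *\<^sub>R (frm (hess bq x) * Hl vs x)) - et x *\<^sub>R (frm (E x) * Hl vs x)"
          by (simp add: fG left_diff_distrib scaleR_diff_right mult.commute)
        also have "et x *\<^sub>R (frm (E x) * Hl vs x) = frm (E x) * Hl vs x" by (rule e[symmetric])
        finally show "et x *\<^sub>R (frm (G x) * Hl vs x) = (n * b) *\<^sub>R (et x *\<^sub>R (frm (hess bq x) * Hl vs x)) - frm (E x) * Hl vs x" .
      qed
      also have "Pf T \<dots> = n * b * Q - Pf T (\<lambda>x. frm (E x) * Hl vs x)"
        unfolding Q_def Pf_diff[OF L tsf_cscale[OF tQ] tt[OF tE]] Pf_cscale[OF L tQ] ..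
      finally show ?thesis by simp
    qed
    have Q: "0 \<le> Q" "Q \<le> M1"
    proof -
      show "0 \<le> Q" unfolding Q_def by (rule pos_Hl1[OF pos len _ _ cv et(1,2)]) (use cvx_qd smooth_hess[OF smooth_qd] in \<open>auto simp: cvx_def\<close>)
      have "Q = Pf T (\<lambda>x. et x *\<^sub>R Hl (vs @ replicate 1 bq) x)" unfolding Q_def by (simp add: frm_central)
      also have "\<dots> \<le> M1" by (rule M1(2)) (use vs near1 len in auto)
      finally show "Q \<le> M1" .
    qed
    have fl: "2 * l * \<bar>f x\<bar> \<le> 1" if "x \<in> fun_support \<psi>" for x
    proof -
      have "2 * l * \<bar>f x\<bar> \<le> 2 * l * \<epsilon>" using f\<epsilon>[OF that] l(1) by (intro mult_left_mono) auto
      with \<epsilon>(3) show ?thesis by simp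
    qed
    have "A4 \<le> n * (4 * B1) * Q" unfolding A4_def
    proof (rule dom[OF tE4])
      show "E4 x i j = E4 x j i" for x i j by (simp add: E4_def mult.commute)
      show "E4 x i j = 0" if "x \<notin> fun_support \<psi>" for x i j using z\<psi>[OF that] by (simp add: E4_def)
      show "\<bar>E4 x i j\<bar> \<le> 4 * B1" for x i j
      proof (cases "x \<in> fun_support \<psi>")
        case True
        have "\<bar>s x\<bar> \<le> 1 + \<bar>2 * l * f x\<bar>" unfolding s_def by (rule order_trans[OF abs_triangle_ineq]) simp
        also have "\<dots> \<le> 2" using fl[OF True] l(1) by (simp add: abs_mult)
        finally have "\<bar>s x\<bar> * \<bar>s x\<bar> \<le> 2 * 2" by (intro mult_mono) auto
        then have "\<bar>s x * s x\<bar> * \<bar>partial i \<psi> x * partial j \<psi> x\<bar> \<le> 4 * B1" using B1(2) by (intro mult_mono) (auto simp: abs_mult)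
        then show ?thesis by (simp add: E4_def abs_mult)
      qed (use B1(1) in \<open>simp add: E4_def z\<psi>\<close>)
    qed
    then have A4: "(2 / l) * A4 \<le> \<eta> / 3"
    proof -
      have "(2 / l) * A4 \<le> (2 / l) * (n * (4 * B1) * M1)"
        using \<open>A4 \<le> _\<close> Q n B1(1) l(1) by (intro mult_left_mono) (auto intro: order_trans mult_left_mono)
      also have "\<dots> = 8 * n * B1 * M1 / l" by simp
      also have "\<dots> \<le> \<eta> / 3" by (rule l(2))
      finally show ?thesis .
    qed
    have A1: "- A1 \<le> \<eta> / 3"
    proof -
      have "Pf T (\<lambda>x. frm (\<lambda>i j. (-1) * E1 x i j) * Hl vs x) \<le> n * (B2 * (2 * \<epsilon>)) * Q"
      proof (rule dom)
        show "test_function (\<lambda>x. (-1) * E1 x i j)" for i j by (rule test_cmult[OF tE1])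
        show "(-1) * E1 x i j = (-1) * E1 x j i" for x i j using hess_sym[OF test_smooth[OF tP]] by (simp add: E1_def)
        show "(-1) * E1 x i j = 0" if "x \<notin> fun_support \<psi>" for x i j using z\<psi>[OF that] by (simp add: E1_def)
        show "\<bar>(-1) * E1 x i j\<bar> \<le> B2 * (2 * \<epsilon>)" for x i j
        proof (cases "x \<in> fun_support \<psi>")
          case True
          have "\<bar>K x\<bar> \<le> \<bar>f x\<bar> + (l * \<bar>f x\<bar>) * \<bar>f x\<bar>"
            unfolding K_def by (rule order_trans[OF abs_triangle_ineq]) (use l(1) in \<open>simp add: abs_mult\<close>)
          also have "\<dots> \<le> \<bar>f x\<bar> + 1 * \<bar>f x\<bar>" using fl[OF True] l(1) by (intro add_left_mono mult_right_mono) auto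
          also have "\<dots> \<le> 2 * \<epsilon>" using f\<epsilon>[OF True] by simp
          finally have "\<bar>hess P x i j\<bar> * \<bar>K x\<bar> \<le> B2 * (2 * \<epsilon>)" using B2 by (intro mult_mono) auto
          then show ?thesis by (simp add: E1_def abs_mult)
        qed (use B2(1) \<epsilon>(1) in \<open>simp add: E1_def z\<psi>\<close>)
      qed
      also have "Pf T (\<lambda>x. frm (\<lambda>i j. (-1) * E1 x i j) * Hl vs x) = - A1"
        unfolding A1_def frm_scale using Pf_cscale[OF L tt[OF tE1], of "-1"] by simp
      also have "n * (B2 * (2 * \<epsilon>)) * Q \<le> n * (B2 * (2 * \<epsilon>)) * M1" using Q n B2(1) \<epsilon>(1) by (intro mult_left_mono) auto
      also have "\<dots> \<le> \<eta> / 3" using \<epsilon>1 by (simp add: algebra_simps)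
      finally show ?thesis .
    qed
    \<comment> \<open>The square is simply dropped, so the estimate is one-sided; exchanging
      \<open>v\<close> and \<open>w\<close> later supplies the other side.\<close>
    have "0 \<le> 2 * l * A3" using A3 l(1) by simp
    then have A2: "A2 \<le> 2 * \<eta> / 3" using zero A4 A1 by linarith
    define V where "V u = Pf T (\<lambda>x. P x *\<^sub>R (frm (hess u x) * Hl vs x))" for u
    define V' where "V' u = Pf T (\<lambda>x. (P x * f x) *\<^sub>R (frm (hess u x) * Hl vs x))" for u
    have tV: "tsf (\<lambda>x. P x *\<^sub>R (frm (hess u x) * Hl vs x))" "tsf (\<lambda>x. (P x * f x) *\<^sub>R (frm (hess u x) * Hl vs x))" if "smooth u" for u
      by (intro tsf_scale test_mult_smooth2[OF tP] tP ssf_mult ssf_frm smooth_hess sH sf that)+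
    have A2V: "A2 = (V v - V w) + (2 * l) * (V' v - V' w)"
    proof -
      have "frm (\<lambda>i j. (P x * s x) * hess f x i j) * Hl vs x =
        (P x *\<^sub>R (frm (hess v x) * Hl vs x) - P x *\<^sub>R (frm (hess w x) * Hl vs x)) +
        (2 * l) *\<^sub>R ((P x * f x) *\<^sub>R (frm (hess v x) * Hl vs x) - (P x * f x) *\<^sub>R (frm (hess w x) * Hl vs x))" for x
      proof -
        have "hess f x = (\<lambda>i j. hess v x i j - hess w x i j)" unfolding f_def[abs_def] by (intro ext hess_diff sv)
        then have "frm (\<lambda>i j. (P x * s x) * hess f x i j) = (P x * s x) *\<^sub>R (frm (hess v x) - frm (hess w x))"
          unfolding frm_scale by (simp only: frm_diff)
        also have "\<dots> = P x *\<^sub>R (frm (hess v x) - frm (hess w x)) + ((2 * l) * (P x * f x)) *\<^sub>R (frm (hess v x) - frm (hess w x))"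
          by (simp add: s_def algebra_simps flip: scaleR_add_left)
        finally show ?thesis by (simp add: distrib_right left_diff_distrib scaleR_diff_right)
      qed
      then have "A2 = Pf T (\<lambda>x. (P x *\<^sub>R (frm (hess v x) * Hl vs x) - P x *\<^sub>R (frm (hess w x) * Hl vs x)) +
        (2 * l) *\<^sub>R ((P x * f x) *\<^sub>R (frm (hess v x) * Hl vs x) - (P x * f x) *\<^sub>R (frm (hess w x) * Hl vs x)))"
        unfolding A2_def by (simp only:)
      also have "\<dots> = (V v - V w) + (2 * l) * (V' v - V' w)"
        unfolding V_def V'_def
        by (subst Pf_add[OF L], (intro tsf_diff tsf_cscale tV sv)+,
            subst Pf_cscale[OF L], (intro tsf_diff tV sv)+,
            subst Pf_diff[OF L], (intro tV sv)+,
            subst Pf_diff[OF L], (intro tV sv)+) (rule refl)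
      finally show ?thesis .
    qed
    \<comment> \<open>As |f| \<le> \<epsilon> on the support of \<psi>, both weights \<epsilon> P +
      P f and \<epsilon> P - P f are nonnegative. So the correction V' is bounded by \<epsilon>
      V.\<close>
    have wpos: "0 \<le> \<epsilon> * V u + c * V' u" if u: "cvx u" and c: "c = 1 \<or> c = -1" for u c
    proof -
      have su: "smooth u" by (rule cvx_smooth[OF u])
      have "0 \<le> Pf T (\<lambda>x. (\<epsilon> * P x + c * (P x * f x)) *\<^sub>R (frm (hess u x) * Hl vs x))"
      proof (rule pos_Hl1[OF pos len _ _ cv])
        show "smooth (\<lambda>x. hess u x i j)" for i j by (rule smooth_hess[OF su])
        show "psd (hess u x)" for x using u by (simp add: cvx_def)
        show "test_function (\<lambda>x. \<epsilon> * P x + c * (P x * f x))" by (intro test_add test_cmult tP test_mult_smooth2[OF tP sf])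
        show "0 \<le> \<epsilon> * P x + c * (P x * f x)" for x
        proof (cases "x \<in> fun_support \<psi>")
          case True
          then have "0 \<le> \<epsilon> + c * f x" using f\<epsilon>[OF True] c by (auto simp: abs_le_iff)
          then have "0 \<le> P x * (\<epsilon> + c * f x)" using P01(1)[of x] by simp
          then show ?thesis by (simp add: algebra_simps)
        qed (simp add: P_def z\<psi>)
      qed
      also have "\<dots> = \<epsilon> * V u + c * V' u"
        unfolding V_def V'_def scaleR_add_left scaleR_scaleR[symmetric]
        by (subst Pf_add[OF L], (intro tsf_cscale tV[unfolded scaleR_scaleR[symmetric]] su)+,
            subst Pf_cscale[OF L], (intro tV[unfolded scaleR_scaleR[symmetric]] su)+,
            subst Pf_cscale[OF L], (intro tV[unfolded scaleR_scaleR[symmetric]] su)+) (rule refl)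
      finally show ?thesis .
    qed
    have VM: "V u \<le> B0\<^sup>2 * M2" if u: "near u R \<epsilon>" for u
    proof -
      have "Pf T (\<lambda>x. \<phi>0 x *\<^sub>R Hl ((u # vs) @ replicate 0 bq) x) \<le> M2" by (rule M2(2)) (use vs near2 len u in auto)
      moreover have "Pf T (\<lambda>x. \<phi>0 x *\<^sub>R Hl ((u # vs) @ replicate 0 bq) x) = (1 / B0\<^sup>2) * V u"
        unfolding V_def Pf_cscale[OF L tV(1)[OF near_smooth[OF u]], symmetric] by (simp add: \<phi>0_def)
      ultimately have "(1 / B0\<^sup>2) * V u \<le> M2" by (simp only:)
      then show ?thesis using B0(2) by (simp add: field_simps)
    qed
    have 1: "0 \<le> \<epsilon> * V v + V' v" using wpos[OF near_cvx[OF v], of 1] by simp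
    have 2: "0 \<le> \<epsilon> * V w - V' w" using wpos[OF near_cvx[OF w], of "-1"] by simp
    have "V v - V w = A2 - (2 * l) * (V' v - V' w)" using A2V by simp
    also have "\<dots> \<le> A2 + (2 * l) * (\<epsilon> * V v + \<epsilon> * V w)"
    proof -
      have "(2 * l) * (- (V' v - V' w)) \<le> (2 * l) * (\<epsilon> * V v + \<epsilon> * V w)" using 1 2 l(1) by (intro mult_left_mono) auto
      then show ?thesis by (simp only: mult_minus_right)
    qed
    also have "\<dots> \<le> 2 * \<eta> / 3 + (2 * l) * (\<epsilon> * (B0\<^sup>2 * M2) + \<epsilon> * (B0\<^sup>2 * M2))"
      using A2 VM[OF v] VM[OF w] l(1) \<epsilon>(1) by (intro add_mono mult_left_mono) auto
    also have "\<dots> \<le> \<eta>" using \<epsilon>2 by (simp add: algebra_simps)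
    finally show ?thesis by (simp add: V_def)
  qed
  show ?thesis using \<epsilon>(1) main unfolding P_def by blast
qed

end

section \<open>The product with powers of the Hessian of the norm\<close>

lemma card_full_iff: "card (I :: 'n::finite set) = CARD('n) \<longleftrightarrow> I = UNIV"
  using card_subset_eq[OF finite subset_UNIV, of I] by auto

lemma posfun_Pf_Hl:
  assumes "weakly_positive p T" "length vs = p" "\<And>v. v \<in> set vs \<Longrightarrow> cvx v"
  shows "posfun (\<lambda>\<phi>. Pf T (\<lambda>x. \<phi> x *\<^sub>R Hl vs x))"
  unfolding posfun_def
proof (intro conjI allI impI)
  note L = weakly_positive_lin[OF assms(1)]
  have s: "ssf (Hl vs)" by (rule ssf_Hl) (use assms(3) cvx_smooth in blast)
  fix \<phi> \<psi> :: "(real, 'a) vec \<Rightarrow> real" and a b :: real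
  assume t: "test_function \<phi>" "test_function \<psi>"
  have "Pf T (\<lambda>x. (a * \<phi> x + b * \<psi> x) *\<^sub>R Hl vs x) = Pf T (\<lambda>x. a *\<^sub>R (\<phi> x *\<^sub>R Hl vs x) + b *\<^sub>R (\<psi> x *\<^sub>R Hl vs x))"
    by (simp add: scaleR_add_left)
  also have "\<dots> = a * Pf T (\<lambda>x. \<phi> x *\<^sub>R Hl vs x) + b * Pf T (\<lambda>x. \<psi> x *\<^sub>R Hl vs x)"
    unfolding Pf_add[OF L tsf_cscale[OF tsf_scale[OF t(1) s]] tsf_cscale[OF tsf_scale[OF t(2) s]]]
      Pf_cscale[OF L tsf_scale[OF t(1) s]] Pf_cscale[OF L tsf_scale[OF t(2) s]] ..
  finally show "Pf T (\<lambda>x. (a * \<phi> x + b * \<psi> x) *\<^sub>R Hl vs x) = a * Pf T (\<lambda>x. \<phi> x *\<^sub>R Hl vs x) + b * Pf T (\<lambda>x. \<psi> x *\<^sub>R Hl vs x)" .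
next
  fix \<phi> :: "(real, 'a) vec \<Rightarrow> real" assume "test_function \<phi>" "\<forall>x. 0 \<le> \<phi> x"
  then show "0 \<le> Pf T (\<lambda>x. \<phi> x *\<^sub>R Hl vs x)" using pos_Hl0[OF assms] by blast
qed

lemma top_coeff_current_wedge:
  "top_coeff (current_wedge T (\<lambda>x. coef (\<alpha> x))) \<phi> = Pf (T :: 'n::{finite,linorder} supercurrent) (\<lambda>x. \<phi> x *\<^sub>R \<alpha> x)"
  unfolding top_coeff_def current_wedge_Pf using orientation_nonzero[where 'n='n] by simp

text \<open>By degree: a nonzero term forces \<open>I\<close> and \<open>J\<close> to have n
  elements.\<close>

lemma current_wedge_not_top:
  fixes T :: "'n::{finite,linorder} supercurrent"
  assumes "bidimension p T" "lin T" "\<And>x. bidegree p (\<alpha> x)" "ssf \<alpha>" "test_function \<phi>" "\<not> (I = UNIV \<and> J = UNIV)"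
  shows "current_wedge T (\<lambda>x. coef (\<alpha> x)) I J \<phi> = 0"
  unfolding current_wedge_def wedge_with_def
proof (rule sum.neutral, rule ballI, rule sum.neutral, rule ballI)
  fix K L assume K: "K \<in> Pow I" and Lp: "L \<in> Pow J"
  have "T K L (\<lambda>x. coef (\<alpha> x) (I - K) (J - L) * \<phi> x) = 0"
  proof (cases "card (I - K) = p \<and> card (J - L) = p")
    case False
    then have "coef (\<alpha> x) (I - K) (J - L) = 0" for x using assms(3) by (auto simp: bidegree_def)
    then show ?thesis using lin_zero[OF assms(2)] by simp
  next
    case True
    have "\<not> (card K = CARD('n) - p \<and> card L = CARD('n) - p)"
    proof
      assume c: "card K = CARD('n) - p \<and> card L = CARD('n) - p"
      have "card I = card K + card (I - K)" "card J = card L + card (J - L)"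
        using K Lp by (metis PowD card_Diff_subset card_mono finite le_add_diff_inverse)+
      then have "card I = CARD('n)" "card J = CARD('n)" using c True assms(1) by (auto simp: bidimension_def)
      then have "I = UNIV" "J = UNIV" by (simp_all add: card_full_iff)
      with assms(6) show False by blast
    qed
    moreover have "test_function (\<lambda>x. coef (\<alpha> x) (I - K) (J - L) * \<phi> x)"
      by (rule test_mult_smooth[OF assms(5)]) (use assms(4) in \<open>simp add: ssf_def\<close>)
    ultimately show ?thesis using assms(1) unfolding bidimension_def supercurrent_def by blast
  qed
  then show "wedge_sign K L (I - K) (J - L) * T K L (\<lambda>x. coef (\<alpha> x) (I - K) (J - L) * \<phi> x) = 0" by simp
qed

lemma bidegree_Hl: "bidegree (length vs) (Hl vs x)"
  unfolding Hl_mform using bidegree_mform[of "map hess vs" x] by simp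

text \<open>Dini's theorem on a closed ball: the open sets where the error is below \<epsilon>
  increase with the index and cover the compact ball.\<close>

lemma eventually_near:
  fixes V :: "nat \<Rightarrow> (real, 'n::finite) vec \<Rightarrow> real"
  assumes V: "\<And>j. smooth (V j)" "\<And>j. convex_on UNIV (V j)" and dec: "\<And>x. decseq (\<lambda>j. V j x)"
    and lim: "\<And>x. (\<lambda>j. V j x) \<longlonglongrightarrow> norm x" and e: "0 < \<epsilon>"
  shows "\<exists>N. \<forall>j\<ge>N. near (V j) R \<epsilon>"
proof -
  have low: "norm x \<le> V j x" for j x by (rule decseq_ge[OF dec lim])
  define U where "U j = {x. V j x < norm x + \<epsilon>}" for j
  have oU: "open (U j)" for j unfolding U_def
    by (intro open_Collect_less continuous_intros smooth_continuous V)
  have cover: "cball 0 R \<subseteq> (\<Union>j\<in>UNIV. U j)"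
  proof
    fix x :: "(real, 'n) vec"
    have "\<forall>\<^sub>F j in sequentially. V j x < norm x + \<epsilon>" by (rule order_tendstoD(2)[OF lim]) (use e in simp)
    then obtain j where "V j x < norm x + \<epsilon>" by (auto simp: eventually_sequentially)
    then show "x \<in> (\<Union>j\<in>UNIV. U j)" by (auto simp: U_def)
  qed
  obtain J where J: "finite J" "cball 0 R \<subseteq> (\<Union>j\<in>J. U j)"
    by (rule compactE_image[OF compact_cball oU cover])
  define N where "N = Max (insert 0 J)"
  have "near (V j) R \<epsilon>" if "N \<le> j" for j
    unfolding near_def
  proof (intro conjI allI impI)
    show "cvx (V j)" by (rule cvx_if_convex[OF V])
    fix x :: "(real, 'n) vec" assume "norm x \<le> R"
    then obtain i where i: "i \<in> J" "V i x < norm x + \<epsilon>" using J(2) by (auto simp: U_def subset_iff)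
    have "i \<le> N" unfolding N_def by (rule Max_ge) (use i J(1) in auto)
    then have "V j x \<le> V i x" using decseqD[OF dec, of i j x] that by simp
    then show "V j x \<le> norm x + \<epsilon>" using i(2) by simp
    show "norm x \<le> V j x" by (rule low)
  qed
  then show ?thesis by blast
qed

section \<open>Passage to the limit in the powers of dd#v\<close>

context degree_current
begin

definition power_pairing :: "((real, 'n) vec \<Rightarrow> real) \<Rightarrow> ((real, 'n) vec \<Rightarrow> real) \<Rightarrow> real" where
  "power_pairing \<phi> v = Pf T (\<lambda>x. \<phi> x *\<^sub>R Hl (replicate p v) x)"

text \<open>Telescoping from all factors \<open>v\<close> to all factors \<open>w\<close>, at a cost
  of at most \<eta> / p for each of the p replacements.\<close>

lemma replace_all:
  assumes \<psi>: "test_function \<psi>" and \<eta>: "0 < \<eta>"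
  shows "\<exists>\<epsilon>>0. \<exists>R. \<forall>v w. near v R \<epsilon> \<longrightarrow> near w R \<epsilon> \<longrightarrow> power_pairing (\<lambda>x. \<psi> x * \<psi> x) v - power_pairing (\<lambda>x. \<psi> x * \<psi> x) w \<le> \<eta>"
proof (cases "p = 0")
  case True
  have "power_pairing \<phi> v = power_pairing \<phi> w" for \<phi> v w unfolding power_pairing_def by (simp add: True)
  then have "power_pairing (\<lambda>x. \<psi> x * \<psi> x) v - power_pairing (\<lambda>x. \<psi> x * \<psi> x) w \<le> \<eta>" for v w using \<eta> by (metis cancel_comm_monoid_add_class.diff_cancel less_imp_le)
  then show ?thesis by (intro exI[of _ "1::real"]) simp
next
  case False
  then have "0 < \<eta> / real p" using \<eta> by simp
  from replace_factor[OF \<psi> this] obtain \<epsilon> R where \<epsilon>: "0 < \<epsilon>" and step: "\<And>v w vs. near v R \<epsilon> \<Longrightarrow> near w R \<epsilon> \<Longrightarrow> (\<forall>u\<in>set vs. near u R \<epsilon>) \<Longrightarrow> Suc (length vs) = p \<Longrightarrow>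
    Pf T (\<lambda>x. (\<psi> x * \<psi> x) *\<^sub>R Hl (v # vs) x) - Pf T (\<lambda>x. (\<psi> x * \<psi> x) *\<^sub>R Hl (w # vs) x) \<le> \<eta> / real p" by blast
  show ?thesis
  proof (rule exI[of _ \<epsilon>], rule conjI, rule \<epsilon>, rule exI[of _ R], intro allI impI)
    fix v w :: "(real, 'n) vec \<Rightarrow> real" assume v: "near v R \<epsilon>" and w: "near w R \<epsilon>"
    define D where "D a = Pf T (\<lambda>x. (\<psi> x * \<psi> x) *\<^sub>R Hl (replicate a v @ replicate (p - a) w) x)" for a
    have DS: "D (Suc a) - D a \<le> \<eta> / real p" if "a < p" for a
    proof -
      let ?vs = "replicate a v @ replicate (p - Suc a) w"
      have pa: "p - a = Suc (p - Suc a)" using that by simp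
      have e1: "Hl (replicate (Suc a) v @ replicate (p - Suc a) w) x = Hl (v # ?vs) x" for x by (simp add: mult.assoc)
      have e2: "Hl (replicate a v @ replicate (p - a) w) x = Hl (w # ?vs) x" for x
        unfolding pa by (simp add: frm_central[of "hess w x" "Hl (replicate a v) x"] flip: mult.assoc)
      show ?thesis unfolding D_def e1 e2
        by (rule step[OF v w]) (use v w that in \<open>auto simp: set_replicate_conv_if\<close>)
    qed
    have "D a - D 0 \<le> real a * (\<eta> / real p)" if "a \<le> p" for a
      using that
    proof (induction a)
      case (Suc a)
      then show ?case using DS[of a] by (simp add: distrib_right add_divide_distrib)
    qed simp
    from this[of p] have "D p - D 0 \<le> \<eta>" using False by simp
    then show "power_pairing (\<lambda>x. \<psi> x * \<psi> x) v - power_pairing (\<lambda>x. \<psi> x * \<psi> x) w \<le> \<eta>" by (simp add: D_def power_pairing_def)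
  qed
qed

text \<open>The energy estimate handles squares as weights, and \<phi> is a difference of two: those
  of (et + \<phi>) / 2 and (et - \<phi>) / 2, with \<open>et\<close> equal to 1 on the support of
  \<phi>.\<close>

lemma power_pairing_near:
  assumes \<phi>: "test_function \<phi>" and \<eta>: "0 < \<eta>"
  shows "\<exists>\<epsilon>>0. \<exists>R. \<forall>v w. near v R \<epsilon> \<longrightarrow> near w R \<epsilon> \<longrightarrow> \<bar>power_pairing \<phi> v - power_pairing \<phi> w\<bar> \<le> \<eta>"
proof -
  obtain et W where et: "test_function et" "\<And>x. 0 \<le> et x" "\<And>x. et x \<le> 1" "fun_support \<phi> \<subseteq> W" "\<And>x. x \<in> W \<Longrightarrow> et x = 1"
    using smooth_urysohn[OF test_compact[OF \<phi>] open_UNIV subset_UNIV] by metis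
  define \<psi>1 where "\<psi>1 x = (1/2) * (et x + \<phi> x)" for x
  define \<psi>2 where "\<psi>2 x = (1/2) * (et x - \<phi> x)" for x
  have t1: "test_function \<psi>1" unfolding \<psi>1_def[abs_def] by (intro test_cmult test_add et \<phi>)
  have t2: "test_function \<psi>2" unfolding \<psi>2_def[abs_def] by (intro test_cmult test_diff et \<phi>)
  have tt: "test_function (\<lambda>x. \<psi>1 x * \<psi>1 x)" "test_function (\<lambda>x. \<psi>2 x * \<psi>2 x)"
    by (rule test_mult_smooth[OF t1 test_smooth[OF t1]], rule test_mult_smooth[OF t2 test_smooth[OF t2]])
  have split: "\<phi> x = \<psi>1 x * \<psi>1 x - \<psi>2 x * \<psi>2 x" for x
  proof -
    have "\<psi>1 x * \<psi>1 x - \<psi>2 x * \<psi>2 x = et x * \<phi> x" by (simp add: \<psi>1_def \<psi>2_def algebra_simps add_divide_distrib diff_divide_distrib)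
    also have "\<dots> = \<phi> x" using et(4,5) fun_support_nonzero[of \<phi> x] by (cases "\<phi> x = 0") auto
    finally show ?thesis by simp
  qed
  have lin: "power_pairing \<phi> v = power_pairing (\<lambda>x. \<psi>1 x * \<psi>1 x) v - power_pairing (\<lambda>x. \<psi>2 x * \<psi>2 x) v" if "near v R \<epsilon>" for v :: "(real, 'n) vec \<Rightarrow> real" and R \<epsilon>
  proof -
    have s: "ssf (Hl (replicate p v))" by (rule ssf_Hl) (use near_smooth[OF that] in simp)
    show ?thesis unfolding power_pairing_def Pf_diff[OF L tsf_scale[OF tt(1) s] tsf_scale[OF tt(2) s], symmetric]
      by (rule arg_cong[where f="Pf T"], rule ext, subst split, rule scaleR_diff_left)
  qed
  have \<eta>2: "0 < \<eta> / 2" using \<eta> by simp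
  obtain \<epsilon>1 R1 where 1: "0 < \<epsilon>1" "\<And>v w. near v R1 \<epsilon>1 \<Longrightarrow> near w R1 \<epsilon>1 \<Longrightarrow> power_pairing (\<lambda>x. \<psi>1 x * \<psi>1 x) v - power_pairing (\<lambda>x. \<psi>1 x * \<psi>1 x) w \<le> \<eta> / 2"
    using replace_all[OF t1 \<eta>2] by blast
  obtain \<epsilon>2 R2 where 2: "0 < \<epsilon>2" "\<And>v w. near v R2 \<epsilon>2 \<Longrightarrow> near w R2 \<epsilon>2 \<Longrightarrow> power_pairing (\<lambda>x. \<psi>2 x * \<psi>2 x) v - power_pairing (\<lambda>x. \<psi>2 x * \<psi>2 x) w \<le> \<eta> / 2"
    using replace_all[OF t2 \<eta>2] by blast
  show ?thesis
  proof (rule exI[of _ "min \<epsilon>1 \<epsilon>2"], rule conjI, use 1 2 in simp, rule exI[of _ "max R1 R2"], intro allI impI)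
    fix v w :: "(real, 'n) vec \<Rightarrow> real" assume v: "near v (max R1 R2) (min \<epsilon>1 \<epsilon>2)" and w: "near w (max R1 R2) (min \<epsilon>1 \<epsilon>2)"
    have n: "near u R1 \<epsilon>1" "near u R2 \<epsilon>2" if "near u (max R1 R2) (min \<epsilon>1 \<epsilon>2)" for u
      using near_mono[OF that, of R1 \<epsilon>1] near_mono[OF that, of R2 \<epsilon>2] by simp_all
    show "\<bar>power_pairing \<phi> v - power_pairing \<phi> w\<bar> \<le> \<eta>"
      using 1(2)[OF n(1)[OF v] n(1)[OF w]] 1(2)[OF n(1)[OF w] n(1)[OF v]]
        2(2)[OF n(2)[OF v] n(2)[OF w]] 2(2)[OF n(2)[OF w] n(2)[OF v]] lin[OF v] lin[OF w]
      by (simp add: abs_le_iff)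
  qed
qed

definition approximates :: "(nat \<Rightarrow> (real, 'n) vec \<Rightarrow> real) \<Rightarrow> bool" where
  "approximates v \<longleftrightarrow> (\<forall>j. smooth (v j) \<and> convex_on UNIV (v j)) \<and> (\<forall>x. decseq (\<lambda>j. v j x) \<and> (\<lambda>j. v j x) \<longlonglongrightarrow> norm x)"

lemma approximates_near: "approximates v \<Longrightarrow> 0 < \<epsilon> \<Longrightarrow> \<exists>N. \<forall>j\<ge>N. near (v j) R \<epsilon>"
  unfolding approximates_def by (rule eventually_near) auto

lemma approximates_cvx: "approximates v \<Longrightarrow> cvx (v j)"
  unfolding approximates_def using cvx_if_convex by blast

lemma power_pairing_diff_limit:
  assumes "approximates v" "approximates w" "test_function \<phi>"
  shows "(\<lambda>j. power_pairing \<phi> (v j) - power_pairing \<phi> (w j)) \<longlonglongrightarrow> 0"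
proof (rule LIMSEQ_I)
  fix r :: real assume "0 < r"
  then have "0 < r / 2" by simp
  then obtain \<epsilon> R where e: "0 < \<epsilon>" "\<And>v w. near v R \<epsilon> \<Longrightarrow> near w R \<epsilon> \<Longrightarrow> \<bar>power_pairing \<phi> v - power_pairing \<phi> w\<bar> \<le> r / 2"
    using power_pairing_near[OF assms(3)] by blast
  obtain N1 where N1: "\<forall>j\<ge>N1. near (v j) R \<epsilon>" using approximates_near[OF assms(1) e(1)] by blast
  obtain N2 where N2: "\<forall>j\<ge>N2. near (w j) R \<epsilon>" using approximates_near[OF assms(2) e(1)] by blast
  show "\<exists>N. \<forall>j\<ge>N. norm (power_pairing \<phi> (v j) - power_pairing \<phi> (w j) - 0) < r"
  proof (intro exI[of _ "max N1 N2"] allI impI)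
    fix j assume "max N1 N2 \<le> j"
    then have "\<bar>power_pairing \<phi> (v j) - power_pairing \<phi> (w j)\<bar> \<le> r / 2" using N1 N2 by (intro e(2)) auto
    then show "norm (power_pairing \<phi> (v j) - power_pairing \<phi> (w j) - 0) < r" using \<open>0 < r\<close> by simp
  qed
qed

lemma power_pairing_convergent:
  assumes "approximates v" "test_function \<phi>"
  shows "convergent (\<lambda>j. power_pairing \<phi> (v j))"
proof -
  have "Cauchy (\<lambda>j. power_pairing \<phi> (v j))"
  proof (rule CauchyI)
    fix r :: real assume "0 < r"
    then have "0 < r / 2" by simp
    then obtain \<epsilon> R where e: "0 < \<epsilon>" "\<And>v w. near v R \<epsilon> \<Longrightarrow> near w R \<epsilon> \<Longrightarrow> \<bar>power_pairing \<phi> v - power_pairing \<phi> w\<bar> \<le> r / 2"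
      using power_pairing_near[OF assms(2)] by blast
    obtain N where N: "\<forall>j\<ge>N. near (v j) R \<epsilon>" using approximates_near[OF assms(1) e(1)] by blast
    show "\<exists>M. \<forall>m\<ge>M. \<forall>n\<ge>M. norm (power_pairing \<phi> (v m) - power_pairing \<phi> (v n)) < r"
    proof (intro exI[of _ N] allI impI)
      fix m n assume "N \<le> m" "N \<le> n"
      then have "\<bar>power_pairing \<phi> (v m) - power_pairing \<phi> (v n)\<bar> \<le> r / 2" using N by (intro e(2)) auto
      then show "norm (power_pairing \<phi> (v m) - power_pairing \<phi> (v n)) < r" using \<open>0 < r\<close> by simp
    qed
  qed
  then show ?thesis by (rule Cauchy_convergent)
qed

lemma power_pairing_le:
  assumes "approximates v" "test_function \<phi>" "\<And>x. 0 \<le> \<phi> x" "\<And>x. \<phi> x \<le> 1"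
  shows "\<exists>N. \<forall>j\<ge>N. power_pairing \<phi> (v j) \<le> mass_bound"
proof -
  obtain r0 where r0: "\<forall>x\<in>fun_support \<phi>. norm x \<le> r0"
    using compact_imp_bounded[OF test_compact[OF assms(2)]] bounded_iff by metis
  define r where "r = max 1 r0"
  have z: "\<phi> x = 0" if "r < norm x" for x
    using r0 fun_support_nonzero[of \<phi> x] that by (fastforce simp: r_def)
  obtain N where N: "\<forall>j\<ge>N. near (v j) (4 ^ p * r) 1" using approximates_near[OF assms(1) zero_less_one] by blast
  have "power_pairing \<phi> (v j) \<le> mass_bound" if "N \<le> j" for j
    unfolding power_pairing_def
  proof (rule mass_near[where r=r])
    show "1 \<le> r" by (simp add: r_def)
    show "near (v j) (4 ^ p * r) 1" using N that by blast
  qed (use assms(2-4) z in auto)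
  then show ?thesis by blast
qed

text \<open>The bound by \<open>mass_bound\<close> has two uses: with positivity it makes
  \<open>A\<close> a distribution of order 0, and it bounds the mass of the representing measure on
  the whole space.\<close>

lemma finite_degree_if_limit:
  fixes A :: "((real, 'n) vec \<Rightarrow> real) \<Rightarrow> real"
  assumes lin: "\<And>\<phi> \<psi> a b. test_function \<phi> \<Longrightarrow> test_function \<psi> \<Longrightarrow> A (\<lambda>x. a * \<phi> x + b * \<psi> x) = a * A \<phi> + b * A \<psi>"
    and nn: "\<And>\<phi>. test_function \<phi> \<Longrightarrow> (\<And>x. 0 \<le> \<phi> x) \<Longrightarrow> 0 \<le> A \<phi>"
    and le: "\<And>\<phi>. test_function \<phi> \<Longrightarrow> (\<And>x. 0 \<le> \<phi> x) \<Longrightarrow> (\<And>x. \<phi> x \<le> 1) \<Longrightarrow> A \<phi> \<le> mass_bound"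
    and conv: "\<And>v \<phi>. approximates v \<Longrightarrow> test_function \<phi> \<Longrightarrow> (\<lambda>j. power_pairing \<phi> (v j)) \<longlonglongrightarrow> A \<phi>"
  shows "finite_degree p T"
proof -
  define c where "c = orientation TYPE('n)"
  have c: "c \<noteq> 0" unfolding c_def by (rule orientation_nonzero)
  \<comment> \<open>In bidegree (n, n) there is one coefficient. The factor \<open>c\<close> is
    removed again by \<open>top_coeff\<close>.\<close>
  define S :: "'n supercurrent" where "S I J \<phi> = (if I = UNIV \<and> J = UNIV then c * A \<phi> else 0)" for I J \<phi>
  have pA: "posfun A" unfolding posfun_def using lin nn by blast
  have mass_bound: "0 \<le> mass_bound" unfolding mass_bound_def using C by simp
  have bound: "\<bar>A \<phi>\<bar> \<le> mass_bound * (SUP x. \<bar>\<phi> x\<bar>)" if t: "test_function \<phi>" for \<phi>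
  proof -
    obtain et W where et: "test_function et" "\<And>x. 0 \<le> et x" "\<And>x. et x \<le> 1" "fun_support \<phi> \<subseteq> W" "\<And>x. x \<in> W \<Longrightarrow> et x = 1"
      using smooth_urysohn[OF test_compact[OF t] open_UNIV subset_UNIV] by metis
    define B where "B = (SUP x. \<bar>\<phi> x\<bar>)"
    obtain B' where "\<And>x. \<bar>\<phi> x\<bar> \<le> B'" using test_bounded[OF t] by blast
    then have "bdd_above (range (\<lambda>x. \<bar>\<phi> x\<bar>))" by (intro bdd_aboveI2)
    then have B: "\<bar>\<phi> x\<bar> \<le> B" for x unfolding B_def by (intro cSUP_upper) auto
    then have B0: "0 \<le> B" using abs_ge_zero order_trans by blast
    have dom: "\<bar>\<phi> x\<bar> \<le> B * et x" for x
      using B[of x] B0 et(2)[of x] et(4,5) fun_support_nonzero[of \<phi> x] by (cases "\<phi> x = 0") auto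
    have "0 \<le> A (\<lambda>x. B * et x + 1 * \<phi> x)"
      by (rule nn) (use test_add[OF test_cmult[OF et(1)] t] dom in \<open>auto simp: abs_le_iff\<close>, use dom in \<open>smt (verit)\<close>)
    then have "0 \<le> B * A et + A \<phi>" unfolding lin[OF et(1) t] by simp
    moreover have "0 \<le> A (\<lambda>x. B * et x + (-1) * \<phi> x)"
    proof (rule nn)
      show "test_function (\<lambda>x. B * et x + (-1) * \<phi> x)" by (intro test_add test_cmult et t)
      show "0 \<le> B * et x + (-1) * \<phi> x" for x using dom[of x] by simp
    qed
    then have "0 \<le> B * A et - A \<phi>" unfolding lin[OF et(1) t] by simp
    moreover have "B * A et \<le> B * mass_bound" by (rule mult_left_mono[OF le[OF et(1-3)] B0])
    ultimately show ?thesis by (simp add: B_def[symmetric] abs_le_iff mult.commute)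
  qed
  have "distribution (S I J)" for I J
    unfolding distribution_def
  proof (intro conjI allI impI)
    fix \<phi> \<psi> :: "(real, 'n) vec \<Rightarrow> real" and a b assume "test_function \<phi>" "test_function \<psi>"
    then show "S I J (\<lambda>x. a * \<phi> x + b * \<psi> x) = a * S I J \<phi> + b * S I J \<psi>"
      by (simp add: S_def lin algebra_simps)
  next
    fix K :: "(real, 'n) vec set"
    show "\<exists>C N. \<forall>\<phi>. test_function \<phi> \<longrightarrow> fun_support \<phi> \<subseteq> K \<longrightarrow> \<bar>S I J \<phi>\<bar> \<le> C * (\<Sum>w | length w \<le> N. SUP x. \<bar>partials w \<phi> x\<bar>)"
    proof (rule exI[of _ "\<bar>c\<bar> * mass_bound"], rule exI[of _ 0], intro allI impI)
      fix \<phi> :: "(real, 'n) vec \<Rightarrow> real" assume t: "test_function \<phi>"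
      have s: "(\<Sum>w | length w \<le> 0. SUP x. \<bar>partials w \<phi> x\<bar>) = (SUP x. \<bar>\<phi> x\<bar>)" by simp
      have "0 \<le> mass_bound * (SUP x. \<bar>\<phi> x\<bar>)" using bound[OF t] abs_ge_zero order_trans by blast
      moreover have "\<bar>c\<bar> * \<bar>A \<phi>\<bar> \<le> \<bar>c\<bar> * (mass_bound * (SUP x. \<bar>\<phi> x\<bar>))" by (rule mult_left_mono[OF bound[OF t]]) simp
      ultimately show "\<bar>S I J \<phi>\<bar> \<le> (\<bar>c\<bar> * mass_bound) * (\<Sum>w | length w \<le> 0. SUP x. \<bar>partials w \<phi> x\<bar>)"
        unfolding s by (auto simp: S_def abs_mult mult.assoc)
    qed
  qed
  then have sup: "supercurrent (CARD('n)) (CARD('n)) S"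
    unfolding supercurrent_def by (auto simp: S_def card_full_iff)
  have prod: "is_ddsharp_product p T norm S"
    unfolding is_ddsharp_product_def
  proof (intro conjI sup allI impI)
    fix v :: "nat \<Rightarrow> (real, 'n) vec \<Rightarrow> real" and I J and \<phi> :: "(real, 'n) vec \<Rightarrow> real"
    assume v: "\<forall>j. smooth (v j) \<and> convex_on UNIV (v j)" "\<forall>x. decseq (\<lambda>j. v j x) \<and> (\<lambda>j. v j x) \<longlonglongrightarrow> norm x"
      and t: "test_function \<phi>"
    have ap: "approximates v" using v by (simp add: approximates_def)
    have sv: "smooth (v j)" for j using v by simp
    show "(\<lambda>j. current_wedge T (form_power (ddsharp_fun (v j)) p) I J \<phi>) \<longlonglongrightarrow> S I J \<phi>"
    proof (cases "I = UNIV \<and> J = UNIV")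
      case True
      then have "current_wedge T (form_power (ddsharp_fun (v j)) p) I J \<phi> = c * power_pairing \<phi> (v j)" for j
        unfolding form_power_ddsharp[OF sv] by (simp add: current_wedge_Pf c_def power_pairing_def)
      then show ?thesis using True tendsto_mult[OF tendsto_const[of c] conv[OF ap t]] by (simp add: S_def)
    next
      case False
      have "bidimension p T" using pos by (simp add: weakly_positive_def)
      then have "current_wedge T (form_power (ddsharp_fun (v j)) p) I J \<phi> = 0" for j
        unfolding form_power_ddsharp[OF sv]
        by (rule current_wedge_not_top[OF _ L _ ssf_Hl t False]) (use bidegree_Hl[of "replicate p (v j)"] sv in auto)
      then show ?thesis using False by (auto simp: S_def)
    qed
  qed
  have "top_coeff S = A" using c by (intro ext) (simp add: top_coeff_def S_def c_def)
  then have "super_integral UNIV S = open_content A UNIV"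
    unfolding super_integral_def using measure_of_dist_open[OF pA open_UNIV] by simp
  also have "\<dots> \<le> ennreal mass_bound" by (rule open_content_least) (intro ennreal_leI le)
  finally have "super_integral UNIV S < \<infinity>" using le_less_trans by fastforce
  with prod show ?thesis unfolding finite_degree_def by blast
qed

lemma finite_degree: "finite_degree p T"
proof (cases "\<exists>w. approximates w")
  \<comment> \<open>Without approximating sequences, every current is a product in the sense of \<open>is_ddsharp_product\<close>.\<close>
  case False
  then show ?thesis
    by (intro finite_degree_if_limit[of "\<lambda>_. 0"]) (use C in \<open>auto simp: mass_bound_def\<close>)
next
  case True
  then obtain w where w: "approximates w" by blast
  have pw: "posfun (\<lambda>\<phi>. power_pairing \<phi> (w j))" for j
    unfolding power_pairing_def by (rule posfun_Pf_Hl[OF pos]) (use approximates_cvx[OF w] in auto)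
  \<comment> \<open>The limit along one sequence; every other sequence has the same limit by
    \<open>power_pairing_diff_limit\<close>.\<close>
  define A where "A \<phi> = lim (\<lambda>j. power_pairing \<phi> (w j))" for \<phi>
  have A: "(\<lambda>j. power_pairing \<phi> (w j)) \<longlonglongrightarrow> A \<phi>" if "test_function \<phi>" for \<phi>
    unfolding A_def using power_pairing_convergent[OF w that] by (simp add: convergent_LIMSEQ_iff)
  show ?thesis
  proof (rule finite_degree_if_limit[of A])
    fix \<phi> \<psi> :: "(real, 'n) vec \<Rightarrow> real" and a b :: real assume t: "test_function \<phi>" "test_function \<psi>"
    have "power_pairing (\<lambda>x. a * \<phi> x + b * \<psi> x) (w j) = a * power_pairing \<phi> (w j) + b * power_pairing \<psi> (w j)" for j
      using posfun_lin[OF pw t] .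
    moreover have "(\<lambda>j. a * power_pairing \<phi> (w j) + b * power_pairing \<psi> (w j)) \<longlonglongrightarrow> a * A \<phi> + b * A \<psi>"
      by (intro tendsto_intros A t)
    moreover have "(\<lambda>j. power_pairing (\<lambda>x. a * \<phi> x + b * \<psi> x) (w j)) \<longlonglongrightarrow> A (\<lambda>x. a * \<phi> x + b * \<psi> x)"
      by (intro A test_add test_cmult t)
    ultimately show "A (\<lambda>x. a * \<phi> x + b * \<psi> x) = a * A \<phi> + b * A \<psi>" using LIMSEQ_unique by force
  next
    fix \<phi> :: "(real, 'n) vec \<Rightarrow> real" assume t: "test_function \<phi>" "\<And>x. 0 \<le> \<phi> x"
    show "0 \<le> A \<phi>" by (rule LIMSEQ_le_const[OF A[OF t(1)]]) (use posfun_nonneg[OF pw t] in blast)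
  next
    fix \<phi> :: "(real, 'n) vec \<Rightarrow> real" assume t: "test_function \<phi>" "\<And>x. 0 \<le> \<phi> x" "\<And>x. \<phi> x \<le> 1"
    show "A \<phi> \<le> mass_bound" by (rule LIMSEQ_le_const2[OF A[OF t(1)] power_pairing_le[OF w t]])
  next
    fix v and \<phi> :: "(real, 'n) vec \<Rightarrow> real" assume v: "approximates v" "test_function \<phi>"
    show "(\<lambda>j. power_pairing \<phi> (v j)) \<longlonglongrightarrow> A \<phi>"
      using tendsto_add[OF power_pairing_diff_limit[OF v(1) w v(2)] A[OF v(2)]] by simp
  qed
qed

end

theorem theorem6:
  fixes T :: "'n::{finite,linorder} supercurrent" and p k \<delta> :: nat
  assumes "weakly_positive p T"
    and "concave_current p T"
    and "1 \<le> \<delta>"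
    and "k \<le> p"
    and "current_support T \<subseteq> {x. (\<Sum>i | k \<le> card {..<i}. \<bar>x $ i\<bar> ^ \<delta>) \<le> 1}"
  shows "(\<exists>C::real. C > 0 \<and> (\<forall>r::real. r \<ge> 1 \<longrightarrow> lelong_nu p T 0 r \<le> ennreal C)) \<and>
         (zero_current (ddsharp_current T) \<longrightarrow> finite_degree p T)"
proof -
  \<comment> \<open>\<open>card {..<i}\<close> is the position of \<open>i\<close> counted from 0,
    so these are the first k coordinates. Positions are distinct, whence at most k indices.\<close>
  define A where "A = {i::'n. card {..<i} < k}"
  have "card A \<le> card {..<k}"
  proof (rule card_inj_on_le)
    have "card {..<i} < card {..<j}" if "i < j" for i j :: 'n
      using that by (intro psubset_card_mono) auto
    then show "inj_on (\<lambda>i. card {..<i}) A" by (intro linorder_inj_onI) (auto simp: less_imp_neq)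
  qed (auto simp: A_def)
  then have cA: "card A \<le> p" using assms(4) by simp
  interpret tube_current T p A
  proof (unfold_locales, rule assms(1), rule assms(2), rule cA)
    fix x i assume x: "x \<in> current_support T" and i: "i \<notin> A"
    have "\<bar>x $ i\<bar> ^ \<delta> \<le> (\<Sum>i | k \<le> card {..<i}. \<bar>x $ i\<bar> ^ \<delta>)"
      by (rule member_le_sum) (use i in \<open>auto simp: A_def\<close>)
    also have "\<dots> \<le> 1" using x assms(5) by auto
    finally have le: "\<bar>x $ i\<bar> ^ \<delta> \<le> 1" .
    show "\<bar>x $ i\<bar> \<le> 1"
    proof (rule ccontr)
      assume "\<not> \<bar>x $ i\<bar> \<le> 1"
      then have "1 < \<bar>x $ i\<bar> ^ \<delta>" using assms(3) by (intro one_less_power) auto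
      with le show False by simp
    qed
  qed
  obtain C where C: "0 < C" and growth: "\<And>r \<phi>. 1 \<le> r \<Longrightarrow> test_function \<phi> \<Longrightarrow> (\<And>x. 0 \<le> \<phi> x) \<Longrightarrow> (\<And>x. \<phi> x \<le> 1) \<Longrightarrow> (\<And>x. r < norm x \<Longrightarrow> \<phi> x = 0) \<Longrightarrow>
    Pf T (\<lambda>x. \<phi> x *\<^sub>R Hl (replicate p bq) x) \<le> C * r ^ p" by (rule mass_growth) blast
  have top: "top_coeff (current_wedge T (form_power beta p)) = (\<lambda>\<phi>. Pf T (\<lambda>x. \<phi> x *\<^sub>R Hl (replicate p bq) x))"
    unfolding form_power_beta by (rule ext) (rule top_coeff_current_wedge)
  have posb: "posfun (\<lambda>\<phi>. Pf T (\<lambda>x. \<phi> x *\<^sub>R Hl (replicate p bq) x))"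
    by (rule posfun_Pf_Hl[OF assms(1)]) (use cvx_qd in auto)
  have nu: "lelong_nu p T 0 r \<le> ennreal C" if r: "1 \<le> r" for r
  proof -
    have "super_integral (ball 0 r) (current_wedge T (form_power beta p)) \<le> ennreal (C * r ^ p)"
      unfolding super_integral_def top measure_of_dist_open[OF posb open_ball]
    proof (rule open_content_least)
      fix \<phi> :: "(real, 'n) vec \<Rightarrow> real"
      assume \<phi>: "test_function \<phi>" "\<And>x. 0 \<le> \<phi> x" "\<And>x. \<phi> x \<le> 1" "fun_support \<phi> \<subseteq> ball 0 r"
      have z: "\<phi> x = 0" if "r < norm x" for x using \<phi>(4) fun_support_nonzero[of \<phi> x] that by fastforce
      show "ennreal (Pf T (\<lambda>x. \<phi> x *\<^sub>R Hl (replicate p bq) x)) \<le> ennreal (C * r ^ p)"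
        by (intro ennreal_leI growth[OF r \<phi>(1-3) z])
    qed
    then have "lelong_nu p T 0 r \<le> ennreal (C * r ^ p) / ennreal (r ^ p)"
      unfolding lelong_nu_def by (rule divide_right_mono_ennreal)
    also have "\<dots> = ennreal C" using r C by (subst divide_ennreal) auto
    finally show ?thesis .
  qed
  have "finite_degree p T" if z: "zero_current (ddsharp_current T)"
  proof -
    interpret degree_current T p C
      by (unfold_locales; (rule assms z C growth; assumption?)+)
    show ?thesis by (rule finite_degree)
  qed
  with nu C show ?thesis by blast
qed

end
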